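(* Let $S$ be a continuous dimension scale, let $\mathrm{Proj}\,S$ be the complete Boolean algebra of projections of $S$, and let $\Omega$ be the ultrafilter space of $\mathrm{Proj}\,S$, with its canonical decomposition $\Omega=\Omega_{\mathrm I}\sqcup\Omega_{\mathrm{II}}\sqcup\Omega_{\mathrm{III}}$. Let $E$ be a finitary unit of $S$. Then there exists a unique lower embedding $$\varepsilon\colon S\hookrightarrow\mathbf C(\Omega_{\mathrm I},\mathbb Z_\infty;\Omega_{\mathrm{II}},\mathbb R_\infty;\Omega_{\mathrm{III}},\mathbf 2_\infty)$$ such that $\varepsilon(p(x))=\varepsilon(x)\rfloor_{\Omega_p}$ for all $x\in S$ and all $p\in\mathrm{Proj}\,S$, and $\varepsilon(e)$ takes its values in $\{0,1\}$ for all $e\in E\cap S_{\mathrm{II}}$. Furthermore, for this embedding, $\varepsilon(e)$ takes its values in $\{0,1\}$ for all $e\in E$.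
   Context: **Partial commutative monoids.** A partial commutative monoid is $(S,+,0)$ with $+$ a partial binary operation on $S$ and $0\in S$ such that: $(a+b)+c$ is defined iff $a+(b+c)$ is, and then they are equal; $a+b$ is defined iff $b+a$ is, and then they are equal; $a+0=a$ for all $a$. Algebraic preordering: $a\le b$ iff $a+x=b$ for some $x\in S$. Write $a\perp b$ if $x\le a$ and $x\le b$ imply $x=0$; $X^\perp=\{s\in S: s\perp x\ \forall x\in X\}$ and $x^\perp=\{x\}^\perp$. A projection of $S$ is a map $p\colon S\to S$ with $p(0)=0$, with $p(a)+p(b)$ defined and equal to $p(a+b)$ whenever $a+b$ is defined, such that for every $x\in S$ there is $y\in(pS)^\perp$ with $x=p(x)+y$. $\mathrm{Proj}\,S$ is the set of projections, ordered by $p\le q$ iff $pS\subseteq qS$. If (M1) below holds, then for each projection $p$ there is a unique projection $p^\perp$ with $p^\perp S=(pS)^\perp$, and $x=p(x)+p^\perp(x)$ for all $x$. An element $a$ is directly finite if $x+a=a$ implies $x=0$; purely infinite if $a+a$ is defined and equal to $a$; multiple-free if, for all $x$, ($x+x$ defined and $x+x\le a$) implies $x=0$. Write $a\ll_{\mathrm{rem}}b$ if $a\le b$ and, for all $x\in S$, $b\le a+x$ implies $b\le x$. **Continuous dimension scales.** A continuous dimension scale is a partial commutative monoid $S$ such that: (M1) $S$ has refinement (if $a_0+a_1=b_0+b_1$, there are $c_{ij}$, $i,j<2$, with $a_i=c_{i0}+c_{i1}$ and $b_j=c_{0j}+c_{1j}$), and the algebraic preordering is antisymmetric. (M2) Every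 nonempty subset of $S$ has an infimum. (M3) For all $x,y\in S$ there is a projection $p$ of $S$ with $p(x)\le p(y)$ and $p^\perp(y)\le p^\perp(x)$. (M4) For all $a,b\in S$ there is a largest projection $p$ of $S$ with $p(a)\le p(b)$. (M5) Every element is the sum of a directly finite element and a purely infinite element. (M6) If $a,b$ are purely infinite and $a\ll_{\mathrm{rem}}b$, then the set of all purely infinite $x\in S$ with $a\ll_{\mathrm{rem}}x$ and $x^\perp=b^\perp$ has a least element. **Lower embeddings.** A map $\varphi\colon A\to B$ between partial commutative monoids is a lower embedding if: it is a homomorphism of partial monoids ($\varphi(0)=0$, and $c=a+b$ implies $\varphi(c)=\varphi(a)+\varphi(b)$); it is one-to-one and $\varphi(x)\le\varphi(y)$ implies $x\le y$; and its range is a lower subset of $B$ (downward closed for the algebraic preordering). **The decomposition of $\Omega$; finitary units.** For a continuous dimension scale $S$, $\mathrm{Proj}\,S$ is a complete Boolean algebra; $\Omega$ is its ultrafilter (Stone) space and $\Omega_p=\{\mathfrak a\in\Omega:p\in\mathfrak a\}$. Let $S_{\mathrm{mf}}$ and $S_{\mathrm{fin}}$ be the sets of multiple-free and of directly finite elements of $S$. Put $S_{\mathrm I}=S_{\mathrm{mf}}^{\perp\perp}$, $S_{\mathrm{II}}=S_{\mathrm{mf}}^{\perp}\cap S_{\mathrm{fin}}^{\perp\perp}$, $S_{\mathrm{III}}=S_{\mathrm{fin}}^\perp$. For $J\in\{\mathrm{I},\mathrm{II},\mathrm{III}\}$, there is a unique projection $p_J$ of $S$ with range $S_J$, and $\Omega_J:=\Omega_{p_J}$;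 these are pairwise disjoint clopen sets with union $\Omega$. A finitary unit of $S$ is a set $E\subseteq S_{\mathrm{fin}}\setminus\{0\}$ of pairwise orthogonal elements such that every nonzero element of $S_{\mathrm{fin}}$ is non-orthogonal to some element of $E$, and such that each $e\in E$ either is multiple-free or has no nonzero multiple-free element below it. **Function spaces.** For an ordinal $\gamma$: $\mathbb Z_\gamma=\mathbb Z^+\cup\{\aleph_\xi:0\le\xi\le\gamma\}$, $\mathbb R_\gamma=\mathbb R^+\cup\{\aleph_\xi:0\le\xi\le\gamma\}$, $\mathbf 2_\gamma=\{0\}\cup\{\aleph_\xi:0\le\xi\le\gamma\}$ ($\mathbb Z^+,\mathbb R^+$ are the nonnegative integers and reals). Addition extends the usual one on finite elements, $\aleph_\alpha+\aleph_\beta=\aleph_{\max(\alpha,\beta)}$, and every finite element is absorbed by every aleph. They are naturally totally ordered and carry the interval topology (the least topology in which all sets $\{x:x\le a\}$, $\{x:x\ge a\}$ are closed). $\mathbb Z_\infty$, $\mathbb R_\infty$, $\mathbf 2_\infty$ are the proper classes obtained by allowing all alephs ($\xi$ ranging over all ordinals); a map from a topological space (a set) $X$ to one of them has its values in the corresponding $\mathbb Z_\gamma$, $\mathbb R_\gamma$, $\mathbf 2_\gamma$ for some $\gamma$, and it is continuous iff it is continuous as a map into the latter (this does not depend on $\gamma$). $\mathbf C(\Omega_{\mathrm I},K_{\mathrm I};\Omega_{\mathrm{II}},K_{\mathrm{II}};\Omega_{\mathrm{III}},K_{\mathrm{III}})$ consists of all maps $f\colon\Omega\to K_{\mathrm I}\cup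 K_{\mathrm{II}}\cup K_{\mathrm{III}}$ such that $f|_{\Omega_J}$ is a continuous map $\Omega_J\to K_J$ for each $J$, with pointwise addition. For $U\subseteq\Omega$, $f\rfloor_U$ is the map equal to $f$ on $U$ and to $0$ on $\Omega\setminus U$. *)

theory Defs
  imports "HOL-Analysis.Analysis" "HOL-Library.Equipollence"
begin

section \<open>Partial commutative monoids\<close>

text \<open>
  A structure is given by an explicit carrier; \<open>None\<close> means that a sum is undefined.  All
  notions below are relativised to the carrier.
\<close>

record 'a pcm =
  elems :: "'a set"
  pzero :: 'a
  pplus :: "'a \<Rightarrow> 'a \<Rightarrow> 'a option"

definition partial_comm_monoid :: "('a, 'm) pcm_scheme \<Rightarrow> bool" where
  "partial_comm_monoid S \<longleftrightarrow>
     pzero S \<in> elems S \<and>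
     (\<forall>a\<in>elems S. \<forall>b\<in>elems S. \<forall>c. pplus S a b = Some c \<longrightarrow> c \<in> elems S) \<and>
     (\<forall>a\<in>elems S. \<forall>b\<in>elems S. \<forall>c\<in>elems S.
        Option.bind (pplus S a b) (\<lambda>u. pplus S u c) = Option.bind (pplus S b c) (\<lambda>v. pplus S a v)) \<and>
     (\<forall>a\<in>elems S. \<forall>b\<in>elems S. pplus S a b = pplus S b a) \<and>
     (\<forall>a\<in>elems S. pplus S a (pzero S) = Some a)"

definition ple :: "('a, 'm) pcm_scheme \<Rightarrow> 'a \<Rightarrow> 'a \<Rightarrow> bool" where
  "ple S a b \<longleftrightarrow> (\<exists>x\<in>elems S. pplus S a x = Some b)"

definition orthogonal :: "('a, 'm) pcm_scheme \<Rightarrow> 'a \<Rightarrow> 'a \<Rightarrow> bool" where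
  "orthogonal S a b \<longleftrightarrow> (\<forall>x\<in>elems S. ple S x a \<and> ple S x b \<longrightarrow> x = pzero S)"

definition perp :: "('a, 'm) pcm_scheme \<Rightarrow> 'a set \<Rightarrow> 'a set" where
  "perp S X = {s \<in> elems S. \<forall>x\<in>X. orthogonal S s x}"

definition directly_finite :: "('a, 'm) pcm_scheme \<Rightarrow> 'a \<Rightarrow> bool" where
  "directly_finite S a \<longleftrightarrow> (\<forall>x\<in>elems S. pplus S x a = Some a \<longrightarrow> x = pzero S)"

definition purely_infinite :: "('a, 'm) pcm_scheme \<Rightarrow> 'a \<Rightarrow> bool" where
  "purely_infinite S a \<longleftrightarrow> pplus S a a = Some a"

definition multiple_free :: "('a, 'm) pcm_scheme \<Rightarrow> 'a \<Rightarrow> bool" where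
  "multiple_free S a \<longleftrightarrow>
     (\<forall>x\<in>elems S. (\<exists>y. pplus S x x = Some y \<and> ple S y a) \<longrightarrow> x = pzero S)"

definition ll_rem :: "('a, 'm) pcm_scheme \<Rightarrow> 'a \<Rightarrow> 'a \<Rightarrow> bool" where
  "ll_rem S a b \<longleftrightarrow>
     ple S a b \<and> (\<forall>x\<in>elems S. (\<exists>y. pplus S a x = Some y \<and> ple S b y) \<longrightarrow> ple S b x)"

definition lower_embedding ::
  "('a, 'm) pcm_scheme \<Rightarrow> ('b, 'n) pcm_scheme \<Rightarrow> ('a \<Rightarrow> 'b) \<Rightarrow> bool" where
  "lower_embedding A B \<phi> \<longleftrightarrow>
     \<phi> \<in> elems A \<rightarrow> elems B \<and>
     \<phi> (pzero A) = pzero B \<and>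
     (\<forall>a\<in>elems A. \<forall>b\<in>elems A. \<forall>c. pplus A a b = Some c \<longrightarrow> pplus B (\<phi> a) (\<phi> b) = Some (\<phi> c)) \<and>
     inj_on \<phi> (elems A) \<and>
     (\<forall>x\<in>elems A. \<forall>y\<in>elems A. ple B (\<phi> x) (\<phi> y) \<longrightarrow> ple A x y) \<and>
     (\<forall>x\<in>elems A. \<forall>y\<in>elems B. ple B y (\<phi> x) \<longrightarrow> y \<in> \<phi> ` elems A)"


section \<open>Projections\<close>

text \<open>
  Projections are extensional functions on the carrier, so that equality of HOL functions is
  equality of maps from \<open>S\<close> to \<open>S\<close>.
\<close>

definition Proj :: "('a, 'm) pcm_scheme \<Rightarrow> ('a \<Rightarrow> 'a) set" where
  "Proj S = {p \<in> elems S \<rightarrow>\<^sub>E elems S.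
     p (pzero S) = pzero S \<and>
     (\<forall>a\<in>elems S. \<forall>b\<in>elems S. \<forall>c. pplus S a b = Some c \<longrightarrow> pplus S (p a) (p b) = Some (p c)) \<and>
     (\<forall>x\<in>elems S. \<exists>y\<in>perp S (p ` elems S). pplus S (p x) y = Some x)}"

definition proj_le :: "('a, 'm) pcm_scheme \<Rightarrow> ('a \<Rightarrow> 'a) \<Rightarrow> ('a \<Rightarrow> 'a) \<Rightarrow> bool" where
  "proj_le S p q \<longleftrightarrow> p ` elems S \<subseteq> q ` elems S"

text \<open>
  The projection with a prescribed range.  Under refinement and antisymmetry a projection is
  determined by its range; this is only applied to sets that are ranges of projections of a
  continuous dimension scale.
\<close>

definition proj_onto :: "('a, 'm) pcm_scheme \<Rightarrow> 'a set \<Rightarrow> 'a \<Rightarrow> 'a" where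
  "proj_onto S X = (THE p. p \<in> Proj S \<and> p ` elems S = X)"

definition proj_perp :: "('a, 'm) pcm_scheme \<Rightarrow> ('a \<Rightarrow> 'a) \<Rightarrow> 'a \<Rightarrow> 'a" where
  "proj_perp S p = proj_onto S (perp S (p ` elems S))"


section \<open>Continuous dimension scales\<close>

definition refinement :: "('a, 'm) pcm_scheme \<Rightarrow> bool" where
  "refinement S \<longleftrightarrow>
     (\<forall>a0\<in>elems S. \<forall>a1\<in>elems S. \<forall>b0\<in>elems S. \<forall>b1\<in>elems S. \<forall>s.
        pplus S a0 a1 = Some s \<and> pplus S b0 b1 = Some s \<longrightarrow>
        (\<exists>c00\<in>elems S. \<exists>c01\<in>elems S. \<exists>c10\<in>elems S. \<exists>c11\<in>elems S.
           pplus S c00 c01 = Some a0 \<and> pplus S c10 c11 = Some a1 \<and>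
           pplus S c00 c10 = Some b0 \<and> pplus S c01 c11 = Some b1))"

locale continuous_dimension_scale =
  fixes S :: "'a pcm"
  assumes pcm: "partial_comm_monoid S"
    and M1_refinement: "refinement S"
    and M1_antisym: "\<forall>a\<in>elems S. \<forall>b\<in>elems S. ple S a b \<and> ple S b a \<longrightarrow> a = b"
    and M2: "\<forall>X. X \<subseteq> elems S \<and> X \<noteq> {} \<longrightarrow>
      (\<exists>m\<in>elems S. (\<forall>x\<in>X. ple S m x) \<and> (\<forall>y\<in>elems S. (\<forall>x\<in>X. ple S y x) \<longrightarrow> ple S y m))"
    and M3: "\<forall>x\<in>elems S. \<forall>y\<in>elems S. \<exists>p\<in>Proj S.
      ple S (p x) (p y) \<and> ple S (proj_perp S p y) (proj_perp S p x)"
    and M4: "\<forall>a\<in>elems S. \<forall>b\<in>elems S. \<exists>p\<in>Proj S.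
      ple S (p a) (p b) \<and> (\<forall>q\<in>Proj S. ple S (q a) (q b) \<longrightarrow> proj_le S q p)"
    and M5: "\<forall>x\<in>elems S. \<exists>a\<in>elems S. \<exists>b\<in>elems S.
      directly_finite S a \<and> purely_infinite S b \<and> pplus S a b = Some x"
    and M6: "\<forall>a\<in>elems S. \<forall>b\<in>elems S.
      purely_infinite S a \<and> purely_infinite S b \<and> ll_rem S a b \<longrightarrow>
      (let X = {x \<in> elems S. purely_infinite S x \<and> ll_rem S a x \<and> perp S {x} = perp S {b}}
       in \<exists>m\<in>X. \<forall>x\<in>X. ple S m x)"

definition S_mf :: "('a, 'm) pcm_scheme \<Rightarrow> 'a set" where
  "S_mf S = {a \<in> elems S. multiple_free S a}"

definition S_fin :: "('a, 'm) pcm_scheme \<Rightarrow> 'a set" where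
  "S_fin S = {a \<in> elems S. directly_finite S a}"

definition S_I :: "('a, 'm) pcm_scheme \<Rightarrow> 'a set" where
  "S_I S = perp S (perp S (S_mf S))"

definition S_II :: "('a, 'm) pcm_scheme \<Rightarrow> 'a set" where
  "S_II S = perp S (S_mf S) \<inter> perp S (perp S (S_fin S))"

definition S_III :: "('a, 'm) pcm_scheme \<Rightarrow> 'a set" where
  "S_III S = perp S (S_fin S)"

definition finitary_unit :: "('a, 'm) pcm_scheme \<Rightarrow> 'a set \<Rightarrow> bool" where
  "finitary_unit S E \<longleftrightarrow>
     E \<subseteq> S_fin S - {pzero S} \<and>
     (\<forall>e\<in>E. \<forall>e'\<in>E. e \<noteq> e' \<longrightarrow> orthogonal S e e') \<and>
     (\<forall>x\<in>S_fin S - {pzero S}. \<exists>e\<in>E. \<not> orthogonal S x e) \<and>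
     (\<forall>e\<in>E. multiple_free S e \<or> \<not> (\<exists>x\<in>S_mf S - {pzero S}. ple S x e))"


section \<open>The ultrafilter space of the algebra of projections\<close>

text \<open>
  Ultrafilters are maximal proper filters of the ordered set of projections; since that
  order has binary meets, filters may be described by downward directedness.
\<close>

definition proj_filter :: "('a, 'm) pcm_scheme \<Rightarrow> ('a \<Rightarrow> 'a) set \<Rightarrow> bool" where
  "proj_filter S F \<longleftrightarrow>
     F \<subseteq> Proj S \<and> F \<noteq> {} \<and>
     (\<forall>p\<in>F. \<forall>q\<in>Proj S. proj_le S p q \<longrightarrow> q \<in> F) \<and>
     (\<forall>p\<in>F. \<forall>q\<in>F. \<exists>r\<in>F. proj_le S r p \<and> proj_le S r q)"

definition proj_ultrafilter :: "('a, 'm) pcm_scheme \<Rightarrow> ('a \<Rightarrow> 'a) set \<Rightarrow> bool" where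
  "proj_ultrafilter S F \<longleftrightarrow>
     proj_filter S F \<and> F \<noteq> Proj S \<and>
     (\<forall>G. proj_filter S G \<and> G \<noteq> Proj S \<and> F \<subseteq> G \<longrightarrow> G = F)"

definition Omega :: "('a, 'm) pcm_scheme \<Rightarrow> ('a \<Rightarrow> 'a) set set" where
  "Omega S = {F. proj_ultrafilter S F}"

definition Omega_at :: "('a, 'm) pcm_scheme \<Rightarrow> ('a \<Rightarrow> 'a) \<Rightarrow> ('a \<Rightarrow> 'a) set set" where
  "Omega_at S p = {F \<in> Omega S. p \<in> F}"

definition Omega_topology :: "('a, 'm) pcm_scheme \<Rightarrow> ('a \<Rightarrow> 'a) set topology" where
  "Omega_topology S = topology_generated_by (Omega_at S ` Proj S)"

definition Omega_I :: "('a, 'm) pcm_scheme \<Rightarrow> ('a \<Rightarrow> 'a) set set" where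
  "Omega_I S = Omega_at S (proj_onto S (S_I S))"

definition Omega_II :: "('a, 'm) pcm_scheme \<Rightarrow> ('a \<Rightarrow> 'a) set set" where
  "Omega_II S = Omega_at S (proj_onto S (S_II S))"

definition Omega_III :: "('a, 'm) pcm_scheme \<Rightarrow> ('a \<Rightarrow> 'a) set set" where
  "Omega_III S = Omega_at S (proj_onto S (S_III S))"


section \<open>Reals extended by alephs\<close>

text \<open>
  The alephs are indexed by the elements of a well-ordered type \<open>'o\<close>, i.e. by the ordinals
  below the order type of \<open>'o\<close>; the least element of \<open>'o\<close> is the index \<open>0\<close>.
  The proper class of all ordinals is replaced by an arbitrary type \<open>'o\<close> of cardinality larger
  than that of the scale \<open>S\<close>.  This loses nothing: if a lower embedding takes a value
  \<open>Aleph \<xi>\<close>, its range contains a nonzero function below it for each \<open>\<eta> < \<xi>\<close> (constant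
  \<open>Aleph \<eta>\<close> on a clopen set, zero elsewhere), and these are
  pairwise distinct, so \<open>\<xi>\<close> has at most as many predecessors as \<open>S\<close> has elements.
  Negative reals never occur in the sets of values \<open>Zval\<close>, \<open>Rval\<close>, \<open>Tval\<close> below.
\<close>

datatype 'o scale_val = Fin real | Aleph 'o

instantiation scale_val :: (linorder) linorder
begin

fun less_eq_scale_val :: "'a scale_val \<Rightarrow> 'a scale_val \<Rightarrow> bool" where
  "Fin r \<le> Fin s \<longleftrightarrow> r \<le> s"
| "Fin r \<le> Aleph b \<longleftrightarrow> True"
| "Aleph a \<le> Fin s \<longleftrightarrow> False"
| "Aleph a \<le> Aleph b \<longleftrightarrow> a \<le> b"

definition less_scale_val :: "'a scale_val \<Rightarrow> 'a scale_val \<Rightarrow> bool" where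
  "less_scale_val x y \<longleftrightarrow> x \<le> y \<and> \<not> y \<le> x"

instance
proof
  fix x y z :: "'a scale_val"
  show "x < y \<longleftrightarrow> x \<le> y \<and> \<not> y \<le> x" by (rule less_scale_val_def)
  show "x \<le> x" by (cases x) auto
  show "x \<le> y \<Longrightarrow> y \<le> z \<Longrightarrow> x \<le> z" by (cases x; cases y; cases z) auto
  show "x \<le> y \<Longrightarrow> y \<le> x \<Longrightarrow> x = y" by (cases x; cases y) auto
  show "x \<le> y \<or> y \<le> x" by (cases x; cases y) auto
qed

end

instantiation scale_val :: (linorder) "{comm_monoid_add, one}"
begin

fun plus_scale_val :: "'a scale_val \<Rightarrow> 'a scale_val \<Rightarrow> 'a scale_val" where
  "Fin r + Fin s = Fin (r + s)"
| "Fin r + Aleph b = Aleph b"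
| "Aleph a + Fin s = Aleph a"
| "Aleph a + Aleph b = Aleph (max a b)"

definition zero_scale_val :: "'a scale_val" where "0 = Fin 0"

definition one_scale_val :: "'a scale_val" where "1 = Fin 1"

instance
proof
  fix x y z :: "'a scale_val"
  show "x + y + z = x + (y + z)" by (cases x; cases y; cases z) (auto simp: max.assoc)
  show "x + y = y + x" by (cases x; cases y) (auto simp: max.commute)
  show "0 + x = x" by (cases x) (auto simp: zero_scale_val_def)
qed

end

definition Zval :: "'o::linorder \<Rightarrow> 'o scale_val set" where
  "Zval \<gamma> = {Fin n | n. n \<in> \<nat>} \<union> {Aleph \<xi> | \<xi>. \<xi> \<le> \<gamma>}"

definition Rval :: "'o::linorder \<Rightarrow> 'o scale_val set" where
  "Rval \<gamma> = {Fin r | r. 0 \<le> r} \<union> {Aleph \<xi> | \<xi>. \<xi> \<le> \<gamma>}"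

definition Tval :: "'o::linorder \<Rightarrow> 'o scale_val set" where
  "Tval \<gamma> = {Fin 0} \<union> {Aleph \<xi> | \<xi>. \<xi> \<le> \<gamma>}"

definition interval_topology :: "'b::linorder set \<Rightarrow> 'b topology" where
  "interval_topology A = topology_generated_by
     ({A} \<union> {A - {x \<in> A. x \<le> a} | a. a \<in> A} \<union> {A - {x \<in> A. a \<le> x} | a. a \<in> A})"


section \<open>The function space\<close>

text \<open>
  Elements are extensional functions on \<open>topspace X\<close>.  The families \<open>K\<close> stand for
  \<open>\<Union>\<gamma>. K \<gamma>\<close>; \<open>continuous_map\<close> includes that the values lie in \<open>K \<gamma>\<close>.
\<close>

definition continuous_into ::
  "'x topology \<Rightarrow> 'x set \<Rightarrow> ('o::linorder \<Rightarrow> 'o scale_val set) \<Rightarrow> ('x \<Rightarrow> 'o scale_val) \<Rightarrow> bool" where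
  "continuous_into X U K f \<longleftrightarrow>
     (\<exists>\<gamma>. continuous_map (subtopology X U) (interval_topology (K \<gamma>)) f)"

definition C_pcm ::
  "'x topology \<Rightarrow> 'x set \<Rightarrow> ('o::linorder \<Rightarrow> 'o scale_val set) \<Rightarrow>
   'x set \<Rightarrow> ('o \<Rightarrow> 'o scale_val set) \<Rightarrow> 'x set \<Rightarrow> ('o \<Rightarrow> 'o scale_val set) \<Rightarrow>
   ('x \<Rightarrow> 'o scale_val) pcm" where
  "C_pcm X U1 K1 U2 K2 U3 K3 =
     \<lparr> elems = {f \<in> extensional (topspace X).
                 continuous_into X U1 K1 f \<and> continuous_into X U2 K2 f \<and> continuous_into X U3 K3 f},
       pzero = (\<lambda>x\<in>topspace X. 0),
       pplus = (\<lambda>f g. Some (\<lambda>x\<in>topspace X. f x + g x)) \<rparr>"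

definition C_scale :: "('a, 'm) pcm_scheme \<Rightarrow> (('a \<Rightarrow> 'a) set \<Rightarrow> 'o::linorder scale_val) pcm" where
  "C_scale S = C_pcm (Omega_topology S) (Omega_I S) Zval (Omega_II S) Rval (Omega_III S) Tval"

definition fun_restrict :: "'x set \<Rightarrow> 'x set \<Rightarrow> ('x \<Rightarrow> 'v::zero) \<Rightarrow> 'x \<Rightarrow> 'v" where
  "fun_restrict X U f = (\<lambda>x\<in>X. if x \<in> U then f x else 0)"

text \<open>
  The lower embeddings of \<open>S\<close> considered in the main theorem, as extensional functions on the
  carrier of \<open>S\<close>.
\<close>

definition scale_embedding ::
  "('a, 'm) pcm_scheme \<Rightarrow> 'a set \<Rightarrow> ('a \<Rightarrow> ('a \<Rightarrow> 'a) set \<Rightarrow> 'o::linorder scale_val) \<Rightarrow> bool" where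
  "scale_embedding S E \<epsilon> \<longleftrightarrow>
     \<epsilon> \<in> extensional (elems S) \<and>
     lower_embedding S (C_scale S) \<epsilon> \<and>
     (\<forall>x\<in>elems S. \<forall>p\<in>Proj S. \<epsilon> (p x) = fun_restrict (Omega S) (Omega_at S p) (\<epsilon> x)) \<and>
     (\<forall>e\<in>E \<inter> S_II S. \<forall>\<aa>\<in>Omega S. \<epsilon> e \<aa> \<in> {0, 1})"

end

(*
  An element u of S is a unit of value v if it is to be represented by the function with
  constant value v on a clopen set and 0 elsewhere.  Units can be described inside S: finite
  dyadic values by halving the elements of E (in type I only integers occur), alephs by
  transfinite recursion, the unit of value aleph_xi being the least purely infinite element
  with the given support that is strictly above the units of all smaller aleph values (M6).
  Then epsilon(x) at an ultrafilter a is the supremum of the values of the units u <= x whose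
  support belongs to a.  By (M2), each x dominates a largest unit of each value, which gives
  continuity; (M3) and the cancellation of directly finite elements give additivity.
  Every nonzero element dominates a nonzero unit, and every nonzero purely infinite element is
  somewhere an aleph unit; with (M4) this shows that epsilon reflects the order.  A continuous
  h <= epsilon(x) is the image of the supremum of the units below x with values below h.
  For uniqueness, any other embedding with the same properties is shown to send units to the
  corresponding constant functions and to have no other preimages for them.
*)

theory Submission
  imports Defs
begin

section \<open>Partial commutative monoids and projections\<close>

text \<open>Statements at single points of \<Omega> have to be read off from projections, and two
  devices do this. By (M4) there is a largest projection on which a lies below b, so an inequality
  need only be checked on arbitrarily small pieces (\<open>dense_le\<close>). This is why finite
  units are defined by a dense condition: the supremum of all units of one value below x is then a
  unit again. Second, between two values allowed at a point there is either a unit value, or no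
  allowed value at all, the larger one being itself a unit value (\<open>Kat_gap\<close>). This
  alternative covers dyadic approximation in type II as well as the jumps of discrete values. The
  obstacle is the behaviour of alephs under restriction. Being strictly above must mean being so on
  every nonzero piece (\<open>slt\<close>), and minimality survives cutting only because a smaller
  competitor on a piece can be glued to the rest of the unit (\<open>au_act\<close>). Since units of
  different alephs are different elements of S, a large index type contains some \<gamma> at which
  only zero is a unit; this bounds all values and stops the transfinite searches.\<close>

text \<open>
  The sum is total on the type, and a sum is defined iff it lies in \<open>D\<close>: for a scale on
  \<open>'a\<close>, the type is \<open>'a option\<close>, with \<open>None\<close> for undefined sums.  The projections
  are an abstract set \<open>Pr\<close> acting on \<open>D\<close>, with an axiom \<open>act_ex\<close> saying that there
  are enough of them.
\<close>

locale total_pcm = comm_monoid add zero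
  for add :: "'b \<Rightarrow> 'b \<Rightarrow> 'b" (infixl "\<oplus>" 65) and zero :: 'b ("\<zero>") +
  fixes D :: "'b set"
  assumes add_D: "x \<oplus> y \<in> D \<Longrightarrow> x \<in> D"
    and zero_D [simp]: "\<zero> \<in> D"
begin

lemmas ac = assoc commute left_commute

lemma add_D2: "x \<oplus> y \<in> D \<Longrightarrow> y \<in> D"
  using add_D commute by metis

text \<open>Requiring \<open>y \<in> D\<close> keeps undefined sums from being upper bounds;
  membership of the smaller element is then automatic, by \<open>add_D\<close>.\<close>

definition le :: "'b \<Rightarrow> 'b \<Rightarrow> bool" (infix "\<sqsubseteq>" 50) where
  "x \<sqsubseteq> y \<longleftrightarrow> y \<in> D \<and> (\<exists>z. x \<oplus> z = y)"

definition orth :: "'b \<Rightarrow> 'b \<Rightarrow> bool" where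
  "orth x y \<longleftrightarrow> (\<forall>t. t \<sqsubseteq> x \<and> t \<sqsubseteq> y \<longrightarrow> t = \<zero>)"

lemma leI: "x \<oplus> z = y \<Longrightarrow> y \<in> D \<Longrightarrow> x \<sqsubseteq> y"
  unfolding le_def by blast

lemma leE:
  assumes "x \<sqsubseteq> y" obtains z where "y = x \<oplus> z" "z \<in> D"
  using assms add_D2 unfolding le_def by metis

lemma le_D1: "x \<sqsubseteq> y \<Longrightarrow> x \<in> D"
  unfolding le_def using add_D by blast

lemma le_D2: "x \<sqsubseteq> y \<Longrightarrow> y \<in> D"
  unfolding le_def by blast

lemma le_refl [simp]: "x \<in> D \<Longrightarrow> x \<sqsubseteq> x"
  unfolding le_def using right_neutral by blast

lemma le_trans [trans]: "x \<sqsubseteq> y \<Longrightarrow> y \<sqsubseteq> z \<Longrightarrow> x \<sqsubseteq> z"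
  unfolding le_def using assoc by metis

lemma zero_le [simp]: "x \<in> D \<Longrightarrow> \<zero> \<sqsubseteq> x"
  unfolding le_def using left_neutral by blast

lemma le_add1: "x \<oplus> y \<in> D \<Longrightarrow> x \<sqsubseteq> x \<oplus> y"
  unfolding le_def by blast

lemma le_add2: "x \<oplus> y \<in> D \<Longrightarrow> y \<sqsubseteq> x \<oplus> y"
  unfolding le_def using commute by metis

lemma add_mono:
  assumes "x \<sqsubseteq> x'" "y \<sqsubseteq> y'" "x' \<oplus> y' \<in> D"
  shows "x \<oplus> y \<sqsubseteq> x' \<oplus> y'"
proof -
  obtain a b where "x' = x \<oplus> a" "y' = y \<oplus> b" using assms leE by metis
  then have "(x \<oplus> y) \<oplus> (a \<oplus> b) = x' \<oplus> y'" by (simp add: ac)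
  then show ?thesis using leI assms(3) by blast
qed

lemma add_mono_D:
  assumes "x \<sqsubseteq> x'" "y \<sqsubseteq> y'" "x' \<oplus> y' \<in> D"
  shows "x \<oplus> y \<in> D"
  using add_mono[OF assms] le_D1 by blast

lemma orth_sym: "orth x y \<Longrightarrow> orth y x"
  unfolding orth_def by blast

lemma orth_mono: "orth x y \<Longrightarrow> x' \<sqsubseteq> x \<Longrightarrow> y' \<sqsubseteq> y \<Longrightarrow> orth x' y'"
  unfolding orth_def using le_trans by blast

lemma orthD: "orth x y \<Longrightarrow> t \<sqsubseteq> x \<Longrightarrow> t \<sqsubseteq> y \<Longrightarrow> t = \<zero>"
  unfolding orth_def by blast

primrec mult :: "nat \<Rightarrow> 'b \<Rightarrow> 'b" where
  "mult 0 f = \<zero>"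
| "mult (Suc n) f = f \<oplus> mult n f"

lemma mult_add: "mult (m + n) f = mult m f \<oplus> mult n f"
  by (induction m) (auto simp: ac)

lemma mult_mult: "mult m (mult n f) = mult (m * n) f"
  by (induction m) (auto simp: mult_add)

lemma mult_distrib: "mult n (f \<oplus> g) = mult n f \<oplus> mult n g"
  by (induction n) (auto simp: ac)

lemma mult_1 [simp]: "mult (Suc 0) f = f"
  by simp

lemma mult_zero [simp]: "mult n \<zero> = \<zero>"
  by (induction n) auto

lemma mult_mono_D: "m \<le> n \<Longrightarrow> mult n f \<in> D \<Longrightarrow> mult m f \<in> D"
  using mult_add[of m "n - m" f] add_D by simp

lemma mult_mono: "m \<le> n \<Longrightarrow> mult n f \<in> D \<Longrightarrow> mult m f \<sqsubseteq> mult n f"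
  using mult_add[of m "n - m" f] leI by simp

lemma mult_D: "0 < n \<Longrightarrow> mult n f \<in> D \<Longrightarrow> f \<in> D"
  using mult_mono_D[of 1 n f] by simp

lemma mult_le: "0 < n \<Longrightarrow> mult n f \<in> D \<Longrightarrow> f \<sqsubseteq> mult n f"
  using mult_mono[of 1 n f] by simp

definition fin :: "'b \<Rightarrow> bool" where
  "fin a \<longleftrightarrow> a \<in> D \<and> (\<forall>x. x \<oplus> a = a \<longrightarrow> x = \<zero>)"

definition pinf :: "'b \<Rightarrow> bool" where
  "pinf a \<longleftrightarrow> a \<in> D \<and> a \<oplus> a = a"

definition mf :: "'b \<Rightarrow> bool" where
  "mf a \<longleftrightarrow> a \<in> D \<and> (\<forall>x. x \<oplus> x \<sqsubseteq> a \<longrightarrow> x = \<zero>)"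

definition llrem :: "'b \<Rightarrow> 'b \<Rightarrow> bool" where
  "llrem a b \<longleftrightarrow> a \<sqsubseteq> b \<and> (\<forall>x. b \<sqsubseteq> a \<oplus> x \<longrightarrow> b \<sqsubseteq> x)"

definition is_sup :: "'b set \<Rightarrow> 'b \<Rightarrow> bool" where
  "is_sup X s \<longleftrightarrow> s \<in> D \<and> (\<forall>x\<in>X. x \<sqsubseteq> s) \<and> (\<forall>t. (\<forall>x\<in>X. x \<sqsubseteq> t) \<and> t \<in> D \<longrightarrow> s \<sqsubseteq> t)"

lemma fin_D: "fin a \<Longrightarrow> a \<in> D" unfolding fin_def by blast
lemma pinf_D: "pinf a \<Longrightarrow> a \<in> D" unfolding pinf_def by blast
lemma mf_D: "mf a \<Longrightarrow> a \<in> D" unfolding mf_def by blast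

lemma fin_absorb: "fin a \<Longrightarrow> x \<oplus> a = a \<Longrightarrow> x = \<zero>" unfolding fin_def by blast

lemma fin_le: "fin a \<Longrightarrow> x \<sqsubseteq> a \<Longrightarrow> fin x"
  unfolding fin_def using le_D1 leE assoc by metis

lemma mf_le: "mf a \<Longrightarrow> x \<sqsubseteq> a \<Longrightarrow> mf x"
  unfolding mf_def using le_D1 le_trans by blast

text \<open>If x is absorbed by a, then so is \<open>x \<oplus> x\<close>, which therefore lies
  below a.\<close>

lemma mf_fin: "mf a \<Longrightarrow> fin a"
  unfolding mf_def fin_def by (metis leI assoc)

lemma fin_pinf_zero: "fin a \<Longrightarrow> pinf a \<Longrightarrow> a = \<zero>"
  unfolding fin_def pinf_def by blast

end

section \<open>Projections of a refinement monoid\<close>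

locale proj_monoid = total_pcm add zero D
  for add :: "'b \<Rightarrow> 'b \<Rightarrow> 'b" (infixl "\<oplus>" 65) and zero :: 'b ("\<zero>") and D :: "'b set" +
  fixes Pr :: "'p set" and act :: "'p \<Rightarrow> 'b \<Rightarrow> 'b" (infixr "\<cdot>" 75)
  assumes refine: "\<And>a b c d. a \<oplus> b = c \<oplus> d \<Longrightarrow> c \<oplus> d \<in> D \<Longrightarrow>
      \<exists>w x y z. a = w \<oplus> x \<and> b = y \<oplus> z \<and> c = w \<oplus> y \<and> d = x \<oplus> z"
    and antisym: "x \<sqsubseteq> y \<Longrightarrow> y \<sqsubseteq> x \<Longrightarrow> x = y"
    and act_D: "\<And>p x. p \<in> Pr \<Longrightarrow> x \<in> D \<Longrightarrow> p \<cdot> x \<in> D"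
    and act_zero: "\<And>p. p \<in> Pr \<Longrightarrow> p \<cdot> \<zero> = \<zero>"
    and act_add: "\<And>p x y. p \<in> Pr \<Longrightarrow> x \<oplus> y \<in> D \<Longrightarrow> p \<cdot> (x \<oplus> y) = p \<cdot> x \<oplus> p \<cdot> y"
    and act_split: "\<And>p x. p \<in> Pr \<Longrightarrow> x \<in> D \<Longrightarrow>
      \<exists>y. p \<cdot> x \<oplus> y = x \<and> (\<forall>z\<in>D. orth y (p \<cdot> z))"
    and act_ex: "\<And>f. (\<And>x. x \<in> D \<Longrightarrow> f x \<in> D) \<Longrightarrow> f \<zero> = \<zero> \<Longrightarrow>
      (\<And>x y. x \<oplus> y \<in> D \<Longrightarrow> f (x \<oplus> y) = f x \<oplus> f y) \<Longrightarrow>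
      (\<And>x. x \<in> D \<Longrightarrow> \<exists>y. f x \<oplus> y = x \<and> (\<forall>z\<in>D. orth y (f z))) \<Longrightarrow>
      \<exists>p\<in>Pr. \<forall>x\<in>D. p \<cdot> x = f x"
begin

lemma le_zero: "x \<sqsubseteq> \<zero> \<Longrightarrow> x = \<zero>"
  using antisym zero_le le_D1 by blast

lemma add_zero1: "x \<oplus> y = \<zero> \<Longrightarrow> x = \<zero>"
  using le_zero le_add1 zero_D by metis

lemma add_zero2: "x \<oplus> y = \<zero> \<Longrightarrow> y = \<zero>"
  using add_zero1 commute by metis

text \<open>Refining the two decompositions of \<open>y \<oplus> z\<close>, one into x and a rest,
  the other into y and z, cuts x into the two pieces.\<close>

lemma riesz:
  assumes "x \<sqsubseteq> y \<oplus> z"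
  obtains y' z' where "x = y' \<oplus> z'" "y' \<sqsubseteq> y" "z' \<sqsubseteq> z"
proof -
  have D: "y \<oplus> z \<in> D" using assms le_D2 by blast
  obtain t where "x \<oplus> t = y \<oplus> z" using assms leE by metis
  from refine[OF this D] obtain a b c d where
    *: "x = a \<oplus> b" "t = c \<oplus> d" "y = a \<oplus> c" "z = b \<oplus> d" by blast
  show ?thesis
  proof (rule that)
    show "x = a \<oplus> b" by fact
    show "a \<sqsubseteq> y" using * D add_D by (auto intro: leI)
    show "b \<sqsubseteq> z" using * D add_D2 by (auto intro: leI)
  qed
qed

lemma orth_add:
  assumes "orth x t" "orth y t" "x \<oplus> y \<in> D" shows "orth (x \<oplus> y) t"
  unfolding orth_def
proof (intro allI impI)
  fix s assume s: "s \<sqsubseteq> x \<oplus> y \<and> s \<sqsubseteq> t"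
  then obtain a b where ab: "s = a \<oplus> b" "a \<sqsubseteq> x" "b \<sqsubseteq> y" using riesz by blast
  have "s \<in> D" using s le_D1 by blast
  then have "a \<sqsubseteq> t" "b \<sqsubseteq> t" using s ab le_add1 le_add2 le_trans by metis+
  then have "a = \<zero>" "b = \<zero>" using ab assms orthD by blast+
  then show "s = \<zero>" using ab by simp
qed

text \<open>Of the two Riesz pieces of x, the one below y is also below x, hence zero.\<close>

lemma orth_le_add:
  assumes "x \<sqsubseteq> y \<oplus> z" "orth x y" shows "x \<sqsubseteq> z"
proof -
  obtain y' z' where *: "x \<sqsubseteq> y \<oplus> z" "orth x y" "x = y' \<oplus> z'" "y' \<sqsubseteq> y" "z' \<sqsubseteq> z"
    using riesz assms by metis
  have "x \<in> D" using * le_D1 by blast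
  then have "y' \<sqsubseteq> x" using * le_add1 by metis
  then have "y' = \<zero>" using * orthD by blast
  then show ?thesis using * by simp
qed

lemma act_le: "p \<in> Pr \<Longrightarrow> x \<in> D \<Longrightarrow> p \<cdot> x \<sqsubseteq> x"
  using act_split le_def by blast

lemma act_mono: "p \<in> Pr \<Longrightarrow> x \<sqsubseteq> y \<Longrightarrow> p \<cdot> x \<sqsubseteq> p \<cdot> y"
  unfolding le_def using act_add act_D by metis

text \<open>The part of x missed by p is below \<open>p \<cdot> y\<close> and orthogonal to the
  range of p, so it is orthogonal to an element above it and vanishes. Ranges of projections are
  thus downward closed.\<close>

lemma act_fixI:
  assumes "p \<in> Pr" "x \<sqsubseteq> p \<cdot> y" "y \<in> D" shows "p \<cdot> x = x"
proof -
  have xD: "x \<in> D" using assms le_D1 by blast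
  obtain t where t: "p \<cdot> x \<oplus> t = x" "\<forall>z\<in>D. orth t (p \<cdot> z)"
    using act_split assms(1) xD by blast
  have "t \<sqsubseteq> x" using t xD le_add2 by metis
  then have "t \<sqsubseteq> p \<cdot> y" using assms le_trans by blast
  then have "t = \<zero>" using t assms(3) orthD le_refl \<open>t \<sqsubseteq> x\<close> le_D1 by blast
  then show ?thesis using t by simp
qed

lemma act_idem: "p \<in> Pr \<Longrightarrow> x \<in> D \<Longrightarrow> p \<cdot> p \<cdot> x = p \<cdot> x"
  using act_fixI act_D le_refl by blast

text \<open>\<open>p \<cdot> q \<cdot> x\<close> lies below \<open>q \<cdot> x\<close>, so q fixes
  it, and below \<open>p \<cdot> x\<close>; applying q to the second inequality gives one half of
  the claim, and symmetry the other.\<close>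

lemma act_comm:
  assumes "p \<in> Pr" "q \<in> Pr" "x \<in> D" shows "p \<cdot> q \<cdot> x = q \<cdot> p \<cdot> x"
proof -
  have half: "p \<cdot> q \<cdot> x \<sqsubseteq> q \<cdot> p \<cdot> x" if "p \<in> Pr" "q \<in> Pr" for p q
  proof -
    have "p \<cdot> q \<cdot> x \<sqsubseteq> q \<cdot> x" using act_le act_D that assms by blast
    then have "q \<cdot> p \<cdot> q \<cdot> x = p \<cdot> q \<cdot> x" using act_fixI that assms by blast
    moreover have "p \<cdot> q \<cdot> x \<sqsubseteq> p \<cdot> x" using act_mono act_le that assms by blast
    ultimately show ?thesis using act_mono[of q] that by metis
  qed
  show ?thesis using half[of p q] half[of q p] assms antisym by blast
qed

lemma act_mult: "p \<in> Pr \<Longrightarrow> mult n f \<in> D \<Longrightarrow> p \<cdot> mult n f = mult n (p \<cdot> f)"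
  by (induction n) (auto simp: act_zero act_add dest: add_D2)

text \<open>Orthogonality makes the splitting of an element into a Z part and a Y part unique.
  Taking the Z part is therefore additive, and \<open>act_ex\<close> turns it into a projection.
  Complements and the projections onto orthogonals of sets are obtained in this way.\<close>

lemma band_proj:
  assumes orth: "\<And>y z. y \<in> Y \<Longrightarrow> z \<in> Z \<Longrightarrow> orth y z"
    and addZ: "\<And>x y. x \<in> Z \<Longrightarrow> y \<in> Z \<Longrightarrow> x \<oplus> y \<in> D \<Longrightarrow> x \<oplus> y \<in> Z"
    and addY: "\<And>x y. x \<in> Y \<Longrightarrow> y \<in> Y \<Longrightarrow> x \<oplus> y \<in> D \<Longrightarrow> x \<oplus> y \<in> Y"
    and dec: "\<And>x. x \<in> D \<Longrightarrow> \<exists>z\<in>Z. \<exists>y\<in>Y. x = z \<oplus> y"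
  shows "\<exists>p\<in>Pr. \<forall>z\<in>Z. \<forall>y\<in>Y. z \<oplus> y \<in> D \<longrightarrow> p \<cdot> (z \<oplus> y) = z"
proof -
  have uniq: "z = z'" if *: "z \<in> Z" "y \<in> Y" "z' \<in> Z" "y' \<in> Y" "z \<oplus> y = z' \<oplus> y'" "z \<oplus> y \<in> D"
    for z y z' y'
  proof -
    have "z \<sqsubseteq> z'" if *: "z \<in> Z" "y \<in> Y" "z' \<in> Z" "y' \<in> Y" "z \<oplus> y = z' \<oplus> y'" "z \<oplus> y \<in> D"
      for z y z' y'
    proof -
      have "z \<sqsubseteq> y' \<oplus> z'" using * commute le_add1 by metis
      then show ?thesis using orth_le_add orth orth_sym * by blast
    qed
    from this[OF *] this[of z' y' z y] * show ?thesis using antisym by metis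
  qed
  define f where "f x = (SOME z. z \<in> Z \<and> (\<exists>y\<in>Y. x = z \<oplus> y))" for x
  have fs: "f x \<in> Z \<and> (\<exists>y\<in>Y. x = f x \<oplus> y)" if "x \<in> D" for x
    unfolding f_def by (rule someI_ex) (use dec that in blast)
  have fe: "f (z \<oplus> y) = z" if "z \<in> Z" "y \<in> Y" "z \<oplus> y \<in> D" for z y
    using fs[OF that(3)] uniq that by metis
  have "\<exists>p\<in>Pr. \<forall>x\<in>D. p \<cdot> x = f x"
  proof (rule act_ex)
    fix x assume x: "x \<in> D"
    then obtain y where y: "y \<in> Y" "x = f x \<oplus> y" using fs by blast
    show "f x \<in> D" using y x add_D by metis
    show "\<exists>y. f x \<oplus> y = x \<and> (\<forall>z\<in>D. orth y (f z))"
      using y fs orth by metis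
  next
    have "orth \<zero> z" for z unfolding orth_def using le_zero by blast
    obtain z y where "z \<in> Z" "y \<in> Y" "\<zero> = z \<oplus> y" using dec zero_D by blast
    then show "f \<zero> = \<zero>" using fe zero_D add_zero1 by metis
  next
    fix x y assume xy: "x \<oplus> y \<in> D"
    obtain a where a: "a \<in> Y" "x = f x \<oplus> a" using fs add_D xy by metis
    obtain b where b: "b \<in> Y" "y = f y \<oplus> b" using fs add_D2 xy by metis
    have e: "x \<oplus> y = (f x \<oplus> f y) \<oplus> (a \<oplus> b)" by (subst a(2), subst b(2)) (simp add: ac)
    have "f x \<oplus> f y \<in> Z" using addZ fs xy e add_D add_D2 by metis
    moreover have "a \<oplus> b \<in> Y" using addY a b xy e add_D2 by metis
    ultimately show "f (x \<oplus> y) = f x \<oplus> f y" using fe e xy by metis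
  qed
  then show ?thesis using fe by metis
qed

text \<open>Different elements of \<open>Pr\<close> may act alike, so complements and meets are
  characterised by their action only.\<close>

definition compl_pair :: "'p \<Rightarrow> 'p \<Rightarrow> bool" where
  "compl_pair p q \<longleftrightarrow> p \<in> Pr \<and> q \<in> Pr \<and> (\<forall>x\<in>D. p \<cdot> x \<oplus> q \<cdot> x = x \<and> p \<cdot> q \<cdot> x = \<zero> \<and> q \<cdot> p \<cdot> x = \<zero>)"

text \<open>The bands are the orthogonal of the range of p and the range itself. The second conjunct
  is kept in order to recognise the complement as the projection onto the orthogonal of the range in
  the concrete scale.\<close>

lemma compl_ex_orth:
  assumes p: "p \<in> Pr"
  shows "\<exists>q. compl_pair p q \<and> (\<forall>x\<in>D. q \<cdot> x = x \<longleftrightarrow> (\<forall>z\<in>D. orth x (p \<cdot> z)))"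
proof -
  let ?Z = "{t\<in>D. \<forall>z\<in>D. orth t (p \<cdot> z)}" and ?Y = "{p \<cdot> z | z. z \<in> D}"
  have "\<exists>q\<in>Pr. \<forall>z\<in>?Z. \<forall>y\<in>?Y. z \<oplus> y \<in> D \<longrightarrow> q \<cdot> (z \<oplus> y) = z"
  proof (rule band_proj)
    fix x y assume "x \<in> ?Y" "y \<in> ?Y" "x \<oplus> y \<in> D"
    then show "x \<oplus> y \<in> ?Y" using act_add p act_idem by (smt (verit) mem_Collect_eq)
  next
    fix x assume "x \<in> D"
    then obtain y where "p \<cdot> x \<oplus> y = x" "\<forall>z\<in>D. orth y (p \<cdot> z)" using act_split p by blast
    then have "x = y \<oplus> p \<cdot> x" "y \<in> ?Z" "p \<cdot> x \<in> ?Y" using add_D2[of "p \<cdot> x" y] \<open>x \<in> D\<close> by (auto simp: commute)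
    then show "\<exists>z\<in>?Z. \<exists>y\<in>?Y. x = z \<oplus> y" by blast
  qed (auto intro: orth_add orth_sym)
  then obtain q where q: "q \<in> Pr" "\<And>z y. z \<in> ?Z \<Longrightarrow> y \<in> ?Y \<Longrightarrow> z \<oplus> y \<in> D \<Longrightarrow> q \<cdot> (z \<oplus> y) = z" by blast
  have *: "p \<cdot> x \<oplus> q \<cdot> x = x \<and> (\<forall>z\<in>D. orth (q \<cdot> x) (p \<cdot> z))" if "x \<in> D" for x
  proof -
    obtain y where y: "p \<cdot> x \<oplus> y = x" "\<forall>z\<in>D. orth y (p \<cdot> z)" using act_split p \<open>x \<in> D\<close> by blast
    have e: "y \<oplus> p \<cdot> x = x" using y(1) commute by simp
    have "y \<in> ?Z" "p \<cdot> x \<in> ?Y" using y that e add_D[of y "p \<cdot> x"] by auto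
    then have "q \<cdot> x = y" using q(2)[of y "p \<cdot> x"] that e by simp
    then show ?thesis using y by simp
  qed
  have z: "p \<cdot> q \<cdot> x = \<zero>" if x: "x \<in> D" for x
  proof -
    have "q \<cdot> x \<in> D" using act_D q x by blast
    then have "p \<cdot> q \<cdot> x \<sqsubseteq> q \<cdot> x" "p \<cdot> q \<cdot> x \<sqsubseteq> p \<cdot> q \<cdot> x" using act_le p act_D by auto
    then show ?thesis using * x orthD \<open>q \<cdot> x \<in> D\<close> by blast
  qed
  have "compl_pair p q" unfolding compl_pair_def using p q * z act_comm by metis
  moreover have "q \<cdot> x = x" if x: "x \<in> D" "\<forall>z\<in>D. orth x (p \<cdot> z)" for x
  proof -
    have "p \<cdot> x \<sqsubseteq> x" "p \<cdot> x \<sqsubseteq> p \<cdot> x" using act_le p act_D x by auto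
    then have "p \<cdot> x = \<zero>" using x orthD by blast
    then show ?thesis using * x left_neutral by metis
  qed
  ultimately show ?thesis using * by metis
qed

definition cpl :: "'p \<Rightarrow> 'p" where
  "cpl p = (SOME q. compl_pair p q)"

definition mt :: "'p \<Rightarrow> 'p \<Rightarrow> 'p" where
  "mt p q = (SOME r. r \<in> Pr \<and> (\<forall>x\<in>D. r \<cdot> x = p \<cdot> q \<cdot> x))"

lemma compl_pair_cpl: "p \<in> Pr \<Longrightarrow> compl_pair p (cpl p)"
  unfolding cpl_def using compl_ex_orth someI_ex by metis

lemma cpl_Pr [simp]: "p \<in> Pr \<Longrightarrow> cpl p \<in> Pr"
  using compl_pair_cpl compl_pair_def by blast

lemma cpl_add: "p \<in> Pr \<Longrightarrow> x \<in> D \<Longrightarrow> p \<cdot> x \<oplus> cpl p \<cdot> x = x"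
  using compl_pair_cpl compl_pair_def by blast

lemma cpl_zero1: "p \<in> Pr \<Longrightarrow> x \<in> D \<Longrightarrow> p \<cdot> cpl p \<cdot> x = \<zero>"
  using compl_pair_cpl compl_pair_def by blast

lemma cpl_zero2: "p \<in> Pr \<Longrightarrow> x \<in> D \<Longrightarrow> cpl p \<cdot> p \<cdot> x = \<zero>"
  using compl_pair_cpl compl_pair_def by blast

text \<open>Splitting x by either pair shows that each of the two complements of p acts like their
  composition.\<close>

lemma compl_pair_act:
  assumes "compl_pair p q" "x \<in> D" shows "q \<cdot> x = cpl p \<cdot> x"
proof -
  note pq = assms[unfolded compl_pair_def]
  have p: "p \<in> Pr" "q \<in> Pr" using pq by auto
  have "q \<cdot> x = q \<cdot> (p \<cdot> x \<oplus> cpl p \<cdot> x)" using cpl_add p assms by metis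
  also have "\<dots> = q \<cdot> cpl p \<cdot> x" using act_add[of q "p \<cdot> x" "cpl p \<cdot> x"] p pq cpl_add by (metis left_neutral)
  also have "\<dots> = cpl p \<cdot> q \<cdot> x" using act_comm p assms by simp
  also have "\<dots> = cpl p \<cdot> (p \<cdot> x \<oplus> q \<cdot> x)" using act_add[of "cpl p" "p \<cdot> x" "q \<cdot> x"] p pq cpl_zero2
    by (metis left_neutral cpl_Pr)
  finally show ?thesis using pq by metis
qed

text \<open>The remainder of x under q and the remainder of \<open>q \<cdot> x\<close> under p are
  both orthogonal to every \<open>p \<cdot> q \<cdot> z\<close>; their sum is the remainder of x
  under the composition.\<close>

lemma mt: "p \<in> Pr \<Longrightarrow> q \<in> Pr \<Longrightarrow> mt p q \<in> Pr \<and> (\<forall>x\<in>D. mt p q \<cdot> x = p \<cdot> q \<cdot> x)"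
  unfolding mt_def
proof (rule someI_ex)
  assume pq: "p \<in> Pr" "q \<in> Pr"
  have "\<exists>r\<in>Pr. \<forall>x\<in>D. r \<cdot> x = p \<cdot> q \<cdot> x"
  proof (rule act_ex)
    fix x assume x: "x \<in> D"
    then have qx: "q \<cdot> x \<in> D" using act_D pq by blast
    then show "p \<cdot> q \<cdot> x \<in> D" using act_D pq by blast
    obtain y where y: "q \<cdot> x \<oplus> y = x" "\<forall>z\<in>D. orth y (q \<cdot> z)" using act_split pq x by blast
    obtain y' where y': "p \<cdot> q \<cdot> x \<oplus> y' = q \<cdot> x" "\<forall>z\<in>D. orth y' (p \<cdot> z)" using act_split pq qx by blast
    have e: "p \<cdot> q \<cdot> x \<oplus> (y' \<oplus> y) = x" using y y' assoc by metis
    have "orth (y' \<oplus> y) (p \<cdot> q \<cdot> z)" if "z \<in> D" for z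
    proof (rule orth_add)
      have "q \<cdot> z \<in> D" using act_D pq that by blast
      then show "orth y' (p \<cdot> q \<cdot> z)" using y' by blast
      show "orth y (p \<cdot> q \<cdot> z)"
        using y(2) that orth_mono act_le \<open>q \<cdot> z \<in> D\<close> pq le_refl add_D2 x y(1) by metis
      show "y' \<oplus> y \<in> D" using e x add_D2 by metis
    qed
    then show "\<exists>y. p \<cdot> q \<cdot> x \<oplus> y = x \<and> (\<forall>z\<in>D. orth y (p \<cdot> q \<cdot> z))" using e by blast
  next
    fix x y assume "x \<oplus> y \<in> D"
    then show "p \<cdot> q \<cdot> (x \<oplus> y) = p \<cdot> q \<cdot> x \<oplus> p \<cdot> q \<cdot> y" using act_add pq act_D by metis
  qed (use act_zero pq in auto)
  then show "\<exists>r. r \<in> Pr \<and> (\<forall>x\<in>D. r \<cdot> x = p \<cdot> q \<cdot> x)" by blast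
qed

lemma mt_Pr [simp]: "p \<in> Pr \<Longrightarrow> q \<in> Pr \<Longrightarrow> mt p q \<in> Pr" using mt by blast
lemma mt_act: "p \<in> Pr \<Longrightarrow> q \<in> Pr \<Longrightarrow> x \<in> D \<Longrightarrow> mt p q \<cdot> x = p \<cdot> q \<cdot> x" using mt by blast

text \<open>Inclusion of ranges, expressed by fixed points: a projection fixes exactly the elements
  of its range.\<close>

definition pleq :: "'p \<Rightarrow> 'p \<Rightarrow> bool" where
  "pleq p q \<longleftrightarrow> p \<in> Pr \<and> q \<in> Pr \<and> (\<forall>x\<in>D. q \<cdot> p \<cdot> x = p \<cdot> x)"

lemma pleqI: "p \<in> Pr \<Longrightarrow> q \<in> Pr \<Longrightarrow> (\<And>x. x \<in> D \<Longrightarrow> p \<cdot> x \<sqsubseteq> q \<cdot> x) \<Longrightarrow> pleq p q"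
  unfolding pleq_def using act_fixI act_D by metis

lemma pleq_act: "pleq p q \<Longrightarrow> x \<in> D \<Longrightarrow> q \<cdot> p \<cdot> x = p \<cdot> x" unfolding pleq_def by blast

lemma pleq_act2: "pleq p q \<Longrightarrow> x \<in> D \<Longrightarrow> p \<cdot> q \<cdot> x = p \<cdot> x" unfolding pleq_def using act_comm by metis

lemma pleq_le: "pleq p q \<Longrightarrow> x \<in> D \<Longrightarrow> p \<cdot> x \<sqsubseteq> q \<cdot> x"
  using pleq_act2[of p q x] act_le act_D pleq_def by metis

lemma mt_le1: "p \<in> Pr \<Longrightarrow> q \<in> Pr \<Longrightarrow> pleq (mt p q) p"
  unfolding pleq_def by (simp add: mt_act act_idem act_D)

lemma mt_le2: "p \<in> Pr \<Longrightarrow> q \<in> Pr \<Longrightarrow> pleq (mt p q) q"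
  unfolding pleq_def by (metis act_comm act_idem mt mt_act act_D)

lemma pleq_refl: "p \<in> Pr \<Longrightarrow> pleq p p" unfolding pleq_def using act_idem by blast

lemma pleq_trans: "pleq p q \<Longrightarrow> pleq q r \<Longrightarrow> pleq p r"
  unfolding pleq_def using act_D by metis

lemma fin_act: "p \<in> Pr \<Longrightarrow> fin x \<Longrightarrow> fin (p \<cdot> x)"
  using fin_le act_le fin_D by blast

lemma pinf_act: "p \<in> Pr \<Longrightarrow> pinf x \<Longrightarrow> pinf (p \<cdot> x)"
  unfolding pinf_def using act_add act_D by metis

lemma local_le:
  assumes "p \<in> Pr" "x \<in> D" "y \<in> D" "p \<cdot> x \<sqsubseteq> p \<cdot> y" "cpl p \<cdot> x \<sqsubseteq> cpl p \<cdot> y"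
  shows "x \<sqsubseteq> y"
  using add_mono[OF assms(4,5)] cpl_add assms(1-3) by simp

lemma local_eq:
  assumes "p \<in> Pr" "x \<in> D" "y \<in> D" "p \<cdot> x = p \<cdot> y" "cpl p \<cdot> x = cpl p \<cdot> y"
  shows "x = y"
  using assms cpl_add by metis

end

section \<open>General comparability\<close>

text \<open>The assumptions are (M2) to (M6) in this order.\<close>

locale dim_scale = proj_monoid add zero D Pr act
  for add :: "'b \<Rightarrow> 'b \<Rightarrow> 'b" (infixl "\<oplus>" 65) and zero :: 'b ("\<zero>") and D :: "'b set"
    and Pr :: "'p set" and act :: "'p \<Rightarrow> 'b \<Rightarrow> 'b" (infixr "\<cdot>" 75) +
  assumes inf_ex: "\<And>X. X \<subseteq> D \<Longrightarrow> X \<noteq> {} \<Longrightarrow>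
      \<exists>m\<in>D. (\<forall>x\<in>X. m \<sqsubseteq> x) \<and> (\<forall>y\<in>D. (\<forall>x\<in>X. y \<sqsubseteq> x) \<longrightarrow> y \<sqsubseteq> m)"
    and compare: "\<And>x y. x \<in> D \<Longrightarrow> y \<in> D \<Longrightarrow> \<exists>p\<in>Pr. p \<cdot> x \<sqsubseteq> p \<cdot> y \<and> cpl p \<cdot> y \<sqsubseteq> cpl p \<cdot> x"
    and largest: "\<And>a b. a \<in> D \<Longrightarrow> b \<in> D \<Longrightarrow>
      \<exists>p\<in>Pr. p \<cdot> a \<sqsubseteq> p \<cdot> b \<and> (\<forall>q\<in>Pr. q \<cdot> a \<sqsubseteq> q \<cdot> b \<longrightarrow> pleq q p)"
    and decompose: "\<And>x. x \<in> D \<Longrightarrow> \<exists>a b. fin a \<and> pinf b \<and> x = a \<oplus> b"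
    and least_remote: "\<And>a b. pinf a \<Longrightarrow> pinf b \<Longrightarrow> llrem a b \<Longrightarrow>
      \<exists>m. (pinf m \<and> llrem a m \<and> (\<forall>t\<in>D. orth t m \<longleftrightarrow> orth t b)) \<and>
        (\<forall>x. pinf x \<and> llrem a x \<and> (\<forall>t\<in>D. orth t x \<longleftrightarrow> orth t b) \<longrightarrow> m \<sqsubseteq> x)"
begin

text \<open>Let c be the largest projection with \<open>c \<cdot> a\<close> below
  \<open>c \<cdot> b\<close>. If a did not vanish off c, a nonzero piece of it there would satisfy
  the inequality, and the corresponding projection would lie below both c and its
  complement.\<close>

lemma dense_le:
  assumes "a \<in> D" "b \<in> D"
    and dense: "\<And>q. q \<in> Pr \<Longrightarrow> q \<cdot> a \<noteq> \<zero> \<Longrightarrow> \<exists>q'\<in>Pr. q' \<cdot> q \<cdot> a \<noteq> \<zero> \<and> q' \<cdot> q \<cdot> a \<sqsubseteq> q' \<cdot> q \<cdot> b"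
  shows "a \<sqsubseteq> b"
proof -
  obtain c where c: "c \<in> Pr" "c \<cdot> a \<sqsubseteq> c \<cdot> b" "\<And>q. q \<in> Pr \<Longrightarrow> q \<cdot> a \<sqsubseteq> q \<cdot> b \<Longrightarrow> pleq q c"
    using largest[OF assms(1,2)] by blast
  have "cpl c \<cdot> a = \<zero>"
  proof (rule ccontr)
    assume "cpl c \<cdot> a \<noteq> \<zero>"
    then obtain q where q: "q \<in> Pr" "q \<cdot> cpl c \<cdot> a \<noteq> \<zero>" "q \<cdot> cpl c \<cdot> a \<sqsubseteq> q \<cdot> cpl c \<cdot> b"
      using dense c cpl_Pr by blast
    then have "pleq (mt q (cpl c)) c" using c assms by (simp add: mt_act)
    then have "c \<cdot> q \<cdot> cpl c \<cdot> a = q \<cdot> cpl c \<cdot> a" using pleq_act[of "mt q (cpl c)" c a] c(1) q(1) assms(1) by (simp add: mt_act)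
    moreover have "c \<cdot> q \<cdot> cpl c \<cdot> a = q \<cdot> c \<cdot> cpl c \<cdot> a" using act_comm act_D q c assms by simp
    ultimately show False using q cpl_zero1 act_zero c assms by metis
  qed
  then show ?thesis using local_le[OF c(1) assms(1,2) c(2)] act_D c assms by simp
qed

text \<open>(M4) with zero as second element yields the largest projection annihilating a; its
  complement is the support.\<close>

lemma support_ex:
  assumes "a \<in> D"
  shows "\<exists>s. s \<in> Pr \<and> s \<cdot> a = a \<and> (\<forall>q\<in>Pr. q \<cdot> a = \<zero> \<longrightarrow> (\<forall>y\<in>D. q \<cdot> s \<cdot> y = \<zero>))"
proof -
  obtain p where p: "p \<in> Pr" "p \<cdot> a \<sqsubseteq> p \<cdot> \<zero>" "\<And>q. q \<in> Pr \<Longrightarrow> q \<cdot> a \<sqsubseteq> q \<cdot> \<zero> \<Longrightarrow> pleq q p"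
    using largest assms zero_D by blast
  have "cpl p \<cdot> a = a" using p act_zero le_zero cpl_add assms left_neutral by metis
  moreover have "q \<cdot> cpl p \<cdot> y = \<zero>" if "q \<in> Pr" "q \<cdot> a = \<zero>" "y \<in> D" for q y
  proof -
    have "pleq q p" using p that act_zero by simp
    then have "q \<cdot> p \<cdot> cpl p \<cdot> y = q \<cdot> cpl p \<cdot> y" using pleq_act2 act_D that p by simp
    then show ?thesis using cpl_zero1 p that act_zero by simp
  qed
  ultimately show ?thesis using p cpl_Pr by blast
qed

definition sp :: "'b \<Rightarrow> 'p" where
  "sp a = (SOME s. s \<in> Pr \<and> s \<cdot> a = a \<and> (\<forall>q\<in>Pr. q \<cdot> a = \<zero> \<longrightarrow> (\<forall>y\<in>D. q \<cdot> s \<cdot> y = \<zero>)))"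

lemma sp: "a \<in> D \<Longrightarrow> sp a \<in> Pr \<and> sp a \<cdot> a = a \<and> (\<forall>q\<in>Pr. q \<cdot> a = \<zero> \<longrightarrow> (\<forall>y\<in>D. q \<cdot> sp a \<cdot> y = \<zero>))"
  unfolding sp_def using someI_ex[OF support_ex] by blast

lemma sp_Pr [simp]: "a \<in> D \<Longrightarrow> sp a \<in> Pr" using sp by blast
lemma sp_act [simp]: "a \<in> D \<Longrightarrow> sp a \<cdot> a = a" using sp by blast
lemma sp_kill: "a \<in> D \<Longrightarrow> q \<in> Pr \<Longrightarrow> q \<cdot> a = \<zero> \<Longrightarrow> y \<in> D \<Longrightarrow> q \<cdot> sp a \<cdot> y = \<zero>" using sp by blast

lemma sp_pleq: 
  assumes "a \<in> D" "p \<in> Pr" "p \<cdot> a = a" shows "pleq (sp a) p"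
proof -
  have "cpl p \<cdot> a = \<zero>" using cpl_zero2 assms by metis
  then have "cpl p \<cdot> sp a \<cdot> y = \<zero>" if "y \<in> D" for y using sp_kill that assms by simp
  then have "p \<cdot> sp a \<cdot> y = sp a \<cdot> y" if "y \<in> D" for y
    using that cpl_add[of p "sp a \<cdot> y"] assms act_D by (metis right_neutral sp_Pr)
  then show ?thesis using assms pleq_def by simp
qed

lemma sp_le_act: "a \<in> D \<Longrightarrow> x \<sqsubseteq> a \<Longrightarrow> sp a \<cdot> x = x"
  using act_fixI[of "sp a" x a] by simp

lemma sp_mono: "x \<sqsubseteq> a \<Longrightarrow> pleq (sp x) (sp a)"
  using sp_pleq sp_le_act le_D1 le_D2 sp_Pr by blast

text \<open>\<open>x\<close> and \<open>y\<close> generate the same band.\<close>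

definition ss :: "'b \<Rightarrow> 'b \<Rightarrow> bool" where
  "ss x y \<longleftrightarrow> (\<forall>q\<in>Pr. q \<cdot> x = \<zero> \<longleftrightarrow> q \<cdot> y = \<zero>)"

lemma ss_refl [simp]: "ss x x" unfolding ss_def by blast
lemma ss_sym: "ss x y \<Longrightarrow> ss y x" unfolding ss_def by blast
lemma ss_trans: "ss x y \<Longrightarrow> ss y z \<Longrightarrow> ss x z" unfolding ss_def by blast
lemma ssD: "ss x y \<Longrightarrow> q \<in> Pr \<Longrightarrow> q \<cdot> x = \<zero> \<longleftrightarrow> q \<cdot> y = \<zero>" unfolding ss_def by blast

lemma ss_act: "ss x y \<Longrightarrow> p \<in> Pr \<Longrightarrow> x \<in> D \<Longrightarrow> y \<in> D \<Longrightarrow> ss (p \<cdot> x) (p \<cdot> y)"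
  unfolding ss_def using mt_act mt_Pr by metis

lemma ss_sp: "ss x y \<Longrightarrow> x \<in> D \<Longrightarrow> y \<in> D \<Longrightarrow> sp x \<cdot> y = y"
proof -
  assume a: "ss x y" "x \<in> D" "y \<in> D"
  have "cpl (sp x) \<cdot> x = \<zero>" using cpl_zero2 a sp_act sp_Pr by metis
  then have "cpl (sp x) \<cdot> y = \<zero>" using a ssD by simp
  then show ?thesis using cpl_add[of "sp x" y] a by simp
qed

lemma ss_pleq: "ss x y \<Longrightarrow> x \<in> D \<Longrightarrow> y \<in> D \<Longrightarrow> pleq (sp x) (sp y)"
  using sp_pleq ss_sp ss_sym sp_Pr by metis

lemma ss_sp_act:
  assumes "ss x y" "x \<in> D" "y \<in> D" "z \<in> D"
  shows "sp x \<cdot> z = sp y \<cdot> z"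
  using ss_pleq[OF assms(1-3)] ss_pleq[OF ss_sym[OF assms(1)] assms(3,2)] antisym pleq_le assms(4) by blast

lemma act_zero_mono: "q \<in> Pr \<Longrightarrow> x \<sqsubseteq> y \<Longrightarrow> q \<cdot> y = \<zero> \<Longrightarrow> q \<cdot> x = \<zero>"
  using act_mono le_zero by metis

lemma ss_zero: "ss x y \<Longrightarrow> x \<in> D \<Longrightarrow> y \<in> D \<Longrightarrow> x = \<zero> \<longleftrightarrow> y = \<zero>"
  using ss_sp sp_act sp_Pr act_zero ssD by metis

lemma ss_below:
  assumes "x \<sqsubseteq> y" shows "ss x (sp x \<cdot> y)"
  unfolding ss_def
proof (intro ballI iffI)
  have D: "x \<in> D" "y \<in> D" using assms le_D1 le_D2 by auto
  fix q assume q: "q \<in> Pr"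
  show "q \<cdot> sp x \<cdot> y = \<zero>" if "q \<cdot> x = \<zero>" using sp_kill D q that by blast
  show "q \<cdot> x = \<zero>" if z: "q \<cdot> sp x \<cdot> y = \<zero>"
  proof -
    have "x \<sqsubseteq> sp x \<cdot> y" using act_mono[OF _ assms, of "sp x"] D by simp
    then show ?thesis using act_zero_mono q z by blast
  qed
qed

text \<open>Comparability splits the scale into a part where t is below x and a part where x is
  below t. Orthogonality annihilates t on the first and x on the second, so t vanishes on the
  support of x.\<close>

lemma orth_iff:
  assumes "t \<in> D" "x \<in> D" shows "orth t x \<longleftrightarrow> sp x \<cdot> t = \<zero>"
proof
  assume o: "orth t x"
  obtain p where p: "p \<in> Pr" "p \<cdot> t \<sqsubseteq> p \<cdot> x" "cpl p \<cdot> x \<sqsubseteq> cpl p \<cdot> t" using compare assms by blast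
  have "p \<cdot> t \<sqsubseteq> x" using p act_le assms le_trans by blast
  then have 1: "p \<cdot> t = \<zero>" using o orthD act_le p assms by blast
  have "cpl p \<cdot> x \<sqsubseteq> t" using p act_le assms le_trans cpl_Pr by blast
  then have "cpl p \<cdot> x = \<zero>" using o orthD act_le p assms cpl_Pr by blast
  then have "cpl p \<cdot> sp x \<cdot> t = \<zero>" using sp_kill assms p by simp
  moreover have "p \<cdot> sp x \<cdot> t = \<zero>" using act_comm[of p "sp x" t] 1 act_zero assms p by simp
  ultimately show "sp x \<cdot> t = \<zero>" using cpl_add[of p "sp x \<cdot> t"] act_D p assms by simp
next
  assume z: "sp x \<cdot> t = \<zero>"
  show "orth t x"
    unfolding orth_def
  proof (intro allI impI)
    fix s assume s: "s \<sqsubseteq> t \<and> s \<sqsubseteq> x"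
    then have "sp x \<cdot> s = s" using sp_le_act assms by blast
    moreover have "sp x \<cdot> s = \<zero>" using act_zero_mono s z assms sp_Pr by blast
    ultimately show "s = \<zero>" by simp
  qed
qed

text \<open>Serves to read the condition on orthogonals in (M6) as one on supports. If q kills x,
  then \<open>q \<cdot> b\<close> is orthogonal to x, hence to b, hence to itself.\<close>

lemma perp_eq_iff:
  assumes "x \<in> D" "b \<in> D" shows "(\<forall>t\<in>D. orth t x \<longleftrightarrow> orth t b) \<longleftrightarrow> ss x b"
proof
  assume *: "\<forall>t\<in>D. orth t x \<longleftrightarrow> orth t b"
  have half: "q \<cdot> b = \<zero>" if *: "\<forall>t\<in>D. orth t x \<longleftrightarrow> orth t b" "q \<in> Pr" "q \<cdot> x = \<zero>" "x \<in> D" "b \<in> D" for q x b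
  proof -
    have "sp x \<cdot> q \<cdot> b = \<zero>" using sp_kill[of x q b] act_comm[of "sp x" q b] that by simp
    then have "orth (q \<cdot> b) b" using orth_iff that act_D by metis
    then show ?thesis using orthD act_le that act_D le_refl by blast
  qed
  show "ss x b" unfolding ss_def using half[of x b] half[of b x] * assms by blast
next
  assume "ss x b" then show "\<forall>t\<in>D. orth t x \<longleftrightarrow> orth t b" using orth_iff ss_sp_act assms by metis
qed

text \<open>The supremum is the infimum of all upper bounds, a set that is nonempty because X is
  bounded.\<close>

lemma sup_ex:
  assumes "\<And>x. x \<in> X \<Longrightarrow> x \<sqsubseteq> b" "b \<in> D"
  shows "\<exists>s. is_sup X s \<and> s \<sqsubseteq> b"
proof -
  let ?U = "{t\<in>D. \<forall>x\<in>X. x \<sqsubseteq> t}"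
  have "?U \<subseteq> D" "b \<in> ?U" using assms by auto
  then obtain m where m: "m \<in> D" "\<forall>t\<in>?U. m \<sqsubseteq> t" "\<And>y. y \<in> D \<Longrightarrow> \<forall>t\<in>?U. y \<sqsubseteq> t \<Longrightarrow> y \<sqsubseteq> m"
    using inf_ex[of ?U] by (metis (no_types, lifting) empty_iff)
  have "x \<sqsubseteq> m" if "x \<in> X" for x using m(3)[of x] that assms le_D1 by blast
  then show ?thesis unfolding is_sup_def using m \<open>b \<in> ?U\<close> by blast
qed

text \<open>An upper bound of the projected set is completed by \<open>cpl p \<cdot> s\<close> to an
  upper bound of X, hence lies above s after completion; projecting back gives the claim.\<close>

lemma sup_act:
  assumes s: "is_sup X s" and p: "p \<in> Pr"
  shows "is_sup ((\<cdot>) p ` X) (p \<cdot> s)"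
  unfolding is_sup_def
proof (intro conjI ballI allI impI)
  have sD: "s \<in> D" using s is_sup_def by blast
  then show psD: "p \<cdot> s \<in> D" using act_D p by blast
  show "y \<sqsubseteq> p \<cdot> s" if "y \<in> (\<cdot>) p ` X" for y using that act_mono s p unfolding is_sup_def by blast
  fix t assume t: "(\<forall>x\<in>(\<cdot>) p ` X. x \<sqsubseteq> t) \<and> t \<in> D"
  \<comment> \<open>Cutting t down to \<open>p \<cdot> s\<close> makes its sum with
    \<open>cpl p \<cdot> s\<close> defined.\<close>
  obtain m where m: "m \<in> D" "m \<sqsubseteq> t" "m \<sqsubseteq> p \<cdot> s" "\<And>y. y \<in> D \<Longrightarrow> y \<sqsubseteq> t \<Longrightarrow> y \<sqsubseteq> p \<cdot> s \<Longrightarrow> y \<sqsubseteq> m"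
    using inf_ex[of "{t, p \<cdot> s}"] t psD by auto
  have csD: "p \<cdot> s \<oplus> cpl p \<cdot> s \<in> D" using cpl_add p sD by simp
  have mD: "m \<oplus> cpl p \<cdot> s \<in> D" using add_mono_D[OF m(3) _ csD] act_D p sD by simp
  have "x \<sqsubseteq> m \<oplus> cpl p \<cdot> s" if "x \<in> X" for x
  proof -
    have xs: "x \<sqsubseteq> s" using that s is_sup_def by blast
    then have xD: "x \<in> D" using le_D1 by blast
    have "p \<cdot> x \<sqsubseteq> m" using m(4) t that act_mono p xs act_D xD by blast
    moreover have "cpl p \<cdot> x \<sqsubseteq> cpl p \<cdot> s" using act_mono p xs cpl_Pr by blast
    ultimately show ?thesis using add_mono[OF _ _ mD] cpl_add p xD by metis
  qed
  then have "s \<sqsubseteq> m \<oplus> cpl p \<cdot> s" using s mD is_sup_def by blast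
  then have "p \<cdot> s \<sqsubseteq> p \<cdot> m \<oplus> p \<cdot> cpl p \<cdot> s" using act_mono p act_add mD by metis
  then have "p \<cdot> s \<sqsubseteq> p \<cdot> m" using cpl_zero1 p sD by simp
  then show "p \<cdot> s \<sqsubseteq> t" using act_le[OF p m(1)] m le_trans by blast
qed

text \<open>The Z part of x is the supremum of the pieces \<open>q \<cdot> x\<close> over all
  projections q with values orthogonal to X; the Y part is the infimum of the complementary pieces.
  They add up to x by (M4): the largest projection c on which x is below \<open>z \<oplus> y\<close>
  lies above every such q, so what is left of x off c is below all complementary pieces, hence below
  y.\<close>

lemma perp_proj:
  assumes X: "X \<subseteq> D"
  shows "\<exists>r\<in>Pr. \<forall>x\<in>D. r \<cdot> x = x \<longleftrightarrow> (\<forall>t\<in>X. orth x t)"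
proof -
  let ?Z = "{z\<in>D. \<forall>t\<in>X. orth z t}"
  let ?Y = "{y\<in>D. \<forall>z\<in>?Z. orth y z}"
  define R where "R = {q\<in>Pr. \<forall>x\<in>D. \<forall>t\<in>X. orth (q \<cdot> x) t}"
  have "\<exists>r\<in>Pr. \<forall>z\<in>?Z. \<forall>y\<in>?Y. z \<oplus> y \<in> D \<longrightarrow> r \<cdot> (z \<oplus> y) = z"
  proof (rule band_proj)
    fix x assume x: "x \<in> D"
    have "q \<cdot> x \<sqsubseteq> x" if "q \<in> R" for q using that act_le x R_def by blast
    then have "\<exists>z. is_sup {q \<cdot> x |q. q \<in> R} z \<and> z \<sqsubseteq> x" by (intro sup_ex) (use x in auto)
    then obtain z where z: "is_sup {q \<cdot> x |q. q \<in> R} z" "z \<sqsubseteq> x" by blast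
    \<comment> \<open>Inserting x makes the set nonempty and puts its infimum below x.\<close>
    let ?I = "insert x {cpl q \<cdot> x |q. q \<in> R}"
    have "?I \<subseteq> D" using x R_def act_D cpl_Pr by auto
    from inf_ex[OF this] obtain y where
      y: "y \<in> D" "\<forall>t\<in>?I. y \<sqsubseteq> t" "\<And>w. w \<in> D \<Longrightarrow> \<forall>t\<in>?I. w \<sqsubseteq> t \<Longrightarrow> w \<sqsubseteq> y" by blast
    have zD: "z \<in> D" using z le_D1 by blast
    have zZ: "z \<in> ?Z"
    proof (clarsimp simp: zD)
      fix t assume t: "t \<in> X"
      then have tD: "t \<in> D" using X by blast
      have "q \<cdot> x \<sqsubseteq> cpl (sp t) \<cdot> x" if q: "q \<in> R" for q
      proof -
        have qP: "q \<in> Pr" using q R_def by blast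
        have qD: "q \<cdot> x \<in> D" using act_D qP x by blast
        have "orth (q \<cdot> x) t" using q t x R_def by blast
        then have "sp t \<cdot> q \<cdot> x = \<zero>" using orth_iff tD qD by blast
        then have "q \<cdot> x = cpl (sp t) \<cdot> q \<cdot> x" using cpl_add[of "sp t" "q \<cdot> x"] tD qD by simp
        then show ?thesis using act_mono[of "cpl (sp t)" "q \<cdot> x" x] act_le qP x tD by simp
      qed
      moreover have "cpl (sp t) \<cdot> x \<in> D" using act_D x tD by simp
      ultimately have "z \<sqsubseteq> cpl (sp t) \<cdot> x" using z(1) unfolding is_sup_def by blast
      then have "sp t \<cdot> z \<sqsubseteq> \<zero>" using act_mono[of "sp t"] cpl_zero1[of "sp t" x] tD x by fastforce
      then show "orth z t" using orth_iff zD tD le_zero by blast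
    qed
    have yY: "y \<in> ?Y"
    proof (clarsimp simp: y(1))
      fix z' assume z': "z' \<in> D" "\<forall>t\<in>X. orth z' t"
      show "orth y z'" unfolding orth_def
      proof (intro allI impI)
        fix s assume s: "s \<sqsubseteq> y \<and> s \<sqsubseteq> z'"
        then have sD: "s \<in> D" using le_D1 by blast
        have "sp s \<in> R" unfolding R_def
        proof (clarsimp simp: sD)
          fix w t assume w: "w \<in> D" "t \<in> X"
          then have tD: "t \<in> D" using X by blast
          then have "orth s t" using orth_mono s z' w le_refl by blast
          then have "sp t \<cdot> sp s \<cdot> w = \<zero>" using orth_iff sp_kill sD tD w by simp
          then show "orth (sp s \<cdot> w) t" using orth_iff act_D sD tD w by simp
        qed
        then have "s \<sqsubseteq> cpl (sp s) \<cdot> x" using y s le_trans by blast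
        then have "sp s \<cdot> s \<sqsubseteq> sp s \<cdot> cpl (sp s) \<cdot> x" by (intro act_mono sp_Pr sD)
        then show "s = \<zero>" using cpl_zero1 sD x le_zero by simp
      qed
    qed
    have "x = z \<oplus> y"
    proof (rule antisym)
      obtain w where w: "x = z \<oplus> w" using z leE by blast
      have "y \<sqsubseteq> x" using y by blast
      then have "y \<sqsubseteq> w" using orth_le_add[of y z w] yY zZ w by blast
      then show le: "z \<oplus> y \<sqsubseteq> x" using add_mono[of z z y w] w zD x by simp
      then have yD: "z \<oplus> y \<in> D" using le_D1 by blast
      obtain c where c: "c \<in> Pr" "c \<cdot> x \<sqsubseteq> c \<cdot> (z \<oplus> y)" "\<And>q. q \<in> Pr \<Longrightarrow> q \<cdot> x \<sqsubseteq> q \<cdot> (z \<oplus> y) \<Longrightarrow> pleq q c"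
        using largest x yD by blast
      have "cpl c \<cdot> x \<sqsubseteq> cpl q \<cdot> x" if q: "q \<in> R" for q
      proof -
        have qP: "q \<in> Pr" using q R_def by blast
        have "q \<cdot> x \<sqsubseteq> z" using z q unfolding is_sup_def by blast
        then have "q \<cdot> x \<sqsubseteq> z \<oplus> y" using le_trans le_add1 yD by blast
        then have "q \<cdot> q \<cdot> x \<sqsubseteq> q \<cdot> (z \<oplus> y)" using act_mono qP by blast
        then have "pleq q c" using c qP act_idem x by simp
        then have "q \<cdot> cpl c \<cdot> x = q \<cdot> c \<cdot> cpl c \<cdot> x" using pleq_act2 act_D c x by simp
        then have "q \<cdot> cpl c \<cdot> x = \<zero>" using cpl_zero1 c x act_zero qP by simp
        then have "cpl c \<cdot> x = cpl q \<cdot> cpl c \<cdot> x" using cpl_add[of q "cpl c \<cdot> x"] act_D c x qP by simp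
        then show ?thesis using act_mono[of "cpl q" "cpl c \<cdot> x" x] act_le c x qP by simp
      qed
      moreover have "cpl c \<cdot> x \<in> D" "cpl c \<cdot> x \<sqsubseteq> x" using act_D act_le c(1) x by auto
      ultimately have "cpl c \<cdot> x \<sqsubseteq> y" using y(3)[of "cpl c \<cdot> x"] by blast
      then have "cpl c \<cdot> x \<sqsubseteq> z \<oplus> y" using le_trans le_add2 yD by blast
      then have "cpl c \<cdot> cpl c \<cdot> x \<sqsubseteq> cpl c \<cdot> (z \<oplus> y)" using act_mono c by simp
      then show "x \<sqsubseteq> z \<oplus> y" using local_le c x yD act_idem by simp
    qed
    then show "\<exists>z\<in>?Z. \<exists>y\<in>?Y. x = z \<oplus> y" using zZ yY by blast
  qed (auto intro: orth_add orth_sym)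
  then obtain r where r: "r \<in> Pr" "\<And>z y. z \<in> ?Z \<Longrightarrow> y \<in> ?Y \<Longrightarrow> z \<oplus> y \<in> D \<Longrightarrow> r \<cdot> (z \<oplus> y) = z" by blast
  have zY: "\<zero> \<in> ?Y" unfolding orth_def using le_zero by auto
  have fixed: "r \<cdot> x = x" if "x \<in> ?Z" for x using r(2)[OF that zY] that by simp
  have "orth x t" if x: "x \<in> D" "r \<cdot> x = x" "t \<in> X" for x t
  proof -
    have tD: "t \<in> D" using X that by blast
    have rt: "r \<cdot> t = \<zero>"
    proof -
      have "t \<in> ?Y" using tD x(3) orth_sym by blast
      moreover have "\<zero> \<in> ?Z" unfolding orth_def using le_zero by auto
      ultimately show ?thesis using r(2)[of \<zero> t] tD by simp
    qed
    have "sp t \<cdot> x = sp t \<cdot> r \<cdot> x" using x by simp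
    also have "\<dots> = r \<cdot> sp t \<cdot> x" using act_comm[of "sp t" r x] r(1) tD x(1) by simp
    also have "\<dots> = \<zero>" using sp_kill rt r tD x by simp
    finally show ?thesis using orth_iff x tD by simp
  qed
  then show ?thesis by (intro bexI[OF _ r(1)]) (use fixed in auto)
qed

text \<open>Refinement leaves \<open>r \<oplus> s = a = r \<oplus> t\<close>, while b and c share
  the last piece u. Where s is below t, their difference is absorbed by the finite a and vanishes;
  comparability gives the other half.\<close>

lemma cancel:
  assumes a: "fin a" and e: "a \<oplus> b = a \<oplus> c" and d: "a \<oplus> c \<in> D"
  shows "b = c"
proof -
  from refine[OF e d] obtain r s t u where
    m: "a = r \<oplus> s" "b = t \<oplus> u" "a = r \<oplus> t" "c = s \<oplus> u" by blast
  have D: "r \<oplus> s \<in> D" "r \<oplus> t \<in> D" using m a fin_D by auto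
  then have D': "r \<in> D" "s \<in> D" "t \<in> D" using add_D add_D2 by blast+
  have key: "s = t" if h: "s \<sqsubseteq> t" "r \<oplus> s = r \<oplus> t" "fin (r \<oplus> t)" for r s t
  proof -
    obtain w where w: "t = s \<oplus> w" using leE[OF h(1)] by blast
    then have "w \<oplus> (r \<oplus> t) = r \<oplus> t" using h by (metis ac)
    then have "w = \<zero>" using h fin_absorb by blast
    then show ?thesis using w by simp
  qed
  obtain p where p: "p \<in> Pr" "p \<cdot> s \<sqsubseteq> p \<cdot> t" "cpl p \<cdot> t \<sqsubseteq> cpl p \<cdot> s" using compare D' by blast
  have eq: "q \<cdot> r \<oplus> q \<cdot> s = q \<cdot> r \<oplus> q \<cdot> t \<and> fin (q \<cdot> r \<oplus> q \<cdot> t)" if "q \<in> Pr" for q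
    using act_add that m D fin_act a by metis
  have "p \<cdot> s = p \<cdot> t" using key p eq by blast
  moreover have "cpl p \<cdot> t = cpl p \<cdot> s" using key p eq cpl_Pr by metis
  ultimately have "s = t" using local_eq p D' by metis
  then show ?thesis using m by simp
qed

lemma cancel_le: "fin a \<Longrightarrow> a \<oplus> b \<sqsubseteq> a \<oplus> c \<Longrightarrow> b \<sqsubseteq> c"
proof -
  assume a: "fin a" "a \<oplus> b \<sqsubseteq> a \<oplus> c"
  then obtain t where "a \<oplus> c = a \<oplus> (b \<oplus> t)" using leE assoc by metis
  then have "c = b \<oplus> t" using cancel a le_D2 by metis
  then show ?thesis using leI a le_D2 add_D2 by metis
qed

lemma fin_add: "fin a \<Longrightarrow> fin b \<Longrightarrow> a \<oplus> b \<in> D \<Longrightarrow> fin (a \<oplus> b)"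
  unfolding fin_def[of "a \<oplus> b"]
proof (intro conjI allI impI)
  fix x assume *: "fin a" "fin b" "a \<oplus> b \<in> D" "x \<oplus> (a \<oplus> b) = a \<oplus> b"
  then have "a \<oplus> (x \<oplus> b) = a \<oplus> b" using left_commute by metis
  then have "x \<oplus> b = b" using cancel * by metis
  then show "x = \<zero>" using * fin_absorb by blast
qed

lemma fin_zero [simp]: "fin \<zero>"
  unfolding fin_def by simp

lemma fin_mult: "fin f \<Longrightarrow> mult n f \<in> D \<Longrightarrow> fin (mult n f)"
  by (induction n) (auto intro: fin_add dest: add_D2)

lemma pinf_absorb: "pinf u \<Longrightarrow> x \<sqsubseteq> u \<Longrightarrow> x \<oplus> u = u"
proof -
  assume a: "pinf u" "x \<sqsubseteq> u"
  then have "x \<oplus> u \<sqsubseteq> u" using add_mono[of x u u u] pinf_def by simp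
  moreover have "u \<sqsubseteq> x \<oplus> u" using le_add2 calculation le_D1 by blast
  ultimately show ?thesis using antisym by blast
qed

lemma pinf_add_le: "pinf u \<Longrightarrow> x \<sqsubseteq> u \<Longrightarrow> y \<sqsubseteq> u \<Longrightarrow> x \<oplus> y \<sqsubseteq> u"
  using add_mono[of x u y u] pinf_def by simp

lemma pinf_mult_le: "pinf u \<Longrightarrow> x \<sqsubseteq> u \<Longrightarrow> mult n x \<sqsubseteq> u"
  by (induction n) (auto intro: pinf_add_le zero_le pinf_D)

lemma pinf_add: "pinf a \<Longrightarrow> pinf b \<Longrightarrow> a \<oplus> b \<in> D \<Longrightarrow> pinf (a \<oplus> b)"
  unfolding pinf_def by (metis ac)

text \<open>In a Riesz decomposition of u the piece below f is absorbed by u, and being finite it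
  can be cancelled from that equation. So u equals its piece below g.\<close>

lemma pinf_le_fin_add:
  assumes "pinf u" "fin f" "u \<sqsubseteq> f \<oplus> g" shows "u \<sqsubseteq> g"
proof -
  obtain f' g' where *: "u = f' \<oplus> g'" "f' \<sqsubseteq> f" "g' \<sqsubseteq> g" using riesz assms by metis
  have uD: "u \<in> D" using assms pinf_D by blast
  have "f' \<oplus> u = u" using pinf_absorb assms * le_add1 uD by metis
  then have "f' \<oplus> (f' \<oplus> g') = f' \<oplus> g'" using * by simp
  then have "f' \<oplus> g' = g'" using cancel[of f' "f' \<oplus> g'" g'] fin_le assms * uD by blast
  then show ?thesis using * by simp
qed

lemma fin_pinf_le: "fin f \<Longrightarrow> pinf u \<Longrightarrow> u \<sqsubseteq> f \<Longrightarrow> u = \<zero>"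
  using fin_le fin_pinf_zero by blast

text \<open>The finite parts of y and z may be dropped by \<open>pinf_le_fin_add\<close>. Of the two
  purely infinite parts, the locally larger one absorbs the other.\<close>

lemma pinf_prime:
  assumes u: "pinf u" "u \<sqsubseteq> y \<oplus> z"
  shows "\<exists>p\<in>Pr. p \<cdot> u \<sqsubseteq> p \<cdot> y \<and> cpl p \<cdot> u \<sqsubseteq> cpl p \<cdot> z"
proof -
  have yzD: "y \<oplus> z \<in> D" using u le_D2 by blast
  then have D: "y \<in> D" "z \<in> D" using add_D add_D2 by blast+
  obtain f g where y: "fin f" "pinf g" "y = f \<oplus> g" using decompose D by blast
  obtain f' g' where z: "fin f'" "pinf g'" "z = f' \<oplus> g'" using decompose D by blast
  have "u \<sqsubseteq> f \<oplus> (f' \<oplus> (g \<oplus> g'))" using u y z by (metis ac)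
  then have ug: "u \<sqsubseteq> g \<oplus> g'" using pinf_le_fin_add u y z by blast
  then have gD: "g \<oplus> g' \<in> D" using le_D2 by blast
  obtain p where p: "p \<in> Pr" "p \<cdot> g' \<sqsubseteq> p \<cdot> g" "cpl p \<cdot> g \<sqsubseteq> cpl p \<cdot> g'"
    using compare y z pinf_D by metis
  have "p \<cdot> u \<sqsubseteq> p \<cdot> g \<oplus> p \<cdot> g'" using act_mono p ug act_add gD by metis
  also have "\<dots> \<sqsubseteq> p \<cdot> g" using pinf_add_le pinf_act p y act_D pinf_D le_refl by metis
  also have "\<dots> \<sqsubseteq> p \<cdot> y" using act_mono p y D le_add2 by metis
  finally have 1: "p \<cdot> u \<sqsubseteq> p \<cdot> y" .
  have "cpl p \<cdot> u \<sqsubseteq> cpl p \<cdot> g \<oplus> cpl p \<cdot> g'" using act_mono p ug act_add gD cpl_Pr by metis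
  also have "\<dots> \<sqsubseteq> cpl p \<cdot> g'" using pinf_add_le pinf_act p z act_D pinf_D le_refl cpl_Pr by metis
  also have "\<dots> \<sqsubseteq> cpl p \<cdot> z" using act_mono p z D le_add2 cpl_Pr by metis
  finally show ?thesis using 1 p by blast
qed

text \<open>All members of X lie below the purely infinite part of s, which is therefore already an
  upper bound.\<close>

lemma sup_pinf:
  assumes "is_sup X s" "\<And>x. x \<in> X \<Longrightarrow> pinf x" shows "pinf s"
proof -
  have sD: "s \<in> D" using assms is_sup_def by blast
  obtain f g where s: "fin f" "pinf g" "s = f \<oplus> g" using decompose sD by blast
  have "x \<sqsubseteq> g" if "x \<in> X" for x
    using that pinf_le_fin_add assms s unfolding is_sup_def by metis
  then have "s \<sqsubseteq> g" using assms s pinf_D is_sup_def by metis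
  moreover have "g \<sqsubseteq> s" using s sD le_add2 by blast
  ultimately show ?thesis using antisym s by metis
qed

end

section \<open>Multiples, halving and strict inequality\<close>

context dim_scale
begin

lemma mult_mono_arg: "a \<sqsubseteq> b \<Longrightarrow> mult n b \<in> D \<Longrightarrow> mult n a \<sqsubseteq> mult n b"
  by (induction n) (auto intro: add_mono dest: add_D2)

text \<open>Where f is below g, the n-fold difference is absorbed by the finite
  \<open>mult n g\<close>; comparability reduces to this case.\<close>

lemma mult_inj:
  assumes eq: "mult n f = mult n g" and fin: "fin (mult n g)" and n: "0 < n"
  shows "f = g"
proof -
  have gD: "mult n g \<in> D" using fin fin_D by blast
  then have D: "f \<in> D" "g \<in> D" using eq n mult_D by metis+
  have key: "f = g" if h: "mult n f = mult n g" "fin (mult n g)" "f \<sqsubseteq> g" for f g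
  proof -
    obtain w where w: "g = f \<oplus> w" using leE[OF h(3)] by blast
    then have "mult n w \<oplus> mult n g = mult n g" using h mult_distrib commute by metis
    then have "mult n w = \<zero>" using h fin_absorb by blast
    then have "w = \<zero>" using mult_le[of n w] n le_zero by simp
    then show ?thesis using w by simp
  qed
  obtain p where p: "p \<in> Pr" "p \<cdot> f \<sqsubseteq> p \<cdot> g" "cpl p \<cdot> g \<sqsubseteq> cpl p \<cdot> f" using compare D by blast
  have e: "mult n (q \<cdot> f) = mult n (q \<cdot> g) \<and> fin (mult n (q \<cdot> g))" if "q \<in> Pr" for q
    using act_mult eq gD that fin_act fin by metis
  show ?thesis using local_eq[of p f g] key[of "p \<cdot> f" "p \<cdot> g"] key[of "cpl p \<cdot> g" "cpl p \<cdot> f"] e p D cpl_Pr by metis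
qed

text \<open>Let \<open>y n\<close> be what is left of e after n copies of t. Then
  \<open>y n = t \<oplus> y (Suc n)\<close>, so the infimum m of these remainders absorbs t, and m
  is finite because it is below e.\<close>

lemma archimedean:
  assumes e: "fin e" and le: "\<And>n. mult n t \<sqsubseteq> e" shows "t = \<zero>"
proof -
  have "\<exists>z. e = mult n t \<oplus> z" for n using le leE by metis
  then obtain y where y: "\<And>n. e = mult n t \<oplus> y n" by metis
  have yD: "y n \<in> D" for n using y e fin_D add_D2 by metis
  have mfin: "fin (mult n t)" for n using le e fin_le by blast
  have step: "y n = t \<oplus> y (Suc n)" for n
  proof (rule cancel[OF mfin[of n]])
    show "mult n t \<oplus> y n = mult n t \<oplus> (t \<oplus> y (Suc n))" using y[of n] y[of "Suc n"] by (simp add: ac)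
    then show "mult n t \<oplus> (t \<oplus> y (Suc n)) \<in> D" using y e fin_D by metis
  qed
  have "range y \<subseteq> D" "range y \<noteq> {}" using yD by auto
  from inf_ex[OF this] obtain m where
    m: "m \<in> D" "\<And>n. m \<sqsubseteq> y n" "\<And>w. w \<in> D \<Longrightarrow> (\<And>n. w \<sqsubseteq> y n) \<Longrightarrow> w \<sqsubseteq> m"
    by blast
  have tD: "t \<in> D" using mult_D[of 1 t] le[of 1] le_D1 by simp
  have "t \<oplus> m \<sqsubseteq> y n" for n
    using add_mono[of t t m "y (Suc n)"] m(2)[of "Suc n"] tD step[of n] yD[of n] by simp
  then have "t \<oplus> m \<sqsubseteq> m" using m(3)[of "t \<oplus> m"] le_D1 by blast
  then have "t \<oplus> m = m" using antisym le_add2 le_D1 by blast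
  moreover have "fin m" using e fin_le[of e m] m(2)[of 0] y[of 0] by simp
  ultimately show ?thesis using fin_absorb by blast
qed

text \<open>With \<open>e = t \<oplus> z\<close>, the locally smaller summand would fit twice into e
  and so vanishes. Hence t is the part of e on which z is the smaller one.\<close>

lemma mf_le_act:
  assumes "mf e" "t \<sqsubseteq> e" shows "\<exists>q\<in>Pr. t = q \<cdot> e"
proof -
  have eD: "e \<in> D" using assms mf_D by blast
  obtain z where z: "e = t \<oplus> z" using leE assms by blast
  have D: "t \<in> D" "z \<in> D" "t \<oplus> z \<in> D" using z eD add_D add_D2 by metis+
  obtain p where p: "p \<in> Pr" "p \<cdot> t \<sqsubseteq> p \<cdot> z" "cpl p \<cdot> z \<sqsubseteq> cpl p \<cdot> t" using compare D by blast
  have qe: "q \<cdot> t \<oplus> q \<cdot> z \<sqsubseteq> e" if "q \<in> Pr" for q using act_add act_le that z D by metis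
  have qD: "q \<cdot> t \<oplus> q \<cdot> z \<in> D" "q \<cdot> t \<in> D" "q \<cdot> z \<in> D" if "q \<in> Pr" for q
    using le_D1[OF qe[OF that]] act_D D that by auto
  have "p \<cdot> t \<oplus> p \<cdot> t \<sqsubseteq> p \<cdot> t \<oplus> p \<cdot> z" using add_mono[of "p \<cdot> t" "p \<cdot> t" "p \<cdot> t" "p \<cdot> z"] p qD by simp
  then have 1: "p \<cdot> t = \<zero>" using qe[OF p(1)] le_trans assms(1) unfolding mf_def by blast
  have "cpl p \<cdot> z \<oplus> cpl p \<cdot> z \<sqsubseteq> cpl p \<cdot> t \<oplus> cpl p \<cdot> z"
    using add_mono[of "cpl p \<cdot> z" "cpl p \<cdot> t" "cpl p \<cdot> z" "cpl p \<cdot> z"] p qD by simp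
  then have 2: "cpl p \<cdot> z = \<zero>" using qe[OF cpl_Pr[OF p(1)]] le_trans assms(1) unfolding mf_def by blast
  have "cpl p \<cdot> e = cpl p \<cdot> t" using z act_add[of "cpl p" t z] p D 2 by simp
  then have "t = cpl p \<cdot> e" using cpl_add[of p t] p D 1 by simp
  then show ?thesis using p cpl_Pr by blast
qed

text \<open>Take a maximal f with \<open>f \<oplus> f\<close> below e. A nonzero remainder is not
  multiple-free, so it contains some \<open>x \<oplus> x\<close> with x nonzero; then f could be
  enlarged by x, which maximality and finiteness forbid.\<close>

lemma halving:
  assumes e: "fin e" and nmf: "\<And>x. mf x \<Longrightarrow> x \<sqsubseteq> e \<Longrightarrow> x = \<zero>"
  shows "\<exists>f. f \<oplus> f = e"
proof -
  define A where "A = {f. f \<oplus> f \<sqsubseteq> e}"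
  have AD: "f \<in> D" "f \<sqsubseteq> e" if "f \<in> A" for f
    using that le_D1 add_D le_add1 le_trans unfolding A_def by blast+
  have eD: "e \<in> D" using e fin_D by blast
  have "\<exists>m\<in>A. \<forall>a\<in>A. m \<sqsubseteq> a \<longrightarrow> a = m"
  proof (rule predicate_Zorn)
    show "partial_order_on A (relation_of (\<sqsubseteq>) A)"
      by (rule partial_order_on_relation_ofI) (use AD le_refl le_trans antisym in blast)+
    fix C assume "C \<in> Chains (relation_of (\<sqsubseteq>) A)"
    then have C: "C \<subseteq> A" "\<And>x y. x \<in> C \<Longrightarrow> y \<in> C \<Longrightarrow> x \<sqsubseteq> y \<or> y \<sqsubseteq> x"
      unfolding Chains_def relation_of_def by auto
    have "\<exists>s. is_sup C s \<and> s \<sqsubseteq> e" by (rule sup_ex) (use AD C eD in blast)+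
    then obtain s where s: "is_sup C s" "s \<sqsubseteq> e" by blast
    \<comment> \<open>Cancelling x turns the bounds on all \<open>x \<oplus> c\<close> into one
      fixed bound on c, which passes to the supremum. It is applied to each argument of the sum in
      turn.\<close>
    have half: "x \<oplus> s \<sqsubseteq> e" if x: "x \<sqsubseteq> e" "\<And>c. c \<in> C \<Longrightarrow> x \<oplus> c \<sqsubseteq> e" for x
    proof -
      obtain y where y: "e = x \<oplus> y" "y \<in> D" using leE x by blast
      have "c \<sqsubseteq> y" if "c \<in> C" for c using cancel_le[of x c y] x that y fin_le e by metis
      then have "s \<sqsubseteq> y" using s y is_sup_def by blast
      then show ?thesis using add_mono[of x x s y] y eD x le_D1 by simp
    qed
    have cc: "c \<oplus> c' \<sqsubseteq> e" if "c \<in> C" "c' \<in> C" for c c'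
    proof -
      have c: "c \<oplus> c \<sqsubseteq> e" "c' \<oplus> c' \<sqsubseteq> e" using that C A_def by auto
      have "c \<in> D" "c' \<in> D" using that C(1) AD(1) by blast+
      have "c \<oplus> c' \<sqsubseteq> c' \<oplus> c' \<or> c \<oplus> c' \<sqsubseteq> c \<oplus> c"
        using C(2)[OF that] add_mono[of c c' c' c'] add_mono[of c c c' c] le_D1[OF c(1)] le_D1[OF c(2)]
          le_refl[OF \<open>c \<in> D\<close>] le_refl[OF \<open>c' \<in> D\<close>] by argo
      then show ?thesis using c le_trans by blast
    qed
    have "c \<oplus> s \<sqsubseteq> e" if "c \<in> C" for c using half[of c] cc that AD C by blast
    then have "s \<oplus> s \<sqsubseteq> e" using half[of s] s commute by metis
    then show "\<exists>u\<in>A. \<forall>a\<in>C. a \<sqsubseteq> u" using s is_sup_def A_def by blast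
  qed
  then obtain f where f: "f \<in> A" "\<And>a. a \<in> A \<Longrightarrow> f \<sqsubseteq> a \<Longrightarrow> a = f" by blast
  then obtain t where t: "e = (f \<oplus> f) \<oplus> t" using leE A_def by blast
  have "t = \<zero>"
  proof (rule ccontr)
    assume "t \<noteq> \<zero>"
    moreover have te: "t \<sqsubseteq> e" using t eD le_add2 by blast
    ultimately have "\<not> mf t" using nmf by blast
    then obtain x where x: "x \<oplus> x \<sqsubseteq> t" "x \<noteq> \<zero>" using te le_D1 unfolding mf_def by blast
    have "f \<oplus> f \<in> D" using t eD add_D by metis
    then have "(f \<oplus> f) \<oplus> (x \<oplus> x) \<sqsubseteq> e" using add_mono[of "f \<oplus> f" "f \<oplus> f" "x \<oplus> x" t] x t eD by simp
    then have a: "f \<oplus> x \<in> A" unfolding A_def by (simp add: ac)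
    then have "f \<oplus> x = f" using f le_add1 AD by blast
    then have "x \<oplus> f = f" using commute by metis
    then show False using fin_absorb fin_le e AD f x by blast
  qed
  then show ?thesis using t by auto
qed

text \<open>
  For the representing functions: \<open>v < x\<close> on a dense subset of the support of \<open>x\<close>.
  For purely infinite elements this is the relation of (M6).
\<close>

definition slt :: "'b \<Rightarrow> 'b \<Rightarrow> bool" where
  "slt v x \<longleftrightarrow> v \<sqsubseteq> x \<and> (\<forall>q\<in>Pr. q \<cdot> x \<sqsubseteq> q \<cdot> v \<longrightarrow> q \<cdot> x = \<zero>)"

lemma slt_le: "slt v x \<Longrightarrow> v \<sqsubseteq> x" unfolding slt_def by blast
lemma sltD: "slt v x \<Longrightarrow> q \<in> Pr \<Longrightarrow> q \<cdot> x \<sqsubseteq> q \<cdot> v \<Longrightarrow> q \<cdot> x = \<zero>" unfolding slt_def by blast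

text \<open>If a dominates b under q, then b is below a plus the rest of b, so remoteness removes
  \<open>q \<cdot> b\<close>. Conversely, \<open>pinf_prime\<close> distributes b over a and x, and
  strictness kills the part under a.\<close>

lemma llrem_iff:
  assumes a: "pinf a" and b: "pinf b" shows "llrem a b \<longleftrightarrow> slt a b"
proof
  assume l: "llrem a b"
  show "slt a b" unfolding slt_def
  proof (intro conjI ballI impI)
    show ab: "a \<sqsubseteq> b" using l llrem_def by blast
    fix q assume q: "q \<in> Pr" "q \<cdot> b \<sqsubseteq> q \<cdot> a"
    have D: "a \<in> D" "b \<in> D" using a b pinf_D by auto
    have cq: "cpl q \<cdot> b \<sqsubseteq> b" using act_le q D by simp
    have "a \<oplus> cpl q \<cdot> b \<in> D" using pinf_add_le[OF b ab cq] le_D1 by blast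
    moreover have "q \<cdot> b \<sqsubseteq> a" using q act_le D le_trans by blast
    ultimately have "b \<sqsubseteq> a \<oplus> cpl q \<cdot> b" using add_mono[of "q \<cdot> b" a "cpl q \<cdot> b" "cpl q \<cdot> b"] cpl_add q D act_D cpl_Pr by simp
    then have "b \<sqsubseteq> cpl q \<cdot> b" using l llrem_def by blast
    then have "q \<cdot> b \<sqsubseteq> q \<cdot> cpl q \<cdot> b" using act_mono q by blast
    then show "q \<cdot> b = \<zero>" using cpl_zero1 q D le_zero by simp
  qed
next
  assume s: "slt a b"
  show "llrem a b" unfolding llrem_def
  proof (intro conjI allI impI)
    show "a \<sqsubseteq> b" using s slt_le by blast
    fix x assume x: "b \<sqsubseteq> a \<oplus> x"
    obtain p where p: "p \<in> Pr" "p \<cdot> b \<sqsubseteq> p \<cdot> a" "cpl p \<cdot> b \<sqsubseteq> cpl p \<cdot> x" using pinf_prime b x by blast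
    have D: "b \<in> D" "x \<in> D" using x le_D1 le_D2 add_D2 by blast+
    have "p \<cdot> b = \<zero>" using sltD s p by blast
    then have "b = cpl p \<cdot> b" using cpl_add[of p b] p D by simp
    then show "b \<sqsubseteq> x" using p(3) act_le[of "cpl p" x] p(1) D le_trans by simp
  qed
qed

lemma slt_act: "slt v x \<Longrightarrow> p \<in> Pr \<Longrightarrow> slt (p \<cdot> v) (p \<cdot> x)"
  unfolding slt_def using act_mono mt_act mt_Pr le_D1 le_D2 by metis

lemma slt_le_trans: "slt v c \<Longrightarrow> c \<sqsubseteq> u \<Longrightarrow> ss c u \<Longrightarrow> slt v u"
  unfolding slt_def using le_trans act_mono ssD by metis

text \<open>Both elements live on the common part of the two supports; this is how two units are
  brought to equal supports.\<close>

lemma ss_meet: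
  assumes "x \<in> D" "y \<in> D" shows "ss (sp x \<cdot> y) (sp y \<cdot> x)"
proof -
  have "q \<cdot> sp y \<cdot> x = \<zero>" if *: "x \<in> D" "y \<in> D" "q \<in> Pr" "q \<cdot> sp x \<cdot> y = \<zero>" for x y q
  proof -
    have "mt q (sp x) \<cdot> sp y \<cdot> x = \<zero>" using sp_kill[of y "mt q (sp x)" x] * by (simp add: mt_act)
    then have "q \<cdot> sp x \<cdot> sp y \<cdot> x = \<zero>" using mt_act * act_D by simp
    then show ?thesis using act_comm[of "sp x" "sp y" x] * by simp
  qed
  then show ?thesis unfolding ss_def using assms by blast
qed

end

section \<open>Units of finite value\<close>

locale dim_unit = dim_scale add zero D Pr act
  for add :: "'b \<Rightarrow> 'b \<Rightarrow> 'b" (infixl "\<oplus>" 65) and zero :: 'b ("\<zero>") and D :: "'b set"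
    and Pr :: "'p set" and act :: "'p \<Rightarrow> 'b \<Rightarrow> 'b" (infixr "\<cdot>" 75) +
  fixes E :: "'b set"
  assumes E_fin: "\<And>e. e \<in> E \<Longrightarrow> fin e"
    and E_orth: "\<And>e e'. e \<in> E \<Longrightarrow> e' \<in> E \<Longrightarrow> e \<noteq> e' \<Longrightarrow> orth e e'"
    and E_dense: "\<And>x. fin x \<Longrightarrow> x \<noteq> \<zero> \<Longrightarrow> \<exists>e\<in>E. \<not> orth x e"
    and E_type: "\<And>e. e \<in> E \<Longrightarrow> mf e \<or> (\<forall>x. mf x \<and> x \<sqsubseteq> e \<longrightarrow> x = \<zero>)"
begin

lemma E_D: "e \<in> E \<Longrightarrow> e \<in> D" using E_fin fin_D by blast

text \<open>\<open>E_type\<close> excludes nonzero multiple-free elements below e, hence below each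
  of its roots, so \<open>halving\<close> can be iterated.\<close>

lemma roots:
  assumes e: "e \<in> E" "\<not> mf e" shows "\<exists>f. mult (2 ^ k) f = e"
proof (induction k)
  case 0 show ?case by simp
next
  case (Suc k)
  then obtain f where f: "mult (2 ^ k) f = e" by blast
  have fe: "f \<sqsubseteq> e" using mult_le[of "2 ^ k" f] f E_D e by simp
  have "\<exists>g. g \<oplus> g = f"
  proof (rule halving)
    show "fin f" using fe E_fin e fin_le by blast
    show "x = \<zero>" if "mf x" "x \<sqsubseteq> f" for x using that E_type e fe le_trans by blast
  qed
  then obtain g where "g \<oplus> g = f" by blast
  then have "mult 2 g = f" by (simp add: numeral_2_eq_2)
  then have "mult (2 ^ k * 2) g = e" using f mult_mult by metis
  then show ?case by (auto simp: mult.commute)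
qed

text \<open>
  \<open>fu r u\<close> holds for the elements \<open>u\<close> represented by the constant \<open>r\<close> on their support.
  The value \<open>n / 2 ^ k\<close> is attained by \<open>n f\<close>, where \<open>2 ^ k f\<close> is a piece of an element of
  \<open>E\<close>; as no single element of \<open>E\<close> need cover the support of \<open>u\<close>, this is required
  densely only.
\<close>

definition bu :: "real \<Rightarrow> 'b \<Rightarrow> bool" where
  "bu r u \<longleftrightarrow> (\<exists>e\<in>E. \<exists>q\<in>Pr. \<exists>k n f. mult (2 ^ k) f = q \<cdot> e \<and> u = mult n f \<and> u \<in> D \<and> 0 < n \<and>
     r = real n / 2 ^ k)"

lemma bu_act:
  assumes "bu r u" "p \<in> Pr" shows "bu r (p \<cdot> u)"
proof -
  obtain e q k n f where *: "e \<in> E" "q \<in> Pr" "mult (2 ^ k) f = q \<cdot> e" "u = mult n f" "u \<in> D" "0 < n"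
    "r = real n / 2 ^ k" using assms(1) unfolding bu_def by blast
  have "mult (2 ^ k) (p \<cdot> f) = mt p q \<cdot> e"
    using act_mult[of p "2 ^ k" f] * assms act_D E_D mt_act by simp
  moreover have "p \<cdot> u = mult n (p \<cdot> f)" using act_mult * assms by simp
  ultimately show ?thesis unfolding bu_def using * assms act_D mt_Pr by blast
qed

text \<open>The projection in the definition of \<open>bu\<close> may exceed the support of u.
  Replacing it by \<open>sp u\<close> makes units with equal supports comparable.\<close>

lemma bu_norm:
  assumes "bu r u" "u \<noteq> \<zero>"
  shows "\<exists>e\<in>E. \<exists>k n f. mult (2 ^ k) f = sp u \<cdot> e \<and> u = mult n f \<and> 0 < n \<and>
     r = real n / 2 ^ k \<and> f \<in> D \<and> pleq (sp u) (sp e)"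
proof -
  obtain e q k n f where *: "e \<in> E" "q \<in> Pr" "mult (2 ^ k) f = q \<cdot> e" "u = mult n f" "u \<in> D" "0 < n"
    "r = real n / 2 ^ k" using assms(1) unfolding bu_def by blast
  have eD: "e \<in> D" using * E_D by blast
  have fD: "f \<in> D" using * mult_D by metis
  have "f \<sqsubseteq> u" using * mult_le by metis
  then have spf: "sp u \<cdot> f = f" using sp_le_act * by blast
  have fq: "f \<sqsubseteq> q \<cdot> e" using mult_le[of "2 ^ k" f] * act_D eD by simp
  then have "q \<cdot> f = f" using act_fixI * eD by blast
  then have "q \<cdot> u = u" using act_mult[of q n f] * by simp
  then have pl: "pleq (sp u) q" using sp_pleq * by blast
  have "mult (2 ^ k) f = sp u \<cdot> q \<cdot> e" using act_mult[of "sp u" "2 ^ k" f] * spf act_D eD by simp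
  also have "\<dots> = sp u \<cdot> e" using pleq_act2 pl eD by blast
  finally have 1: "mult (2 ^ k) f = sp u \<cdot> e" .
  have "f \<sqsubseteq> e" using fq act_le * eD le_trans by blast
  then have "sp e \<cdot> u = u" using act_mult[of "sp e" n f] sp_le_act[of e f] * eD by simp
  then have "pleq (sp u) (sp e)" using sp_pleq * eD by simp
  then show ?thesis using 1 * fD by blast
qed

lemma bu_fin: assumes "bu r u" shows "fin u"
proof -
  obtain e q k n f where *: "e \<in> E" "q \<in> Pr" "mult (2 ^ k) f = q \<cdot> e" "u = mult n f" "u \<in> D" "0 < n"
    "r = real n / 2 ^ k" using assms(1) unfolding bu_def by blast
  have "f \<sqsubseteq> q \<cdot> e" using mult_le[of "2 ^ k" f] * act_D E_D by simp
  then have "fin f" using fin_le fin_act E_fin * by blast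
  then show ?thesis using fin_mult * by blast
qed

lemma dyadic_shift:
  assumes "k \<le> k'" shows "real n / 2 ^ k = real (n * 2 ^ (k' - k)) / 2 ^ k'"
proof -
  have "(2::real) ^ k' = 2 ^ k * 2 ^ (k' - k)" using assms by (simp add: power_add[symmetric])
  then show ?thesis by (simp add: field_simps)
qed

text \<open>Equal nonzero supports force the same element of E, as different ones are orthogonal.
  Both roots then divide the same piece of it, and by \<open>mult_inj\<close> the coarser root is a
  multiple of the finer one.\<close>

lemma bu_common:
  assumes a: "bu r a" and b: "bu s b" and s: "ss a b" and nz: "a \<noteq> \<zero>"
  shows "\<exists>K n m f. (\<exists>e\<in>E. mult (2 ^ K) f = sp a \<cdot> e) \<and> a = mult n f \<and> b = mult m f \<and> r = real n / 2 ^ K \<and> s = real m / 2 ^ K \<and> f \<in> D \<and> 0 < n \<and> 0 < m"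
proof -
  have D: "a \<in> D" "b \<in> D" using a b bu_fin fin_D by auto
  have nzb: "b \<noteq> \<zero>" using ss_zero s D nz by blast
  obtain e k n f where A: "e \<in> E" "mult (2 ^ k) f = sp a \<cdot> e" "a = mult n f" "0 < n"
     "r = real n / 2 ^ k" "f \<in> D" "pleq (sp a) (sp e)" using bu_norm a nz by blast
  obtain e' k' n' f' where B: "e' \<in> E" "mult (2 ^ k') f' = sp b \<cdot> e'" "b = mult n' f'" "0 < n'"
     "s = real n' / 2 ^ k'" "f' \<in> D" "pleq (sp b) (sp e')" using bu_norm b nzb by blast
  have eD: "e \<in> D" "e' \<in> D" using A B E_D by auto
  have sab: "sp a \<cdot> y = sp b \<cdot> y" if "y \<in> D" for y using ss_sp_act s D that by blast
  have nze: "sp a \<cdot> e \<noteq> \<zero>"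
  proof
    assume "sp a \<cdot> e = \<zero>"
    then have "f = \<zero>" using mult_le[of "2 ^ k" f] A le_zero by simp
    then show False using A nz by simp
  qed
  have "e = e'"
  proof (rule ccontr)
    assume "e \<noteq> e'"
    then have "sp e' \<cdot> e = \<zero>" using E_orth A B orth_iff eD by blast
    then have "sp b \<cdot> e = \<zero>" using pleq_act2[OF B(7) eD(1)] act_zero D by simp
    then show False using nze sab eD by simp
  qed
  then have eq: "mult (2 ^ k) f = mult (2 ^ k') f'" using A B sab eD by simp
  have fin: "fin (mult (2 ^ k) f)" using A(1,2) E_fin fin_act D by simp
  have key: "f = mult (2 ^ (k' - k)) f'" if "k \<le> k'" "mult (2 ^ k) f = mult (2 ^ k') f'" "fin (mult (2 ^ k) f)" for k k' f f'
  proof -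
    have "mult (2 ^ k) f = mult (2 ^ k) (mult (2 ^ (k' - k)) f')"
      using that by (simp add: mult_mult power_add[symmetric])
    then show ?thesis using mult_inj[of "2 ^ k"] that by simp
  qed
  show ?thesis
  proof (cases "k \<le> k'")
    case True
    then have "f = mult (2 ^ (k' - k)) f'" using key eq fin by blast
    then have "a = mult (n * 2 ^ (k' - k)) f'" using A mult_mult by simp
    moreover have "r = real (n * 2 ^ (k' - k)) / 2 ^ k'" using A(5) dyadic_shift[OF True] by simp
    moreover have "0 < n * 2 ^ (k' - k)" using A by simp
    moreover have "mult (2 ^ k') f' = sp a \<cdot> e" using eq A by simp
    ultimately show ?thesis using A(1) B by blast
  next
    case False
    then have "f' = mult (2 ^ (k - k')) f" using key[of k' k f' f] eq fin by simp
    then have "b = mult (n' * 2 ^ (k - k')) f" using B mult_mult by simp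
    moreover have "s = real (n' * 2 ^ (k - k')) / 2 ^ k" using B(5) dyadic_shift[of k' k n'] False by simp
    moreover have "0 < n' * 2 ^ (k - k')" using B by simp
    ultimately show ?thesis using A by blast
  qed
qed

definition fu :: "real \<Rightarrow> 'b \<Rightarrow> bool" where
  "fu r u \<longleftrightarrow> u \<in> D \<and> (\<forall>q\<in>Pr. q \<cdot> u \<noteq> \<zero> \<longrightarrow> (\<exists>q'\<in>Pr. q' \<cdot> q \<cdot> u \<noteq> \<zero> \<and> bu r (q' \<cdot> q \<cdot> u)))"

lemma fu_D: "fu r u \<Longrightarrow> u \<in> D" unfolding fu_def by blast

lemma bu_fu: assumes "bu r u" shows "fu r u"
  unfolding fu_def
proof (intro conjI ballI impI)
  show D: "u \<in> D" using assms bu_fin fin_D by blast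
  fix q assume "q \<in> Pr" "q \<cdot> u \<noteq> \<zero>"
  then have "q \<cdot> q \<cdot> u \<noteq> \<zero> \<and> bu r (q \<cdot> q \<cdot> u)" using act_idem D bu_act assms by simp
  then show "\<exists>q'\<in>Pr. q' \<cdot> q \<cdot> u \<noteq> \<zero> \<and> bu r (q' \<cdot> q \<cdot> u)" using \<open>q \<in> Pr\<close> by blast
qed

lemma fu_act: "fu r u \<Longrightarrow> p \<in> Pr \<Longrightarrow> fu r (p \<cdot> u)"
  unfolding fu_def using act_D mt_act mt_Pr by metis

text \<open>A nonzero absorbed x would be absorbed on a piece of its support where u is a basic
  unit, and basic units are finite.\<close>

lemma fu_fin: assumes "fu r u" shows "fin u"
  unfolding fin_def
proof (intro conjI allI impI)
  show D: "u \<in> D" using assms fu_D by blast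
  fix x assume x: "x \<oplus> u = u"
  then have xu: "x \<sqsubseteq> u" using leI D by blast
  then have xD: "x \<in> D" using le_D1 by blast
  show "x = \<zero>"
  proof (rule ccontr)
    assume nz: "x \<noteq> \<zero>"
    have "sp x \<cdot> u \<noteq> \<zero>" using act_zero_mono[OF sp_Pr[OF xD] xu] nz xD by auto
    then obtain q where q: "q \<in> Pr" "q \<cdot> sp x \<cdot> u \<noteq> \<zero>" "bu r (q \<cdot> sp x \<cdot> u)"
      using assms xD unfolding fu_def by (meson sp_Pr)
    have "q \<cdot> x \<oplus> q \<cdot> sp x \<cdot> u = q \<cdot> sp x \<cdot> u"
      using act_add[of q x "sp x \<cdot> u"] act_add[of "sp x" x u] x q xD D act_D by simp
    then have "q \<cdot> x = \<zero>" using bu_fin q fin_absorb by blast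
    then show False using sp_kill q xD D by blast
  qed
qed

text \<open>The two density conditions are met one after the other; shrinking further for b does no
  harm to a, by \<open>bu_act\<close>.\<close>

lemma fu_pair:
  assumes "fu r a" "fu s b" "ss a b" "q \<in> Pr" "q \<cdot> a \<noteq> \<zero>"
  shows "\<exists>q'\<in>Pr. q' \<cdot> q \<cdot> a \<noteq> \<zero> \<and> bu r (q' \<cdot> q \<cdot> a) \<and> bu s (q' \<cdot> q \<cdot> b) \<and> ss (q' \<cdot> q \<cdot> a) (q' \<cdot> q \<cdot> b)"
proof -
  have D: "a \<in> D" "b \<in> D" using assms fu_D by auto
  obtain p where p: "p \<in> Pr" "p \<cdot> q \<cdot> a \<noteq> \<zero>" "bu r (p \<cdot> q \<cdot> a)" using assms unfolding fu_def by meson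
  let ?t = "mt p q"
  have t: "?t \<in> Pr" "?t \<cdot> a = p \<cdot> q \<cdot> a" "?t \<cdot> b = p \<cdot> q \<cdot> b" using assms p D by (auto simp: mt_act)
  have "?t \<cdot> b \<noteq> \<zero>" using ssD assms t p by metis
  then obtain p' where p': "p' \<in> Pr" "p' \<cdot> ?t \<cdot> b \<noteq> \<zero>" "bu s (p' \<cdot> ?t \<cdot> b)" using assms t unfolding fu_def by meson
  let ?q = "mt p' p"
  have e: "?q \<cdot> q \<cdot> a = p' \<cdot> p \<cdot> q \<cdot> a" "?q \<cdot> q \<cdot> b = p' \<cdot> p \<cdot> q \<cdot> b" using p p' assms D act_D by (auto simp: mt_act)
  have s: "ss (?q \<cdot> q \<cdot> a) (?q \<cdot> q \<cdot> b)" using ss_act assms D p p' act_D by simp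
  have "?q \<cdot> q \<cdot> b \<noteq> \<zero>" using e p' t by simp
  then have "?q \<cdot> q \<cdot> a \<noteq> \<zero>" using ss_zero[OF s] p p' assms D act_D by simp
  then show ?thesis using s e p p' bu_act t by (metis mt_Pr)
qed

lemma fu_le:
  assumes "fu r a" "fu s b" "ss a b" "r \<le> s" shows "a \<sqsubseteq> b"
proof (rule dense_le)
  show "a \<in> D" "b \<in> D" using assms fu_D by auto
  fix q assume q: "q \<in> Pr" "q \<cdot> a \<noteq> \<zero>"
  obtain p where p: "p \<in> Pr" "p \<cdot> q \<cdot> a \<noteq> \<zero>" "bu r (p \<cdot> q \<cdot> a)" "bu s (p \<cdot> q \<cdot> b)" "ss (p \<cdot> q \<cdot> a) (p \<cdot> q \<cdot> b)"
    using fu_pair assms q by blast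
  obtain K n m f where c: "p \<cdot> q \<cdot> a = mult n f" "p \<cdot> q \<cdot> b = mult m f" "r = real n / 2 ^ K" "s = real m / 2 ^ K"
    using bu_common p by metis
  have "n \<le> m" using c assms by (simp add: divide_le_cancel)
  then have "p \<cdot> q \<cdot> a \<sqsubseteq> p \<cdot> q \<cdot> b" using mult_mono c p bu_fin fin_D by metis
  then show "\<exists>q'\<in>Pr. q' \<cdot> q \<cdot> a \<noteq> \<zero> \<and> q' \<cdot> q \<cdot> a \<sqsubseteq> q' \<cdot> q \<cdot> b" using p by blast
qed

text \<open>After cutting b to the support of a, both are locally multiples of one finite nonzero f,
  and by cancellation more copies of f do not fit into fewer.\<close>

lemma fu_strict:
  assumes a: "fu r a" and b: "fu s b" and le: "a \<sqsubseteq> b" and nz: "a \<noteq> \<zero>" shows "r \<le> s"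
proof -
  have D: "a \<in> D" "b \<in> D" using assms fu_D by auto
  let ?b = "sp a \<cdot> b"
  have "fu s ?b" "ss a ?b" using b fu_act D ss_below le by auto
  moreover have "sp a \<cdot> a \<noteq> \<zero>" using nz D by simp
  ultimately obtain p where p: "p \<in> Pr" "p \<cdot> sp a \<cdot> a \<noteq> \<zero>" "bu r (p \<cdot> sp a \<cdot> a)" "bu s (p \<cdot> sp a \<cdot> ?b)"
      "ss (p \<cdot> sp a \<cdot> a) (p \<cdot> sp a \<cdot> ?b)"
    using fu_pair a D sp_Pr by blast
  then obtain K n m f where c: "p \<cdot> sp a \<cdot> a = mult n f" "p \<cdot> sp a \<cdot> ?b = mult m f" "r = real n / 2 ^ K" "s = real m / 2 ^ K"
    using bu_common by metis
  have le': "mult n f \<sqsubseteq> mult m f"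
    using c act_mono[OF p(1) act_mono[OF sp_Pr[OF D(1)] act_mono[OF sp_Pr[OF D(1)] le]]] D by (simp add: act_idem act_D)
  have "n \<le> m"
  proof (rule ccontr)
    assume "\<not> n \<le> m"
    then have "mult m f \<oplus> mult (n - m) f \<sqsubseteq> mult m f \<oplus> \<zero>" using le' mult_add[of m "n - m" f] by simp
    then have "mult (n - m) f \<sqsubseteq> \<zero>" using cancel_le bu_fin p c by metis
    then have "mult (n - m) f = \<zero>" using le_zero by blast
    then have "f = \<zero>" using mult_le[of "n - m" f] \<open>\<not> n \<le> m\<close> le_zero by simp
    then show False using c p by simp
  qed
  then show ?thesis using c by (simp add: divide_right_mono)
qed

lemma ss_add:
  assumes "ss a b" "a \<oplus> b \<in> D" shows "ss a (a \<oplus> b)"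
  unfolding ss_def using assms act_add ssD add_zero1 left_neutral by metis

text \<open>Equal supports are essential: elsewhere the sum would have the value of a single
  summand.\<close>

lemma fu_add:
  assumes a: "fu r a" and b: "fu s b" and s: "ss a b" and d: "a \<oplus> b \<in> D" shows "fu (r + s) (a \<oplus> b)"
  unfolding fu_def
proof (intro conjI ballI impI)
  show "a \<oplus> b \<in> D" by fact
  fix q assume q: "q \<in> Pr" "q \<cdot> (a \<oplus> b) \<noteq> \<zero>"
  then have "q \<cdot> a \<noteq> \<zero>" using ss_add[OF s d] ssD by blast
  then obtain p where p: "p \<in> Pr" "p \<cdot> q \<cdot> a \<noteq> \<zero>" "bu r (p \<cdot> q \<cdot> a)" "bu s (p \<cdot> q \<cdot> b)" "ss (p \<cdot> q \<cdot> a) (p \<cdot> q \<cdot> b)"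
    using fu_pair assms q by blast
  have pn: "p \<cdot> q \<cdot> (a \<oplus> b) = p \<cdot> q \<cdot> a \<oplus> p \<cdot> q \<cdot> b" using p q d act_add act_D by metis
  then have nz: "p \<cdot> q \<cdot> (a \<oplus> b) \<noteq> \<zero>" using p add_zero1 by metis
  have pD: "p \<cdot> q \<cdot> (a \<oplus> b) \<in> D" using p q d act_D by simp
  have "bu (r + s) (p \<cdot> q \<cdot> (a \<oplus> b))"
  proof -
    obtain K n m f e where c: "e \<in> E" "mult (2 ^ K) f = sp (p \<cdot> q \<cdot> a) \<cdot> e" "p \<cdot> q \<cdot> a = mult n f"
      "p \<cdot> q \<cdot> b = mult m f" "r = real n / 2 ^ K" "s = real m / 2 ^ K" "0 < n"
      using bu_common[OF p(3,4,5,2)] by blast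
    have "p \<cdot> q \<cdot> (a \<oplus> b) = mult (n + m) f" using c pn mult_add by simp
    moreover have "r + s = real (n + m) / 2 ^ K" using c by (simp add: add_divide_distrib)
    moreover have "sp (p \<cdot> q \<cdot> a) \<in> Pr" using p bu_fin fin_D by simp
    ultimately show ?thesis unfolding bu_def using c pD by (metis trans_less_add1)
  qed
  then show "\<exists>q'\<in>Pr. q' \<cdot> q \<cdot> (a \<oplus> b) \<noteq> \<zero> \<and> bu (r + s) (q' \<cdot> q \<cdot> (a \<oplus> b))" using p nz by blast
qed

end

section \<open>Units of aleph value\<close>

context dim_scale
begin

lemma sup_zero:
  assumes "is_sup X s" "q \<in> Pr" "\<And>t. t \<in> X \<Longrightarrow> q \<cdot> t = \<zero>" shows "q \<cdot> s = \<zero>"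
proof -
  have "is_sup ((\<cdot>) q ` X) (q \<cdot> s)" using sup_act assms by blast
  moreover have "\<forall>y\<in>(\<cdot>) q ` X. y \<sqsubseteq> \<zero>" using assms by auto
  ultimately have "q \<cdot> s \<sqsubseteq> \<zero>" unfolding is_sup_def by simp
  then show ?thesis using le_zero by blast
qed

lemma ss_between: "a \<sqsubseteq> b \<Longrightarrow> b \<sqsubseteq> c \<Longrightarrow> ss a c \<Longrightarrow> ss b c"
  unfolding ss_def using act_zero_mono by blast

lemma ss_join:
  assumes "ss a (p \<cdot> b)" "ss c (cpl p \<cdot> b)" "a \<oplus> c \<in> D" "p \<in> Pr" "b \<in> D"
  shows "ss (a \<oplus> c) b"
  unfolding ss_def
proof
  fix q assume q: "q \<in> Pr"
  have 1: "q \<cdot> (a \<oplus> c) = q \<cdot> a \<oplus> q \<cdot> c" using act_add q assms by blast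
  have 2: "q \<cdot> b = q \<cdot> p \<cdot> b \<oplus> q \<cdot> cpl p \<cdot> b"
    using act_add[of q "p \<cdot> b" "cpl p \<cdot> b"] cpl_add q assms by simp
  have z: "x \<oplus> y = \<zero> \<longleftrightarrow> x = \<zero> \<and> y = \<zero>" for x y
    using add_zero1[of x y] add_zero2[of x y] left_neutral[of \<zero>] by metis
  show "(q \<cdot> (a \<oplus> c) = \<zero>) = (q \<cdot> b = \<zero>)"
    unfolding 1 2 z using ssD[OF assms(1) q] ssD[OF assms(2) q] by blast
qed

text \<open>(M6) with remoteness read as \<open>slt\<close> and equality of orthogonals read as
  \<open>ss\<close>.\<close>

lemma next_pinf:
  assumes "pinf a" "pinf b" "slt a b"
  shows "\<exists>m. pinf m \<and> slt a m \<and> ss m b \<and> (\<forall>x. pinf x \<and> slt a x \<and> ss x b \<longrightarrow> m \<sqsubseteq> x)"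
proof -
  have bD: "b \<in> D" using assms pinf_D by blast
  have "llrem a b" using assms llrem_iff by blast
  from least_remote[OF assms(1,2) this] obtain m where
    m: "pinf m" "llrem a m" "\<forall>t\<in>D. orth t m \<longleftrightarrow> orth t b"
      "\<And>x. pinf x \<and> llrem a x \<and> (\<forall>t\<in>D. orth t x \<longleftrightarrow> orth t b) \<Longrightarrow> m \<sqsubseteq> x" by blast
  have 1: "slt a m" "ss m b" using m llrem_iff assms perp_eq_iff pinf_D bD by blast+
  have 2: "m \<sqsubseteq> x" if "pinf x" "slt a x" "ss x b" for x
    using m(4)[of x] that llrem_iff[OF assms(1) that(1)] perp_eq_iff[OF pinf_D[OF that(1)] bD] by blast
  show ?thesis using m(1) 1 2 by blast
qed

lemma pinf_zero [simp]: "pinf \<zero>" unfolding pinf_def by simp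

lemma slt_zero: "pinf b \<Longrightarrow> slt \<zero> b"
  unfolding slt_def using act_zero le_zero pinf_D by simp

text \<open>
  \<open>au \<xi> u\<close> holds for the elements represented by the constant \<open>Aleph \<xi>\<close> on their support:
  the least purely infinite elements with a given support that are strictly above the
  corresponding elements for all smaller indices.  Existence comes from (M6).
\<close>

function au :: "'o::wellorder \<Rightarrow> 'b \<Rightarrow> bool" where
  "au \<xi> u \<longleftrightarrow> (pinf u \<and> (\<forall>\<eta>\<in>{..<\<xi>}. \<exists>v. au \<eta> v \<and> slt v u \<and> ss v u)) \<and>
     (\<forall>x. (pinf x \<and> (\<forall>\<eta>\<in>{..<\<xi>}. \<exists>v. au \<eta> v \<and> slt v x \<and> ss v x)) \<and> ss x u \<longrightarrow> u \<sqsubseteq> x)"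
  by pat_completeness auto
termination
  by (relation "inv_image {(a, b). a < b} fst") (auto intro: wf)

declare au.simps [simp del]

text \<open>The condition that occurs twice in the equation for \<open>au\<close>: units are its
  least solutions among elements of the same support.\<close>

definition above_all :: "'o::wellorder \<Rightarrow> 'b \<Rightarrow> bool" where
  "above_all \<xi> x \<longleftrightarrow> pinf x \<and> (\<forall>\<eta><\<xi>. \<exists>v. au \<eta> v \<and> slt v x \<and> ss v x)"

lemma au_iff: "au \<xi> u \<longleftrightarrow> above_all \<xi> u \<and> (\<forall>x. above_all \<xi> x \<and> ss x u \<longrightarrow> u \<sqsubseteq> x)"
  unfolding above_all_def by (subst au.simps) (simp add: Ball_def)

lemma au_above: "au \<xi> u \<Longrightarrow> above_all \<xi> u" using au_iff by blast
lemma au_least: "au \<xi> u \<Longrightarrow> above_all \<xi> x \<Longrightarrow> ss x u \<Longrightarrow> u \<sqsubseteq> x" using au_iff by blast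
lemma au_pinf: "au \<xi> u \<Longrightarrow> pinf u" using au_iff above_all_def by blast
lemma au_D: "au \<xi> u \<Longrightarrow> u \<in> D" using au_pinf pinf_D by blast

lemma above_allD: "above_all \<xi> x \<Longrightarrow> \<eta> < \<xi> \<Longrightarrow> \<exists>v. au \<eta> v \<and> slt v x \<and> ss v x"
  unfolding above_all_def by blast

lemma au_unique: "au \<xi> u \<Longrightarrow> au \<xi> v \<Longrightarrow> ss u v \<Longrightarrow> u = v"
  using au_least au_above antisym ss_sym by metis

text \<open>The unit is the supremum of the least purely infinite elements strictly above the units
  of smaller index, each provided by (M6). Using these successors instead of the units themselves
  makes the supremum strictly larger than each unit. It is least because each successor is, and
  because the smaller units are determined by their supports.\<close>

lemma au_ex:
  assumes x: "above_all \<xi> x" shows "\<exists>u. au \<xi> u \<and> ss u x \<and> u \<sqsubseteq> x"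
proof -
  have xp: "pinf x" "x \<in> D" using x above_all_def pinf_D by auto
  define base where "base v \<longleftrightarrow> pinf v \<and> slt v x \<and> (v = \<zero> \<or> (\<exists>\<eta><\<xi>. au \<eta> v \<and> ss v x))" for v
  define suc where "suc v m \<longleftrightarrow> pinf m \<and> slt v m \<and> ss m x \<and> (\<forall>y. pinf y \<and> slt v y \<and> ss y x \<longrightarrow> m \<sqsubseteq> y)" for v m
  have sucx: "\<exists>m. suc v m" if "base v" for v
    using next_pinf[of v x] that xp unfolding base_def suc_def by blast
  let ?X = "{m. \<exists>v. base v \<and> suc v m}"
  have Xx: "m \<sqsubseteq> x" if "m \<in> ?X" for m using that xp(1) ss_refl unfolding base_def suc_def by blast
  then obtain s where s: "is_sup ?X s" "s \<sqsubseteq> x" using sup_ex[of ?X x] xp by blast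
  have sp: "pinf s" by (rule sup_pinf[OF s(1)]) (auto simp: suc_def)
  have Xs: "m \<sqsubseteq> s" if "m \<in> ?X" for m using that s unfolding is_sup_def by blast
  have "base \<zero>" unfolding base_def using slt_zero xp by simp
  then obtain m0 where m0: "suc \<zero> m0" using sucx by blast
  then have "m0 \<in> ?X" using \<open>base \<zero>\<close> by blast
  then have ssx: "ss s x" using ss_between[OF Xs s(2)] m0 suc_def by blast
  have sa: "above_all \<xi> s"
    unfolding above_all_def
  proof (intro conjI allI impI)
    show "pinf s" by fact
    fix \<eta> assume \<eta>: "\<eta> < \<xi>"
    then obtain v where v: "au \<eta> v" "slt v x" "ss v x" using above_allD x by blast
    then have "base v" unfolding base_def using au_pinf \<eta> by blast
    then obtain m where m: "suc v m" using sucx by blast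
    then have "m \<sqsubseteq> s" using Xs \<open>base v\<close> by blast
    moreover have "ss m s" using m ssx ss_trans ss_sym unfolding suc_def by blast
    ultimately have "slt v s" using slt_le_trans m suc_def by blast
    then show "\<exists>v. au \<eta> v \<and> slt v s \<and> ss v s" using v ssx ss_trans ss_sym by blast
  qed
  moreover have "s \<sqsubseteq> y" if y: "above_all \<xi> y" "ss y s" for y
  proof -
    have yx: "ss y x" using y ssx ss_trans by blast
    have yp: "pinf y" using y above_all_def by blast
    have "m \<sqsubseteq> y" if h: "base v" "suc v m" for v m
    proof -
      have "slt v y"
      proof (cases "v = \<zero>")
        case True then show ?thesis using slt_zero yp by blast
      next
        case False
        then obtain \<eta> where e: "\<eta> < \<xi>" "au \<eta> v" "ss v x" using h(1) False unfolding base_def by blast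
        then obtain v' where v': "au \<eta> v'" "slt v' y" "ss v' y" using above_allD[OF y(1) e(1)] by blast
        then have "ss v' v" using e yx ss_trans ss_sym by metis
        then show ?thesis using au_unique v' e by metis
      qed
      then show ?thesis using that yp yx unfolding suc_def by blast
    qed
    then show ?thesis using s(1) yp pinf_D unfolding is_sup_def by blast
  qed
  ultimately show ?thesis using au_iff ssx s by blast
qed

text \<open>Minimality is the issue. A unit \<open>u'\<close> below \<open>p \<cdot> u\<close> is
  glued to the untouched rest of u; the result still satisfies \<open>above_all\<close> and has the
  support of u. Minimality of u puts u below it, and applying p puts \<open>p \<cdot> u\<close>
  below \<open>u'\<close>.\<close>

lemma au_act: "au \<xi> u \<Longrightarrow> p \<in> Pr \<Longrightarrow> au \<xi> (p \<cdot> u)"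
proof (induction \<xi> arbitrary: u p rule: less_induct)
  case (less \<xi>)
  note p = less.prems(2)
  have uD: "u \<in> D" and up: "pinf u" using less.prems au_D au_pinf by auto
  have pa: "above_all \<xi> (p \<cdot> u)" unfolding above_all_def
  proof (intro conjI allI impI)
    show "pinf (p \<cdot> u)" using pinf_act up p by blast
    fix \<eta> assume \<eta>: "\<eta> < \<xi>"
    then obtain v where v: "au \<eta> v" "slt v u" "ss v u" using above_allD au_above less.prems by blast
    then show "\<exists>v. au \<eta> v \<and> slt v (p \<cdot> u) \<and> ss v (p \<cdot> u)"
      using less.IH[OF \<eta> _ p] slt_act ss_act p uD au_D by blast
  qed
  then obtain u' where u': "au \<xi> u'" "ss u' (p \<cdot> u)" "u' \<sqsubseteq> p \<cdot> u" using au_ex by blast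
  have u'D: "u' \<in> D" using u' au_D by blast
  let ?y = "u' \<oplus> cpl p \<cdot> u"
  have "u' \<oplus> cpl p \<cdot> u \<sqsubseteq> p \<cdot> u \<oplus> cpl p \<cdot> u"
    using add_mono[OF u'(3) le_refl[OF act_D[OF cpl_Pr[OF p] uD]]] cpl_add p uD by simp
  then have yD: "?y \<in> D" using le_D1 by blast
  have yp: "pinf ?y" using pinf_add[OF au_pinf[OF u'(1)] pinf_act[OF cpl_Pr[OF p] up] yD] .
  have yss: "ss ?y u" using ss_join[OF u'(2) ss_refl yD p uD] .
  have pu': "p \<cdot> u' = u'" using act_fixI u' p uD by blast
  have "cpl p \<cdot> u' = \<zero>" using cpl_zero2[OF p u'D] pu' by simp
  then have cy: "cpl p \<cdot> ?y = cpl p \<cdot> u" using act_add[of "cpl p"] yD p uD act_idem by simp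
  have py: "p \<cdot> ?y = u'" using act_add[of p] yD p uD pu' cpl_zero1 by simp
  have "above_all \<xi> ?y" unfolding above_all_def
  proof (intro conjI allI impI)
    show "pinf ?y" by fact
    fix \<eta> assume \<eta>: "\<eta> < \<xi>"
    then obtain v where v: "au \<eta> v" "slt v u" "ss v u" using above_allD au_above less.prems by blast
    have vD: "v \<in> D" using v au_D by blast
    obtain v' where v': "au \<eta> v'" "slt v' u'" "ss v' u'" using above_allD au_above u' \<eta> by blast
    have "ss (p \<cdot> u) (p \<cdot> v)" using ss_act[OF ss_sym[OF v(3)] p uD vD] .
    then have "ss v' (p \<cdot> v)" using v'(3) u'(2) ss_trans by blast
    then have v'e: "v' = p \<cdot> v" using au_unique v' less.IH[OF \<eta> v(1) p] by blast
    have "p \<cdot> v \<oplus> cpl p \<cdot> v \<sqsubseteq> ?y"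
      using add_mono[of "p \<cdot> v" u' "cpl p \<cdot> v" "cpl p \<cdot> u"] slt_le v v' v'e act_mono p yD by simp
    then have "v \<sqsubseteq> ?y" using cpl_add p vD by simp
    moreover have "q \<cdot> ?y = \<zero>" if q: "q \<in> Pr" "q \<cdot> ?y \<sqsubseteq> q \<cdot> v" for q
    proof -
      have "q \<cdot> u' = p \<cdot> q \<cdot> ?y" using py act_comm[OF p q(1) yD] by simp
      also have "\<dots> \<sqsubseteq> p \<cdot> q \<cdot> v" using act_mono p q by blast
      also have "p \<cdot> q \<cdot> v = q \<cdot> v'" using act_comm p q vD v'e by simp
      finally have 1: "q \<cdot> u' = \<zero>" using sltD v' q by blast
      have "q \<cdot> cpl p \<cdot> u = cpl p \<cdot> q \<cdot> ?y" using cy act_comm[OF cpl_Pr[OF p] q(1) yD] by simp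
      also have "\<dots> \<sqsubseteq> cpl p \<cdot> q \<cdot> v" using act_mono p q by simp
      also have "cpl p \<cdot> q \<cdot> v = q \<cdot> cpl p \<cdot> v" using act_comm p q vD by simp
      finally have "q \<cdot> cpl p \<cdot> u = \<zero>" using sltD slt_act v p q cpl_Pr by metis
      then show ?thesis using 1 act_add q yD by simp
    qed
    ultimately have "slt v ?y" unfolding slt_def by blast
    moreover have "ss v ?y" using v yss ss_trans ss_sym by blast
    ultimately show "\<exists>v. au \<eta> v \<and> slt v ?y \<and> ss v ?y" using v by blast
  qed
  then have "u \<sqsubseteq> ?y" using au_least less.prems yss by blast
  then have "p \<cdot> u \<sqsubseteq> p \<cdot> ?y" using act_mono p by blast
  then have "p \<cdot> u = u'" using py u' antisym by simp
  then show ?case using u' by simp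
qed

lemma au_le:
  assumes "au \<eta> v" "au \<xi> u" "ss v u" "\<eta> \<le> \<xi>" shows "v \<sqsubseteq> u"
proof (cases "\<eta> = \<xi>")
  case True then show ?thesis using au_unique au_D assms le_refl by metis
next
  case False
  then have "\<eta> < \<xi>" using assms by simp
  then obtain v' where "au \<eta> v'" "slt v' u" "ss v' u" using above_allD[OF au_above[OF assms(2)]] by blast
  then show ?thesis using au_unique assms slt_le ss_trans ss_sym by metis
qed

text \<open>Otherwise the unit of index \<eta> strictly below u would be v cut to the support of u,
  by uniqueness, although u lies below v.\<close>

lemma au_strict:
  assumes v: "au \<eta> v" and u: "au \<xi> u" and le: "u \<sqsubseteq> v" and nz: "u \<noteq> \<zero>" shows "\<xi> \<le> \<eta>"
proof (rule ccontr)
  assume "\<not> \<xi> \<le> \<eta>"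
  then have "\<eta> < \<xi>" by simp
  then obtain w where w: "au \<eta> w" "slt w u" "ss w u" using above_allD[OF au_above[OF u]] by blast
  have D: "u \<in> D" "v \<in> D" using u v au_D by auto
  have "au \<eta> (sp u \<cdot> v)" using au_act[OF v sp_Pr[OF D(1)]] .
  moreover have "ss w (sp u \<cdot> v)" using ss_trans[OF w(3) ss_below[OF le]] .
  ultimately have "w = sp u \<cdot> v" using au_unique w by blast
  then have "sp u \<cdot> u \<sqsubseteq> sp u \<cdot> w" using act_mono[OF _ le, of "sp u"] act_idem D by simp
  then show False using sltD w nz D sp_Pr sp_act by metis
qed

text \<open>The supremum s of all such units has to satisfy \<open>above_all\<close>. For a smaller
  index the witness is the largest unit below x, known by induction, cut to the support of s; on the
  support of each member t it coincides with the witness belonging to t.\<close>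

lemma au_max:
  assumes x: "x \<in> D"
  shows "\<exists>u. au \<xi> u \<and> u \<sqsubseteq> x \<and> (\<forall>t. au \<xi> t \<and> t \<sqsubseteq> x \<longrightarrow> t \<sqsubseteq> u)"
proof (induction \<xi> rule: less_induct)
  case (less \<xi>)
  let ?X = "{t. au \<xi> t \<and> t \<sqsubseteq> x}"
  obtain s where s: "is_sup ?X s" "s \<sqsubseteq> x" using sup_ex[of ?X x] x by blast
  have spi: "pinf s" by (rule sup_pinf[OF s(1)]) (auto simp: au_pinf)
  then have sD: "s \<in> D" using pinf_D by blast
  have Xs: "t \<sqsubseteq> s" if "t \<in> ?X" for t using that s(1) unfolding is_sup_def by blast
  have "above_all \<xi> s" unfolding above_all_def
  proof (intro conjI allI impI)
    show "pinf s" by fact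
    fix \<eta> assume \<eta>: "\<eta> < \<xi>"
    then obtain v where v: "au \<eta> v" "v \<sqsubseteq> x" "\<And>t. au \<eta> t \<Longrightarrow> t \<sqsubseteq> x \<Longrightarrow> t \<sqsubseteq> v" using less by blast
    have vD: "v \<in> D" using v au_D by blast
    let ?v = "sp s \<cdot> v"
    have v'D: "?v \<in> D" using act_D sD vD by simp
    have sub: "slt (sp t \<cdot> v) t \<and> ss (sp t \<cdot> v) t \<and> sp t \<cdot> v \<sqsubseteq> ?v" if t: "t \<in> ?X" for t
    proof -
      have tD: "t \<in> D" using t au_D by blast
      obtain w where w: "au \<eta> w" "slt w t" "ss w t" using above_allD[OF au_above, of \<xi> t \<eta>] t \<eta> by blast
      have wD: "w \<in> D" using w au_D by blast
      have wv: "w \<sqsubseteq> v" using v(3) w slt_le t le_trans by blast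
      have "ss w (sp w \<cdot> v)" using ss_below wv by blast
      then have "ss w (sp t \<cdot> v)" using ss_sp_act[OF w(3) wD tD vD] by simp
      then have e: "w = sp t \<cdot> v" using au_unique w au_act v tD by (metis sp_Pr)
      have "w \<sqsubseteq> s" using w slt_le Xs t le_trans by blast
      then have "sp s \<cdot> w = w" using sp_le_act sD by blast
      then have "w \<sqsubseteq> ?v" using act_mono[OF sp_Pr[OF sD] wv] by simp
      then show ?thesis using e w by simp
    qed
    have ssv: "ss ?v s" unfolding ss_def
    proof (intro ballI iffI)
      fix q assume q: "q \<in> Pr"
      show "q \<cdot> s = \<zero>" if "q \<cdot> ?v = \<zero>"
        using sup_zero[OF s(1) q] sub act_zero_mono[OF q _ that] ssD q by blast
      show "q \<cdot> ?v = \<zero>" if "q \<cdot> s = \<zero>" using sp_kill sD q that vD by blast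
    qed
    have comm: "sp t \<cdot> q \<cdot> ?v = q \<cdot> sp t \<cdot> v" if "q \<in> Pr" "t \<in> ?X" for q t
    proof -
      have tD: "t \<in> D" using that au_D by blast
      have "sp t \<cdot> q \<cdot> ?v = q \<cdot> sp t \<cdot> sp s \<cdot> v" using act_comm[of "sp t" q ?v] that tD v'D by simp
      also have "sp t \<cdot> sp s \<cdot> v = sp t \<cdot> v" using pleq_act2[OF sp_mono[OF Xs[OF that(2)]] vD] .
      finally show ?thesis .
    qed
    have "?v \<sqsubseteq> s"
    proof (rule dense_le)
      fix q assume q: "q \<in> Pr" "q \<cdot> ?v \<noteq> \<zero>"
      then have "q \<cdot> s \<noteq> \<zero>" using ssv ssD by blast
      then obtain t where t: "t \<in> ?X" "q \<cdot> t \<noteq> \<zero>" using sup_zero s q by blast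
      have tD: "t \<in> D" using t au_D by blast
      have "q \<cdot> sp t \<cdot> v \<noteq> \<zero>" using sub t ssD q by blast
      moreover have "sp t \<cdot> q \<cdot> sp t \<cdot> v \<sqsubseteq> sp t \<cdot> q \<cdot> s"
        using act_mono sub[OF t(1)] slt_le Xs[OF t(1)] le_trans q tD by (meson sp_Pr)
      moreover have "sp t \<cdot> q \<cdot> sp t \<cdot> v = q \<cdot> sp t \<cdot> v"
        using act_comm[of "sp t" q "sp t \<cdot> v"] act_idem tD vD q act_D by simp
      ultimately have "sp t \<cdot> q \<cdot> ?v \<noteq> \<zero> \<and> sp t \<cdot> q \<cdot> ?v \<sqsubseteq> sp t \<cdot> q \<cdot> s"
        using comm[OF q(1) t(1)] by simp
      then show "\<exists>q'\<in>Pr. q' \<cdot> q \<cdot> ?v \<noteq> \<zero> \<and> q' \<cdot> q \<cdot> ?v \<sqsubseteq> q' \<cdot> q \<cdot> s" using tD sp_Pr by blast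
    qed (use v'D sD in auto)
    moreover have "q \<cdot> s = \<zero>" if q: "q \<in> Pr" "q \<cdot> s \<sqsubseteq> q \<cdot> ?v" for q
    proof (rule sup_zero[OF s(1) q(1)])
      fix t assume t: "t \<in> ?X"
      have tD: "t \<in> D" using t au_D by blast
      have "q \<cdot> t = sp t \<cdot> q \<cdot> t" using act_comm[of q "sp t" t] q tD by simp
      also have "\<dots> \<sqsubseteq> sp t \<cdot> q \<cdot> s" using act_mono Xs[OF t] q tD by simp
      also have "\<dots> \<sqsubseteq> sp t \<cdot> q \<cdot> ?v" using act_mono q tD by simp
      also have "\<dots> = q \<cdot> sp t \<cdot> v" using comm q t by blast
      finally show "q \<cdot> t = \<zero>" using sub[OF t] sltD q by blast
    qed
    ultimately have "slt ?v s" unfolding slt_def by blast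
    then show "\<exists>v. au \<eta> v \<and> slt v s \<and> ss v s" using ssv au_act v sD sp_Pr by blast
  qed
  then obtain u where u: "au \<xi> u" "ss u s" "u \<sqsubseteq> s" using au_ex by blast
  have uD: "u \<in> D" using u au_D by blast
  have "t \<sqsubseteq> u" if t: "t \<in> ?X" for t
  proof -
    have tD: "t \<in> D" using t au_D by blast
    have "ss t (sp t \<cdot> s)" using ss_below Xs[OF t] by blast
    moreover have "ss (sp t \<cdot> s) (sp t \<cdot> u)" using ss_act[OF ss_sym[OF u(2)]] tD sD uD by simp
    ultimately have "t = sp t \<cdot> u" using au_unique t au_act[OF u(1)] tD ss_trans by (metis (no_types, lifting) mem_Collect_eq sp_Pr)
    then show ?thesis using act_le[of "sp t" u] tD uD by simp
  qed
  then show ?case using u s le_trans by blast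
qed

text \<open>Take the least \<xi> such that some nonzero piece of g has no nonzero unit of index
  \<xi> below it; \<gamma> is such an index. Units of smaller index then fill the support of that
  piece. If all of them were strictly below it, \<open>au_ex\<close> would produce a unit of index
  \<xi>; so one of them agrees with the piece somewhere.\<close>

lemma au_local:
  assumes g: "pinf g" "g \<noteq> \<zero>" and bd: "\<And>u. au (\<gamma>::'o::wellorder) u \<Longrightarrow> u = \<zero>"
  shows "\<exists>\<xi>::'o. \<exists>q\<in>Pr. q \<cdot> g \<noteq> \<zero> \<and> au \<xi> (q \<cdot> g)"
proof -
  have gD: "g \<in> D" using g pinf_D by blast
  define Q where "Q \<xi> \<longleftrightarrow> (\<exists>q\<in>Pr. q \<cdot> g \<noteq> \<zero> \<and> (\<forall>t. au \<xi> t \<and> t \<sqsubseteq> q \<cdot> g \<longrightarrow> t = \<zero>))" for \<xi> :: 'o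
  have "Q \<gamma>" unfolding Q_def using bd g gD sp_Pr sp_act by metis
  then obtain \<xi> where \<xi>: "Q \<xi>" "\<And>\<eta>. \<eta> < \<xi> \<Longrightarrow> \<not> Q \<eta>" using LeastI[of Q \<gamma>] not_less_Least by metis
  obtain q where q: "q \<in> Pr" "q \<cdot> g \<noteq> \<zero>" "\<And>t. au \<xi> t \<Longrightarrow> t \<sqsubseteq> q \<cdot> g \<Longrightarrow> t = \<zero>" using \<xi>(1) unfolding Q_def by blast
  have qgD: "q \<cdot> g \<in> D" using q gD act_D by blast
  have sub: "\<exists>v. au \<eta> v \<and> v \<sqsubseteq> q \<cdot> g \<and> ss v (q \<cdot> g)" if \<eta>: "\<eta> < \<xi>" for \<eta>
  proof -
    obtain v where v: "au \<eta> v" "v \<sqsubseteq> q \<cdot> g" "\<And>t. au \<eta> t \<Longrightarrow> t \<sqsubseteq> q \<cdot> g \<Longrightarrow> t \<sqsubseteq> v" using au_max qgD by blast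
    have "r \<cdot> q \<cdot> g = \<zero>" if r: "r \<in> Pr" "r \<cdot> v = \<zero>" for r
    proof (rule ccontr)
      assume nz: "r \<cdot> q \<cdot> g \<noteq> \<zero>"
      have e: "mt r q \<cdot> g = r \<cdot> q \<cdot> g" using mt_act r q gD by simp
      obtain t where t: "au \<eta> t" "t \<sqsubseteq> r \<cdot> q \<cdot> g" "t \<noteq> \<zero>"
        using \<xi>(2)[OF \<eta>] nz e r q unfolding Q_def by (metis mt_Pr)
      have "t \<sqsubseteq> v" using v(3) t act_le[OF r(1) qgD] le_trans by blast
      then have "r \<cdot> t = \<zero>" using act_zero_mono r by blast
      moreover have "r \<cdot> t = t" using act_fixI r t qgD by blast
      ultimately show False using t by simp
    qed
    then have "ss v (q \<cdot> g)" unfolding ss_def using act_zero_mono v by blast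
    then show ?thesis using v by blast
  qed
  show ?thesis
  proof (cases "\<forall>\<eta><\<xi>. \<forall>v. au \<eta> v \<and> v \<sqsubseteq> q \<cdot> g \<and> ss v (q \<cdot> g) \<longrightarrow> slt v (q \<cdot> g)")
    case True
    then have "above_all \<xi> (q \<cdot> g)" unfolding above_all_def using sub pinf_act g q by metis
    then obtain u where u: "au \<xi> u" "ss u (q \<cdot> g)" "u \<sqsubseteq> q \<cdot> g" using au_ex by blast
    then have "u = \<zero>" using q by blast
    then show ?thesis using u ss_zero zero_D qgD q by metis
  next
    case False
    then obtain \<eta> :: 'o and v where v: "au \<eta> v" "v \<sqsubseteq> q \<cdot> g" "\<not> slt v (q \<cdot> g)" by blast
    then obtain r where r: "r \<in> Pr" "r \<cdot> q \<cdot> g \<sqsubseteq> r \<cdot> v" "r \<cdot> q \<cdot> g \<noteq> \<zero>" unfolding slt_def by blast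
    have "r \<cdot> q \<cdot> g = r \<cdot> v" using antisym r act_mono v by blast
    then have "au \<eta> (mt r q \<cdot> g)" "mt r q \<cdot> g \<noteq> \<zero>" using au_act v r mt_act q gD by auto
    then show ?thesis using r q mt_Pr by blast
  qed
qed

text \<open>At the least index there is nothing to be strictly above, so \<open>above_all\<close> is
  just pure infiniteness.\<close>

lemma aleph_ex:
  assumes g: "pinf g" "g \<noteq> \<zero>"
  shows "\<exists>u. au (LEAST \<xi>::'o::wellorder. True) u \<and> u \<noteq> \<zero> \<and> u \<sqsubseteq> g"
proof -
  have "\<not> \<eta> < (LEAST \<xi>::'o. True)" for \<eta> using not_less_Least by blast
  then have "above_all (LEAST \<xi>::'o. True) g" unfolding above_all_def using g by blast
  then obtain u where "au (LEAST \<xi>::'o. True) u" "ss u g" "u \<sqsubseteq> g" using au_ex by blast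
  then show ?thesis using g ss_zero au_D pinf_D by metis
qed

end

section \<open>Largest and arbitrarily small finite units\<close>

context dim_unit
begin

lemma fu_overlap:
  assumes "fu r t" "fu r t'" shows "sp t \<cdot> t' \<sqsubseteq> t"
proof -
  have D: "t \<in> D" "t' \<in> D" using assms fu_D by auto
  have "sp t \<cdot> t' \<sqsubseteq> sp t' \<cdot> t"
    using fu_le[of r "sp t \<cdot> t'" r "sp t' \<cdot> t"] fu_act assms D ss_meet by simp
  then show ?thesis using act_le[of "sp t'" t] D le_trans by simp
qed

text \<open>Restricted to the support of a member t, the supremum is t itself, because by
  \<open>fu_overlap\<close> the other members do not exceed t there. So the supremum is densely a
  basic unit.\<close>

lemma fu_max:
  assumes x: "x \<in> D"
  shows "\<exists>u. fu r u \<and> u \<sqsubseteq> x \<and> (\<forall>t. fu r t \<and> t \<sqsubseteq> x \<longrightarrow> t \<sqsubseteq> u)"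
proof -
  let ?X = "{t. fu r t \<and> t \<sqsubseteq> x}"
  obtain s where s: "is_sup ?X s" "s \<sqsubseteq> x" using sup_ex[of ?X x] x by blast
  have sD: "s \<in> D" using s is_sup_def by blast
  have Xs: "t \<sqsubseteq> s" if "t \<in> ?X" for t using that s(1) unfolding is_sup_def by blast
  have sps: "sp t \<cdot> s = t" if t: "t \<in> ?X" for t
  proof (rule antisym)
    have tD: "t \<in> D" using t fu_D by blast
    have "is_sup ((\<cdot>) (sp t) ` ?X) (sp t \<cdot> s)" using sup_act s tD sp_Pr by blast
    moreover have "\<forall>y\<in>(\<cdot>) (sp t) ` ?X. y \<sqsubseteq> t" using fu_overlap t by blast
    ultimately show "sp t \<cdot> s \<sqsubseteq> t" unfolding is_sup_def using tD by blast
    show "t \<sqsubseteq> sp t \<cdot> s" using act_mono[OF sp_Pr[OF tD] Xs[OF t]] tD by simp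
  qed
  have "fu r s" unfolding fu_def
  proof (intro conjI ballI impI)
    fix q assume q: "q \<in> Pr" "q \<cdot> s \<noteq> \<zero>"
    then obtain t where t: "t \<in> ?X" "q \<cdot> t \<noteq> \<zero>" using sup_zero s by blast
    have tD: "t \<in> D" using t fu_D by blast
    obtain p where p: "p \<in> Pr" "p \<cdot> q \<cdot> t \<noteq> \<zero>" "bu r (p \<cdot> q \<cdot> t)" using t q unfolding fu_def by blast
    have "mt p (sp t) \<cdot> q \<cdot> s = p \<cdot> q \<cdot> t"
      using mt_act[of p "sp t" "q \<cdot> s"] p q tD sD act_D act_comm[of "sp t" q s] sps[OF t(1)] by simp
    then show "\<exists>q'\<in>Pr. q' \<cdot> q \<cdot> s \<noteq> \<zero> \<and> bu r (q' \<cdot> q \<cdot> s)" using p tD by (metis mt_Pr sp_Pr)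
  qed fact
  then show ?thesis using s Xs by blast
qed

text \<open>Some nonzero s lies below t and an element e of E. If e is multiple-free, s is a piece
  of e. Otherwise, if no root of e had a nonzero piece below s, comparability would put s below
  every root, and all multiples of s below e, against \<open>archimedean\<close>.\<close>

lemma small_unit:
  assumes t: "fin t" "t \<noteq> \<zero>"
  shows "\<exists>e\<in>E. \<exists>q\<in>Pr. \<exists>k f. mult (2 ^ k) f = q \<cdot> e \<and> f \<noteq> \<zero> \<and> f \<sqsubseteq> t \<and> (mf e \<longrightarrow> k = 0)"
proof -
  have tD: "t \<in> D" using t fin_D by blast
  obtain e where e: "e \<in> E" "\<not> orth t e" using E_dense t by blast
  then obtain s where s: "s \<sqsubseteq> t" "s \<sqsubseteq> e" "s \<noteq> \<zero>" unfolding orth_def by blast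
  have eD: "e \<in> D" and sD: "s \<in> D" using e E_D s le_D1 by auto
  show ?thesis
  proof (cases "mf e")
    case True
    then obtain q where "q \<in> Pr" "s = q \<cdot> e" using mf_le_act s by blast
    then have "mult (2 ^ 0) s = q \<cdot> e" "q \<in> Pr" by auto
    then show ?thesis using e s by blast
  next
    case False
    then have "\<exists>g. \<forall>k. mult (2 ^ k) (g k) = e" using roots e by metis
    then obtain g where g: "\<And>k. mult (2 ^ k) (g k) = e" by blast
    have gD: "g k \<in> D" for k using mult_D[of "2 ^ k" "g k"] g eD by simp
    have "\<exists>k. \<exists>q\<in>Pr. q \<cdot> g k \<noteq> \<zero> \<and> q \<cdot> g k \<sqsubseteq> s"
    proof (rule ccontr)
      assume no: "\<not> ?thesis"
      have sg: "s \<sqsubseteq> g k" for k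
      proof -
        obtain p where p: "p \<in> Pr" "p \<cdot> g k \<sqsubseteq> p \<cdot> s" "cpl p \<cdot> s \<sqsubseteq> cpl p \<cdot> g k" using compare gD sD by blast
        have "p \<cdot> g k \<sqsubseteq> s" using p act_le sD le_trans by blast
        then have "p \<cdot> g k = \<zero>" using no p by blast
        then have "p \<cdot> e = \<zero>" using act_mult[of p "2 ^ k" "g k"] g p eD by simp
        then have "p \<cdot> s = \<zero>" using act_zero_mono p s by blast
        then have "s = cpl p \<cdot> s" using cpl_add[of p s] p sD by simp
        then show ?thesis using p act_le[of "cpl p" "g k"] gD le_trans by simp
      qed
      have "mult n s \<sqsubseteq> e" for n
      proof -
        have 1: "mult (2 ^ n) s \<sqsubseteq> e" using mult_mono_arg[OF sg, of "2 ^ n" n] g eD by simp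
        have "n \<le> 2 ^ n" by simp
        then have "mult n s \<sqsubseteq> mult (2 ^ n) s" using mult_mono le_D1[OF 1] by blast
        then show ?thesis using 1 le_trans by blast
      qed
      then have "s = \<zero>" using archimedean E_fin e by blast
      then show False using s by simp
    qed
    then obtain k q where q: "q \<in> Pr" "q \<cdot> g k \<noteq> \<zero>" "q \<cdot> g k \<sqsubseteq> s" by blast
    have "mult (2 ^ k) (q \<cdot> g k) = q \<cdot> e" using act_mult[of q "2 ^ k" "g k"] q g eD by simp
    then show ?thesis using e q False s le_trans by blast
  qed
qed

end

section \<open>Units\<close>

lemma less_scale_val_simps [simp]:
  "Fin r < Fin s \<longleftrightarrow> r < s" "Fin r < Aleph b" "\<not> Aleph a < Fin s" "Aleph a < Aleph b \<longleftrightarrow> a < b"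
  for a b :: "'o::linorder"
  by (auto simp: less_scale_val_def)

text \<open>If a real number bounds X, the supremum is real, and membership of 0 keeps it from being
  taken over the empty set. Otherwise no real bound competes with the least aleph bound.\<close>

lemma lub_ex:
  fixes \<gamma> :: "'o::wellorder"
  assumes b: "\<And>v. v \<in> X \<Longrightarrow> v \<le> Aleph \<gamma>" and z: "0 \<in> X"
  shows "\<exists>l. (\<forall>v\<in>X. v \<le> l) \<and> (\<forall>m. (\<forall>v\<in>X. v \<le> m) \<longrightarrow> l \<le> m)"
proof (cases "\<exists>s. \<forall>v\<in>X. v \<le> Fin s")
  case True
  then obtain s where s: "\<And>v. v \<in> X \<Longrightarrow> v \<le> Fin s" by blast
  define R where "R = {r. Fin r \<in> X}"
  have R: "v \<in> X \<Longrightarrow> \<exists>r\<in>R. v = Fin r" for v using s[of v] by (cases v) (auto simp: R_def)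
  have ne: "R \<noteq> {}" "bdd_above R" using z s unfolding R_def bdd_above_def zero_scale_val_def by fastforce+
  show ?thesis
  proof (intro exI conjI allI impI ballI)
    fix v assume "v \<in> X"
    then obtain r where "r \<in> R" "v = Fin r" using R by blast
    then show "v \<le> Fin (Sup R)" using cSup_upper ne by auto
  next
    fix m assume m: "\<forall>v\<in>X. v \<le> m"
    show "Fin (Sup R) \<le> m"
    proof (cases m)
      case (Fin t)
      then have "\<And>r. r \<in> R \<Longrightarrow> r \<le> t" using m R_def by force
      then show ?thesis using Fin cSup_least[OF ne(1), of t] by simp
    qed simp
  qed
next
  case False
  let ?l = "LEAST \<xi>. \<forall>v\<in>X. v \<le> Aleph \<xi>"
  have l: "\<forall>v\<in>X. v \<le> Aleph ?l" by (rule LeastI[of "\<lambda>\<xi>. \<forall>v\<in>X. v \<le> Aleph \<xi>" \<gamma>]) (use b in blast)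
  show ?thesis
  proof (intro exI conjI allI impI)
    show "\<forall>v\<in>X. v \<le> Aleph ?l" by (rule l)
    fix m assume m: "\<forall>v\<in>X. v \<le> m"
    show "Aleph ?l \<le> m"
    proof (cases m)
      case (Fin t) then show ?thesis using False m by blast
    next
      case (Aleph \<zeta>)
      then show ?thesis using Least_le[of "\<lambda>\<xi>. \<forall>v\<in>X. v \<le> Aleph \<xi>" \<zeta>] m by simp
    qed
  qed
qed

lemma dyadic_between:
  fixes a b :: real assumes "0 \<le> a" "a < b"
  shows "\<exists>n k. 0 < n \<and> a < real n / 2 ^ k \<and> real n / 2 ^ k < b"
proof -
  obtain k where k: "(1/2) ^ k < b - a" using real_arch_pow_inv[of "b - a" "1/2"] assms by auto
  \<comment> \<open>The first multiple of \<open>1 / 2 ^ k\<close> beyond a; the added 1 also makes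
    n positive.\<close>
  define n where "n = nat \<lfloor>a * 2 ^ k\<rfloor> + 1"
  have p: "(0::real) < 2 ^ k" by simp
  have "real n = of_int \<lfloor>a * 2 ^ k\<rfloor> + 1" unfolding n_def using assms by simp
  then have 1: "a * 2 ^ k < real n" "real n \<le> a * 2 ^ k + 1" by linarith+
  have "1 < (b - a) * 2 ^ k" using k by (simp add: power_divide field_simps)
  then have "real n < b * 2 ^ k" using 1 by (simp add: algebra_simps)
  then have "real n / 2 ^ k < b" using p by (simp add: pos_divide_less_eq)
  moreover have "a < real n / 2 ^ k" using 1 p by (simp add: pos_less_divide_eq)
  ultimately show ?thesis unfolding n_def by (metis add_gr_0 zero_less_one)
qed

context dim_scale
begin

text \<open>\<open>jm\<close> projects onto the types II and III, \<open>jf\<close> onto type III.\<close>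

definition jm :: 'p where
  "jm = (SOME r. r \<in> Pr \<and> (\<forall>x\<in>D. r \<cdot> x = x \<longleftrightarrow> (\<forall>t\<in>{t. mf t}. orth x t)))"

definition jf :: 'p where
  "jf = (SOME r. r \<in> Pr \<and> (\<forall>x\<in>D. r \<cdot> x = x \<longleftrightarrow> (\<forall>t\<in>{t. fin t}. orth x t)))"

lemma jm: "jm \<in> Pr" "x \<in> D \<Longrightarrow> jm \<cdot> x = x \<longleftrightarrow> (\<forall>t. mf t \<longrightarrow> orth x t)"
proof -
  have "jm \<in> Pr \<and> (\<forall>x\<in>D. jm \<cdot> x = x \<longleftrightarrow> (\<forall>t\<in>{t. mf t}. orth x t))"
    unfolding jm_def by (rule someI_ex) (use perp_proj[of "{t. mf t}"] mf_D in blast)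
  then show "jm \<in> Pr" "x \<in> D \<Longrightarrow> jm \<cdot> x = x \<longleftrightarrow> (\<forall>t. mf t \<longrightarrow> orth x t)" by auto
qed

lemma jf: "jf \<in> Pr" "x \<in> D \<Longrightarrow> jf \<cdot> x = x \<longleftrightarrow> (\<forall>t. fin t \<longrightarrow> orth x t)"
proof -
  have "jf \<in> Pr \<and> (\<forall>x\<in>D. jf \<cdot> x = x \<longleftrightarrow> (\<forall>t\<in>{t. fin t}. orth x t))"
    unfolding jf_def by (rule someI_ex) (use perp_proj[of "{t. fin t}"] fin_D in blast)
  then show "jf \<in> Pr" "x \<in> D \<Longrightarrow> jf \<cdot> x = x \<longleftrightarrow> (\<forall>t. fin t \<longrightarrow> orth x t)" by auto
qed

lemma jm_mf: "mf t \<Longrightarrow> jm \<cdot> t = \<zero>"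
  using jm(2)[of "jm \<cdot> t"] jm(1) act_idem act_D act_le mf_D orthD le_refl by metis

lemma jf_fin: "fin t \<Longrightarrow> jf \<cdot> t = \<zero>"
  using jf(2)[of "jf \<cdot> t"] jf(1) act_idem act_D act_le fin_D orthD le_refl by metis

text \<open>Multiple-free elements are finite, so orthogonality to all finite elements is the
  stronger condition.\<close>

lemma jf_le_jm: "pleq jf jm"
proof (rule pleqI)
  fix x assume x: "x \<in> D"
  have D: "jf \<cdot> x \<in> D" using act_D x jf by blast
  have "jf \<cdot> jf \<cdot> x = jf \<cdot> x" using act_idem x jf by blast
  then have "jm \<cdot> jf \<cdot> x = jf \<cdot> x" using jf(2)[OF D] jm(2)[OF D] mf_fin by blast
  then show "jf \<cdot> x \<sqsubseteq> jm \<cdot> x" using act_mono[OF jm(1) act_le[OF jf(1) x]] by simp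
qed (use jm jf in auto)

lemma fin_dense:
  assumes "x \<in> D" "x \<noteq> \<zero>" "jf \<cdot> x = \<zero>" shows "\<exists>t. fin t \<and> t \<noteq> \<zero> \<and> t \<sqsubseteq> x"
proof -
  obtain t s where "fin t" "s \<sqsubseteq> x" "s \<sqsubseteq> t" "s \<noteq> \<zero>" using jf(2) assms unfolding orth_def by metis
  then show ?thesis using fin_le by blast
qed

text \<open>Where comparability puts b below the finite a, the purely infinite b vanishes, and then
  a does so by the support condition.\<close>

lemma fin_le_pinf:
  assumes a: "fin a" and b: "pinf b" and s: "\<And>q. q \<in> Pr \<Longrightarrow> q \<cdot> b = \<zero> \<Longrightarrow> q \<cdot> a = \<zero>"
  shows "a \<sqsubseteq> b"
proof -
  have D: "a \<in> D" "b \<in> D" using a b fin_D pinf_D by auto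
  obtain p where p: "p \<in> Pr" "p \<cdot> a \<sqsubseteq> p \<cdot> b" "cpl p \<cdot> b \<sqsubseteq> cpl p \<cdot> a" using compare D by blast
  have "cpl p \<cdot> b = \<zero>" using fin_pinf_le[OF fin_act pinf_act p(3)] a b p(1) by simp
  then have "cpl p \<cdot> a = \<zero>" using s p by simp
  then show ?thesis using local_le[OF p(1) D p(2)] act_D[OF cpl_Pr[OF p(1)] D(2)] by simp
qed

end

context dim_unit
begin

lemma jm_E: "e \<in> E \<Longrightarrow> \<not> mf e \<Longrightarrow> jm \<cdot> e = e"
proof -
  assume e: "e \<in> E" "\<not> mf e"
  have "orth e t" if "mf t" for t
    unfolding orth_def using E_type[OF e(1)] e(2) mf_le[OF that] by blast
  then show ?thesis using jm E_D e by blast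
qed

text \<open>For positive k two copies of f would fit below the multiple-free e.\<close>

lemma mf_root:
  assumes e: "mf e" "q \<in> Pr" and f: "mult (2 ^ k) f = q \<cdot> e" "f \<noteq> \<zero>" shows "k = 0"
proof (rule ccontr)
  assume "k \<noteq> 0"
  then have "(2::nat) \<le> 2 ^ k" by (cases k) auto
  moreover have qe: "q \<cdot> e \<in> D" "q \<cdot> e \<sqsubseteq> e" using e act_D act_le mf_D by auto
  ultimately have "mult 2 f \<sqsubseteq> q \<cdot> e" using mult_mono[of 2 "2 ^ k" f] f by simp
  then have "f \<oplus> f \<sqsubseteq> e" using qe le_trans by (simp add: numeral_2_eq_2)
  then show False using e f mf_def by blast
qed

lemma root_type:
  assumes e: "e \<in> E" "q \<in> Pr" and f: "mult (2 ^ k) f = q \<cdot> e" "f \<noteq> \<zero>"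
  shows "jm \<cdot> f = \<zero> \<Longrightarrow> mf e" "jm \<cdot> f = f \<Longrightarrow> \<not> mf e"
proof -
  have eD: "e \<in> D" "q \<cdot> e \<in> D" using e E_D act_D by auto
  have "f \<sqsubseteq> q \<cdot> e" using mult_le[of "2 ^ k" f] f eD by simp
  then have fe: "f \<sqsubseteq> e" using act_le e eD le_trans by blast
  show "mf e" if "jm \<cdot> f = \<zero>"
  proof (rule ccontr)
    assume "\<not> mf e"
    then have "jm \<cdot> f = f" using act_fixI[OF jm(1), of f e] fe eD jm_E e by simp
    then show False using f that by simp
  qed
  show "\<not> mf e" if "jm \<cdot> f = f"
    using act_zero_mono[OF jm(1) fe] jm_mf that f by metis
qed

text \<open>Off \<open>jm\<close> the element of E involved is multiple-free, has no proper roots by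
  \<open>mf_root\<close>, and so only integer values occur.\<close>

lemma mf_piece:
  assumes u: "fu r u" and j: "jm \<cdot> u = \<zero>" and q: "q \<in> Pr" "q \<cdot> u \<noteq> \<zero>"
  shows "\<exists>p\<in>Pr. p \<cdot> q \<cdot> u \<noteq> \<zero> \<and> (\<exists>e\<in>E. mf e \<and> (\<exists>q'\<in>Pr. \<exists>n. 0 < n \<and> r = real n \<and> p \<cdot> q \<cdot> u = mult n (q' \<cdot> e)))"
proof -
  have uD: "u \<in> D" using u fu_D by blast
  obtain p where p: "p \<in> Pr" "p \<cdot> q \<cdot> u \<noteq> \<zero>" "bu r (p \<cdot> q \<cdot> u)" using u q unfolding fu_def by blast
  let ?w = "p \<cdot> q \<cdot> u"
  have "?w \<sqsubseteq> u" using act_le[OF p(1) act_D[OF q(1) uD]] act_le[OF q(1) uD] le_trans by blast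
  then have jw: "jm \<cdot> ?w = \<zero>" using act_zero_mono jm(1) j by blast
  obtain e q' k n f where *: "e \<in> E" "q' \<in> Pr" "mult (2 ^ k) f = q' \<cdot> e" "?w = mult n f" "?w \<in> D" "0 < n"
    "r = real n / 2 ^ k" using p(3) unfolding bu_def by blast
  have fz: "f \<noteq> \<zero>" using *(4) p(2) mult_zero[of n] by metis
  have "jm \<cdot> f = \<zero>" using act_zero_mono[OF jm(1) _ jw] mult_le[of n f] * by simp
  then have "mf e" using root_type(1) * fz by blast
  moreover have "k = 0" using mf_root *(2,3) fz calculation by blast
  then have "r = real n" "?w = mult n (q' \<cdot> e)" using * by auto
  ultimately show ?thesis using p(1,2) *(1,2,6) by blast
qed

definition U :: "'o::wellorder scale_val \<Rightarrow> 'b \<Rightarrow> bool" where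
  "U v u = (case v of Fin r \<Rightarrow> fu r u | Aleph \<xi> \<Rightarrow> au \<xi> u)"

lemma U_simps [simp]: "U (Fin r) u = fu r u" "U (Aleph \<xi>) u = au \<xi> u"
  by (auto simp: U_def)

lemma U_D: "U v u \<Longrightarrow> u \<in> D"
  by (cases v) (auto dest: fu_D au_D)

lemma U_act: "U v u \<Longrightarrow> p \<in> Pr \<Longrightarrow> U v (p \<cdot> u)"
  by (cases v) (auto intro: fu_act au_act)

lemma U_le:
  assumes "U v a" "U w b" "ss a b" "v \<le> w" shows "a \<sqsubseteq> b"
proof (cases v)
  case (Fin r)
  show ?thesis
  proof (cases w)
    case (Aleph \<xi>)
    then show ?thesis using Fin assms fin_le_pinf[of a b] fu_fin au_pinf ssD by auto
  qed (use Fin assms fu_le in auto)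
next
  case (Aleph \<eta>)
  then obtain \<xi> where "w = Aleph \<xi>" using assms by (cases w) auto
  then show ?thesis using Aleph assms au_le by auto
qed

lemma U_strict:
  assumes "U v a" "U w b" "a \<sqsubseteq> b" "a \<noteq> \<zero>" shows "v \<le> w"
proof (cases v)
  case (Fin r)
  then show ?thesis using assms fu_strict by (cases w) auto
next
  case (Aleph \<eta>)
  show ?thesis
  proof (cases w)
    case (Fin r) then show ?thesis using Aleph assms fin_pinf_le[OF fu_fin au_pinf] by auto
  next
    case w: (Aleph \<xi>) then show ?thesis using Aleph assms au_strict by auto
  qed
qed

lemma U_max:
  assumes "x \<in> D"
  shows "\<exists>u. U v u \<and> u \<sqsubseteq> x \<and> (\<forall>t. U v t \<and> t \<sqsubseteq> x \<longrightarrow> t \<sqsubseteq> u)"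
  using fu_max[OF assms] au_max[OF assms] by (cases v) auto

lemma U_dense:
  assumes z: "z \<in> D" "z \<noteq> \<zero>" shows "\<exists>v::'o::wellorder scale_val. \<exists>u. U v u \<and> u \<noteq> \<zero> \<and> u \<sqsubseteq> z"
proof -
  obtain f g where fg: "fin f" "pinf g" "z = f \<oplus> g" using decompose z by blast
  have le: "f \<sqsubseteq> z" "g \<sqsubseteq> z" using fg z le_add1 le_add2 by auto
  show ?thesis
  proof (cases "g = \<zero>")
    case True
    then have "f \<noteq> \<zero>" using fg z by auto
    then obtain e q k t where "e \<in> E" "q \<in> Pr" "mult (2 ^ k) t = q \<cdot> e" "t \<noteq> \<zero>" "t \<sqsubseteq> f"
      using small_unit fg by blast
    moreover from this have "bu (real 1 / 2 ^ k) (mult 1 t)" unfolding bu_def using le_D1 by (metis One_nat_def mult_1 zero_less_one)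
    ultimately have "U (Fin (1 / 2 ^ k) :: 'o scale_val) t" "t \<noteq> \<zero>" "t \<sqsubseteq> z" using bu_fu le le_trans by auto
    then show ?thesis by blast
  next
    case False
    then obtain u where "au (LEAST \<xi>::'o. True) u" "u \<noteq> \<zero>" "u \<sqsubseteq> g" using aleph_ex fg by blast
    then have "U (Aleph (LEAST \<xi>::'o. True)) u" "u \<noteq> \<zero>" "u \<sqsubseteq> z" using le le_trans by auto
    then show ?thesis by blast
  qed
qed

end

section \<open>Units at the points of the ultrafilter space\<close>

locale dim_space = dim_unit add zero D Pr act E
  for add :: "'b \<Rightarrow> 'b \<Rightarrow> 'b" (infixl "\<oplus>" 65) and zero :: 'b ("\<zero>") and D :: "'b set"
    and Pr :: "'p set" and act :: "'p \<Rightarrow> 'b \<Rightarrow> 'b" (infixr "\<cdot>" 75) and E +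
  fixes \<Omega> :: "'p set set"
  assumes Om_Pr: "\<And>\<aa> p. \<aa> \<in> \<Omega> \<Longrightarrow> p \<in> \<aa> \<Longrightarrow> p \<in> Pr"
    and Om_mt: "\<And>\<aa> p q. \<aa> \<in> \<Omega> \<Longrightarrow> p \<in> \<aa> \<Longrightarrow> q \<in> \<aa> \<Longrightarrow> mt p q \<in> \<aa>"
    and Om_up: "\<And>\<aa> p q. \<aa> \<in> \<Omega> \<Longrightarrow> p \<in> \<aa> \<Longrightarrow> pleq p q \<Longrightarrow> q \<in> \<aa>"
    and Om_prime: "\<And>\<aa> p. \<aa> \<in> \<Omega> \<Longrightarrow> p \<in> Pr \<Longrightarrow> p \<notin> \<aa> \<Longrightarrow> cpl p \<in> \<aa>"
    and Om_nonzero: "\<And>\<aa> p. \<aa> \<in> \<Omega> \<Longrightarrow> p \<in> \<aa> \<Longrightarrow> \<exists>x\<in>D. p \<cdot> x \<noteq> \<zero>"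
    and Om_ex: "\<And>p x. p \<in> Pr \<Longrightarrow> x \<in> D \<Longrightarrow> p \<cdot> x \<noteq> \<zero> \<Longrightarrow> \<exists>\<aa>\<in>\<Omega>. p \<in> \<aa>"
begin

lemma Om_mt_iff: "\<aa> \<in> \<Omega> \<Longrightarrow> p \<in> Pr \<Longrightarrow> q \<in> Pr \<Longrightarrow> mt p q \<in> \<aa> \<longleftrightarrow> p \<in> \<aa> \<and> q \<in> \<aa>"
  using Om_mt Om_up mt_le1 mt_le2 by blast

lemma Om_cpl: "\<aa> \<in> \<Omega> \<Longrightarrow> p \<in> Pr \<Longrightarrow> cpl p \<in> \<aa> \<longleftrightarrow> p \<notin> \<aa>"
  using Om_prime Om_mt Om_nonzero mt_act cpl_zero1 cpl_Pr by metis

text \<open>A member killing x meets the support of x in zero. Conversely, the complement of the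
  support kills x and so is not a member.\<close>

lemma sp_in_iff:
  assumes a: "\<aa> \<in> \<Omega>" and x: "x \<in> D" shows "sp x \<in> \<aa> \<longleftrightarrow> (\<forall>p\<in>\<aa>. p \<cdot> x \<noteq> \<zero>)"
proof (intro iffI ballI notI)
  fix p assume *: "sp x \<in> \<aa>" "p \<in> \<aa>" "p \<cdot> x = \<zero>"
  then have "mt p (sp x) \<in> \<aa>" using Om_mt a by blast
  then obtain y where y: "y \<in> D" "mt p (sp x) \<cdot> y \<noteq> \<zero>" using Om_nonzero a by blast
  have "p \<cdot> sp x \<cdot> y = \<zero>" using sp_kill[OF x Om_Pr[OF a *(2)] *(3) y(1)] .
  then show False using y mt_act[OF Om_Pr[OF a *(2)] sp_Pr[OF x] y(1)] by simp
next
  assume *: "\<forall>p\<in>\<aa>. p \<cdot> x \<noteq> \<zero>"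
  have "cpl (sp x) \<cdot> x = \<zero>" using cpl_zero2[of "sp x" x] x by simp
  then show "sp x \<in> \<aa>" using Om_prime a x sp_Pr * by blast
qed

lemma sp_inD: "\<aa> \<in> \<Omega> \<Longrightarrow> x \<in> D \<Longrightarrow> sp x \<in> \<aa> \<Longrightarrow> p \<in> \<aa> \<Longrightarrow> p \<cdot> x \<noteq> \<zero>"
  using sp_in_iff by blast

lemma sp_act_in: "\<aa> \<in> \<Omega> \<Longrightarrow> x \<in> D \<Longrightarrow> p \<in> Pr \<Longrightarrow> sp (p \<cdot> x) \<in> \<aa> \<longleftrightarrow> p \<in> \<aa> \<and> sp x \<in> \<aa>"
proof (intro iffI)
  assume a: "\<aa> \<in> \<Omega>" "x \<in> D" "p \<in> Pr"
  then have D: "p \<cdot> x \<in> D" using act_D by blast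
  have 1: "pleq (sp (p \<cdot> x)) p" using sp_pleq D a act_idem by simp
  have 2: "pleq (sp (p \<cdot> x)) (sp x)" using sp_mono act_le a by simp
  show "p \<in> \<aa> \<and> sp x \<in> \<aa>" if "sp (p \<cdot> x) \<in> \<aa>" using that 1 2 a Om_up by blast
  show "sp (p \<cdot> x) \<in> \<aa>" if *: "p \<in> \<aa> \<and> sp x \<in> \<aa>"
    unfolding sp_in_iff[OF a(1) D]
  proof
    fix q assume q: "q \<in> \<aa>"
    then have "mt q p \<cdot> x \<noteq> \<zero>" using sp_inD a * Om_mt by blast
    then show "q \<cdot> p \<cdot> x \<noteq> \<zero>" using mt_act a q Om_Pr by simp
  qed
qed

lemma sp_in_mono: "\<aa> \<in> \<Omega> \<Longrightarrow> x \<sqsubseteq> y \<Longrightarrow> sp x \<in> \<aa> \<Longrightarrow> sp y \<in> \<aa>"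
  using sp_mono Om_up by blast

lemma ss_in: "\<aa> \<in> \<Omega> \<Longrightarrow> ss x y \<Longrightarrow> x \<in> D \<Longrightarrow> y \<in> D \<Longrightarrow> sp x \<in> \<aa> \<longleftrightarrow> sp y \<in> \<aa>"
  using ss_pleq Om_up ss_sym by blast

lemma sp_ex: "x \<in> D \<Longrightarrow> x \<noteq> \<zero> \<Longrightarrow> \<exists>\<aa>\<in>\<Omega>. sp x \<in> \<aa>"
  using Om_ex[of "sp x" x] by simp

lemma sp_zero_notin: "\<aa> \<in> \<Omega> \<Longrightarrow> sp \<zero> \<notin> \<aa>"
  using sp_inD[of \<aa> \<zero> "sp \<zero>"] act_zero by auto

lemma compare_at:
  assumes a: "\<aa> \<in> \<Omega>" and D: "x \<in> D" "y \<in> D"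
  shows "(\<exists>p\<in>\<aa>. p \<cdot> x \<sqsubseteq> p \<cdot> y) \<or> (\<exists>p\<in>\<aa>. p \<cdot> y \<sqsubseteq> p \<cdot> x)"
  using compare[OF D] Om_prime[OF a] by blast

lemma jf_jm_in: "\<aa> \<in> \<Omega> \<Longrightarrow> jf \<in> \<aa> \<Longrightarrow> jm \<in> \<aa>"
  using Om_up jf_le_jm by blast

text \<open>
  \<open>Kat \<aa>\<close> is the set of values allowed at \<open>\<aa>\<close>, depending on the type of \<open>\<aa>\<close>, and
  \<open>Vat \<aa>\<close> is the order-dense subset of values of units (dyadic numbers in type II).
\<close>

definition Kfin :: "'p set \<Rightarrow> real set" where
  "Kfin \<aa> = (if jf \<in> \<aa> then {0} else if jm \<in> \<aa> then {0..} else \<nat>)"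

definition Vfin :: "'p set \<Rightarrow> real set" where
  "Vfin \<aa> = (if jf \<in> \<aa> then {} else if jm \<in> \<aa> then {real n / 2 ^ k | n k. 0 < n} else {real n | n. 0 < n})"

definition Kat :: "'p set \<Rightarrow> 'o::wellorder scale_val set" where
  "Kat \<aa> = Fin ` Kfin \<aa> \<union> range Aleph"

definition Vat :: "'p set \<Rightarrow> 'o::wellorder scale_val set" where
  "Vat \<aa> = Fin ` Vfin \<aa> \<union> range Aleph"

lemma Vat_Kat: "Vat \<aa> \<subseteq> Kat \<aa>"
  unfolding Vat_def Kat_def Vfin_def Kfin_def by auto

lemma Vat_pos: "v \<in> Vat \<aa> \<Longrightarrow> 0 < v"
  unfolding Vat_def Vfin_def zero_scale_val_def by (auto split: if_splits)

lemma Kat_nonneg: "v \<in> Kat \<aa> \<Longrightarrow> 0 \<le> v"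
  unfolding Kat_def Kfin_def zero_scale_val_def by (auto split: if_splits elim: Nats_cases)

lemma zero_Kat: "0 \<in> Kat \<aa>"
  unfolding Kat_def Kfin_def zero_scale_val_def by (auto split: if_splits)

lemma Aleph_Vat [simp]: "Aleph \<xi> \<in> Vat \<aa>" unfolding Vat_def by blast
lemma Aleph_Kat [simp]: "Aleph \<xi> \<in> Kat \<aa>" unfolding Kat_def by blast
lemma Fin_Vat: "Fin r \<in> Vat \<aa> \<longleftrightarrow> r \<in> Vfin \<aa>" unfolding Vat_def by blast
lemma Fin_Kat: "Fin r \<in> Kat \<aa> \<longleftrightarrow> r \<in> Kfin \<aa>" unfolding Kat_def by blast

text \<open>In types I and III, and above any aleph, every allowed value larger than k is a unit
  value, so the alternative is immediate. Only a real k in type II needs density, which the dyadic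
  numbers supply.\<close>

lemma Kat_gap:
  fixes k l :: "'o::wellorder scale_val"
  assumes k: "k \<in> Kat \<aa>" and l: "l \<in> Kat \<aa>" and kl: "k < l"
  shows "(\<exists>v\<in>Vat \<aa>. k < v \<and> v < l) \<or>
    (l \<in> Vat \<aa> \<and> (k = 0 \<or> k \<in> Vat \<aa>) \<and> \<not> (\<exists>w\<in>Kat \<aa>. k < w \<and> w < l))"
proof (cases "jf \<notin> \<aa> \<and> jm \<in> \<aa>")
  case False
  have KV: "w \<in> Kat \<aa> \<longleftrightarrow> w = 0 \<or> w \<in> Vat \<aa>" for w :: "'o scale_val"
    using False unfolding Kat_def Kfin_def Vat_def Vfin_def zero_scale_val_def
    by (auto elim!: Nats_cases split: if_splits)
  have "l \<noteq> 0" "\<And>w. k < w \<Longrightarrow> w \<noteq> 0" using Kat_nonneg[OF k] kl by (auto dest: leD)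
  then show ?thesis using k l KV by blast
next
  case True
  have V: "Fin r \<in> (Vat \<aa> :: 'o scale_val set) \<longleftrightarrow> (\<exists>n k. 0 < n \<and> r = real n / 2 ^ k)" for r
    unfolding Fin_Vat Vfin_def using True by auto
  show ?thesis
  proof (cases k)
    case (Fin a)
    then have a: "0 \<le> a" using Kat_nonneg[OF k] by (simp add: zero_scale_val_def)
    have "\<exists>b. a < b \<and> Fin b \<le> l" using kl Fin by (cases l) (auto intro: gt_ex)
    then obtain b where b: "a < b" "Fin b \<le> l" by blast
    obtain n m where nm: "0 < n" "a < real n / 2 ^ m" "real n / 2 ^ m < b" using dyadic_between a b by blast
    then have "Fin (real n / 2 ^ m) \<in> (Vat \<aa> :: 'o scale_val set)" using V by blast
    moreover have "Fin (real n / 2 ^ m) < l" using nm b by (cases l) auto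
    ultimately show ?thesis using nm Fin by (metis less_scale_val_simps(1))
  next
    case (Aleph \<xi>)
    then obtain \<zeta> where "l = Aleph \<zeta>" using kl by (cases l) auto
    moreover have "w \<in> range Aleph" if "k < w" for w using that Aleph by (cases w) auto
    ultimately show ?thesis using Aleph unfolding Vat_def by blast
  qed
qed

text \<open>Finite units vanish under \<open>jf\<close>. Under \<open>jm\<close> their values are
  dyadic by definition, and off \<open>jm\<close> they are integers by
  \<open>mf_piece\<close>.\<close>

lemma U_Vat:
  assumes u: "U v u" and a: "\<aa> \<in> \<Omega>" "sp u \<in> \<aa>" shows "v \<in> Vat \<aa>"
proof (cases v)
  case (Fin r)
  then have fu: "fu r u" using u by simp
  have uD: "u \<in> D" using fu fu_D by blast
  have "jf \<cdot> u = \<zero>" using jf_fin fu fu_fin by blast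
  then have nf: "jf \<notin> \<aa>" using sp_inD a uD by blast
  show ?thesis
  proof (cases "jm \<in> \<aa>")
    case True
    then have "jm \<cdot> u \<noteq> \<zero>" using sp_inD a uD by blast
    then obtain q where "q \<cdot> jm \<cdot> u \<noteq> \<zero>" "bu r (q \<cdot> jm \<cdot> u)" using fu jm unfolding fu_def by blast
    then obtain n k where "0 < n" "r = real n / 2 ^ k" unfolding bu_def by blast
    then show ?thesis using Fin True nf unfolding Vat_def Vfin_def by auto
  next
    case False
    let ?j = "cpl jm"
    have "?j \<in> \<aa>" using False Om_prime a jm by blast
    then have "?j \<cdot> u \<noteq> \<zero>" using sp_inD a uD by blast
    then obtain n where "0 < n" "r = real n"
      using mf_piece[OF fu_act[OF fu cpl_Pr[OF jm(1)]] cpl_zero1[OF jm(1) uD], of ?j] act_idem jm(1) uD by auto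
    then show ?thesis using Fin False nf unfolding Vat_def Vfin_def by auto
  qed
qed simp

text \<open>The largest unit of value v below x will do: if its support missed the ultrafilter, the
  complementary projection would be a member and admit a further such unit below x.\<close>

lemma unit_at:
  assumes x: "x \<in> D" and a: "\<aa> \<in> \<Omega>" and ex: "\<And>q. q \<in> \<aa> \<Longrightarrow> \<exists>u. U v u \<and> u \<noteq> \<zero> \<and> u \<sqsubseteq> q \<cdot> x"
  shows "\<exists>u. U v u \<and> u \<sqsubseteq> x \<and> sp u \<in> \<aa>"
proof -
  obtain u where u: "U v u" "u \<sqsubseteq> x" "\<And>t. U v t \<Longrightarrow> t \<sqsubseteq> x \<Longrightarrow> t \<sqsubseteq> u" using U_max x by blast
  have uD: "u \<in> D" using u U_D by blast
  have "sp u \<in> \<aa>"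
  proof (rule ccontr)
    assume "sp u \<notin> \<aa>"
    then have c: "cpl (sp u) \<in> \<aa>" using Om_prime a uD by simp
    then obtain t where t: "U v t" "t \<noteq> \<zero>" "t \<sqsubseteq> cpl (sp u) \<cdot> x" using ex by blast
    have "t \<sqsubseteq> u" using u t act_le[of "cpl (sp u)" x] uD x le_trans by simp
    then have "cpl (sp u) \<cdot> t = \<zero>" using act_zero_mono[of "cpl (sp u)" t u] cpl_zero2[of "sp u" u] uD by simp
    moreover have "cpl (sp u) \<cdot> t = t" using act_fixI[of "cpl (sp u)" t x] t uD x by simp
    ultimately show False using t by simp
  qed
  then show ?thesis using u by blast
qed

end

context dim_unit
begin

text \<open>On a common basic piece, a and u are m and n copies of one finite f, and cancellation
  identifies b with \<open>n - m\<close> copies.\<close>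

lemma fu_diff:
  assumes u: "fu r u" and a: "fu s a" and ss: "ss a u" and e: "u = a \<oplus> b" and sr: "s < r"
  shows "fu (r - s) b \<and> ss b u"
proof -
  have D: "u \<in> D" "a \<in> D" using u a fu_D by auto
  then have bD: "b \<in> D" using e add_D2 by blast
  have key: "\<exists>p\<in>Pr. p \<cdot> q \<cdot> b \<noteq> \<zero> \<and> bu (r - s) (p \<cdot> q \<cdot> b)" if q: "q \<in> Pr" "q \<cdot> u \<noteq> \<zero>" for q
  proof -
    have "q \<cdot> a \<noteq> \<zero>" using ssD[OF ss] q by blast
    then obtain p where p: "p \<in> Pr" "p \<cdot> q \<cdot> a \<noteq> \<zero>" "bu s (p \<cdot> q \<cdot> a)" "bu r (p \<cdot> q \<cdot> u)" "ss (p \<cdot> q \<cdot> a) (p \<cdot> q \<cdot> u)"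
      using fu_pair[OF a u ss] q by blast
    obtain K m n f e' where c: "e' \<in> E" "mult (2 ^ K) f = sp (p \<cdot> q \<cdot> a) \<cdot> e'" "p \<cdot> q \<cdot> a = mult m f"
      "p \<cdot> q \<cdot> u = mult n f" "s = real m / 2 ^ K" "r = real n / 2 ^ K"
      using bu_common[OF p(3,4,5,2)] by blast
    have mn: "m < n" using sr c by (simp add: divide_less_cancel)
    have pe: "p \<cdot> q \<cdot> u = p \<cdot> q \<cdot> a \<oplus> p \<cdot> q \<cdot> b"
      using e act_add[of q a b] act_add[of p "q \<cdot> a" "q \<cdot> b"] p q D act_D by metis
    have nD: "mult n f \<in> D" using c p bu_fin fin_D by metis
    have "mult m f \<oplus> p \<cdot> q \<cdot> b = mult m f \<oplus> mult (n - m) f"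
      using pe c mult_add[of m "n - m" f] mn by simp
    then have be: "p \<cdot> q \<cdot> b = mult (n - m) f"
      using cancel[of "mult m f"] c p bu_fin nD pe by metis
    have "f \<noteq> \<zero>" using c(3) p(2) mult_zero[of m] by metis
    moreover have bD': "mult (n - m) f \<in> D" using mult_mono_D[of "n - m" n f] nD by simp
    ultimately have "p \<cdot> q \<cdot> b \<noteq> \<zero>" using be mult_le[of "n - m" f] mn le_zero by auto
    moreover have "r - s = real (n - m) / 2 ^ K" using c mn by (simp add: diff_divide_distrib of_nat_diff)
    moreover have "sp (p \<cdot> q \<cdot> a) \<in> Pr" using p(3) bu_fin fin_D by simp
    ultimately show ?thesis unfolding bu_def using p(1) c be bD' mn zero_less_diff by metis
  qed
  have "ss b u" unfolding ss_def
  proof (intro ballI iffI)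
    fix q assume q: "q \<in> Pr"
    show "q \<cdot> b = \<zero>" if "q \<cdot> u = \<zero>" using act_zero_mono[OF q _ that] e D le_add2 by blast
    show "q \<cdot> u = \<zero>" if "q \<cdot> b = \<zero>" using key[OF q] act_zero that by metis
  qed
  then show ?thesis unfolding fu_def using key bD ssD by metis
qed

text \<open>That n copies of a can be added at all is part of the claim; they are taken out of b one
  at a time with \<open>fu_diff\<close>.\<close>

lemma fu_mult:
  assumes "fu 1 a" "fu (real n) b" "ss a b" "0 < n" shows "mult n a \<sqsubseteq> b"
  using assms
proof (induction n arbitrary: b)
  case (Suc n)
  have ab: "a \<sqsubseteq> b" using fu_le[OF Suc.prems(1-3)] by simp
  show ?case
  proof (cases "n = 0")
    case True then show ?thesis using ab by simp
  next
    case False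
    obtain c where c: "b = a \<oplus> c" "c \<in> D" using leE[OF ab] by blast
    have "fu (real (Suc n) - 1) c \<and> ss c b"
      using fu_diff[OF Suc.prems(2,1,3) c(1)] False by simp
    then have "mult n a \<sqsubseteq> c" using Suc.IH[of c] Suc.prems False ss_trans ss_sym by (metis add.commute add_diff_cancel_left' gr0I of_nat_Suc)
    moreover have "a \<oplus> c \<in> D" using c(1) fu_D[OF Suc.prems(2)] by simp
    ultimately show ?thesis using add_mono[of a a "mult n a" c] c ab le_D1 by simp
  qed
qed simp

lemma ss_full:
  assumes "p \<in> Pr" "a \<in> D" "b \<in> D" "pleq p (sp a)" "pleq p (sp b)"
  shows "ss (p \<cdot> a) (p \<cdot> b)"
proof -
  have half: "q \<cdot> p \<cdot> b = \<zero>" if *: "q \<in> Pr" "q \<cdot> p \<cdot> a = \<zero>" "a \<in> D" "b \<in> D" "pleq p (sp a)" for q a b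
  proof -
    have "mt q p \<cdot> sp a \<cdot> b = \<zero>" using sp_kill[of a "mt q p" b] * mt_act assms(1) by simp
    then show ?thesis using mt_act[of q p "sp a \<cdot> b"] * assms(1) act_D pleq_act2 by simp
  qed
  show ?thesis unfolding ss_def using half[of _ a b] half[of _ b a] assms by blast
qed

end

context dim_space
begin

text \<open>A nonzero value of p off q would give an ultrafilter containing p and the complement of
  q.\<close>

lemma Om_pleq:
  assumes "p \<in> Pr" "q \<in> Pr" "\<And>\<aa>. \<aa> \<in> \<Omega> \<Longrightarrow> p \<in> \<aa> \<Longrightarrow> q \<in> \<aa>" shows "pleq p q"
proof -
  have "cpl q \<cdot> p \<cdot> y = \<zero>" if y: "y \<in> D" for y
  proof (rule ccontr)
    assume "cpl q \<cdot> p \<cdot> y \<noteq> \<zero>"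
    then obtain \<aa> where "\<aa> \<in> \<Omega>" "mt (cpl q) p \<in> \<aa>"
      using Om_ex[of "mt (cpl q) p" y] mt_act[of "cpl q" p y] assms(1,2) y by auto
    then show False using assms Om_mt_iff Om_cpl cpl_Pr by metis
  qed
  then have "q \<cdot> p \<cdot> y = p \<cdot> y" if "y \<in> D" for y
    using cpl_add[of q "p \<cdot> y"] act_D assms that by simp
  then show ?thesis unfolding pleq_def using assms by blast
qed

text \<open>The side of \<open>jm\<close> on which the ultrafilter lies; on elements cut by it,
  \<open>jm\<close> acts as identity or as zero.\<close>

definition jt :: "'p set \<Rightarrow> 'p" where
  "jt \<aa> = (if jm \<in> \<aa> then jm else cpl jm)"

lemma jt: "\<aa> \<in> \<Omega> \<Longrightarrow> jt \<aa> \<in> \<aa>" "jt \<aa> \<in> Pr"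
  unfolding jt_def using Om_prime jm by auto

lemma jt_act: "x \<in> D \<Longrightarrow> jm \<cdot> jt \<aa> \<cdot> x = (if jm \<in> \<aa> then jt \<aa> \<cdot> x else \<zero>)"
  unfolding jt_def using act_idem jm(1) cpl_zero1 by simp

text \<open>In type II the element e has roots of all orders, so a denominator common to f and r can
  be used. In type I, e is multiple-free, k is 0 and r is an integer. Either way a unit of value r
  can be built from copies of a root of f.\<close>

lemma rescale:
  assumes r: "r \<in> Vfin \<aa>" and e: "e \<in> E" "q \<in> Pr" and f: "mult (2 ^ k) f = q \<cdot> e" "f \<noteq> \<zero>"
    and t: "jm \<cdot> f = (if jm \<in> \<aa> then f else \<zero>)"
  shows "\<exists>K g m c. k \<le> K \<and> mult (2 ^ K) g = q \<cdot> e \<and> f = mult c g \<and> c = 2 ^ (K - k) \<and> r = real m / 2 ^ K \<and> 0 < m"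
proof (cases "jm \<in> \<aa>")
  case True
  have "\<not> mf e" using root_type(2)[OF e f] t True by simp
  obtain m0 K0 where m0: "0 < m0" "r = real m0 / 2 ^ K0" using r True unfolding Vfin_def by (auto split: if_splits)
  let ?K = "max k K0"
  obtain g0 where g0: "mult (2 ^ ?K) g0 = e" using roots e \<open>\<not> mf e\<close> by blast
  have eD: "e \<in> D" using e E_D by blast
  let ?g = "q \<cdot> g0"
  have g: "mult (2 ^ ?K) ?g = q \<cdot> e" using act_mult[of q "2 ^ ?K" g0] e g0 eD by simp
  have "mult (2 ^ k) f = mult (2 ^ k) (mult (2 ^ (?K - k)) ?g)"
    using f g by (simp add: mult_mult power_add[symmetric])
  moreover have "fin (mult (2 ^ k) f)" using f fin_act E_fin e by simp
  ultimately have "f = mult (2 ^ (?K - k)) ?g" using mult_inj[of "2 ^ k" f "mult (2 ^ (?K - k)) ?g"] by simp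
  moreover have "r = real (m0 * 2 ^ (?K - K0)) / 2 ^ ?K" using m0 dyadic_shift[of K0 ?K m0] by simp
  moreover have "0 < m0 * 2 ^ (?K - K0)" using m0 by simp
  ultimately show ?thesis using g max.cobounded1 by metis
next
  case False
  then have "mf e" using root_type(1)[OF e f] t by simp
  then have "k = 0" using mf_root e f by blast
  moreover obtain m where "0 < m" "r = real m" using r False unfolding Vfin_def by (auto split: if_splits)
  ultimately have "0 \<le> (0::nat)" "k \<le> 0" "mult (2 ^ 0) f = q \<cdot> e" "f = mult 1 f" "1 = (2::nat) ^ (0 - k)" "r = real m / 2 ^ 0" "0 < m"
    using f by auto
  then show ?thesis by metis
qed

text \<open>For alephs, smaller units are part of \<open>above_all\<close>. For finite v it suffices
  by \<open>unit_at\<close> to find a nonzero unit of value v below every piece of u. It consists of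
  copies of a root g: few enough to fit if w is finite, and bounded by pure infiniteness if w is an
  aleph.\<close>

lemma U_down:
  assumes v: "v \<in> Vat \<aa>" and vw: "v \<le> w" and u: "U w u" and a: "\<aa> \<in> \<Omega>" "sp u \<in> \<aa>"
  shows "\<exists>t. U v t \<and> t \<sqsubseteq> u \<and> sp t \<in> \<aa>"
proof -
  have uD: "u \<in> D" using u U_D by blast
  show ?thesis
  proof (cases v)
    case (Aleph \<eta>)
    then obtain \<xi> where w: "w = Aleph \<xi>" "\<eta> \<le> \<xi>" using vw by (cases w) auto
    show ?thesis
    proof (cases "\<eta> = \<xi>")
      case True then show ?thesis using u a w Aleph uD le_refl by blast
    next
      case False
      then have "\<eta> < \<xi>" using w by simp
      moreover have "au \<xi> u" using u w by simp
      ultimately obtain t where "au \<eta> t" "slt t u" "ss t u" using above_allD au_above by blast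
      moreover from this have "sp t \<in> \<aa>" using ss_in[OF a(1) _ au_D uD] a by blast
      ultimately show ?thesis using Aleph slt_le by auto
    qed
  next
    case (Fin r)
    then have r: "r \<in> Vfin \<aa>" using v Fin_Vat by blast
    show ?thesis
    proof (rule unit_at[OF uD a(1)])
      fix q0 assume q0: "q0 \<in> \<aa>"
      have "jf \<notin> \<aa>" using r unfolding Vfin_def by auto
      then have cj: "cpl jf \<in> \<aa>" using Om_prime a jf by blast
      \<comment> \<open>Cutting away type III, and then to one side of \<open>jm\<close>, gives
        every root found below the type that \<open>rescale\<close> asks for.\<close>
      let ?q = "mt (cpl jf) q0"
      have q: "?q \<in> \<aa>" "?q \<in> Pr" using Om_mt a cj q0 Om_Pr by blast+
      let ?y = "jt \<aa> \<cdot> ?q \<cdot> u"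
      have qD: "?q \<cdot> u \<in> D" "q0 \<cdot> u \<in> D" using act_D q uD Om_Pr a q0 by auto
      have yD: "?y \<in> D" using act_D jt qD by blast
      have qe: "?q \<cdot> u = cpl jf \<cdot> q0 \<cdot> u" using mt_act[of "cpl jf" q0 u] jf(1) Om_Pr[OF a(1) q0] uD by simp
      have "?q \<cdot> u \<sqsubseteq> q0 \<cdot> u" using qe act_le[of "cpl jf" "q0 \<cdot> u"] jf(1) qD by simp
      then have yq: "?y \<sqsubseteq> q0 \<cdot> u" using act_le[OF jt(2) qD(1)] le_trans by blast
      have "mt (jt \<aa>) ?q \<in> \<aa>" using Om_mt jt a q by blast
      then have "mt (jt \<aa>) ?q \<cdot> u \<noteq> \<zero>" using sp_inD a uD by blast
      then have ynz: "?y \<noteq> \<zero>" using mt_act jt q uD by simp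
      have jy: "jm \<cdot> ?y = (if jm \<in> \<aa> then ?y else \<zero>)" using jt_act qD by blast
      have jfy: "jf \<cdot> ?y = \<zero>"
      proof -
        have "jf \<cdot> ?q \<cdot> u = \<zero>" using qe cpl_zero1[OF jf(1) qD(2)] by simp
        then show ?thesis using act_zero_mono[OF jf(1) act_le[OF jt(2) qD(1)]] by blast
      qed
      have ty: "jm \<cdot> f = (if jm \<in> \<aa> then f else \<zero>)" if "f \<sqsubseteq> ?y" for f
        using jy act_zero_mono[OF jm(1) that] act_fixI[OF jm(1), of f ?y] that yD by (auto split: if_splits)
      have "\<exists>t. fu r t \<and> t \<noteq> \<zero> \<and> t \<sqsubseteq> ?y"
      proof (cases w)
        case w: (Fin r')
        have rr: "r \<le> r'" using vw Fin w by simp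
        have "fu r' ?y" using u w fu_act q jt by simp
        then obtain p where p: "p \<in> Pr" "p \<cdot> sp ?y \<cdot> ?y \<noteq> \<zero>" "bu r' (p \<cdot> sp ?y \<cdot> ?y)"
          using ynz yD unfolding fu_def by (metis sp_Pr sp_act)
        then have p: "p \<in> Pr" "p \<cdot> ?y \<noteq> \<zero>" "bu r' (p \<cdot> ?y)" using yD by auto
        obtain e q' k n f where *: "e \<in> E" "q' \<in> Pr" "mult (2 ^ k) f = q' \<cdot> e" "p \<cdot> ?y = mult n f" "p \<cdot> ?y \<in> D" "0 < n"
          "r' = real n / 2 ^ k" using p(3) unfolding bu_def by blast
        have fz: "f \<noteq> \<zero>" using *(4) p(2) mult_zero[of n] by metis
        have "f \<sqsubseteq> p \<cdot> ?y" using * mult_le by metis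
        then have fy: "f \<sqsubseteq> ?y" using act_le[OF p(1) yD] le_trans by blast
        obtain K g m c where g: "k \<le> K" "mult (2 ^ K) g = q' \<cdot> e" "f = mult c g" "c = 2 ^ (K - k)" "r = real m / 2 ^ K" "0 < m"
          using rescale[OF r *(1,2,3) fz ty[OF fy]] by blast
        have "r' = real (n * c) / 2 ^ K" using *(7) dyadic_shift[OF g(1)] g by simp
        then have "real m \<le> real (n * c)" using rr g(5) by (simp add: divide_le_cancel)
        then have mn: "m \<le> n * c" by (simp only: of_nat_le_iff)
        have ng: "p \<cdot> ?y = mult (n * c) g" using * g mult_mult by simp
        then have mle: "mult m g \<sqsubseteq> p \<cdot> ?y" using mult_mono[OF mn] * by simp
        have "bu r (mult m g)" unfolding bu_def using * g le_D1[OF mle] by blast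
        moreover have "mult m g \<noteq> \<zero>"
        proof
          assume z: "mult m g = \<zero>"
          have "g = \<zero>" using mult_le[of m g] z g le_zero by simp
          then show False using fz g(3) mult_zero by metis
        qed
        ultimately show ?thesis using bu_fu mle act_le[OF p(1) yD] le_trans by blast
      next
        case w: (Aleph \<xi>)
        have yp: "pinf ?y" using pinf_act[OF jt(2) pinf_act[OF q(2) au_pinf]] u w by simp
        obtain t where t: "fin t" "t \<noteq> \<zero>" "t \<sqsubseteq> ?y" using fin_dense yD ynz jfy by blast
        obtain e q' k f where *: "e \<in> E" "q' \<in> Pr" "mult (2 ^ k) f = q' \<cdot> e" "f \<noteq> \<zero>" "f \<sqsubseteq> t"
          using small_unit t by blast
        have fy: "f \<sqsubseteq> ?y" using * t le_trans by blast
        obtain K g m c where g: "k \<le> K" "mult (2 ^ K) g = q' \<cdot> e" "f = mult c g" "c = 2 ^ (K - k)" "r = real m / 2 ^ K" "0 < m"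
          using rescale[OF r *(1-4) ty[OF fy]] by blast
        have "g \<sqsubseteq> f" using mult_le[of c g] g fy le_D1 by simp
        then have mle: "mult m g \<sqsubseteq> ?y" using pinf_mult_le yp fy le_trans by blast
        have "bu r (mult m g)" unfolding bu_def using * g le_D1[OF mle] by blast
        moreover have "mult m g \<noteq> \<zero>"
        proof
          assume z: "mult m g = \<zero>"
          have "g = \<zero>" using mult_le[of m g] z g le_zero by simp
          then show False using *(4) g(3) mult_zero by metis
        qed
        ultimately show ?thesis using bu_fu mle by blast
      qed
      then show "\<exists>t. U v t \<and> t \<noteq> \<zero> \<and> t \<sqsubseteq> q0 \<cdot> u" using Fin yq le_trans by auto
    qed
  qed
qed

text \<open>Makes \<open>Kat\<close> and \<open>Vat\<close> locally constant, so that a gap between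
  values at one point persists nearby.\<close>

lemma same_type:
  assumes a: "\<aa> \<in> \<Omega>"
  shows "\<exists>p\<in>\<aa>. \<forall>\<bb>\<in>\<Omega>. p \<in> \<bb> \<longrightarrow> (jm \<in> \<bb> \<longleftrightarrow> jm \<in> \<aa>) \<and> (jf \<in> \<bb> \<longleftrightarrow> jf \<in> \<aa>)"
proof -
  have P: "jm \<in> Pr" "jf \<in> Pr" using jm jf by auto
  let ?p = "mt (if jm \<in> \<aa> then jm else cpl jm) (if jf \<in> \<aa> then jf else cpl jf)"
  have "?p \<in> \<aa>" using Om_mt[OF a] Om_prime[OF a] P by simp
  moreover have "(jm \<in> \<bb> \<longleftrightarrow> jm \<in> \<aa>) \<and> (jf \<in> \<bb> \<longleftrightarrow> jf \<in> \<aa>)" if "\<bb> \<in> \<Omega>" "?p \<in> \<bb>" for \<bb>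
    using that Om_mt_iff[OF that(1)] Om_cpl[OF that(1)] P by (auto split: if_splits)
  ultimately show ?thesis by blast
qed

lemma type_Kat: "(jm \<in> \<bb> \<longleftrightarrow> jm \<in> \<aa>) \<Longrightarrow> (jf \<in> \<bb> \<longleftrightarrow> jf \<in> \<aa>) \<Longrightarrow> Kat \<bb> = Kat \<aa> \<and> Vat \<bb> = Vat \<aa>"
  unfolding Kat_def Vat_def Kfin_def Vfin_def by simp

end

section \<open>The representation\<close>

text \<open>The index \<gamma> is what makes the unit values at a point bounded, hence their
  supremum available.\<close>

locale dim_bounded = dim_space add zero D Pr act E \<Omega>
  for add :: "'b \<Rightarrow> 'b \<Rightarrow> 'b" (infixl "\<oplus>" 65) and zero :: 'b ("\<zero>") and D :: "'b set"
    and Pr :: "'p set" and act :: "'p \<Rightarrow> 'b \<Rightarrow> 'b" (infixr "\<cdot>" 75) and E and \<Omega> :: "'p set set" +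
  fixes \<gamma> :: "'o::wellorder"
  assumes bound: "\<And>u. au \<gamma> u \<Longrightarrow> u = \<zero>"
begin

lemma U_bound:
  assumes "U v u" "u \<noteq> \<zero>" shows "v < Aleph \<gamma>"
proof (cases v)
  case (Aleph \<xi>)
  show ?thesis
  proof (rule ccontr)
    assume "\<not> v < Aleph \<gamma>"
    then have "\<gamma> \<le> \<xi>" using Aleph by simp
    moreover have u: "au \<xi> u" using assms Aleph by simp
    moreover have "\<gamma> \<noteq> \<xi>" using bound u assms by blast
    ultimately obtain v where "au \<gamma> v" "ss v u" using above_allD[OF au_above[OF u], of \<gamma>] by fastforce
    then show False using bound ss_zero au_D u assms by metis
  qed
qed simp

text \<open>Zero takes care of points that lie in the support of no unit below x.\<close>

definition vals :: "'b \<Rightarrow> 'p set \<Rightarrow> 'o scale_val set" where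
  "vals x \<aa> = {v. v = 0 \<or> (\<exists>u. U v u \<and> u \<sqsubseteq> x \<and> sp u \<in> \<aa>)}"

text \<open>A least upper bound; the type of values has no supremum operator, and existence at
  points of \<Omega> is \<open>eps_lub\<close>.\<close>

definition eps :: "'b \<Rightarrow> 'p set \<Rightarrow> 'o scale_val" where
  "eps x \<aa> = (SOME l. (\<forall>v\<in>vals x \<aa>. v \<le> l) \<and> (\<forall>m. (\<forall>v\<in>vals x \<aa>. v \<le> m) \<longrightarrow> l \<le> m))"

lemma unit_nonzero: "\<aa> \<in> \<Omega> \<Longrightarrow> sp u \<in> \<aa> \<Longrightarrow> u \<noteq> \<zero>"
  using sp_zero_notin by blast

lemma vals_bound: "\<aa> \<in> \<Omega> \<Longrightarrow> v \<in> vals x \<aa> \<Longrightarrow> v \<le> Aleph \<gamma>"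
  unfolding vals_def zero_scale_val_def using U_bound unit_nonzero less_imp_le by fastforce

lemma eps_lub:
  assumes "\<aa> \<in> \<Omega>"
  shows "(\<forall>v\<in>vals x \<aa>. v \<le> eps x \<aa>) \<and> (\<forall>m. (\<forall>v\<in>vals x \<aa>. v \<le> m) \<longrightarrow> eps x \<aa> \<le> m)"
  unfolding eps_def
  by (rule someI_ex, rule lub_ex[of "vals x \<aa>" \<gamma>]) (use vals_bound assms in \<open>auto simp: vals_def\<close>)

lemma eps_ub: "\<aa> \<in> \<Omega> \<Longrightarrow> v \<in> vals x \<aa> \<Longrightarrow> v \<le> eps x \<aa>"
  using eps_lub by simp

lemma eps_least: "\<aa> \<in> \<Omega> \<Longrightarrow> (\<And>v. v \<in> vals x \<aa> \<Longrightarrow> v \<le> m) \<Longrightarrow> eps x \<aa> \<le> m"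
  using eps_lub by simp

lemma eps_nonneg: "\<aa> \<in> \<Omega> \<Longrightarrow> 0 \<le> eps x \<aa>"
  by (rule eps_ub) (auto simp: vals_def)

lemma eps_ge: "\<aa> \<in> \<Omega> \<Longrightarrow> U v u \<Longrightarrow> u \<sqsubseteq> x \<Longrightarrow> sp u \<in> \<aa> \<Longrightarrow> v \<le> eps x \<aa>"
  by (rule eps_ub) (auto simp: vals_def)

lemma eps_leI:
  "\<aa> \<in> \<Omega> \<Longrightarrow> 0 \<le> m \<Longrightarrow> (\<And>v u. U v u \<Longrightarrow> u \<sqsubseteq> x \<Longrightarrow> sp u \<in> \<aa> \<Longrightarrow> v \<le> m) \<Longrightarrow> eps x \<aa> \<le> m"
  by (rule eps_least) (auto simp: vals_def)

lemma less_eps: 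
  assumes "\<aa> \<in> \<Omega>" "m < eps x \<aa>" shows "\<exists>v\<in>vals x \<aa>. m < v"
  using eps_least[OF assms(1), of x m] assms(2) by (meson leD not_le)

lemma less_eps_unit: 
  assumes "\<aa> \<in> \<Omega>" "m < eps x \<aa>" "0 \<le> m" shows "\<exists>v u. U v u \<and> u \<sqsubseteq> x \<and> sp u \<in> \<aa> \<and> m < v"
  using less_eps[OF assms(1,2)] assms(3) unfolding vals_def by auto

lemma eps_mono: "\<aa> \<in> \<Omega> \<Longrightarrow> x \<sqsubseteq> y \<Longrightarrow> eps x \<aa> \<le> eps y \<aa>"
  by (rule eps_leI) (auto intro: eps_nonneg eps_ge le_trans)

lemma eps_bound: "\<aa> \<in> \<Omega> \<Longrightarrow> eps x \<aa> \<le> Aleph \<gamma>"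
  using eps_least vals_bound by blast

lemma eps_zero: "\<aa> \<in> \<Omega> \<Longrightarrow> x \<in> D \<Longrightarrow> sp x \<notin> \<aa> \<Longrightarrow> eps x \<aa> = 0"
  using eps_leI[of \<aa> 0 x] eps_nonneg[of \<aa> x] sp_in_mono by force

lemma eps_unit: 
  assumes "\<aa> \<in> \<Omega>" "U v u" "sp u \<in> \<aa>" shows "eps u \<aa> = v"
proof (rule order.antisym)
  show "v \<le> eps u \<aa>" using eps_ge assms le_refl U_D by blast
  show "eps u \<aa> \<le> v"
  proof (rule eps_leI[OF assms(1)])
    show "0 \<le> v" using Vat_pos[OF U_Vat[OF assms(2,1,3)]] by simp
  qed (use assms U_strict unit_nonzero in blast)
qed

lemma eps_act:
  assumes a: "\<aa> \<in> \<Omega>" and x: "x \<in> D" and p: "p \<in> Pr"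
  shows "eps (p \<cdot> x) \<aa> = (if p \<in> \<aa> then eps x \<aa> else 0)"
proof (cases "p \<in> \<aa>")
  case True
  have "eps x \<aa> \<le> eps (p \<cdot> x) \<aa>"
  proof (rule eps_leI[OF a eps_nonneg[OF a]])
    fix v :: "'o scale_val" and u assume u: "U v u" "u \<sqsubseteq> x" "sp u \<in> \<aa>"
    have "sp (p \<cdot> u) \<in> \<aa>" using sp_act_in a p u True le_D1 by blast
    then show "v \<le> eps (p \<cdot> x) \<aa>" using eps_ge[OF a U_act[OF u(1) p]] act_mono p u by blast
  qed
  then show ?thesis using True eps_mono[OF a act_le[OF p x]] by (simp add: order.antisym)
next
  case False
  then have "sp (p \<cdot> x) \<notin> \<aa>" using sp_act_in a p x by blast
  then show ?thesis using False eps_zero[OF a act_D[OF p x]] by simp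
qed

lemma eps_local:
  assumes "\<aa> \<in> \<Omega>" "p \<in> \<aa>" "x \<in> D" "y \<in> D" "p \<cdot> x \<sqsubseteq> p \<cdot> y" shows "eps x \<aa> \<le> eps y \<aa>"
  using eps_mono[OF assms(1,5)] eps_act assms Om_Pr by simp

text \<open>Only finite suprema in types I and III need care. In type III there are no finite unit
  values, and in type I integers bounded by r are bounded by its floor.\<close>

lemma eps_Kat:
  assumes a: "\<aa> \<in> \<Omega>" shows "eps x \<aa> \<in> Kat \<aa>"
proof (cases "eps x \<aa>")
  case (Fin r)
  have r0: "0 \<le> r" using eps_nonneg[OF a, of x] Fin by (simp add: zero_scale_val_def)
  have V: "v \<in> Vat \<aa> \<and> v \<le> Fin r" if "U v u" "u \<sqsubseteq> x" "sp u \<in> \<aa>" for v :: "'o scale_val" and u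
    using U_Vat eps_ge that a Fin by metis
  consider "jf \<in> \<aa>" | "jf \<notin> \<aa>" "jm \<in> \<aa>" | "jf \<notin> \<aa>" "jm \<notin> \<aa>" by blast
  then have "r \<in> Kfin \<aa>"
  proof cases
    case 1
    have "eps x \<aa> \<le> 0"
    proof (rule eps_leI[OF a])
      fix v :: "'o scale_val" and u assume "U v u" "u \<sqsubseteq> x" "sp u \<in> \<aa>"
      then show "v \<le> 0" using V[of v u] 1 unfolding Vat_def Vfin_def by auto
    qed simp
    then show ?thesis using Fin r0 1 unfolding Kfin_def by (simp add: zero_scale_val_def)
  next
    case 2 then show ?thesis using r0 unfolding Kfin_def by simp
  next
    case 3
    have "eps x \<aa> \<le> Fin (real_of_int \<lfloor>r\<rfloor>)"
    proof (rule eps_leI[OF a])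
      fix v :: "'o scale_val" and u assume "U v u" "u \<sqsubseteq> x" "sp u \<in> \<aa>"
      then obtain n where "v = Fin (real n)" "real n \<le> r" using V[of v u] 3 unfolding Vat_def Vfin_def by auto
      moreover from this have "int n \<le> \<lfloor>r\<rfloor>" by (simp add: le_floor_iff)
      then have "real n \<le> real_of_int \<lfloor>r\<rfloor>" by linarith
      ultimately show "v \<le> Fin (real_of_int \<lfloor>r\<rfloor>)" by simp
    qed (use r0 in \<open>simp add: zero_scale_val_def\<close>)
    then have "r = real_of_int \<lfloor>r\<rfloor>" using Fin by simp linarith
    moreover have "0 \<le> \<lfloor>r\<rfloor>" using r0 by simp
    ultimately have "r \<in> \<nat>" by (metis of_nat_in_Nats of_nat_nat of_int_of_nat_eq)
    then show ?thesis using 3 unfolding Kfin_def by simp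
  qed
  then show ?thesis using Fin Fin_Kat by metis
qed simp

text \<open>Continuity for the two families of open rays that generate the interval topology, with
  thresholds among the values allowed at the point.\<close>

definition cont :: "('p set \<Rightarrow> 'o scale_val) \<Rightarrow> bool" where
  "cont h \<longleftrightarrow> (\<forall>\<aa>\<in>\<Omega>. \<forall>k\<in>Kat \<aa>.
     (k < h \<aa> \<longrightarrow> (\<exists>p\<in>\<aa>. \<forall>\<bb>\<in>\<Omega>. p \<in> \<bb> \<longrightarrow> k < h \<bb>)) \<and>
     (h \<aa> < k \<longrightarrow> (\<exists>p\<in>\<aa>. \<forall>\<bb>\<in>\<Omega>. p \<in> \<bb> \<longrightarrow> h \<bb> < k)))"

definition CF :: "('p set \<Rightarrow> 'o scale_val) \<Rightarrow> bool" where
  "CF h \<longleftrightarrow> (\<forall>\<aa>\<in>\<Omega>. h \<aa> \<in> Kat \<aa>) \<and> cont h \<and> (\<exists>\<beta>. \<forall>\<aa>\<in>\<Omega>. h \<aa> \<le> Aleph \<beta>)"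

text \<open>A lower bound at a point is witnessed by one unit, on its whole support. For upper
  bounds, let u be the largest unit of value v below x: off its support no unit below x has value v
  or more, since \<open>U_down\<close> would produce one of value v. \<open>Kat_gap\<close> supplies
  a suitable v below k, or k itself.\<close>

lemma eps_cont: 
  assumes x: "x \<in> D" shows "cont (eps x)"
  unfolding cont_def
proof (intro ballI conjI impI)
  fix \<aa> and k :: "'o scale_val" assume a: "\<aa> \<in> \<Omega>" and k: "k \<in> Kat \<aa>"
  show "\<exists>p\<in>\<aa>. \<forall>\<bb>\<in>\<Omega>. p \<in> \<bb> \<longrightarrow> k < eps x \<bb>" if h: "k < eps x \<aa>"
  proof -
    obtain v u where "U v u" "u \<sqsubseteq> x" "sp u \<in> \<aa>" "k < v"
      using less_eps_unit[OF a h Kat_nonneg[OF k]] by blast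
    then show ?thesis using eps_ge less_le_trans by meson
  qed
  assume l: "eps x \<aa> < k"
  let ?m = "eps x \<aa>"
  obtain p0 where p0: "p0 \<in> \<aa>" "\<And>\<bb>. \<bb> \<in> \<Omega> \<Longrightarrow> p0 \<in> \<bb> \<Longrightarrow> (Vat \<bb> :: 'o scale_val set) = Vat \<aa>"
    using same_type[OF a] type_Kat by metis
  have main: "\<exists>p\<in>\<aa>. \<forall>\<bb>\<in>\<Omega>. p \<in> \<bb> \<longrightarrow> (\<forall>w u. U w u \<longrightarrow> u \<sqsubseteq> x \<longrightarrow> sp u \<in> \<bb> \<longrightarrow> w \<in> Vat \<aa> \<and> w < v)"
    if v: "v \<in> Vat \<aa>" "?m < v" for v
  proof -
    obtain u where u: "U v u" "u \<sqsubseteq> x" "\<And>t. U v t \<Longrightarrow> t \<sqsubseteq> x \<Longrightarrow> t \<sqsubseteq> u" using U_max x by blast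
    have uD: "u \<in> D" using u U_D by blast
    have "sp u \<notin> \<aa>" using eps_ge[OF a u(1,2)] v by auto
    then have "mt (cpl (sp u)) p0 \<in> \<aa>" using Om_mt[OF a Om_prime[OF a sp_Pr[OF uD]] p0(1)] by blast
    moreover have "w \<in> Vat \<aa> \<and> w < v"
      if b: "\<bb> \<in> \<Omega>" "mt (cpl (sp u)) p0 \<in> \<bb>" and t: "U w t" "t \<sqsubseteq> x" "sp t \<in> \<bb>" for \<bb> w t
    proof -
      have "p0 \<in> \<bb>" "cpl (sp u) \<in> \<bb>" using b Om_mt_iff[OF b(1) cpl_Pr[OF sp_Pr[OF uD]] Om_Pr[OF a p0(1)]] by auto
      then have nb: "sp u \<notin> \<bb>" "Vat \<bb> = (Vat \<aa> :: 'o scale_val set)" using Om_cpl[OF b(1) sp_Pr[OF uD]] p0(2)[OF b(1)] by auto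
      have "\<not> v \<le> w"
      proof
        assume "v \<le> w"
        then obtain s where s: "U v s" "s \<sqsubseteq> t" "sp s \<in> \<bb>" using U_down[OF _ _ t(1) b(1) t(3)] v nb by blast
        then have "s \<sqsubseteq> u" using u t le_trans by blast
        then show False using sp_in_mono b s nb by blast
      qed
      then show ?thesis using U_Vat[OF t(1) b(1) t(3)] nb by auto
    qed
    ultimately show ?thesis by blast
  qed
  have k0: "0 < k" using l eps_nonneg[OF a, of x] by simp
  show "\<exists>p\<in>\<aa>. \<forall>\<bb>\<in>\<Omega>. p \<in> \<bb> \<longrightarrow> eps x \<bb> < k"
  proof (cases "\<exists>v\<in>Vat \<aa>. ?m < v \<and> v < k")
    case True
    then obtain v where v: "v \<in> Vat \<aa>" "?m < v" "v < k" by blast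
    obtain p where p: "p \<in> \<aa>" "\<And>\<bb> w u. \<bb> \<in> \<Omega> \<Longrightarrow> p \<in> \<bb> \<Longrightarrow> U w u \<Longrightarrow> u \<sqsubseteq> x \<Longrightarrow> sp u \<in> \<bb> \<Longrightarrow> w < v"
      using main[OF v(1,2)] by blast
    have "eps x \<bb> \<le> v" if "\<bb> \<in> \<Omega>" "p \<in> \<bb>" for \<bb>
      by (rule eps_leI[OF that(1)]) (use p that v Vat_pos less_imp_le in blast)+
    then show ?thesis using p(1) v(3) le_less_trans by blast
  next
    case False
    then have g: "k \<in> Vat \<aa>" "\<not> (\<exists>w\<in>Kat \<aa>. ?m < w \<and> w < k)" using Kat_gap[OF eps_Kat[OF a] k l] by blast+
    obtain p where p: "p \<in> \<aa>" "\<And>\<bb> w u. \<bb> \<in> \<Omega> \<Longrightarrow> p \<in> \<bb> \<Longrightarrow> U w u \<Longrightarrow> u \<sqsubseteq> x \<Longrightarrow> sp u \<in> \<bb> \<Longrightarrow> w \<in> Vat \<aa> \<and> w < k"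
      using main[OF g(1) l] by blast
    \<comment> \<open>No allowed value lies between \<open>?m\<close> and k, so unit values below k
      are at most \<open>?m\<close>.\<close>
    have "eps x \<bb> \<le> ?m" if b: "\<bb> \<in> \<Omega>" "p \<in> \<bb>" for \<bb>
    proof (rule eps_leI[OF b(1) eps_nonneg[OF a]])
      fix w :: "'o scale_val" and u assume "U w u" "u \<sqsubseteq> x" "sp u \<in> \<bb>"
      then have "w \<in> Kat \<aa>" "w < k" using p(2)[OF b] Vat_Kat by blast+
      then show "w \<le> ?m" using g(2) by (meson not_le)
    qed
    then show ?thesis using p(1) l le_less_trans by blast
  qed
qed

lemma eps_CF: "x \<in> D \<Longrightarrow> CF (eps x)"
  unfolding CF_def using eps_Kat eps_cont eps_bound by blast

end

lemma scale_add_mono: "a \<le> b \<Longrightarrow> a + c \<le> b + c" for a b c :: "'o::linorder scale_val"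
  by (cases a; cases b; cases c) (auto simp: max_def)

lemma scale_le_add: "0 \<le> c \<Longrightarrow> a \<le> a + c" for a c :: "'o::linorder scale_val"
  by (cases a; cases c) (auto simp: zero_scale_val_def)

lemma scale_le_add2: "0 \<le> c \<Longrightarrow> a \<le> c + a" for a c :: "'o::linorder scale_val"
  using scale_le_add add.commute by metis

context dim_unit
begin

text \<open>Densely, w is a piece of a multiple-free element of E, so an element that fits twice
  into w vanishes on every such piece.\<close>

lemma mf_unit:
  assumes w: "fu 1 w" and j: "jm \<cdot> w = \<zero>" shows "mf w"
  unfolding mf_def
proof (intro conjI allI impI)
  show wD: "w \<in> D" using w fu_D by blast
  fix t assume t: "t \<oplus> t \<sqsubseteq> w"
  show "t = \<zero>"
  proof (rule ccontr)
    assume nz: "t \<noteq> \<zero>"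
    have ttD: "t \<oplus> t \<in> D" using t le_D1 by blast
    then have tD: "t \<in> D" using add_D by blast
    have "t \<sqsubseteq> w" using t le_add1 ttD le_trans by blast
    then have "sp t \<cdot> w \<noteq> \<zero>" using act_zero_mono[of "sp t" t w] tD nz by auto
    then obtain p e q' n where p: "p \<in> Pr" "p \<cdot> sp t \<cdot> w \<noteq> \<zero>" "mf e" "q' \<in> Pr" "1 = real n" "p \<cdot> sp t \<cdot> w = mult n (q' \<cdot> e)"
      using mf_piece[OF w j, of "sp t"] tD sp_Pr by blast
    then have e: "p \<cdot> sp t \<cdot> w = q' \<cdot> e" by simp
    have "p \<cdot> sp t \<cdot> (t \<oplus> t) \<sqsubseteq> q' \<cdot> e" using act_mono[OF p(1) act_mono[OF sp_Pr[OF tD] t]] e by simp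
    then have "p \<cdot> t \<oplus> p \<cdot> t \<sqsubseteq> q' \<cdot> e" using act_add[of "sp t" t t] act_add[of p t t] ttD tD p by simp
    then have "p \<cdot> t \<oplus> p \<cdot> t \<sqsubseteq> e" using le_trans act_le p mf_D by blast
    then have "p \<cdot> t = \<zero>" using p mf_def by blast
    then show False using sp_kill[OF tD p(1) _ wD] p by blast
  qed
qed

end

section \<open>Additivity of the representation\<close>

context dim_bounded
begin

text \<open>Both units are cut to their common support, where \<open>fu_add\<close> applies.\<close>

lemma unit_sum:
  assumes a: "\<aa> \<in> \<Omega>" and u: "fu r u" "u \<sqsubseteq> x" "sp u \<in> \<aa>" and t: "fu s t" "t \<sqsubseteq> y" "sp t \<in> \<aa>" and d: "x \<oplus> y \<in> D"
  shows "Fin (r + s) \<le> eps (x \<oplus> y) \<aa>"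
proof -
  have D: "u \<in> D" "t \<in> D" using u t le_D1 by auto
  let ?u = "sp t \<cdot> u" and ?t = "sp u \<cdot> t"
  have le: "?u \<sqsubseteq> x" "?t \<sqsubseteq> y" using act_le[OF sp_Pr[OF D(2)] D(1)] act_le[OF sp_Pr[OF D(1)] D(2)] u t le_trans by blast+
  have w: "?u \<oplus> ?t \<sqsubseteq> x \<oplus> y" using add_mono le d by blast
  have s: "ss ?u ?t" using ss_meet D by blast
  have wD: "?u \<oplus> ?t \<in> D" using w le_D1 by blast
  have "fu (r + s) (?u \<oplus> ?t)" using fu_add[OF _ _ s wD] fu_act u t D by simp
  moreover have "sp ?u \<in> \<aa>" using sp_act_in a D u t by simp
  then have "sp (?u \<oplus> ?t) \<in> \<aa>" using ss_in[OF a ss_add[OF s wD]] wD act_D D by simp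
  ultimately show ?thesis using eps_ge[OF a _ w, of "Fin (r + s)"] by simp
qed

text \<open>If an aleph occurs, the sum is the larger value and monotonicity suffices. Finite values
  are approximated by units, which are added by \<open>unit_sum\<close>; an approximating value 0
  has no unit and is treated separately.\<close>

lemma eps_add_ge:
  assumes a: "\<aa> \<in> \<Omega>" and d: "x \<oplus> y \<in> D" shows "eps x \<aa> + eps y \<aa> \<le> eps (x \<oplus> y) \<aa>"
proof -
  let ?z = "eps (x \<oplus> y) \<aa>"
  have m: "eps x \<aa> \<le> ?z" "eps y \<aa> \<le> ?z" using eps_mono a le_add1 le_add2 d by auto
  show ?thesis
  proof (cases "\<exists>r s. eps x \<aa> = Fin r \<and> eps y \<aa> = Fin s")
    case False
    then show ?thesis using m by (cases "eps x \<aa>"; cases "eps y \<aa>") (auto simp: max_def)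
  next
    case True
    then obtain r s where rs: "eps x \<aa> = Fin r" "eps y \<aa> = Fin s" by blast
    show ?thesis
    proof (rule ccontr)
      assume "\<not> ?thesis"
      then have "?z < Fin (r + s)" using rs by simp
      then obtain t where t: "?z = Fin t" "t < r + s" by (cases ?z) auto
      \<comment> \<open>Half the defect: two values within d of r and s still add up to more than
        t.\<close>
      define d where "d = (r + s - t) / 2"
      have d: "0 < d" "r + s - 2 * d = t" using t unfolding d_def by (auto simp: field_simps)
      have fin: "\<exists>r'. v = Fin r' \<and> r - d < r'" if "Fin (r - d) < v" "v \<le> Fin r" for r and v :: "'o scale_val"
        using that by (cases v) auto
      have "Fin (r - d) < eps x \<aa>" "Fin (s - d) < eps y \<aa>" using rs d by auto
      then obtain v w where vw: "v \<in> vals x \<aa>" "Fin (r - d) < v" "w \<in> vals y \<aa>" "Fin (s - d) < w"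
        using less_eps[OF a] by metis
      then obtain r' s' where r': "v = Fin r'" "r - d < r'" "w = Fin s'" "s - d < s'"
        using fin eps_ub[OF a] rs by metis
      have "Fin (r' + s') \<le> ?z"
      proof (cases "v = 0 \<or> w = 0")
        case True
        then have "v + w = v \<or> v + w = w" by auto
        then show ?thesis using vw(1,3) eps_ub[OF a] m r' order_trans by (metis plus_scale_val.simps(1))
      next
        case False
        then obtain u u' where "U v u \<and> u \<sqsubseteq> x \<and> sp u \<in> \<aa>" "U w u' \<and> u' \<sqsubseteq> y \<and> sp u' \<in> \<aa>"
          using vw unfolding vals_def by auto
        then show ?thesis using unit_sum[OF a _ _ _ _ _ _ assms(2), of r' u s' u'] r' by simp
      qed
      then show False using t r' d by simp
    qed
  qed
qed

text \<open>Below u there is a unit of value 1, which off \<open>jm\<close> is multiple-free; at the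
  point it therefore falls entirely under x or entirely under y. Cancelling it from u and from that
  summand lowers n by one.\<close>

lemma eps_add_mf:
  assumes a: "\<aa> \<in> \<Omega>" "jm \<notin> \<aa>"
  shows "0 < n \<Longrightarrow> fu (real n) u \<Longrightarrow> u \<sqsubseteq> x \<oplus> y \<Longrightarrow> sp u \<in> \<aa> \<Longrightarrow> Fin (real n) \<le> eps x \<aa> + eps y \<aa>"
proof (induction n arbitrary: u x y)
  case (Suc m)
  let ?n = "Suc m"
  have uD: "u \<in> D" using Suc.prems le_D1 by blast
  have c: "cpl jm \<in> Pr" "cpl jm \<in> \<aa>" using a Om_prime jm by auto
  have "jf \<notin> \<aa>" using a jf_jm_in by blast
  then have "Fin 1 \<in> (Vat \<aa> :: 'o scale_val set)" using a unfolding Vat_def Vfin_def by (auto intro!: exI[of _ 1] imageI)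
  moreover have "U (Fin (real ?n) :: 'o scale_val) u" using Suc.prems by simp
  ultimately obtain t where t: "fu 1 t" "t \<sqsubseteq> u" "sp t \<in> \<aa>"
    using U_down[of "Fin 1 :: 'o scale_val" \<aa> "Fin (real ?n)" u] a Suc.prems by auto
  have tD: "t \<in> D" using t le_D1 by blast
  let ?w = "cpl jm \<cdot> t"
  have w: "fu 1 ?w" "jm \<cdot> ?w = \<zero>" "sp ?w \<in> \<aa>" "?w \<sqsubseteq> u"
    using fu_act t c cpl_zero1 jm(1) tD sp_act_in a act_le[OF c(1) tD] le_trans by auto
  have wD: "?w \<in> D" using w le_D1 by blast
  have mfw: "mf ?w" using mf_unit w by blast
  obtain w1 w2 where w12: "?w = w1 \<oplus> w2" "w1 \<sqsubseteq> x" "w2 \<sqsubseteq> y" using riesz[OF le_trans[OF w(4) Suc.prems(3)]] by blast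
  obtain q where q: "q \<in> Pr" "w1 = q \<cdot> ?w" using mf_le_act[OF mfw, of w1] w12(1) wD le_add1[of w1 w2] by auto
  \<comment> \<open>Stated for a unit under the first summand; x and y are quantified anew so that
    they can be exchanged.\<close>
  have key: "Fin (real ?n) \<le> eps x \<aa> + eps y \<aa>"
    if t: "fu 1 t" "t \<sqsubseteq> u" "sp t \<in> \<aa>" "t \<sqsubseteq> x" and ux: "u \<sqsubseteq> x \<oplus> y" for t x y
  proof -
    have tD: "t \<in> D" using t le_D1 by blast
    obtain x1 where x1: "x = t \<oplus> x1" "x1 \<in> D" using leE t by blast
    have xyD: "x \<oplus> y \<in> D" using ux le_D2 by blast
    have xD: "x \<in> D" using xyD add_D by blast
    have et: "eps t \<aa> = Fin 1" using eps_unit[OF a(1), of "Fin 1" t] t by simp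
    have ex: "Fin 1 + eps x1 \<aa> \<le> eps x \<aa>" using eps_add_ge[OF a(1), of t x1] x1 xD et by simp
    show ?thesis
    proof (cases "m = 0")
      case True
      have "Fin 1 \<le> Fin 1 + eps x1 \<aa>" using scale_le_add eps_nonneg a by blast
      also note ex
      also have "eps x \<aa> \<le> eps x \<aa> + eps y \<aa>" using scale_le_add eps_nonneg a by blast
      finally show ?thesis using True by simp
    next
      case False
      let ?u = "sp t \<cdot> u"
      have s: "ss t ?u" using ss_below t by blast
      have fu: "fu (real ?n) ?u" using fu_act Suc.prems tD by simp
      then have "t \<sqsubseteq> ?u" using fu_le[OF t(1) _ s] by simp
      then obtain u2 where u2: "?u = t \<oplus> u2" "u2 \<in> D" using leE by blast
      have f2: "fu (real m) u2" "ss u2 ?u" using fu_diff[OF fu t(1) s u2(1)] False by auto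
      have "?u \<sqsubseteq> x \<oplus> y" using act_le[OF sp_Pr[OF tD] uD] ux le_trans by blast
      then have "t \<oplus> u2 \<sqsubseteq> t \<oplus> (x1 \<oplus> y)" using u2 x1 assoc by simp
      then have le2: "u2 \<sqsubseteq> x1 \<oplus> y" using cancel_le fu_fin t by blast
      have "sp u2 \<in> \<aa>" using ss_in[OF a(1) f2(2)] sp_act_in a uD tD u2(2) Suc.prems t act_D by simp
      then have ih: "Fin (real m) \<le> eps x1 \<aa> + eps y \<aa>" using Suc.IH[OF _ f2(1) le2] False by simp
      have "Fin (real ?n) = Fin (real m) + Fin 1" by simp
      also have "\<dots> \<le> (eps x1 \<aa> + eps y \<aa>) + Fin 1" using scale_add_mono ih by blast
      also have "\<dots> = (Fin 1 + eps x1 \<aa>) + eps y \<aa>" by (simp add: ac_simps)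
      also have "\<dots> \<le> eps x \<aa> + eps y \<aa>" using scale_add_mono ex by blast
      finally show ?thesis .
    qed
  qed
  show ?case
  proof (cases "q \<in> \<aa>")
    case True
    have "fu 1 w1" "sp w1 \<in> \<aa>" using fu_act w q sp_act_in a wD True by auto
    moreover have "w1 \<sqsubseteq> u" using q act_le wD w le_trans by blast
    ultimately show ?thesis using key w12 Suc.prems by blast
  next
    case False
    have cq: "cpl q \<in> Pr" "cpl q \<in> \<aa>" using False q Om_prime a by auto
    have D: "w1 \<in> D" "w2 \<in> D" using w12 le_D1 by auto
    have "cpl q \<cdot> ?w = cpl q \<cdot> w1 \<oplus> cpl q \<cdot> w2" using act_add[OF cq(1), of w1 w2] w12(1) wD by simp
    also have "cpl q \<cdot> w1 = \<zero>" using q cpl_zero2 wD by simp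
    finally have e: "cpl q \<cdot> ?w \<sqsubseteq> y" using act_le[OF cq(1) D(2)] w12 le_trans by simp
    have "fu 1 (cpl q \<cdot> ?w)" "sp (cpl q \<cdot> ?w) \<in> \<aa>" using fu_act w cq sp_act_in a wD by auto
    moreover have "cpl q \<cdot> ?w \<sqsubseteq> u" using cq act_le wD w le_trans by blast
    moreover have "u \<sqsubseteq> y \<oplus> x" using Suc.prems commute by simp
    ultimately show ?thesis using key[of "cpl q \<cdot> ?w" y x] e by (simp add: ac_simps)
  qed
qed simp

text \<open>A unit below the sum with too large a value is refuted by its kind: alephs by
  \<open>pinf_prime\<close>, type I by \<open>eps_add_mf\<close>. In type II the unit is cut into
  parts of values s and \<open>r - s\<close>. Its share under x is locally below the first part, so
  by cancellation the second part lies below its share under y, which is too small.\<close>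

lemma eps_add_le:
  assumes a: "\<aa> \<in> \<Omega>" and d: "x \<oplus> y \<in> D" shows "eps (x \<oplus> y) \<aa> \<le> eps x \<aa> + eps y \<aa>"
proof (rule ccontr)
  assume "\<not> ?thesis"
  then have less: "eps x \<aa> + eps y \<aa> < eps (x \<oplus> y) \<aa>" by simp
  have nn: "0 \<le> eps x \<aa>" "0 \<le> eps y \<aa>" using eps_nonneg a by auto
  then have le: "eps x \<aa> \<le> eps x \<aa> + eps y \<aa>" "eps y \<aa> \<le> eps x \<aa> + eps y \<aa>"
    using scale_le_add scale_le_add2 by auto
  have nn2: "0 \<le> eps x \<aa> + eps y \<aa>" using le nn by (meson order_trans)
  obtain w u where u: "U w u" "u \<sqsubseteq> x \<oplus> y" "sp u \<in> \<aa>" "eps x \<aa> + eps y \<aa> < w"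
    using less_eps_unit[OF a less nn2] by blast
  have uD: "u \<in> D" using u le_D1 by blast
  show False
  proof (cases w)
    case (Aleph \<xi>)
    then have "pinf u" using u au_pinf by simp
    then obtain p where p: "p \<in> Pr" "p \<cdot> u \<sqsubseteq> p \<cdot> x" "cpl p \<cdot> u \<sqsubseteq> cpl p \<cdot> y" using pinf_prime u by blast
    have D: "x \<in> D" "y \<in> D" using d add_D add_D2 by blast+
    have "w \<le> eps x \<aa> \<or> w \<le> eps y \<aa>"
    proof (cases "p \<in> \<aa>")
      case True
      then show ?thesis using eps_local[OF a _ uD D(1) p(2)] eps_unit[OF a u(1,3)] by simp
    next
      case False
      then have "cpl p \<in> \<aa>" using Om_prime a p by blast
      then show ?thesis using eps_local[OF a _ uD D(2) p(3)] eps_unit[OF a u(1,3)] by simp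
    qed
    then show False using le u(4) by auto
  next
    case (Fin r)
    then obtain r1 r2 where r12: "eps x \<aa> = Fin r1" "eps y \<aa> = Fin r2" "r1 + r2 < r"
      using u(4) by (cases "eps x \<aa>"; cases "eps y \<aa>") auto
    have r0: "0 \<le> r1" "0 \<le> r2" using nn r12 by (auto simp: zero_scale_val_def)
    have fu: "fu r u" using u Fin by simp
    have V: "Fin r \<in> (Vat \<aa> :: 'o scale_val set)" using U_Vat u a Fin by metis
    have "jf \<notin> \<aa>" using V unfolding Fin_Vat Vfin_def by auto
    show False
    proof (cases "jm \<in> \<aa>")
      case False
      then obtain n where n: "r = real n" "0 < n" using V unfolding Fin_Vat Vfin_def by (auto split: if_splits)
      then have "Fin r \<le> eps x \<aa> + eps y \<aa>" using eps_add_mf[OF a False n(2)] fu u by simp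
      then show False using u Fin by simp
    next
      case True
      \<comment> \<open>The cut exceeds the value of x and leaves more than the value of y.\<close>
      obtain n k where nk: "0 < n" "r1 < real n / 2 ^ k" "real n / 2 ^ k < r - r2" using dyadic_between[of r1 "r - r2"] r0 r12 by auto
      let ?s = "real n / 2 ^ k"
      have sV: "Fin ?s \<in> (Vat \<aa> :: 'o scale_val set)" unfolding Fin_Vat Vfin_def using True \<open>jf \<notin> \<aa>\<close> nk by auto
      have sr: "?s < r" using nk r0 by linarith
      obtain t where t: "fu ?s t" "t \<sqsubseteq> u" "sp t \<in> \<aa>"
        using U_down[OF sV _ u(1) a u(3)] Fin sr by auto
      have tD: "t \<in> D" using t le_D1 by blast
      let ?u = "sp t \<cdot> u"
      have s: "ss t ?u" using ss_below t by blast
      have fu': "fu r ?u" using fu_act fu tD by simp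
      then have "t \<sqsubseteq> ?u" using fu_le[OF t(1) _ s] sr by simp
      then obtain u2 where u2: "?u = t \<oplus> u2" "u2 \<in> D" using leE by blast
      have f2: "fu (r - ?s) u2" "ss u2 ?u" using fu_diff[OF fu' t(1) s u2(1) sr] by auto
      have u'D: "?u \<in> D" using act_D tD uD by simp
      have "?u \<sqsubseteq> x \<oplus> y" using act_le[OF sp_Pr[OF tD] uD] u le_trans by blast
      then obtain x' y' where xy: "?u = x' \<oplus> y'" "x' \<sqsubseteq> x" "y' \<sqsubseteq> y" using riesz by metis
      have D: "x' \<in> D" "y' \<in> D" using xy le_D1 by auto
      have sp2: "sp u2 \<in> \<aa>" using ss_in[OF a f2(2) u2(2) u'D] sp_act_in[OF a uD] u t tD by simp
      have nle: "\<not> Fin ?s \<le> eps x' \<aa>" using eps_mono[OF a xy(2)] r12(1) nk(2) by (cases "eps x' \<aa>") auto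
      have et: "eps t \<aa> = Fin ?s" using eps_unit[OF a, of "Fin ?s" t] t by simp
      have "\<exists>p\<in>\<aa>. p \<cdot> x' \<sqsubseteq> p \<cdot> t"
        using compare_at[OF a D(1) tD] eps_local[OF a _ tD D(1)] nle et by auto
      then obtain p where p: "p \<in> \<aa>" "p \<cdot> x' \<sqsubseteq> p \<cdot> t" by blast
      have pP: "p \<in> Pr" using p Om_Pr a by blast
      obtain c where c: "p \<cdot> t = p \<cdot> x' \<oplus> c" using leE p by blast
      have "p \<cdot> ?u = p \<cdot> t \<oplus> p \<cdot> u2" "p \<cdot> ?u = p \<cdot> x' \<oplus> p \<cdot> y'"
        using act_add[OF pP, of t u2] act_add[OF pP, of x' y'] u2(1) xy(1) u'D by simp_all
      then have "p \<cdot> x' \<oplus> (c \<oplus> p \<cdot> u2) = p \<cdot> x' \<oplus> p \<cdot> y'" "p \<cdot> x' \<oplus> p \<cdot> y' \<in> D"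
        using c assoc act_D[OF pP u'D] by auto
      moreover have "fin (p \<cdot> x')" using fin_le[OF fu_fin[OF t(1)]] p(2) act_le[OF pP tD] le_trans by blast
      ultimately have "c \<oplus> p \<cdot> u2 = p \<cdot> y'" using cancel by blast
      then have "p \<cdot> u2 \<sqsubseteq> p \<cdot> y'" using leI[of "p \<cdot> u2" c] act_D[OF pP D(2)] commute by simp
      then have "eps u2 \<aa> \<le> eps y' \<aa>" using eps_local[OF a p(1) u2(2) D(2)] by blast
      moreover have "eps u2 \<aa> = Fin (r - ?s)" using eps_unit[OF a, of "Fin (r - ?s)" u2] f2 sp2 by simp
      moreover have "eps y' \<aa> \<le> Fin r2" using eps_mono[OF a xy(3)] r12 by simp
      ultimately have "Fin (r - ?s) \<le> (Fin r2 :: 'o scale_val)" by (cases "eps y' \<aa>") auto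
      then show False using nk by simp
    qed
  qed
qed

lemma eps_add: "\<aa> \<in> \<Omega> \<Longrightarrow> x \<oplus> y \<in> D \<Longrightarrow> eps (x \<oplus> y) \<aa> = eps x \<aa> + eps y \<aa>"
  using eps_add_le eps_add_ge order.antisym by blast

end

section \<open>Reflection of the order and downward closed range\<close>

context dim_bounded
begin

text \<open>Under p, units of every positive integer value below f have full support. By
  \<open>fu_mult\<close>, f then contains arbitrarily many copies of one unit of value 1, against
  \<open>archimedean\<close>.\<close>

lemma fin_not_unbounded:
  assumes f: "fin f" and p: "p \<in> Pr" "p \<cdot> y \<noteq> \<zero>" "y \<in> D"
    and inf: "\<And>\<aa> n. \<aa> \<in> \<Omega> \<Longrightarrow> p \<in> \<aa> \<Longrightarrow> Fin (real n) < eps f \<aa>"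
  shows False
proof -
  have fD: "f \<in> D" using f fin_D by blast
  have sup: "\<exists>u. fu (real n) u \<and> u \<sqsubseteq> f \<and> pleq p (sp u)" if n: "0 < n" for n
  proof -
    obtain u where u: "fu (real n) u" "u \<sqsubseteq> f" "\<And>t. fu (real n) t \<Longrightarrow> t \<sqsubseteq> f \<Longrightarrow> t \<sqsubseteq> u" using fu_max fD by blast
    have uD: "u \<in> D" using u le_D1 by blast
    have "pleq p (sp u)"
    proof (rule Om_pleq[OF p(1) sp_Pr[OF uD]])
      fix \<aa> assume a: "\<aa> \<in> \<Omega>" "p \<in> \<aa>"
      have "0 \<le> (Fin (real n) :: 'o scale_val)" by (simp add: zero_scale_val_def)
      then obtain w :: "'o scale_val" and t where t: "U w t" "t \<sqsubseteq> f" "sp t \<in> \<aa>" "Fin (real n) < w"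
        using less_eps_unit[OF a(1) inf[OF a, of n]] by blast
      have tf: "fin t" using fin_le f t by blast
      then have "jf \<cdot> t = \<zero>" using jf_fin by blast
      then have "jf \<notin> \<aa>" using sp_inD[OF a(1) fin_D[OF tf] t(3)] by blast
      moreover have "\<exists>n' k. real n = real n' / 2 ^ k \<and> 0 < n'"
        by (rule exI[of _ n], rule exI[of _ 0]) (use n in simp)
      ultimately have "Fin (real n) \<in> (Vat \<aa> :: 'o scale_val set)"
        unfolding Fin_Vat Vfin_def using n by auto
      then obtain s where s: "U (Fin (real n) :: 'o scale_val) s" "s \<sqsubseteq> t" "sp s \<in> \<aa>"
        using U_down[OF _ less_imp_le[OF t(4)] t(1) a(1) t(3)] by blast
      have "s \<sqsubseteq> u" using u(3)[of s] s(1) le_trans[OF s(2) t(2)] by simp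
      then show "sp u \<in> \<aa>" using sp_in_mono[OF a(1) _ s(3)] by blast
    qed
    then show ?thesis using u by blast
  qed
  then obtain u where u: "fu 1 u" "u \<sqsubseteq> f" "pleq p (sp u)" using sup[of 1] by auto
  have uD: "u \<in> D" using u le_D1 by blast
  have "mult n (p \<cdot> u) \<sqsubseteq> f" for n
  proof (cases "n = 0")
    case True then show ?thesis using fD by simp
  next
    case False
    then obtain v where v: "fu (real n) v" "v \<sqsubseteq> f" "pleq p (sp v)" using sup[of n] by auto
    have vD: "v \<in> D" using v le_D1 by blast
    have "mult n (p \<cdot> u) \<sqsubseteq> p \<cdot> v"
      using fu_mult[OF fu_act[OF u(1) p(1)] fu_act[OF v(1) p(1)] ss_full[OF p(1) uD vD u(3) v(3)]] False by simp
    then show ?thesis using act_le[OF p(1) vD] v le_trans by blast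
  qed
  then have "p \<cdot> u = \<zero>" using archimedean f by blast
  then have "p \<cdot> sp u \<cdot> y = \<zero>" using sp_kill uD p by blast
  then show False using pleq_act2[OF u(3) p(3)] p by simp
qed

text \<open>Write \<open>x = y \<oplus> z\<close> and let u be a nonzero unit below z. On the
  support of u the value of y is an aleph, so finite parts are negligible there and only the purely
  infinite parts \<open>g1\<close> of x and \<open>g2\<close> of y matter. Somewhere
  \<open>g2\<close> is a unit of some index \<xi>; \<open>g1\<close>, being strictly above it,
  contains a unit of the next index, and there x has the larger value.\<close>

lemma not_slt_eps:
  assumes s: "slt y x" and nz: "x \<noteq> \<zero>" and le: "\<And>\<aa>. \<aa> \<in> \<Omega> \<Longrightarrow> eps x \<aa> \<le> eps y \<aa>"
  shows False
proof -
  obtain z where z: "x = y \<oplus> z" using leE slt_le[OF s] by blast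
  have D: "x \<in> D" "y \<in> D" using slt_le[OF s] le_D1 le_D2 by auto
  then have zD: "z \<in> D" using z add_D2 by metis
  have "z \<noteq> \<zero>"
  proof
    assume "z = \<zero>"
    then have "x = y" using z by simp
    then show False using sltD[OF s sp_Pr[OF D(1)]] nz D by simp
  qed
  then obtain v :: "'o scale_val" and u where u: "U v u" "u \<noteq> \<zero>" "u \<sqsubseteq> z" using U_dense zD by blast
  have uD: "u \<in> D" using u le_D1 by blast
  \<comment> \<open>A finite value of y would be strictly increased by the positive value of
    z.\<close>
  have inf: "\<exists>\<xi>. eps y \<aa> = Aleph \<xi>" if a: "\<aa> \<in> \<Omega>" "sp u \<in> \<aa>" for \<aa>
  proof (cases "eps y \<aa>")
    case (Fin r)
    have "0 < eps z \<aa>" using less_le_trans[OF Vat_pos[OF U_Vat[OF u(1) a]] eps_ge[OF a(1) u(1,3) a(2)]] .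
    moreover have "eps y \<aa> + eps z \<aa> \<le> eps y \<aa>" using eps_add[OF a(1), of y z] le[OF a(1)] z D by simp
    ultimately show ?thesis using Fin by (cases "eps z \<aa>") (auto simp: zero_scale_val_def)
  qed simp
  obtain f2 g2 where y: "fin f2" "pinf g2" "y = f2 \<oplus> g2" using decompose D by blast
  obtain f1 g1 where x: "fin f1" "pinf g1" "x = f1 \<oplus> g1" using decompose D by blast
  have gD: "f1 \<in> D" "f2 \<in> D" "g1 \<in> D" "g2 \<in> D" using x y fin_D pinf_D by auto
  \<comment> \<open>Where \<open>g2\<close> vanishes, y reduces to its finite part, which cannot
    have aleph values on a nonzero piece of u.\<close>
  have full: "q \<cdot> u = \<zero>" if q: "q \<in> Pr" "q \<cdot> g2 = \<zero>" for q
  proof (rule ccontr)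
    assume nzu: "q \<cdot> u \<noteq> \<zero>"
    let ?p = "mt q (sp u)"
    have p: "?p \<in> Pr" "?p \<cdot> u = q \<cdot> u" using q uD mt_act by auto
    have yq: "q \<cdot> y = q \<cdot> f2" using act_add[OF q(1), of f2 g2] y D q by simp
    show False
    proof (rule fin_not_unbounded[OF y(1) p(1) _ uD])
      show "?p \<cdot> u \<noteq> \<zero>" using p nzu by simp
      fix \<aa> n assume a: "\<aa> \<in> \<Omega>" "?p \<in> \<aa>"
      then have qa: "q \<in> \<aa>" "sp u \<in> \<aa>" using Om_mt_iff q uD by auto
      then obtain \<xi> where "eps y \<aa> = Aleph \<xi>" using inf a by blast
      moreover have "eps y \<aa> \<le> eps f2 \<aa>" using eps_local[OF a(1) qa(1) D(2) gD(2)] yq act_D[OF q(1) gD(2)] by simp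
      ultimately show "Fin (real n) < eps f2 \<aa>" by (cases "eps f2 \<aa>") auto
    qed
  qed
  let ?s = "sp u"
  have s': "?s \<in> Pr" using uD by simp
  have absorb: "?s \<cdot> f \<sqsubseteq> ?s \<cdot> g2" if f: "fin f" for f
  proof (rule fin_le_pinf)
    show "fin (?s \<cdot> f)" "pinf (?s \<cdot> g2)" using fin_act pinf_act s' f y by auto
    fix q assume q: "q \<in> Pr" "q \<cdot> ?s \<cdot> g2 = \<zero>"
    then have "mt q ?s \<cdot> u = \<zero>" using full[of "mt q ?s"] mt_act s' gD by simp
    then have "q \<cdot> u = \<zero>" using mt_act q s' uD by simp
    then show "q \<cdot> ?s \<cdot> f = \<zero>" using sp_kill uD q f fin_D by blast
  qed
  have "g2 \<sqsubseteq> x" using slt_le[OF s] y D le_add2 le_trans by metis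
  then have g21: "g2 \<sqsubseteq> g1" using pinf_le_fin_add x y by blast
  have spi: "pinf (?s \<cdot> g2)" using pinf_act s' y by blast
  have sy: "?s \<cdot> y \<sqsubseteq> ?s \<cdot> g2"
    using pinf_add_le[OF spi absorb[OF y(1)] le_refl[OF pinf_D[OF spi]]] act_add[OF s', of f2 g2] y D by simp
  have slt: "slt (?s \<cdot> g2) (?s \<cdot> g1)"
    unfolding slt_def
  proof (intro conjI ballI impI)
    show "?s \<cdot> g2 \<sqsubseteq> ?s \<cdot> g1" using act_mono s' g21 by blast
    fix q assume q: "q \<in> Pr" "q \<cdot> ?s \<cdot> g1 \<sqsubseteq> q \<cdot> ?s \<cdot> g2"
    let ?t = "mt q ?s"
    have t: "?t \<in> Pr" using q s' by simp
    have tx: "?t \<cdot> x = q \<cdot> ?s \<cdot> f1 \<oplus> q \<cdot> ?s \<cdot> g1"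
      using mt_act[OF q(1) s' D(1)] act_add[OF s', of f1 g1] act_add[OF q(1), of "?s \<cdot> f1" "?s \<cdot> g1"] x D act_D[OF s' D(1)] by simp
    have "?t \<cdot> x \<sqsubseteq> q \<cdot> ?s \<cdot> g2" unfolding tx
      using pinf_add_le[OF pinf_act[OF q(1) spi] act_mono[OF q(1) absorb[OF x(1)]] q(2)] .
    also have "q \<cdot> ?s \<cdot> g2 \<sqsubseteq> q \<cdot> ?s \<cdot> y" using act_mono q s' y D le_add2 by metis
    also have "q \<cdot> ?s \<cdot> y = ?t \<cdot> y" using mt_act q s' D by simp
    finally have "?t \<cdot> x = \<zero>" using sltD[OF s t] by blast
    then show "q \<cdot> ?s \<cdot> g1 = \<zero>" using tx add_zero2 by metis
  qed
  have "?s \<cdot> g2 \<noteq> \<zero>" using full[OF s'] u uD by auto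
  then obtain \<xi> :: 'o and q where q: "q \<in> Pr" "q \<cdot> ?s \<cdot> g2 \<noteq> \<zero>" "au \<xi> (q \<cdot> ?s \<cdot> g2)"
    using au_local[OF spi _ bound] by blast
  let ?a = "q \<cdot> ?s \<cdot> g2"
  have aD: "?a \<in> D" using q au_D by blast
  let ?b = "sp ?a \<cdot> q \<cdot> ?s \<cdot> g1"
  have g1D: "q \<cdot> ?s \<cdot> g1 \<in> D" using act_D q s' gD by simp
  have ab: "slt ?a ?b" using slt_act[OF slt_act[OF slt q(1)] sp_Pr[OF aD]] aD by simp
  have ssab: "ss ?a ?b" using ss_below act_mono q(1) slt_le[OF slt] by blast
  have bpi: "pinf ?b" using pinf_act sp_Pr[OF aD] q(1) s' x by blast
  have "\<xi> < \<gamma>" using U_bound[of "Aleph \<xi>" ?a] q by simp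
  \<comment> \<open>The successor of \<xi>, which exists because \<xi> is below \<gamma>.\<close>
  define \<zeta> where "\<zeta> = (LEAST \<eta>. \<xi> < \<eta>)"
  have \<zeta>: "\<xi> < \<zeta>" "\<And>\<eta>. \<eta> < \<zeta> \<Longrightarrow> \<eta> \<le> \<xi>"
    unfolding \<zeta>_def using LeastI[of "\<lambda>\<eta>. \<xi> < \<eta>" \<gamma>] \<open>\<xi> < \<gamma>\<close> not_less_Least[of _ "\<lambda>\<eta>. \<xi> < \<eta>"] not_le by blast+
  have "above_all \<zeta> ?b"
    unfolding above_all_def
  proof (intro conjI allI impI)
    fix \<eta> assume "\<eta> < \<zeta>"
    then have "\<eta> = \<xi> \<or> \<eta> < \<xi>" using \<zeta>(2) by (auto simp: le_less)
    then show "\<exists>v. au \<eta> v \<and> slt v ?b \<and> ss v ?b"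
    proof
      assume "\<eta> < \<xi>"
      then obtain v where "au \<eta> v" "slt v ?a" "ss v ?a" using above_allD[OF au_above[OF q(3)]] by blast
      then show ?thesis using slt_le_trans slt_le[OF ab] ssab ss_trans by blast
    qed (use q ab ssab in blast)
  qed (rule bpi)
  then obtain w where w: "au \<zeta> w" "ss w ?b" "w \<sqsubseteq> ?b" using au_ex by blast
  have wD: "w \<in> D" using w le_D1 by blast
  have ssw: "ss w ?a" using w ssab ss_trans ss_sym by blast
  then have "w \<noteq> \<zero>" using ss_zero[OF ssw wD aD] q by simp
  then obtain \<aa> where a: "\<aa> \<in> \<Omega>" "sp w \<in> \<aa>" using sp_ex wD by blast
  have "?b \<sqsubseteq> g1" using act_le[OF sp_Pr[OF aD] g1D] act_le[OF q(1) act_D[OF s' gD(3)]] act_le[OF s' gD(3)] le_trans by blast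
  then have "w \<sqsubseteq> x" using w x D le_add2 le_trans by metis
  then have "Aleph \<zeta> \<le> eps x \<aa>" using eps_ge[OF a(1), of "Aleph \<zeta>" w] w a by simp
  moreover have spa: "sp ?a \<in> \<aa>" using ss_in[OF a(1) ssw wD aD] a by blast
  then have "q \<in> \<aa>" "?s \<in> \<aa>" using sp_act_in[OF a(1)] act_D[OF s' gD(4)] q(1) s' gD by auto
  then have "eps y \<aa> = eps (q \<cdot> ?s \<cdot> y) \<aa>" using eps_act[OF a(1)] act_D s' D q by simp
  then have "eps y \<aa> \<le> eps ?a \<aa>" using eps_mono[OF a(1) act_mono[OF q(1) sy]] by simp
  moreover have "eps ?a \<aa> = Aleph \<xi>" using eps_unit[OF a(1), of "Aleph \<xi>" ?a] q spa by simp
  ultimately have "Aleph \<zeta> \<le> (Aleph \<xi> :: 'o scale_val)" using le[OF a(1)] by (metis order_trans)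
  then show False using \<zeta>(1) by simp
qed

text \<open>If no nonzero piece of \<open>q \<cdot> x\<close> were below the corresponding piece of
  y, comparability would make y strictly smaller than x there, which \<open>not_slt_eps\<close>
  excludes.\<close>

lemma eps_reflect:
  assumes D: "x \<in> D" "y \<in> D" and le: "\<And>\<aa>. \<aa> \<in> \<Omega> \<Longrightarrow> eps x \<aa> \<le> eps y \<aa>"
  shows "x \<sqsubseteq> y"
proof (rule dense_le[OF D])
  fix q assume q: "q \<in> Pr" "q \<cdot> x \<noteq> \<zero>"
  have qD: "q \<cdot> x \<in> D" "q \<cdot> y \<in> D" using act_D q D by auto
  show "\<exists>q'\<in>Pr. q' \<cdot> q \<cdot> x \<noteq> \<zero> \<and> q' \<cdot> q \<cdot> x \<sqsubseteq> q' \<cdot> q \<cdot> y"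
  proof (rule ccontr)
    assume no: "\<not> ?thesis"
    obtain p where p: "p \<in> Pr" "p \<cdot> q \<cdot> x \<sqsubseteq> p \<cdot> q \<cdot> y" "cpl p \<cdot> q \<cdot> y \<sqsubseteq> cpl p \<cdot> q \<cdot> x" using compare qD by blast
    have cp: "cpl p \<in> Pr" using p by simp
    have "p \<cdot> q \<cdot> x = \<zero>" using no p by blast
    then have ex: "cpl p \<cdot> q \<cdot> x = q \<cdot> x" using cpl_add[OF p(1) qD(1)] by simp
    have "slt (cpl p \<cdot> q \<cdot> y) (cpl p \<cdot> q \<cdot> x)"
      unfolding slt_def
    proof (intro conjI ballI impI)
      fix r assume r: "r \<in> Pr" "r \<cdot> cpl p \<cdot> q \<cdot> x \<sqsubseteq> r \<cdot> cpl p \<cdot> q \<cdot> y"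
      then show "r \<cdot> cpl p \<cdot> q \<cdot> x = \<zero>" using no mt_act[OF r(1) cp qD(1)] mt_act[OF r(1) cp qD(2)] mt_Pr[OF r(1) cp] by metis
    qed (rule p)
    moreover have "eps (cpl p \<cdot> q \<cdot> x) \<aa> \<le> eps (cpl p \<cdot> q \<cdot> y) \<aa>" if "\<aa> \<in> \<Omega>" for \<aa>
      using le[OF that] eps_act[OF that] D qD q(1) cp by simp
    ultimately show False using not_slt_eps[of "cpl p \<cdot> q \<cdot> y" "cpl p \<cdot> q \<cdot> x"] ex q by auto
  qed
qed

text \<open>Continuity of h gives both inequalities for the supremum z. If h is at least v near a
  point, units of value v below x, cut to that neighbourhood, belong to X and push z up. If h is at
  most v near a point, all members of X are there below one unit of value v, hence so is z.
  \<open>Kat_gap\<close> chooses v in both cases.\<close>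

lemma eps_lower:
  assumes x: "x \<in> D" and h: "CF h" and hx: "\<And>\<aa>. \<aa> \<in> \<Omega> \<Longrightarrow> h \<aa> \<le> eps x \<aa>"
  shows "\<exists>z\<in>D. \<forall>\<aa>\<in>\<Omega>. eps z \<aa> = h \<aa>"
proof -
  define X where "X = {u. u \<sqsubseteq> x \<and> (\<exists>v. U v u \<and> (\<forall>\<aa>\<in>\<Omega>. sp u \<in> \<aa> \<longrightarrow> v \<le> h \<aa>))}"
  have "\<exists>z. is_sup X z \<and> z \<sqsubseteq> x" by (rule sup_ex) (auto simp: X_def x)
  then obtain z where z: "is_sup X z" "z \<sqsubseteq> x" by blast
  have zD: "z \<in> D" using z le_D1 by blast
  have Xz: "u \<sqsubseteq> z" if "u \<in> X" for u using z that is_sup_def by blast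
  have hK: "h \<aa> \<in> Kat \<aa>" if "\<aa> \<in> \<Omega>" for \<aa> using h that CF_def by blast
  have up: "\<exists>p\<in>\<aa>. \<forall>\<bb>\<in>\<Omega>. p \<in> \<bb> \<longrightarrow> k < h \<bb>" if "\<aa> \<in> \<Omega>" "k \<in> Kat \<aa>" "k < h \<aa>" for \<aa> k
    using h that unfolding CF_def cont_def by blast
  have down: "\<exists>p\<in>\<aa>. \<forall>\<bb>\<in>\<Omega>. p \<in> \<bb> \<longrightarrow> h \<bb> < k" if "\<aa> \<in> \<Omega>" "k \<in> Kat \<aa>" "h \<aa> < k" for \<aa> k
    using h that unfolding CF_def cont_def by blast
  have ge: "h \<aa> \<le> eps z \<aa>" if a: "\<aa> \<in> \<Omega>" for \<aa>
  proof (rule ccontr)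
    let ?k = "eps z \<aa>"
    assume "\<not> ?thesis"
    then have l: "?k < h \<aa>" by simp
    have main: False if v: "v \<in> Vat \<aa>" "?k < v" "\<exists>p\<in>\<aa>. \<forall>\<bb>\<in>\<Omega>. p \<in> \<bb> \<longrightarrow> v \<le> h \<bb>" "\<exists>w u. U w u \<and> u \<sqsubseteq> x \<and> sp u \<in> \<aa> \<and> v \<le> w" for v
    proof -
      obtain p where p: "p \<in> \<aa>" "\<And>\<bb>. \<bb> \<in> \<Omega> \<Longrightarrow> p \<in> \<bb> \<Longrightarrow> v \<le> h \<bb>" using v by blast
      obtain w u' where "U w u'" "u' \<sqsubseteq> x" "sp u' \<in> \<aa>" "v \<le> w" using v by blast
      then obtain u where u: "U v u" "u \<sqsubseteq> x" "sp u \<in> \<aa>" using U_down[OF v(1) _ _ a] le_trans by metis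
      have uD: "u \<in> D" and pP: "p \<in> Pr" using u le_D1 p Om_Pr a by auto
      have "p \<cdot> u \<sqsubseteq> x" using act_le[OF pP uD] u le_trans by blast
      moreover have "v \<le> h \<bb>" if "\<bb> \<in> \<Omega>" "sp (p \<cdot> u) \<in> \<bb>" for \<bb>
        using p(2) sp_act_in[OF that(1) uD pP] that by blast
      ultimately have "p \<cdot> u \<in> X" unfolding X_def using U_act[OF u(1) pP] by blast
      then have "v \<le> eps z \<aa>" using eps_ge[OF a U_act[OF u(1) pP] Xz] sp_act_in[OF a uD pP] p u by blast
      then show False using v by auto
    qed
    have lx: "?k < eps x \<aa>" using l hx[OF a] by auto
    show False
    proof (cases "\<exists>v\<in>Vat \<aa>. ?k < v \<and> v < h \<aa>")
      case True
      then obtain v where v: "v \<in> Vat \<aa>" "?k < v" "v < h \<aa>" by blast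
      have vK: "v \<in> Kat \<aa>" using v Vat_Kat by blast
      have "v < eps x \<aa>" using v hx[OF a] by auto
      then obtain w u where "U w u" "u \<sqsubseteq> x" "sp u \<in> \<aa>" "v < w" using less_eps_unit[OF a _ Kat_nonneg[OF vK]] by blast
      then show False using main[OF v(1,2)] up[OF a vK v(3)] less_imp_le by meson
    next
      case False
      then have g: "h \<aa> \<in> Vat \<aa>" "\<not> (\<exists>w\<in>Kat \<aa>. ?k < w \<and> w < h \<aa>)" using Kat_gap[OF eps_Kat[OF a] hK[OF a] l] by blast+
      obtain p where p: "p \<in> \<aa>" "\<And>\<bb>. \<bb> \<in> \<Omega> \<Longrightarrow> p \<in> \<bb> \<Longrightarrow> ?k < h \<bb>" using up[OF a eps_Kat[OF a] l] by blast
      obtain p0 where p0: "p0 \<in> \<aa>" "\<And>\<bb>. \<bb> \<in> \<Omega> \<Longrightarrow> p0 \<in> \<bb> \<Longrightarrow> (Kat \<bb> :: 'o scale_val set) = Kat \<aa>"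
        using same_type[OF a] type_Kat by metis
      have "h \<aa> \<le> h \<bb>" if b: "\<bb> \<in> \<Omega>" "mt p p0 \<in> \<bb>" for \<bb>
      proof -
        have "p \<in> \<bb>" "p0 \<in> \<bb>" using b Om_mt_iff[OF b(1) Om_Pr[OF a p(1)] Om_Pr[OF a p0(1)]] by auto
        then have "?k < h \<bb>" "h \<bb> \<in> Kat \<aa>" using p(2)[OF b(1)] p0(2)[OF b(1)] hK[OF b(1)] by auto
        then show ?thesis using g(2) by (meson not_le)
      qed
      moreover have "mt p p0 \<in> \<aa>" using Om_mt a p p0 by blast
      moreover obtain w u where u: "U w u" "u \<sqsubseteq> x" "sp u \<in> \<aa>" "?k < w" using less_eps_unit[OF a lx eps_nonneg[OF a]] by blast
      moreover have "h \<aa> \<le> w"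
      proof -
        have "w \<in> Kat \<aa>" using U_Vat[OF u(1) a u(3)] Vat_Kat by blast
        then show ?thesis using g(2) u(4) by (meson not_le)
      qed
      ultimately show False using main[OF g(1) l] by blast
    qed
  qed
  have le: "eps z \<aa> \<le> h \<aa>" if a: "\<aa> \<in> \<Omega>" for \<aa>
  proof (rule ccontr)
    let ?k = "h \<aa>" and ?l = "eps z \<aa>"
    assume "\<not> ?thesis"
    then have l: "?k < ?l" by simp
    have main: False if v: "v = 0 \<or> v \<in> Vat \<aa>" "\<exists>p\<in>\<aa>. \<forall>\<bb>\<in>\<Omega>. p \<in> \<bb> \<longrightarrow> h \<bb> \<le> v"
      and w: "U w u" "u \<sqsubseteq> z" "sp u \<in> \<aa>" "v < w" for v w u
    proof -
      have uD: "u \<in> D" using w le_D1 by blast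
      obtain p where p: "p \<in> \<aa>" "\<And>\<bb>. \<bb> \<in> \<Omega> \<Longrightarrow> p \<in> \<bb> \<Longrightarrow> h \<bb> \<le> v" using v by blast
      \<comment> \<open>Zero is not in \<open>Vat\<close>, so for v = 0 the role of the unit is
        played by the zero element.\<close>
      have "\<exists>t. (v = 0 \<and> t = \<zero> \<or> v \<noteq> 0 \<and> U v t \<and> sp t \<in> \<aa>) \<and> t \<sqsubseteq> u"
        using v(1) U_down[OF _ less_imp_le[OF w(4)] w(1) a w(3)] uD zero_le by blast
      then obtain t where t: "v = 0 \<and> t = \<zero> \<or> v \<noteq> 0 \<and> U v t \<and> sp t \<in> \<aa>" "t \<sqsubseteq> u" by blast
      have tD: "t \<in> D" using t le_D1 by blast
      let ?q = "if v = 0 then p else mt p (sp t)"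
      have q: "?q \<in> \<aa>" "?q \<in> Pr" using Om_mt a p t Om_Pr by auto
      have sup: "is_sup ((\<cdot>) ?q ` X) (?q \<cdot> z)" using sup_act z q by blast
      \<comment> \<open>Near the point the members of X have value at most v and so fit under t;
        \<open>sup_act\<close> carries this over to z.\<close>
      have "s \<sqsubseteq> ?q \<cdot> t" if s: "s \<in> (\<cdot>) ?q ` X" for s
      proof -
        obtain y v' where y: "s = ?q \<cdot> y" "y \<sqsubseteq> x" "U v' y" "\<forall>\<aa>\<in>\<Omega>. sp y \<in> \<aa> \<longrightarrow> v' \<le> h \<aa>" using s unfolding X_def by blast
        have yD: "y \<in> D" using y le_D1 by blast
        have sU: "U v' s" using U_act y q by blast
        show ?thesis
        proof (cases "s = \<zero>")
          case True then show ?thesis using act_D q tD by simp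
        next
          case False
          then obtain \<bb> where b: "\<bb> \<in> \<Omega>" "sp s \<in> \<bb>" using sp_ex[of s] U_D[OF sU] by blast
          then have qb: "?q \<in> \<bb>" "sp y \<in> \<bb>" using sp_act_in[OF b(1) yD q(2)] y by auto
          then have "p \<in> \<bb>" using Om_mt_iff[OF b(1) Om_Pr[OF a p(1)] sp_Pr[OF tD]] by (auto split: if_splits)
          then have v'v: "v' \<le> v" using y(4) qb b p(2)[OF b(1)] by (meson order_trans)
          moreover have "0 < v'" using Vat_pos[OF U_Vat[OF sU b]] .
          ultimately have v0: "v \<noteq> 0" by auto
          then have tU: "U v t" using t by blast
          have "s = sp t \<cdot> s" 
            using y(1) v0 mt_act[OF Om_Pr[OF a p(1)] sp_Pr[OF tD] yD] act_comm[OF sp_Pr[OF tD] Om_Pr[OF a p(1)] act_D[OF sp_Pr[OF tD] yD]]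
              act_idem[OF sp_Pr[OF tD] yD] by simp
          then have pl: "pleq (sp s) (sp t)" using sp_pleq[OF U_D[OF sU] sp_Pr[OF tD]] by simp
          have "ss (sp s \<cdot> s) (sp s \<cdot> t)"
            using ss_full[OF sp_Pr[OF U_D[OF sU]] U_D[OF sU] tD pleq_refl[OF sp_Pr[OF U_D[OF sU]]] pl] .
          then have "s \<sqsubseteq> sp s \<cdot> t" using U_le[OF sU U_act[OF tU sp_Pr[OF U_D[OF sU]]] _ v'v] U_D[OF sU] by simp
          then have "s \<sqsubseteq> t" using act_le[OF sp_Pr[OF U_D[OF sU]] tD] le_trans by blast
          then have "?q \<cdot> s \<sqsubseteq> ?q \<cdot> t" using act_mono q by blast
          moreover have "?q \<cdot> s = s" using y(1) act_idem[OF q(2) yD] by simp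
          ultimately show ?thesis by simp
        qed
      qed
      then have "?q \<cdot> z \<sqsubseteq> ?q \<cdot> t" using sup act_D q tD unfolding is_sup_def by blast
      then have qu: "?q \<cdot> u \<sqsubseteq> ?q \<cdot> t" using act_mono[OF q(2) w(2)] le_trans by blast
      have nz: "?q \<cdot> u \<noteq> \<zero>" using sp_inD[OF a uD w(3) q(1)] .
      show False
      proof (cases "v = 0")
        case True
        then have "t = \<zero>" using t by blast
        then show False using qu nz act_zero[OF q(2)] le_zero by metis
      next
        case False
        then have "U v t" using t by blast
        then have "w \<le> v" using U_strict[OF U_act[OF w(1) q(2)] U_act[OF _ q(2)] qu nz] by blast
        then show False using w by auto
      qed
    qed
    have k0: "0 \<le> ?k" using Kat_nonneg[OF hK[OF a]] .
    show False
    proof (cases "\<exists>v\<in>Vat \<aa>. ?k < v \<and> v < ?l")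
      case True
      then obtain v where v: "v \<in> Vat \<aa>" "?k < v" "v < ?l" by blast
      have vK: "v \<in> Kat \<aa>" using v Vat_Kat by blast
      obtain w u where u: "U w u" "u \<sqsubseteq> z" "sp u \<in> \<aa>" "v < w" using less_eps_unit[OF a v(3) Kat_nonneg[OF vK]] by blast
      show False using main[OF _ _ u] v(1) down[OF a vK v(2)] less_imp_le by meson
    next
      case False
      then have g: "?l \<in> Vat \<aa>" "?k = 0 \<or> ?k \<in> Vat \<aa>" "\<not> (\<exists>w\<in>Kat \<aa>. ?k < w \<and> w < ?l)" using Kat_gap[OF hK[OF a] eps_Kat[OF a] l] by blast+
      obtain p where p: "p \<in> \<aa>" "\<And>\<bb>. \<bb> \<in> \<Omega> \<Longrightarrow> p \<in> \<bb> \<Longrightarrow> h \<bb> < ?l" using down[OF a eps_Kat[OF a] l] by blast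
      obtain p0 where p0: "p0 \<in> \<aa>" "\<And>\<bb>. \<bb> \<in> \<Omega> \<Longrightarrow> p0 \<in> \<bb> \<Longrightarrow> (Kat \<bb> :: 'o scale_val set) = Kat \<aa>"
        using same_type[OF a] type_Kat by metis
      have "h \<bb> \<le> ?k" if b: "\<bb> \<in> \<Omega>" "mt p p0 \<in> \<bb>" for \<bb>
      proof -
        have "p \<in> \<bb>" "p0 \<in> \<bb>" using b Om_mt_iff[OF b(1) Om_Pr[OF a p(1)] Om_Pr[OF a p0(1)]] by auto
        then have "h \<bb> < ?l" "h \<bb> \<in> Kat \<aa>" using p(2)[OF b(1)] p0(2)[OF b(1)] hK[OF b(1)] by auto
        then show ?thesis using g(3) by (meson not_le)
      qed
      moreover have "mt p p0 \<in> \<aa>" using Om_mt a p p0 by blast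
      moreover obtain w u where "U w u" "u \<sqsubseteq> z" "sp u \<in> \<aa>" "?k < w" using less_eps_unit[OF a l k0] by blast
      ultimately show False using main[OF g(2)] by blast
    qed
  qed
  show ?thesis using zD ge le order.antisym by blast
qed

end

section \<open>Uniqueness\<close>

text \<open>
  The assumptions on \<open>\<phi>\<close> are those of the theorem.  Any such \<open>\<phi>\<close> maps exactly the units of
  value \<open>v\<close> to the functions that are constant \<open>v\<close> on a clopen set and \<open>0\<close> elsewhere.
\<close>

locale dim_emb = dim_bounded add zero D Pr act E \<Omega> \<gamma>
  for add :: "'b \<Rightarrow> 'b \<Rightarrow> 'b" (infixl "\<oplus>" 65) and zero :: 'b ("\<zero>") and D :: "'b set"
    and Pr :: "'p set" and act :: "'p \<Rightarrow> 'b \<Rightarrow> 'b" (infixr "\<cdot>" 75) and E and \<Omega> :: "'p set set"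
    and \<gamma> :: "'o::wellorder" +
  fixes \<phi> :: "'b \<Rightarrow> 'p set \<Rightarrow> 'o scale_val"
  assumes phi_CF: "\<And>x. x \<in> D \<Longrightarrow> CF (\<phi> x)"
    and phi_add: "\<And>x y \<aa>. x \<oplus> y \<in> D \<Longrightarrow> \<aa> \<in> \<Omega> \<Longrightarrow> \<phi> (x \<oplus> y) \<aa> = \<phi> x \<aa> + \<phi> y \<aa>"
    and phi_reflect: "\<And>x y h. x \<in> D \<Longrightarrow> y \<in> D \<Longrightarrow> CF h \<Longrightarrow> (\<And>\<aa>. \<aa> \<in> \<Omega> \<Longrightarrow> \<phi> x \<aa> + h \<aa> = \<phi> y \<aa>) \<Longrightarrow> x \<sqsubseteq> y"
    and phi_lower: "\<And>x h h'. x \<in> D \<Longrightarrow> CF h \<Longrightarrow> CF h' \<Longrightarrow> (\<And>\<aa>. \<aa> \<in> \<Omega> \<Longrightarrow> h \<aa> + h' \<aa> = \<phi> x \<aa>) \<Longrightarrow>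
      \<exists>y\<in>D. \<forall>\<aa>\<in>\<Omega>. \<phi> y \<aa> = h \<aa>"
    and phi_act: "\<And>p x \<aa>. p \<in> Pr \<Longrightarrow> x \<in> D \<Longrightarrow> \<aa> \<in> \<Omega> \<Longrightarrow> \<phi> (p \<cdot> x) \<aa> = (if p \<in> \<aa> then \<phi> x \<aa> else 0)"
    and phi_E: "\<And>e \<aa>. e \<in> E \<Longrightarrow> jm \<cdot> e = e \<Longrightarrow> \<aa> \<in> \<Omega> \<Longrightarrow> \<phi> e \<aa> \<in> {0, 1}"

section \<open>The representation as an embedding; constants and differences in the function
  space\<close>

context dim_bounded
begin

lemma E_bu: "e \<in> E \<Longrightarrow> bu 1 e"
proof -
  assume e: "e \<in> E"
  then have "mult (2 ^ 0) e = sp e \<cdot> e" "sp e \<in> Pr" "e = mult 1 e" "e \<in> D" using E_D by auto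
  then show ?thesis unfolding bu_def using e
    by (metis div_by_1 of_nat_1 power_0 zero_less_one)
qed

lemma eps_E: "e \<in> E \<Longrightarrow> \<aa> \<in> \<Omega> \<Longrightarrow> eps e \<aa> \<in> {0, 1}"
  using eps_unit[of \<aa> "Fin 1" e] bu_fu[OF E_bu] eps_zero[of \<aa> e] E_D
  by (cases "sp e \<in> \<aa>") (auto simp: one_scale_val_def)

lemma CF_nonneg: "CF h \<Longrightarrow> \<aa> \<in> \<Omega> \<Longrightarrow> 0 \<le> h \<aa>"
  using Kat_nonneg unfolding CF_def by blast

text \<open>Makes everything proved for an arbitrary \<phi> available for \<open>eps\<close>, in
  particular injectivity.\<close>

lemma eps_emb: "dim_emb add zero D Pr act E \<Omega> \<gamma> eps"
proof unfold_locales
  fix x y h assume "x \<in> D" "y \<in> D" and h: "CF h" "\<And>\<aa>. \<aa> \<in> \<Omega> \<Longrightarrow> eps x \<aa> + h \<aa> = eps y \<aa>"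
  then show "x \<sqsubseteq> y" using eps_reflect scale_le_add CF_nonneg by metis
next
  fix x h h' assume "x \<in> D" "CF h" "CF h'" "\<And>\<aa>. \<aa> \<in> \<Omega> \<Longrightarrow> h \<aa> + h' \<aa> = eps x \<aa>"
  then show "\<exists>y\<in>D. \<forall>\<aa>\<in>\<Omega>. eps y \<aa> = h \<aa>" using eps_lower scale_le_add CF_nonneg by metis
qed (use eps_CF eps_add eps_act eps_E in auto)

definition cst :: "'o scale_val \<Rightarrow> 'p \<Rightarrow> 'p set \<Rightarrow> 'o scale_val" where
  "cst v p \<aa> = (if p \<in> \<aa> then v else 0)"

lemma CF_cst:
  assumes p: "p \<in> Pr" and v: "\<And>\<aa>. \<aa> \<in> \<Omega> \<Longrightarrow> p \<in> \<aa> \<Longrightarrow> v \<in> Kat \<aa>"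
  shows "CF (cst v p)"
  unfolding CF_def
proof (intro conjI)
  show "\<forall>\<aa>\<in>\<Omega>. cst v p \<aa> \<in> Kat \<aa>" unfolding cst_def by (simp add: v zero_Kat)
  have "\<exists>q\<in>\<aa>. \<forall>\<bb>\<in>\<Omega>. q \<in> \<bb> \<longrightarrow> cst v p \<bb> = cst v p \<aa>" if a: "\<aa> \<in> \<Omega>" for \<aa>
  proof (cases "p \<in> \<aa>")
    case True then show ?thesis unfolding cst_def by auto
  next
    case False
    then have "cpl p \<in> \<aa>" using Om_prime a p by blast
    then show ?thesis unfolding cst_def using False Om_cpl p by (metis (full_types))
  qed
  then show "cont (cst v p)" unfolding cont_def by metis
  show "\<exists>\<beta>. \<forall>\<aa>\<in>\<Omega>. cst v p \<aa> \<le> Aleph \<beta>"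
    unfolding cst_def zero_scale_val_def by (cases v) auto
qed

lemma Kat_add: "k \<in> Kat \<aa> \<Longrightarrow> l \<in> Kat \<aa> \<Longrightarrow> k + l \<in> (Kat \<aa> :: 'o scale_val set)"
  unfolding Kat_def Kfin_def by (auto split: if_splits)

text \<open>Needed because the algebraic order of the function space asks for a continuous
  difference, not just for pointwise inequality; alephs absorb the subtrahend.\<close>

primrec sub :: "'o scale_val \<Rightarrow> real \<Rightarrow> 'o scale_val" where
  "sub (Fin a) b = Fin (a - b)"
| "sub (Aleph \<xi>) b = Aleph \<xi>"

lemma sub_less: "k < sub x b \<longleftrightarrow> k + Fin b < x" "sub x b < k \<longleftrightarrow> x < k + Fin b"
  by (cases k; cases x; auto)+

text \<open>Under p, comparing the difference with k means comparing h with
  \<open>k + Fin b\<close>, which is an allowed value by \<open>Kat_add\<close>.\<close>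

lemma CF_sub:
  assumes h: "CF h" and p: "p \<in> Pr" and v: "\<And>\<aa>. \<aa> \<in> \<Omega> \<Longrightarrow> p \<in> \<aa> \<Longrightarrow> Fin b \<in> (Kat \<aa> :: 'o scale_val set) \<and> Fin b \<le> h \<aa>"
  shows "CF (\<lambda>\<aa>. if p \<in> \<aa> then sub (h \<aa>) b else h \<aa>)"
proof -
  let ?h = "\<lambda>\<aa>. if p \<in> \<aa> then sub (h \<aa>) b else h \<aa>"
  have K: "h \<aa> \<in> Kat \<aa>" if "\<aa> \<in> \<Omega>" for \<aa> using h that CF_def by blast
  obtain \<beta> where \<beta>: "\<And>\<aa>. \<aa> \<in> \<Omega> \<Longrightarrow> h \<aa> \<le> Aleph \<beta>" using h CF_def by blast
  have hc: "cont h" using h CF_def by blast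
  have "?h \<aa> \<in> Kat \<aa>" if a: "\<aa> \<in> \<Omega>" for \<aa>
    using K[OF a] v[OF a] unfolding Kat_def Kfin_def
    by (cases "h \<aa>") (auto split: if_splits simp: Nats_diff)
  moreover have "?h \<aa> \<le> Aleph \<beta>" if a: "\<aa> \<in> \<Omega>" for \<aa>
    using \<beta>[OF a] by (cases "h \<aa>") auto
  moreover have "cont ?h"
    unfolding cont_def
  proof (intro ballI)
    fix \<aa> and k :: "'o scale_val" assume a: "\<aa> \<in> \<Omega>" and k: "k \<in> Kat \<aa>"
    show "(k < ?h \<aa> \<longrightarrow> (\<exists>q\<in>\<aa>. \<forall>\<bb>\<in>\<Omega>. q \<in> \<bb> \<longrightarrow> k < ?h \<bb>)) \<and> (?h \<aa> < k \<longrightarrow> (\<exists>q\<in>\<aa>. \<forall>\<bb>\<in>\<Omega>. q \<in> \<bb> \<longrightarrow> ?h \<bb> < k))"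
    proof -
      define p' where "p' = (if p \<in> \<aa> then p else cpl p)"
      have p': "p' \<in> \<aa>" "p' \<in> Pr" unfolding p'_def using Om_prime a p by auto
      define l where "l = (if p \<in> \<aa> then k + Fin b else k)"
      have l: "l \<in> Kat \<aa>" unfolding l_def using k v a Kat_add by simp
      have e: "(k < ?h \<bb> \<longleftrightarrow> l < h \<bb>) \<and> (?h \<bb> < k \<longleftrightarrow> h \<bb> < l)" if "\<bb> \<in> \<Omega>" "p' \<in> \<bb>" for \<bb>
        using that Om_cpl[OF that(1) p] unfolding p'_def l_def by (auto simp: sub_less split: if_splits)
      have tr: "\<exists>r\<in>\<aa>. \<forall>\<bb>\<in>\<Omega>. r \<in> \<bb> \<longrightarrow> P' \<bb>" if q: "q \<in> \<aa>" "\<forall>\<bb>\<in>\<Omega>. q \<in> \<bb> \<longrightarrow> P \<bb>"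
        "\<And>\<bb>. \<bb> \<in> \<Omega> \<Longrightarrow> p' \<in> \<bb> \<Longrightarrow> P \<bb> \<Longrightarrow> P' \<bb>" for q P P'
      proof (intro bexI ballI impI)
        show "mt q p' \<in> \<aa>" using Om_mt[OF a q(1) p'(1)] .
        fix \<bb> assume b: "\<bb> \<in> \<Omega>" "mt q p' \<in> \<bb>"
        then have "q \<in> \<bb>" "p' \<in> \<bb>" using Om_mt_iff[OF b(1) Om_Pr[OF a q(1)] p'(2)] by auto
        then show "P' \<bb>" using q b by blast
      qed
      have "\<exists>r\<in>\<aa>. \<forall>\<bb>\<in>\<Omega>. r \<in> \<bb> \<longrightarrow> k < ?h \<bb>" if "k < ?h \<aa>"
      proof -
        have "l < h \<aa>" using e[OF a p'(1)] that by blast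
        then obtain q where "q \<in> \<aa>" "\<forall>\<bb>\<in>\<Omega>. q \<in> \<bb> \<longrightarrow> l < h \<bb>" using hc a l unfolding cont_def by blast
        then show ?thesis by (rule tr) (use e in blast)
      qed
      moreover have "\<exists>r\<in>\<aa>. \<forall>\<bb>\<in>\<Omega>. r \<in> \<bb> \<longrightarrow> ?h \<bb> < k" if "?h \<aa> < k"
      proof -
        have "h \<aa> < l" using e[OF a p'(1)] that by blast
        then obtain q where "q \<in> \<aa>" "\<forall>\<bb>\<in>\<Omega>. q \<in> \<bb> \<longrightarrow> h \<bb> < l" using hc a l unfolding cont_def by blast
        then show ?thesis by (rule tr) (use e in blast)
      qed
      ultimately show ?thesis by blast
    qed
  qed
  ultimately show ?thesis unfolding CF_def by blast
qed

end

context dim_emb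
begin

lemma phi_Kat: "x \<in> D \<Longrightarrow> \<aa> \<in> \<Omega> \<Longrightarrow> \<phi> x \<aa> \<in> Kat \<aa>"
  using phi_CF CF_def by blast

lemma phi_nonneg: "x \<in> D \<Longrightarrow> \<aa> \<in> \<Omega> \<Longrightarrow> 0 \<le> \<phi> x \<aa>"
  using phi_CF CF_nonneg by blast

lemma phi_greater: "x \<in> D \<Longrightarrow> \<aa> \<in> \<Omega> \<Longrightarrow> k \<in> Kat \<aa> \<Longrightarrow> k < \<phi> x \<aa> \<Longrightarrow> \<exists>p\<in>\<aa>. \<forall>\<bb>\<in>\<Omega>. p \<in> \<bb> \<longrightarrow> k < \<phi> x \<bb>"
  using phi_CF unfolding CF_def cont_def by blast

lemma phi_smaller: "x \<in> D \<Longrightarrow> \<aa> \<in> \<Omega> \<Longrightarrow> k \<in> Kat \<aa> \<Longrightarrow> \<phi> x \<aa> < k \<Longrightarrow> \<exists>p\<in>\<aa>. \<forall>\<bb>\<in>\<Omega>. p \<in> \<bb> \<longrightarrow> \<phi> x \<bb> < k"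
  using phi_CF unfolding CF_def cont_def by blast

lemma phi_zero: "\<aa> \<in> \<Omega> \<Longrightarrow> \<phi> \<zero> \<aa> = 0"
  using phi_act[of "cpl (sp \<zero>)" \<zero> \<aa>] phi_act[of "sp \<zero>" \<zero> \<aa>] sp_zero_notin by simp

lemma phi_inj:
  assumes "x \<in> D" "y \<in> D" "\<And>\<aa>. \<aa> \<in> \<Omega> \<Longrightarrow> \<phi> x \<aa> = \<phi> y \<aa>" shows "x = y"
proof -
  have c: "CF (\<phi> \<zero>)" using phi_CF by simp
  show ?thesis
    using phi_reflect[OF assms(1,2) c] phi_reflect[OF assms(2,1) c] assms(3) phi_zero antisym by simp
qed

lemma phi_eq_zero: "x \<in> D \<Longrightarrow> (\<And>\<aa>. \<aa> \<in> \<Omega> \<Longrightarrow> \<phi> x \<aa> = 0) \<Longrightarrow> x = \<zero>"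
  using phi_inj[of x \<zero>] phi_zero by simp

lemma phi_act_zero: "x \<in> D \<Longrightarrow> p \<in> Pr \<Longrightarrow> (\<And>\<aa>. \<aa> \<in> \<Omega> \<Longrightarrow> p \<in> \<aa> \<Longrightarrow> \<phi> x \<aa> = 0) \<Longrightarrow> p \<cdot> x = \<zero>"
  using phi_eq_zero[of "p \<cdot> x"] phi_act act_D by simp

lemma phi_sp: "x \<in> D \<Longrightarrow> \<aa> \<in> \<Omega> \<Longrightarrow> \<phi> x \<aa> \<noteq> 0 \<Longrightarrow> sp x \<in> \<aa>"
  using phi_act[of "sp x" x \<aa>] by (auto split: if_splits)

lemma phi_mono: "x \<sqsubseteq> y \<Longrightarrow> \<aa> \<in> \<Omega> \<Longrightarrow> \<phi> x \<aa> \<le> \<phi> y \<aa>"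
proof -
  assume a: "x \<sqsubseteq> y" "\<aa> \<in> \<Omega>"
  then obtain z where "y = x \<oplus> z" "z \<in> D" using leE by blast
  then show ?thesis using phi_add[of x z \<aa>] a le_D2[OF a(1)] scale_le_add[OF phi_nonneg] by simp
qed

text \<open>The constant has a continuous complement in \<open>\<phi> x\<close>: the difference if v
  is finite, and \<open>\<phi> x\<close> itself, which absorbs the constant, if v is an aleph. So
  the constant lies in the range of \<phi>.\<close>

lemma phi_const_below:
  assumes x: "x \<in> D" and p: "p \<in> Pr" and v: "\<And>\<aa>. \<aa> \<in> \<Omega> \<Longrightarrow> p \<in> \<aa> \<Longrightarrow> v \<in> Kat \<aa> \<and> v \<le> \<phi> x \<aa>"
  shows "\<exists>w. w \<sqsubseteq> x \<and> (\<forall>\<aa>\<in>\<Omega>. \<phi> w \<aa> = cst v p \<aa>)"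
proof -
  have c: "CF (cst v p)" using CF_cst p v by blast
  obtain h where h: "CF h" "\<And>\<aa>. \<aa> \<in> \<Omega> \<Longrightarrow> cst v p \<aa> + h \<aa> = \<phi> x \<aa>"
  proof (cases v)
    case (Fin b)
    let ?h = "\<lambda>\<aa>. if p \<in> \<aa> then sub (\<phi> x \<aa>) b else \<phi> x \<aa>"
    have "CF ?h" by (rule CF_sub[OF phi_CF[OF x] p]) (use v Fin in auto)
    moreover have "cst v p \<aa> + ?h \<aa> = \<phi> x \<aa>" for \<aa>
      using Fin by (cases "\<phi> x \<aa>") (auto simp: cst_def zero_scale_val_def)
    ultimately show ?thesis using that by blast
  next
    case (Aleph \<xi>)
    have "cst v p \<aa> + \<phi> x \<aa> = \<phi> x \<aa>" if "\<aa> \<in> \<Omega>" for \<aa>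
      using v[OF that] Aleph by (cases "\<phi> x \<aa>") (auto simp: cst_def zero_scale_val_def max_def)
    then show ?thesis using that phi_CF x by blast
  qed
  obtain w where w: "w \<in> D" "\<forall>\<aa>\<in>\<Omega>. \<phi> w \<aa> = cst v p \<aa>" using phi_lower[OF x c h] by blast
  then have "w \<sqsubseteq> x" using phi_reflect[OF w(1) x h(1)] h(2) by simp
  then show ?thesis using w by blast
qed

lemma one_Kat: "\<aa> \<in> \<Omega> \<Longrightarrow> jf \<notin> \<aa> \<Longrightarrow> Fin (real n) \<in> Kat \<aa>"
  unfolding Fin_Kat Kfin_def by simp

lemma fin_jf: "fin x \<Longrightarrow> \<aa> \<in> \<Omega> \<Longrightarrow> sp x \<in> \<aa> \<Longrightarrow> jf \<notin> \<aa>"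
  using sp_inD jf_fin fin_D by metis

text \<open>Value 0 would persist on a neighbourhood, and e would vanish there by injectivity. Under
  \<open>jm\<close> only 0 and 1 are possible, by assumption. Off \<open>jm\<close>, where e is
  multiple-free, a value of at least 2 would yield a preimage of the constant 2 below e that is
  twice a preimage of 1; so the normalisation there is automatic.\<close>

lemma phi_unit_E:
  assumes e: "e \<in> E" and a: "\<aa> \<in> \<Omega>" "sp e \<in> \<aa>" shows "\<phi> e \<aa> = 1"
proof -
  have eD: "e \<in> D" using e E_D by blast
  have nf: "jf \<notin> \<aa>" using fin_jf E_fin e a by blast
  have K1: "1 \<in> (Kat \<aa> :: 'o scale_val set)" using one_Kat[OF a(1) nf, of 1] by (simp add: one_scale_val_def)
  have tyE: "jm \<in> \<aa> \<longleftrightarrow> \<not> mf e"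
  proof (cases "mf e")
    case True then show ?thesis using jm_mf sp_inD[OF a(1) eD a(2)] by blast
  next
    case False
    then show ?thesis using jm_E[OF e False] sp_pleq[OF eD jm(1)] Om_up[OF a] by blast
  qed
  obtain p0 where p0: "p0 \<in> \<aa>" "\<And>\<bb>. \<bb> \<in> \<Omega> \<Longrightarrow> p0 \<in> \<bb> \<Longrightarrow> (jm \<in> \<bb> \<longleftrightarrow> jm \<in> \<aa>) \<and> (jf \<in> \<bb> \<longleftrightarrow> jf \<in> \<aa>)"
    using same_type[OF a(1)] by blast
  have vals: "\<phi> e \<bb> = 0 \<or> \<phi> e \<bb> = 1 \<or> (jm \<notin> \<aa> \<and> Fin 2 \<le> \<phi> e \<bb>)" if b: "\<bb> \<in> \<Omega>" "p0 \<in> \<bb>" for \<bb>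
  proof (cases "jm \<in> \<aa>")
    case True then show ?thesis using phi_E[OF e jm_E[OF e] b(1)] tyE by auto
  next
    case False
    then have "jm \<notin> \<bb>" "jf \<notin> \<bb>" using p0 b nf by auto
    then have "\<phi> e \<bb> \<in> Fin ` \<nat> \<union> range Aleph" using phi_Kat[OF eD b(1)] unfolding Kat_def Kfin_def by simp
    then consider (nat) n where "\<phi> e \<bb> = Fin (real n)" | (aleph) \<xi> where "\<phi> e \<bb> = Aleph \<xi>" by (auto elim: Nats_cases)
    then show ?thesis
    proof cases
      case (nat n)
      then show ?thesis using False by (cases "n = 0 \<or> n = 1") (auto simp: zero_scale_val_def one_scale_val_def)
    qed (use False in auto)
  qed
  have nz: "\<phi> e \<aa> \<noteq> 0"
  proof
    assume "\<phi> e \<aa> = 0"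
    then have "\<phi> e \<aa> < 1" by (simp add: zero_scale_val_def one_scale_val_def)
    then obtain p where p: "p \<in> \<aa>" "\<And>\<bb>. \<bb> \<in> \<Omega> \<Longrightarrow> p \<in> \<bb> \<Longrightarrow> \<phi> e \<bb> < 1" using phi_smaller[OF eD a(1) K1] by blast
    have q: "mt p p0 \<in> \<aa>" using Om_mt a p p0 by blast
    have "mt p p0 \<cdot> e = \<zero>"
    proof (rule phi_act_zero[OF eD Om_Pr[OF a(1) q]])
      fix \<bb> assume b: "\<bb> \<in> \<Omega>" "mt p p0 \<in> \<bb>"
      then have pb: "p \<in> \<bb>" "p0 \<in> \<bb>" using Om_mt_iff[OF b(1) Om_Pr[OF a(1) p(1)] Om_Pr[OF a(1) p0(1)]] by auto
      have "\<phi> e \<bb> < Fin 1" using p(2) b pb by (simp add: one_scale_val_def)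
      then have "\<not> Fin 2 \<le> \<phi> e \<bb>" by (cases "\<phi> e \<bb>") auto
      then show "\<phi> e \<bb> = 0" using vals[OF b(1) pb(2)] p(2)[OF b(1) pb(1)] by auto
    qed
    then show False using sp_inD[OF a(1) eD a(2) q] by blast
  qed
  have "\<not> (jm \<notin> \<aa> \<and> Fin 2 \<le> \<phi> e \<aa>)"
  proof
    assume h: "jm \<notin> \<aa> \<and> Fin 2 \<le> \<phi> e \<aa>"
    then have "1 < \<phi> e \<aa>" by (cases "\<phi> e \<aa>") (auto simp: one_scale_val_def)
    then obtain p where p: "p \<in> \<aa>" "\<And>\<bb>. \<bb> \<in> \<Omega> \<Longrightarrow> p \<in> \<bb> \<Longrightarrow> 1 < \<phi> e \<bb>" using phi_greater[OF eD a(1) K1] by blast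
    let ?q = "mt p p0"
    have q: "?q \<in> \<aa>" "?q \<in> Pr" using Om_mt a p p0 Om_Pr by blast+
    have qb: "p \<in> \<bb>" "p0 \<in> \<bb>" if "\<bb> \<in> \<Omega>" "?q \<in> \<bb>" for \<bb>
      using Om_mt_iff[OF that(1) Om_Pr[OF a(1) p(1)] Om_Pr[OF a(1) p0(1)]] that by auto
    have K: "Fin 2 \<in> (Kat \<bb> :: 'o scale_val set)" "Fin 1 \<in> (Kat \<bb> :: 'o scale_val set)" if "\<bb> \<in> \<Omega>" "?q \<in> \<bb>" for \<bb>
      using one_Kat[of \<bb> 2] one_Kat[of \<bb> 1] p0(2)[OF that(1) qb(2)[OF that]] nf that by simp_all
    have "Fin 2 \<le> \<phi> e \<bb>" if "\<bb> \<in> \<Omega>" "?q \<in> \<bb>" for \<bb>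
      using vals[OF that(1) qb(2)[OF that]] p(2)[OF that(1) qb(1)[OF that]] by (auto simp: zero_scale_val_def one_scale_val_def)
    then have "Fin 2 \<in> (Kat \<bb> :: 'o scale_val set) \<and> Fin 2 \<le> \<phi> e \<bb>" if "\<bb> \<in> \<Omega>" "?q \<in> \<bb>" for \<bb>
      using K(1) that by blast
    from phi_const_below[OF eD q(2) this]
    obtain w2 where w2: "w2 \<sqsubseteq> e" "\<And>\<bb>. \<bb> \<in> \<Omega> \<Longrightarrow> \<phi> w2 \<bb> = cst (Fin 2) ?q \<bb>"
      by blast
    have w2D: "w2 \<in> D" using w2 le_D1 by blast
    have "Fin 1 \<in> (Kat \<bb> :: 'o scale_val set) \<and> Fin 1 \<le> \<phi> w2 \<bb>" if "\<bb> \<in> \<Omega>" "?q \<in> \<bb>" for \<bb>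
      using K(2)[OF that] w2(2)[OF that(1)] that by (simp add: cst_def)
    from phi_const_below[OF w2D q(2) this]
    obtain w1 where w1: "w1 \<sqsubseteq> w2" "\<And>\<bb>. \<bb> \<in> \<Omega> \<Longrightarrow> \<phi> w1 \<bb> = cst (Fin 1) ?q \<bb>"
      by blast
    obtain w where w: "w2 = w1 \<oplus> w" "w \<in> D" using leE w1 by blast
    have w1D: "w1 \<in> D" using w1 le_D1 by blast
    have "w = w1"
    proof (rule phi_inj[OF w(2) w1D])
      fix \<bb> assume b: "\<bb> \<in> \<Omega>"
      have "\<phi> w1 \<bb> + \<phi> w \<bb> = \<phi> w2 \<bb>" using phi_add[of w1 w] w w2D b by simp
      then show "\<phi> w \<bb> = \<phi> w1 \<bb>" unfolding w1(2)[OF b] w2(2)[OF b] cst_def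
        by (cases "\<phi> w \<bb>") (auto simp: zero_scale_val_def split: if_splits)
    qed
    then have "w1 = \<zero>" using w w2(1) tyE h unfolding mf_def by blast
    then have "\<phi> w1 \<aa> = 0" using phi_zero a by simp
    then show False using w1(2)[OF a(1)] q by (simp add: cst_def zero_scale_val_def)
  qed
  then show ?thesis using vals[OF a(1) p0(1)] nz by blast
qed

lemma phi_mult:
  assumes "mult n f \<in> D" "0 < n" "\<aa> \<in> \<Omega>"
  shows "\<phi> (mult n f) \<aa> = (case \<phi> f \<aa> of Fin s \<Rightarrow> Fin (real n * s) | Aleph \<xi> \<Rightarrow> Aleph \<xi>)"
  using assms
proof (induction n)
  case (Suc n)
  show ?case
  proof (cases "n = 0")
    case True then show ?thesis by (cases "\<phi> f \<aa>") auto
  next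
    case False
    have "mult n f \<in> D" using Suc.prems(1) mult_mono_D[of n "Suc n"] by simp
    then have "\<phi> (mult n f) \<aa> = (case \<phi> f \<aa> of Fin s \<Rightarrow> Fin (real n * s) | Aleph \<xi> \<Rightarrow> Aleph \<xi>)" using Suc False by simp
    then show ?thesis using phi_add[of f "mult n f" \<aa>] Suc.prems by (cases "\<phi> f \<aa>") (auto simp: algebra_simps)
  qed
qed simp

text \<open>\<open>2 ^ k\<close> copies of f make up a piece of e, where \<phi> has value 1; this
  fixes the value of f and hence of its n copies.\<close>

lemma phi_bu:
  assumes u: "bu r u" and a: "\<aa> \<in> \<Omega>" "sp u \<in> \<aa>" shows "\<phi> u \<aa> = Fin r"
proof -
  obtain e q k n f where *: "e \<in> E" "q \<in> Pr" "mult (2 ^ k) f = q \<cdot> e" "u = mult n f" "u \<in> D" "0 < n"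
    "r = real n / 2 ^ k" using u unfolding bu_def by blast
  have fD: "f \<in> D" using * mult_D by metis
  have eD: "e \<in> D" "q \<cdot> e \<in> D" using * E_D act_D by auto
  have "sp f \<in> \<aa>" unfolding sp_in_iff[OF a(1) fD]
  proof (intro ballI notI)
    fix p assume p: "p \<in> \<aa>" "p \<cdot> f = \<zero>"
    then have "p \<cdot> u = \<zero>" using act_mult[OF Om_Pr[OF a(1) p(1)], of n f] * by simp
    then show False using sp_inD[OF a(1) *(5) a(2) p(1)] by blast
  qed
  moreover have "f \<sqsubseteq> q \<cdot> e" using mult_le[of "2 ^ k" f] * eD by simp
  ultimately have "sp (q \<cdot> e) \<in> \<aa>" using sp_in_mono a by blast
  then have q: "q \<in> \<aa>" "sp e \<in> \<aa>" using sp_act_in[OF a(1) eD(1) *(2)] by auto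
  then have "\<phi> (mult (2 ^ k) f) \<aa> = Fin 1" using phi_act[OF *(2) eD(1) a(1)] phi_unit_E[OF *(1) a(1)] *(3) by (simp add: one_scale_val_def)
  then have "\<phi> f \<aa> = Fin (1 / 2 ^ k)" using phi_mult[of "2 ^ k" f \<aa>] *(3) eD a by (cases "\<phi> f \<aa>") (auto simp: field_simps)
  then show ?thesis using phi_mult[of n f \<aa>] * a by simp
qed

text \<open>A different value would persist on a neighbourhood by continuity, but that neighbourhood
  contains a basic piece of u.\<close>

lemma phi_fu:
  assumes u: "fu r u" and a: "\<aa> \<in> \<Omega>" "sp u \<in> \<aa>" shows "\<phi> u \<aa> = Fin r"
proof (rule ccontr)
  assume ne: "\<phi> u \<aa> \<noteq> Fin r"
  have uD: "u \<in> D" using u fu_D by blast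
  have K: "Fin r \<in> (Kat \<aa> :: 'o scale_val set)" using U_Vat[of "Fin r" u \<aa>] u a Vat_Kat by auto
  have "\<exists>p\<in>\<aa>. \<forall>\<bb>\<in>\<Omega>. p \<in> \<bb> \<longrightarrow> \<phi> u \<bb> \<noteq> Fin r"
    using phi_greater[OF uD a(1) K] phi_smaller[OF uD a(1) K] ne by (metis less_irrefl neqE)
  then obtain p where p: "p \<in> \<aa>" "\<And>\<bb>. \<bb> \<in> \<Omega> \<Longrightarrow> p \<in> \<bb> \<Longrightarrow> \<phi> u \<bb> \<noteq> Fin r" by blast
  have pP: "p \<in> Pr" using p Om_Pr a by blast
  have puD: "p \<cdot> u \<in> D" using act_D pP uD by blast
  have "p \<cdot> u \<noteq> \<zero>" using sp_inD[OF a(1) uD a(2) p(1)] .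
  then obtain q where q: "q \<in> Pr" "q \<cdot> p \<cdot> u \<noteq> \<zero>" "bu r (q \<cdot> p \<cdot> u)" using u pP unfolding fu_def by blast
  then obtain \<bb> where b: "\<bb> \<in> \<Omega>" "sp (q \<cdot> p \<cdot> u) \<in> \<bb>" using sp_ex act_D[OF q(1) puD] by blast
  have "q \<in> \<bb>" "sp (p \<cdot> u) \<in> \<bb>" using sp_act_in[OF b(1) puD q(1)] b by auto
  then have "p \<in> \<bb>" "q \<in> \<bb>" using sp_act_in[OF b(1) uD pP] by auto
  then have "\<phi> (q \<cdot> p \<cdot> u) \<bb> = \<phi> u \<bb>" using phi_act b q pP uD puD by simp
  then show False using phi_bu[OF q(3) b] p(2)[OF b(1) \<open>p \<in> \<bb>\<close>] by simp
qed

text \<open>Elements with the image of f are split off from y by \<open>phi_const_below\<close>, and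
  injectivity recognises each of them as f.\<close>

lemma phi_mult_eq:
  assumes f: "f \<in> D" "\<And>\<aa>. \<aa> \<in> \<Omega> \<Longrightarrow> \<phi> f \<aa> = cst (Fin s) p \<aa>" and s: "0 < s" and p: "p \<in> Pr"
  shows "y \<in> D \<Longrightarrow> (\<And>\<aa>. \<aa> \<in> \<Omega> \<Longrightarrow> \<phi> y \<aa> = cst (Fin (real n * s)) p \<aa>) \<Longrightarrow> y = mult n f"
proof (induction n arbitrary: y)
  case 0
  have "y = \<zero>" using phi_eq_zero[OF 0(1)] 0(2) by (simp add: cst_def zero_scale_val_def)
  then show ?case by simp
next
  case (Suc n)
  have K: "Fin s \<in> (Kat \<aa> :: 'o scale_val set) \<and> Fin s \<le> \<phi> y \<aa>" if "\<aa> \<in> \<Omega>" "p \<in> \<aa>" for \<aa>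
    using phi_Kat[OF f(1) that(1)] f(2)[OF that(1)] Suc.prems(2)[OF that(1)] that s by (simp add: cst_def)
  obtain w where w: "w \<sqsubseteq> y" "\<And>\<aa>. \<aa> \<in> \<Omega> \<Longrightarrow> \<phi> w \<aa> = cst (Fin s) p \<aa>"
    using phi_const_below[OF Suc.prems(1) p K] by blast
  have wf: "w = f" using phi_inj[OF le_D1[OF w(1)] f(1)] w(2) f(2) by simp
  then obtain z where z: "y = f \<oplus> z" "z \<in> D" using leE w by blast
  have "\<phi> z \<aa> = cst (Fin (real n * s)) p \<aa>" if a: "\<aa> \<in> \<Omega>" for \<aa>
  proof -
    have "\<phi> f \<aa> + \<phi> z \<aa> = \<phi> y \<aa>" using phi_add[of f z] z Suc.prems(1) a by simp
    then show ?thesis unfolding f(2)[OF a] Suc.prems(2)[OF a] cst_def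
      by (cases "\<phi> z \<aa>") (auto simp: zero_scale_val_def algebra_simps split: if_splits)
  qed
  then have "z = mult n f" using Suc.IH z by blast
  then show ?case using z by simp
qed

lemma phi_cst_sp:
  assumes w: "w \<in> D" "\<And>\<aa>. \<aa> \<in> \<Omega> \<Longrightarrow> \<phi> w \<aa> = cst v p \<aa>" and p: "p \<in> Pr" and a: "\<aa> \<in> \<Omega>" "sp w \<in> \<aa>"
  shows "p \<in> \<aa>"
proof (rule ccontr)
  assume "p \<notin> \<aa>"
  then have c: "cpl p \<in> \<aa>" using Om_prime a p by blast
  have "cpl p \<cdot> w = \<zero>"
    by (rule phi_act_zero[OF w(1) cpl_Pr[OF p]]) (use w(2) Om_cpl p in \<open>simp add: cst_def\<close>)
  then show False using sp_inD[OF a(1) w(1) a(2) c] by blast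
qed

lemma phi_pinf: "pinf g \<Longrightarrow> \<aa> \<in> \<Omega> \<Longrightarrow> \<phi> g \<aa> = 0 \<or> (\<exists>\<xi>. \<phi> g \<aa> = Aleph \<xi>)"
  using phi_add[of g g \<aa>] unfolding pinf_def by (cases "\<phi> g \<aa>") (auto simp: zero_scale_val_def)

text \<open>A purely infinite part of w would have aleph values, so every piece of w is finite and
  contains a small root g. The value of g is known from \<open>phi_bu\<close>, and
  \<open>phi_mult_eq\<close> shows that w is a multiple of g on the support of g.\<close>

lemma fu_of_phi:
  assumes w: "w \<in> D" "\<And>\<aa>. \<aa> \<in> \<Omega> \<Longrightarrow> \<phi> w \<aa> = cst (Fin r) p \<aa>" and p: "p \<in> Pr"
    and r: "\<And>\<aa>. \<aa> \<in> \<Omega> \<Longrightarrow> p \<in> \<aa> \<Longrightarrow> Fin r \<in> (Vat \<aa> :: 'o scale_val set)"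
  shows "fu r w"
  unfolding fu_def
proof (intro conjI ballI impI)
  fix q assume q: "q \<in> Pr" "q \<cdot> w \<noteq> \<zero>"
  let ?y = "q \<cdot> w"
  have yD: "?y \<in> D" using act_D q w by blast
  have yw: "?y \<sqsubseteq> w" using act_le q w by blast
  obtain f g where fg: "fin f" "pinf g" "?y = f \<oplus> g" using decompose yD by blast
  have gw: "g \<sqsubseteq> w" using fg yw le_add2 yD le_trans by metis
  have "g = \<zero>"
  proof (rule phi_eq_zero[OF pinf_D[OF fg(2)]])
    fix \<aa> assume a: "\<aa> \<in> \<Omega>"
    have "\<phi> g \<aa> \<le> cst (Fin r) p \<aa>" using phi_mono[OF gw a] w(2)[OF a] by simp
    then show "\<phi> g \<aa> = 0" using phi_pinf[OF fg(2) a] by (auto simp: cst_def zero_scale_val_def split: if_splits)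
  qed
  then have "fin ?y" using fg by simp
  then obtain e q0 k f where f: "e \<in> E" "q0 \<in> Pr" "mult (2 ^ k) f = q0 \<cdot> e" "f \<noteq> \<zero>" "f \<sqsubseteq> ?y"
    using small_unit q by blast
  have fD: "f \<in> D" using f le_D1 by blast
  then obtain \<aa> where a: "\<aa> \<in> \<Omega>" "sp f \<in> \<aa>" using sp_ex f by blast
  have "sp w \<in> \<aa>" using sp_in_mono[OF a(1) le_trans[OF f(5) yw]] a by blast
  then have pa: "p \<in> \<aa>" using phi_cst_sp[OF w p a(1)] by blast
  then have rV: "r \<in> Vfin \<aa>" using r a Fin_Vat by blast
  let ?f = "jt \<aa> \<cdot> f" and ?q = "mt (jt \<aa>) q0"
  have eD: "e \<in> D" "q0 \<cdot> e \<in> D" using f E_D act_D by auto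
  have fm: "mult (2 ^ k) ?f = ?q \<cdot> e" "?q \<in> Pr"
    using act_mult[OF jt(2), of "2 ^ k" f] f eD mt_act[OF jt(2) f(2)] jt(2) by auto
  have fz: "?f \<noteq> \<zero>" using sp_inD[OF a(1) fD a(2) jt(1)[OF a(1)]] .
  obtain K g m c where g: "k \<le> K" "mult (2 ^ K) g = ?q \<cdot> e" "?f = mult c g" "c = 2 ^ (K - k)" "r = real m / 2 ^ K" "0 < m"
    using rescale[OF rV f(1) fm(2,1) fz jt_act[OF fD]] by blast
  have "mult c g \<in> D" using act_D[OF jt(2) fD] g(3) by metis
  then have gf: "g \<sqsubseteq> ?f" using mult_le[of c g] g(3,4) by simp
  have gy: "g \<sqsubseteq> ?y" using gf act_le[OF jt(2) fD] f(5) le_trans by blast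
  have gD: "g \<in> D" using gf le_D1 by blast
  have gz: "g \<noteq> \<zero>" using g(3) fz mult_zero by metis
  have bg: "bu (real 1 / 2 ^ K) (mult 1 g)" unfolding bu_def using g(2) f(1) fm(2) gD by (metis One_nat_def mult_1 zero_less_one)
  let ?s = "sp g"
  have sP: "?s \<in> Pr" using gD by simp
  have gs: "\<phi> g \<bb> = cst (Fin (1 / 2 ^ K)) ?s \<bb>" if b: "\<bb> \<in> \<Omega>" for \<bb>
  proof (cases "?s \<in> \<bb>")
    case True then show ?thesis using phi_bu[OF _ b, of "1 / 2 ^ K" g] bg by (simp add: cst_def)
  next
    case False then show ?thesis using phi_sp[OF gD b] by (auto simp: cst_def)
  qed
  have sy: "?s \<cdot> ?y = ?s \<cdot> w"
  proof -
    have "q \<cdot> g = g" using act_fixI q gy w by blast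
    then show ?thesis using pleq_act2 sp_pleq gD q w by blast
  qed
  have "?s \<cdot> ?y = mult m g"
  proof (rule phi_mult_eq[OF gD gs _ sP])
    show "?s \<cdot> ?y \<in> D" using act_D sP yD by blast
    fix \<bb> assume b: "\<bb> \<in> \<Omega>"
    have "p \<in> \<bb>" if "?s \<in> \<bb>" using phi_cst_sp[OF w p b] sp_in_mono[OF b le_trans[OF gy yw]] that by blast
    then show "\<phi> (?s \<cdot> ?y) \<bb> = cst (Fin (real m * (1 / 2 ^ K))) ?s \<bb>"
      unfolding sy using phi_act[OF sP w(1) b] w(2)[OF b] g(5) by (simp add: cst_def)
  qed simp_all
  moreover from this have mD: "mult m g \<in> D" using act_D[OF sP yD] by simp
  moreover have "mult m g \<noteq> \<zero>" using mult_le[OF g(6) mD] gz le_zero by metis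
  moreover have "bu r (mult m g)" unfolding bu_def using g f(1) fm(2) mD by blast
  ultimately show "\<exists>q'\<in>Pr. q' \<cdot> q \<cdot> w \<noteq> \<zero> \<and> bu r (q' \<cdot> q \<cdot> w)" using sP by metis
qed (rule w)

end

context dim_emb
begin

text \<open>Otherwise a contains a preimage c of the constant first aleph, and c contains a preimage
  of the constant 1. By injectivity c absorbs the latter, hence so does a, against
  finiteness.\<close>

lemma fin_phi_not_aleph:
  assumes f: "fin a" and q: "q \<in> Pr" and at: "\<aa> \<in> \<Omega>" "q \<in> \<aa>"
    and inf: "\<And>\<bb>. \<bb> \<in> \<Omega> \<Longrightarrow> q \<in> \<bb> \<Longrightarrow> Aleph (LEAST \<xi>. True) \<le> \<phi> a \<bb>"
  shows False
proof -
  let ?A = "Aleph (LEAST \<xi>. True) :: 'o scale_val"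
  have D: "a \<in> D" using f fin_D by blast
  have "\<phi> a \<aa> \<noteq> 0" using inf[OF at] by (auto simp: zero_scale_val_def)
  then have "jf \<notin> \<aa>" using fin_jf[OF f at(1)] phi_sp[OF D at(1)] by blast
  \<comment> \<open>The value 1 is allowed only off type III, where finite elements live
    anyway.\<close>
  let ?q = "mt q (cpl jf)"
  have cj: "cpl jf \<in> Pr" using jf by simp
  have qq: "?q \<in> Pr" "?q \<in> \<aa>" using q cj Om_mt[OF at] Om_prime[OF at(1) jf(1)] \<open>jf \<notin> \<aa>\<close> by auto
  have b: "q \<in> \<bb>" "jf \<notin> \<bb>" if "\<bb> \<in> \<Omega>" "?q \<in> \<bb>" for \<bb>
    using Om_mt_iff[OF that(1) q cj] Om_cpl[OF that(1) jf(1)] that by auto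
  have "?A \<in> Kat \<bb> \<and> ?A \<le> \<phi> a \<bb>" if "\<bb> \<in> \<Omega>" "?q \<in> \<bb>" for \<bb>
    using inf[OF that(1) b(1)[OF that]] by simp
  from phi_const_below[OF D qq(1) this]
  obtain c where c: "c \<sqsubseteq> a" "\<And>\<bb>. \<bb> \<in> \<Omega> \<Longrightarrow> \<phi> c \<bb> = cst ?A ?q \<bb>" by blast
  have cD: "c \<in> D" using c le_D1 by blast
  have "Fin 1 \<in> (Kat \<bb> :: 'o scale_val set) \<and> Fin 1 \<le> \<phi> c \<bb>" if "\<bb> \<in> \<Omega>" "?q \<in> \<bb>" for \<bb>
    using one_Kat[OF that(1) b(2)[OF that], of 1] c(2)[OF that(1)] that by (simp add: cst_def)
  from phi_const_below[OF cD qq(1) this]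
  obtain c1 where c1: "c1 \<sqsubseteq> c" "\<And>\<bb>. \<bb> \<in> \<Omega> \<Longrightarrow> \<phi> c1 \<bb> = cst (Fin 1) ?q \<bb>" by blast
  obtain c' where c': "c = c1 \<oplus> c'" "c' \<in> D" using leE c1 by blast
  have "c' = c"
  proof (rule phi_inj[OF c'(2) cD])
    fix \<bb> assume b: "\<bb> \<in> \<Omega>"
    have "\<phi> c1 \<bb> + \<phi> c' \<bb> = \<phi> c \<bb>" using phi_add[of c1 c'] c' cD b by simp
    then show "\<phi> c' \<bb> = \<phi> c \<bb>" unfolding c1(2)[OF b] c(2)[OF b] cst_def
      by (cases "\<phi> c' \<bb>") (auto simp: zero_scale_val_def split: if_splits)
  qed
  moreover obtain d where "a = c \<oplus> d" using leE c by blast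
  ultimately have "c1 \<oplus> a = a" using c' assoc by metis
  then have "c1 = \<zero>" using fin_absorb f by blast
  then have "\<phi> c1 \<aa> = 0" using phi_zero at by simp
  then show False using c1(2)[OF at(1)] qq by (simp add: cst_def zero_scale_val_def)
qed

text \<open>If the purely infinite part of w fell short of the aleph near a point, the finite part
  would have to supply it.\<close>

lemma pinf_of_phi:
  assumes w: "w \<in> D" "\<And>\<aa>. \<aa> \<in> \<Omega> \<Longrightarrow> \<phi> w \<aa> = cst (Aleph \<xi>) p \<aa>" and p: "p \<in> Pr"
  shows "pinf w"
proof -
  obtain a b where ab: "fin a" "pinf b" "w = a \<oplus> b" using decompose w by blast
  have D: "a \<in> D" "b \<in> D" using ab fin_D pinf_D by auto
  have sum: "\<phi> a \<aa> + \<phi> b \<aa> = cst (Aleph \<xi>) p \<aa>" if "\<aa> \<in> \<Omega>" for \<aa> using phi_add[of a b] ab(3) w that by simp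
  have "b = w"
  proof (rule phi_inj[OF D(2) w(1)])
    fix \<aa> assume a: "\<aa> \<in> \<Omega>"
    have le: "\<phi> b \<aa> \<le> \<phi> w \<aa>" using phi_mono[OF _ a] ab(3) w(1) le_add2 by blast
    show "\<phi> b \<aa> = \<phi> w \<aa>"
    proof (rule ccontr)
      assume "\<phi> b \<aa> \<noteq> \<phi> w \<aa>"
      then have lt: "\<phi> b \<aa> < cst (Aleph \<xi>) p \<aa>" using le w(2)[OF a] by simp
      then have pa: "p \<in> \<aa>" using phi_nonneg[OF D(2) a] unfolding cst_def by (auto split: if_splits)
      then obtain p' where p': "p' \<in> \<aa>" "\<And>\<bb>. \<bb> \<in> \<Omega> \<Longrightarrow> p' \<in> \<bb> \<Longrightarrow> \<phi> b \<bb> < Aleph \<xi>"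
        using phi_smaller[OF D(2) a, of "Aleph \<xi>"] lt unfolding cst_def by auto
      have q: "mt p p' \<in> \<aa>" "mt p p' \<in> Pr" using Om_mt[OF a pa p'(1)] Om_Pr[OF a] by blast+
      show False
      proof (rule fin_phi_not_aleph[OF ab(1) q(2) a q(1)])
        fix \<bb> assume b: "\<bb> \<in> \<Omega>" "mt p p' \<in> \<bb>"
        then have "p \<in> \<bb>" "p' \<in> \<bb>" using Om_mt_iff[OF b(1) p Om_Pr[OF a p'(1)]] by auto
        then have "\<phi> a \<bb> + \<phi> b \<bb> = Aleph \<xi>" "\<phi> b \<bb> < Aleph \<xi>" using sum[OF b(1)] p'(2)[OF b(1)] by (auto simp: cst_def)
        then have "\<phi> a \<bb> = Aleph \<xi>" by (cases "\<phi> a \<bb>"; cases "\<phi> b \<bb>") (auto simp: max_def split: if_splits)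
        then show "Aleph (LEAST \<xi>. True) \<le> \<phi> a \<bb>" by (simp add: Least_le)
      qed
    qed
  qed
  then show ?thesis using ab by simp
qed

text \<open>Preimages of the constants of smaller index exist below w by
  \<open>phi_const_below\<close> and are units by \<open>IH\<close>; strictness and supports are
  read off from the values.\<close>

lemma phi_above_all:
  assumes w: "w \<in> D" "\<And>\<aa>. \<aa> \<in> \<Omega> \<Longrightarrow> \<phi> w \<aa> = cst (Aleph \<xi>) p \<aa>" and p: "p \<in> Pr"
    and IH: "\<And>\<eta> v. \<eta> < \<xi> \<Longrightarrow> v \<in> D \<Longrightarrow> (\<And>\<aa>. \<aa> \<in> \<Omega> \<Longrightarrow> \<phi> v \<aa> = cst (Aleph \<eta>) p \<aa>) \<Longrightarrow> au \<eta> v"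
  shows "above_all \<xi> w"
  unfolding above_all_def
proof (intro conjI allI impI)
  show "pinf w" using pinf_of_phi w p by blast
  fix \<eta> assume \<eta>: "\<eta> < \<xi>"
  have "Aleph \<eta> \<in> Kat \<aa> \<and> Aleph \<eta> \<le> \<phi> w \<aa>" if "\<aa> \<in> \<Omega>" "p \<in> \<aa>" for \<aa>
    using w(2)[OF that(1)] that \<eta> by (simp add: cst_def)
  from phi_const_below[OF w(1) p this]
  obtain v where v: "v \<sqsubseteq> w" "\<And>\<aa>. \<aa> \<in> \<Omega> \<Longrightarrow> \<phi> v \<aa> = cst (Aleph \<eta>) p \<aa>" by blast
  have vD: "v \<in> D" using v le_D1 by blast
  have zero: "q \<cdot> x = \<zero> \<longleftrightarrow> (\<forall>\<aa>\<in>\<Omega>. \<not> (q \<in> \<aa> \<and> p \<in> \<aa>))"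
    if q: "q \<in> Pr" and x: "x \<in> D" "\<And>\<aa>. \<aa> \<in> \<Omega> \<Longrightarrow> \<phi> x \<aa> = cst (Aleph \<zeta>) p \<aa>" for q x \<zeta>
  proof
    assume z: "q \<cdot> x = \<zero>"
    show "\<forall>\<aa>\<in>\<Omega>. \<not> (q \<in> \<aa> \<and> p \<in> \<aa>)"
    proof (intro ballI notI)
      fix \<aa> assume a: "\<aa> \<in> \<Omega>" "q \<in> \<aa> \<and> p \<in> \<aa>"
      then show False using phi_act[OF q x(1) a(1)] z phi_zero[OF a(1)] x(2)[OF a(1)] by (simp add: cst_def zero_scale_val_def)
    qed
  next
    assume "\<forall>\<aa>\<in>\<Omega>. \<not> (q \<in> \<aa> \<and> p \<in> \<aa>)"
    then show "q \<cdot> x = \<zero>" using phi_act_zero[OF x(1) q] x(2) by (simp add: cst_def)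
  qed
  have "q \<cdot> w = \<zero>" if q: "q \<in> Pr" "q \<cdot> w \<sqsubseteq> q \<cdot> v" for q
  proof (rule iffD2[OF zero[OF q(1) w]], assumption, intro ballI notI)
    fix \<aa> assume a: "\<aa> \<in> \<Omega>" "q \<in> \<aa> \<and> p \<in> \<aa>"
    then show False using phi_mono[OF q(2) a(1)] phi_act[OF q(1) w(1) a(1)] phi_act[OF q(1) vD a(1)] w(2)[OF a(1)] v(2)[OF a(1)] \<eta>
      by (simp add: cst_def)
  qed
  then have "slt v w" unfolding slt_def using v by blast
  moreover have "ss v w" unfolding ss_def using zero[OF _ vD v(2)] zero[OF _ w] by blast
  ultimately show "\<exists>v. au \<eta> v \<and> slt v w \<and> ss v w" using IH[OF \<eta> vD v(2)] by blast
qed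

text \<open>The two halves support each other along the induction. If a unit u had a value \<zeta>
  below \<xi> at a point of its support, it would coincide nearby with the unit of index \<zeta>
  strictly below it. The value is not larger, because a preimage of the constant \<xi> below u
  satisfies \<open>above_all\<close> and minimality puts u below it. A given preimage then equals
  the unit that \<open>au_ex\<close> finds below it.\<close>

lemma au_phi:
  "(\<forall>u \<aa>. au \<xi> u \<and> \<aa> \<in> \<Omega> \<and> sp u \<in> \<aa> \<longrightarrow> \<phi> u \<aa> = Aleph \<xi>) \<and>
   (\<forall>w p. w \<in> D \<and> p \<in> Pr \<and> (\<forall>\<aa>\<in>\<Omega>. \<phi> w \<aa> = cst (Aleph \<xi>) p \<aa>) \<longrightarrow> au \<xi> w)"
proof (induction \<xi> rule: less_induct)
  case (less \<xi>)
  have IH1: "\<phi> u \<aa> = Aleph \<eta>" if "\<eta> < \<xi>" "au \<eta> u" "\<aa> \<in> \<Omega>" "sp u \<in> \<aa>" for \<eta> u \<aa> using less that by blast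
  have IH2: "au \<eta> w" if "\<eta> < \<xi>" "w \<in> D" "p \<in> Pr" "\<And>\<aa>. \<aa> \<in> \<Omega> \<Longrightarrow> \<phi> w \<aa> = cst (Aleph \<eta>) p \<aa>" for \<eta> w p using less that by blast
  have ab: "above_all \<xi> w" if "w \<in> D" "p \<in> Pr" "\<And>\<aa>. \<aa> \<in> \<Omega> \<Longrightarrow> \<phi> w \<aa> = cst (Aleph \<xi>) p \<aa>" for w p
    by (rule phi_above_all[OF that(1,3,2)]) (use IH2 that(2) in blast)+
  have ge: "Aleph \<xi> \<le> \<phi> u \<aa>" if u: "au \<xi> u" and a: "\<aa> \<in> \<Omega>" "sp u \<in> \<aa>" for u \<aa>
  proof -
    have uD: "u \<in> D" using u au_D by blast
    have vals: "\<phi> u \<bb> = 0 \<or> (\<exists>\<zeta>. \<phi> u \<bb> = Aleph \<zeta>)" if "\<bb> \<in> \<Omega>" for \<bb> using phi_pinf au_pinf u that by blast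
    have nz: "\<phi> u \<aa> \<noteq> 0"
    proof
      assume "\<phi> u \<aa> = 0"
      then obtain p where p: "p \<in> \<aa>" "\<And>\<bb>. \<bb> \<in> \<Omega> \<Longrightarrow> p \<in> \<bb> \<Longrightarrow> \<phi> u \<bb> < Aleph (LEAST \<zeta>. True)"
        using phi_smaller[OF uD a(1), of "Aleph (LEAST \<zeta>. True)"] by (auto simp: zero_scale_val_def)
      have "p \<cdot> u = \<zero>"
      proof (rule phi_act_zero[OF uD Om_Pr[OF a(1) p(1)]])
        fix \<bb> assume b: "\<bb> \<in> \<Omega>" "p \<in> \<bb>"
        have "\<not> \<zeta> < (LEAST \<zeta>::'o. True)" for \<zeta> using not_less_Least by blast
        then show "\<phi> u \<bb> = 0" using vals[OF b(1)] p(2)[OF b] by auto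
      qed
      then show False using sp_inD[OF a(1) uD a(2) p(1)] by blast
    qed
    then obtain \<zeta> where \<zeta>: "\<phi> u \<aa> = Aleph \<zeta>" using vals a by blast
    show ?thesis
    proof (rule ccontr)
      assume "\<not> ?thesis"
      then have lt: "\<zeta> < \<xi>" using \<zeta> by simp
      then obtain v where v: "au \<zeta> v" "slt v u" "ss v u" using above_allD[OF au_above[OF u]] by blast
      have vD: "v \<in> D" using v au_D by blast
      \<comment> \<open>The successor of \<zeta>: aleph values below it are at most \<zeta>, so the
        bound at the point becomes an open condition.\<close>
      define \<kappa> where "\<kappa> = (LEAST \<eta>. \<zeta> < \<eta>)"
      have \<kappa>: "\<zeta> < \<kappa>" "\<And>\<eta>. \<eta> < \<kappa> \<Longrightarrow> \<eta> \<le> \<zeta>"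
        unfolding \<kappa>_def using LeastI[of "\<lambda>\<eta>. \<zeta> < \<eta>" \<xi>] lt not_less_Least[of _ "\<lambda>\<eta>. \<zeta> < \<eta>"] not_le by blast+
      obtain p where p: "p \<in> \<aa>" "\<And>\<bb>. \<bb> \<in> \<Omega> \<Longrightarrow> p \<in> \<bb> \<Longrightarrow> \<phi> u \<bb> < Aleph \<kappa>"
        using phi_smaller[OF uD a(1), of "Aleph \<kappa>"] \<zeta> \<kappa>(1) by auto
      let ?q = "mt p (sp u)"
      have pP: "p \<in> Pr" using p a Om_Pr by blast
      have q: "?q \<in> \<aa>" "?q \<in> Pr" using Om_mt[OF a(1) p(1) a(2)] pP uD by auto
      have "?q \<cdot> u = ?q \<cdot> v"
      proof (rule phi_inj)
        fix \<bb> assume b: "\<bb> \<in> \<Omega>"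
        show "\<phi> (?q \<cdot> u) \<bb> = \<phi> (?q \<cdot> v) \<bb>"
        proof (cases "?q \<in> \<bb>")
          case True
          then have pb: "p \<in> \<bb>" "sp u \<in> \<bb>" using Om_mt_iff[OF b pP sp_Pr[OF uD]] by auto
          then have "sp v \<in> \<bb>" using ss_in[OF b v(3) vD uD] by blast
          then have "\<phi> v \<bb> = Aleph \<zeta>" using IH1[OF lt v(1) b] by blast
          moreover have "\<phi> v \<bb> \<le> \<phi> u \<bb>" using phi_mono[OF slt_le[OF v(2)] b] .
          ultimately have "\<phi> u \<bb> = \<phi> v \<bb>" using p(2)[OF b pb(1)] \<kappa>(2) by (cases "\<phi> u \<bb>") (auto intro: order.antisym)
          then show ?thesis using phi_act[OF q(2)] uD vD b by simp
        next
          case False then show ?thesis using phi_act[OF q(2)] uD vD b by simp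
        qed
      qed (use act_D q uD vD in auto)
      then have "?q \<cdot> u = \<zero>" using sltD[OF v(2) q(2)] act_D[OF q(2) uD] le_refl by simp
      then show False using sp_inD[OF a(1) uD a(2) q(1)] by blast
    qed
  qed
  have eq: "\<phi> u \<aa> = Aleph \<xi>" if u: "au \<xi> u" and a: "\<aa> \<in> \<Omega>" "sp u \<in> \<aa>" for u \<aa>
  proof -
    have uD: "u \<in> D" using u au_D by blast
    have "Aleph \<xi> \<in> Kat \<bb> \<and> Aleph \<xi> \<le> \<phi> u \<bb>" if "\<bb> \<in> \<Omega>" "sp u \<in> \<bb>" for \<bb> using ge[OF u that] by simp
    from phi_const_below[OF uD sp_Pr[OF uD] this]
    obtain w where w: "w \<sqsubseteq> u" "\<And>\<bb>. \<bb> \<in> \<Omega> \<Longrightarrow> \<phi> w \<bb> = cst (Aleph \<xi>) (sp u) \<bb>" by blast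
    have wD: "w \<in> D" using w le_D1 by blast
    have "ss w u" unfolding ss_def
    proof (intro ballI iffI)
      fix q assume q: "q \<in> Pr"
      show "q \<cdot> w = \<zero>" if "q \<cdot> u = \<zero>" using act_zero_mono[OF q w(1) that] .
      show "q \<cdot> u = \<zero>" if z: "q \<cdot> w = \<zero>"
      proof (rule phi_act_zero[OF uD q])
        fix \<bb> assume b: "\<bb> \<in> \<Omega>" "q \<in> \<bb>"
        have "\<phi> w \<bb> = 0" using phi_act[OF q wD b(1)] z phi_zero[OF b(1)] b by simp
        then have "sp u \<notin> \<bb>" using w(2)[OF b(1)] by (auto simp: cst_def zero_scale_val_def)
        then show "\<phi> u \<bb> = 0" using phi_sp[OF uD b(1)] by blast
      qed
    qed
    moreover have "above_all \<xi> w" using ab[OF wD sp_Pr[OF uD] w(2)] .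
    ultimately have "u \<sqsubseteq> w" using au_least[OF u] by blast
    then have "\<phi> u \<aa> \<le> Aleph \<xi>" using phi_mono[OF _ a(1)] w(2)[OF a(1)] a(2) by (metis cst_def)
    then show ?thesis using ge[OF u a] by (rule order.antisym)
  qed
  have "au \<xi> w" if w: "w \<in> D" "p \<in> Pr" "\<forall>\<aa>\<in>\<Omega>. \<phi> w \<aa> = cst (Aleph \<xi>) p \<aa>" for w p
  proof -
    have w3: "\<And>\<aa>. \<aa> \<in> \<Omega> \<Longrightarrow> \<phi> w \<aa> = cst (Aleph \<xi>) p \<aa>" using w by blast
    obtain u where u: "au \<xi> u" "ss u w" "u \<sqsubseteq> w" using au_ex ab[OF w(1,2) w3] by blast
    have uD: "u \<in> D" using u au_D by blast
    have "u = w"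
    proof (rule phi_inj[OF uD w(1)])
      fix \<aa> assume a: "\<aa> \<in> \<Omega>"
      show "\<phi> u \<aa> = \<phi> w \<aa>"
      proof (cases "p \<in> \<aa>")
        case True
        then have "\<phi> w \<aa> = Aleph \<xi>" using w3[OF a] by (simp add: cst_def)
        moreover from this have "sp w \<in> \<aa>" using phi_sp[OF w(1) a] by (simp add: zero_scale_val_def)
        ultimately show ?thesis using eq[OF u(1) a] ss_in[OF a u(2) uD w(1)] by simp
      next
        case False
        then have "\<phi> w \<aa> = 0" using w3[OF a] by (simp add: cst_def)
        then show ?thesis using phi_mono[OF u(3) a] phi_nonneg[OF uD a] by simp
      qed
    qed
    then show ?thesis using u by simp
  qed
  then show ?case using eq by blast
qed

lemma phi_U:
  assumes "U v u" "\<aa> \<in> \<Omega>" "sp u \<in> \<aa>" shows "\<phi> u \<aa> = v"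
proof (cases v)
  case (Fin r) then show ?thesis using assms phi_fu by simp
next
  case (Aleph \<xi>) then show ?thesis using assms au_phi by simp
qed

lemma U_of_phi:
  assumes w: "w \<in> D" "\<And>\<aa>. \<aa> \<in> \<Omega> \<Longrightarrow> \<phi> w \<aa> = cst v p \<aa>" and p: "p \<in> Pr"
    and v: "\<And>\<aa>. \<aa> \<in> \<Omega> \<Longrightarrow> p \<in> \<aa> \<Longrightarrow> v \<in> Vat \<aa>"
  shows "U v w"
proof (cases v)
  case (Fin r) then show ?thesis using fu_of_phi[OF w(1) _ p, of r] w(2) v by simp
next
  case (Aleph \<xi>)
  then have "\<forall>\<aa>\<in>\<Omega>. \<phi> w \<aa> = cst (Aleph \<xi>) p \<aa>" using w(2) by simp
  then have "au \<xi> w" using au_phi[of \<xi>] w(1) p by blast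
  then show ?thesis using Aleph by simp
qed

text \<open>Units are sent to their values, so \<phi> is at least \<open>eps\<close>. If it were
  larger at a point, \<open>Kat_gap\<close> would give a unit value v above \<open>eps x\<close> and
  at most \<open>\<phi> x\<close> nearby; the preimage of the constant v is a unit below x by
  \<open>U_of_phi\<close>, against the definition of \<open>eps\<close>.\<close>

theorem phi_eq_eps:
  assumes x: "x \<in> D" and a: "\<aa> \<in> \<Omega>" shows "\<phi> x \<aa> = eps x \<aa>"
proof (rule order.antisym)
  show "eps x \<aa> \<le> \<phi> x \<aa>"
  proof (rule eps_leI[OF a phi_nonneg[OF x a]])
    fix v :: "'o scale_val" and u assume u: "U v u" "u \<sqsubseteq> x" "sp u \<in> \<aa>"
    then show "v \<le> \<phi> x \<aa>" using phi_U[OF u(1) a u(3)] phi_mono[OF u(2) a] by simp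
  qed
  show "\<phi> x \<aa> \<le> eps x \<aa>"
  proof (rule ccontr)
    let ?k = "eps x \<aa>"
    assume "\<not> ?thesis"
    then have l: "?k < \<phi> x \<aa>" by simp
    have kK: "?k \<in> Kat \<aa>" using eps_Kat a by blast
    obtain p0 where p0: "p0 \<in> \<aa>" "\<And>\<bb>. \<bb> \<in> \<Omega> \<Longrightarrow> p0 \<in> \<bb> \<Longrightarrow> (Kat \<bb> :: 'o scale_val set) = Kat \<aa> \<and> (Vat \<bb> :: 'o scale_val set) = Vat \<aa>"
      using same_type[OF a] type_Kat by metis
    have main: False if v: "v \<in> Vat \<aa>" "?k < v" "\<exists>p\<in>\<aa>. \<forall>\<bb>\<in>\<Omega>. p \<in> \<bb> \<and> p0 \<in> \<bb> \<longrightarrow> v \<le> \<phi> x \<bb>" for v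
    proof -
      obtain p where p: "p \<in> \<aa>" "\<And>\<bb>. \<bb> \<in> \<Omega> \<Longrightarrow> p \<in> \<bb> \<Longrightarrow> p0 \<in> \<bb> \<Longrightarrow> v \<le> \<phi> x \<bb>" using v by blast
      let ?q = "mt p p0"
      have q: "?q \<in> \<aa>" "?q \<in> Pr" using Om_mt[OF a p(1) p0(1)] Om_Pr[OF a] by blast+
      have b: "p \<in> \<bb>" "p0 \<in> \<bb>" if "\<bb> \<in> \<Omega>" "?q \<in> \<bb>" for \<bb>
        using Om_mt_iff[OF that(1) Om_Pr[OF a p(1)] Om_Pr[OF a p0(1)]] that by auto
      have V: "v \<in> Vat \<bb>" if "\<bb> \<in> \<Omega>" "?q \<in> \<bb>" for \<bb> using p0(2)[OF that(1) b(2)[OF that]] v by simp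
      then have "v \<in> Kat \<bb> \<and> v \<le> \<phi> x \<bb>" if "\<bb> \<in> \<Omega>" "?q \<in> \<bb>" for \<bb>
        using p(2)[OF that(1) b[OF that]] Vat_Kat that by blast
      from phi_const_below[OF x q(2) this]
      obtain w where w: "w \<sqsubseteq> x" "\<And>\<bb>. \<bb> \<in> \<Omega> \<Longrightarrow> \<phi> w \<bb> = cst v ?q \<bb>" by blast
      have wD: "w \<in> D" using w le_D1 by blast
      have "U v w" using U_of_phi[OF wD w(2) q(2) V] .
      moreover have "\<phi> w \<aa> \<noteq> 0" using w(2)[OF a] q v(2) eps_nonneg[OF a, of x] by (auto simp: cst_def)
      then have "sp w \<in> \<aa>" using phi_sp[OF wD a] by blast
      ultimately have "v \<le> ?k" using eps_ge[OF a _ w(1)] by blast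
      then show False using v by simp
    qed
    show False
    proof (cases "\<exists>v\<in>Vat \<aa>. ?k < v \<and> v < \<phi> x \<aa>")
      case True
      then obtain v where v: "v \<in> Vat \<aa>" "?k < v" "v < \<phi> x \<aa>" by blast
      have vK: "v \<in> Kat \<aa>" using v Vat_Kat by blast
      show False using main[OF v(1,2)] phi_greater[OF x a vK v(3)] less_imp_le by meson
    next
      case False
      then have g: "\<phi> x \<aa> \<in> Vat \<aa>" "\<not> (\<exists>w\<in>Kat \<aa>. ?k < w \<and> w < \<phi> x \<aa>)" using Kat_gap[OF kK phi_Kat[OF x a] l] by blast+
      obtain p where p: "p \<in> \<aa>" "\<And>\<bb>. \<bb> \<in> \<Omega> \<Longrightarrow> p \<in> \<bb> \<Longrightarrow> ?k < \<phi> x \<bb>" using phi_greater[OF x a kK l] by blast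
      have "\<phi> x \<aa> \<le> \<phi> x \<bb>" if b: "\<bb> \<in> \<Omega>" "p \<in> \<bb> \<and> p0 \<in> \<bb>" for \<bb>
      proof -
        have "?k < \<phi> x \<bb>" "\<phi> x \<bb> \<in> Kat \<aa>" using p(2)[OF b(1)] p0(2)[OF b(1)] phi_Kat[OF x b(1)] b(2) by auto
        then show ?thesis using g(2) by (meson not_le)
      qed
      then show False using main[OF g(1) l] p(1) by blast
    qed
  qed
qed

end

section \<open>Continuous dimension scales\<close>

context continuous_dimension_scale
begin

abbreviation "z0 \<equiv> Some (pzero S)"
abbreviation "DS \<equiv> Some ` elems S"

text \<open>\<open>z0\<close> is neutral even for values outside the carrier, because
  \<open>comm_monoid\<close> speaks about the whole type; every other sum leaving the carrier is
  \<open>None\<close>.\<close>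

definition tadd :: "'a option \<Rightarrow> 'a option \<Rightarrow> 'a option" where
  "tadd x y = (if x = z0 then y else if y = z0 then x else
     (case (x, y) of (Some a, Some b) \<Rightarrow> if a \<in> elems S \<and> b \<in> elems S then pplus S a b else None | _ \<Rightarrow> None))"

lemma zero_elem: "pzero S \<in> elems S"
  and plus_elem: "a \<in> elems S \<Longrightarrow> b \<in> elems S \<Longrightarrow> pplus S a b = Some c \<Longrightarrow> c \<in> elems S"
  and plus_assoc: "a \<in> elems S \<Longrightarrow> b \<in> elems S \<Longrightarrow> c \<in> elems S \<Longrightarrow>
        Option.bind (pplus S a b) (\<lambda>u. pplus S u c) = Option.bind (pplus S b c) (\<lambda>v. pplus S a v)"
  and plus_comm: "a \<in> elems S \<Longrightarrow> b \<in> elems S \<Longrightarrow> pplus S a b = pplus S b a"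
  and plus_zero: "a \<in> elems S \<Longrightarrow> pplus S a (pzero S) = Some a"
  using pcm unfolding partial_comm_monoid_def by blast+

lemma plus_eq_zero:
  assumes "a \<in> elems S" "b \<in> elems S" "pplus S a b = z0" shows "a = pzero S"
proof -
  have "ple S a (pzero S)" using assms unfolding ple_def by blast
  moreover have "ple S (pzero S) a" using assms plus_comm plus_zero zero_elem unfolding ple_def by metis
  ultimately show ?thesis using M1_antisym assms zero_elem by blast
qed

lemma tadd_Some: "a \<in> elems S \<Longrightarrow> b \<in> elems S \<Longrightarrow> tadd (Some a) (Some b) = pplus S a b"
  unfolding tadd_def using plus_zero plus_comm zero_elem by auto

lemma tadd_proper: "x \<noteq> z0 \<Longrightarrow> y \<noteq> z0 \<Longrightarrow> x \<notin> DS \<or> y \<notin> DS \<Longrightarrow> tadd x y = None"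
  unfolding tadd_def by (auto split: option.splits)

lemma tadd_zero: "tadd z0 y = y" "tadd x z0 = x"
  unfolding tadd_def by auto

lemma tadd_D: "tadd x y \<in> DS \<Longrightarrow> x \<in> DS"
proof -
  assume a: "tadd x y \<in> DS"
  show ?thesis
  proof (cases "x = z0 \<or> y = z0")
    case True
    have "z0 \<in> DS" using zero_elem by (rule imageI)
    then show ?thesis using True a tadd_zero(2)[of x] by metis
  next
    case False
    have "None \<notin> DS" by blast
    then show ?thesis using False a tadd_proper[of x y] by metis
  qed
qed

text \<open>Used for associativity: a partial sum of nonzero arguments never falls under the
  neutrality clauses of \<open>tadd\<close>.\<close>

lemma tadd_nonzero: 
  assumes "x \<noteq> z0" "y \<noteq> z0" shows "tadd x y \<noteq> z0"
proof
  assume e: "tadd x y = z0"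
  then have D: "x \<in> DS" "y \<in> DS" using tadd_proper[of x y] assms by (metis option.distinct(1))+
  then obtain a b where "x = Some a" "y = Some b" "a \<in> elems S" "b \<in> elems S" by blast
  then show False using e assms(1) tadd_Some[of a b] plus_eq_zero[of a b] by metis
qed

lemma tadd_monoid: "comm_monoid tadd z0"
proof
  fix x y w :: "'a option"
  show comm: "tadd x y = tadd y x" for x y
    unfolding tadd_def using plus_comm by (auto split: option.splits)
  show "tadd x z0 = x" by (rule tadd_zero)
  have none: "tadd None y = None" if "y \<noteq> z0" for y using that tadd_proper by force
  show "tadd (tadd x y) w = tadd x (tadd y w)"
  proof (cases "x = z0 \<or> y = z0 \<or> w = z0")
    case True then show ?thesis using tadd_zero by auto
  next
    case False
    then have nz: "tadd x y \<noteq> z0" "tadd y w \<noteq> z0" using tadd_nonzero by auto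
    show ?thesis
    proof (cases "x \<in> DS \<and> y \<in> DS \<and> w \<in> DS")
      case True
      then obtain a b c where abc: "x = Some a" "y = Some b" "w = Some c" "a \<in> elems S" "b \<in> elems S" "c \<in> elems S" by blast
      have l: "tadd (pplus S a b) w = Option.bind (pplus S a b) (\<lambda>u. pplus S u c)"
      proof (cases "pplus S a b")
        case None
        then show ?thesis using none[of w] False by simp
      next
        case (Some u)
        then show ?thesis using tadd_Some[OF plus_elem[OF abc(4,5) Some] abc(6)] abc(3) by simp
      qed
      have r: "tadd x (pplus S b c) = Option.bind (pplus S b c) (\<lambda>v. pplus S a v)"
      proof (cases "pplus S b c")
        case None
        then show ?thesis using none[of x] comm[of x None] False by simp
      next
        case (Some u)
        then show ?thesis using tadd_Some[OF abc(4) plus_elem[OF abc(5,6) Some]] abc(1) by simp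
      qed
      show ?thesis using l r abc plus_assoc tadd_Some by simp
    next
      case f: False
      consider "x \<notin> DS" | "y \<notin> DS" | "w \<notin> DS" using f by blast
      then show ?thesis
      proof cases
        case 1
        then have "tadd x y = None" "tadd x (tadd y w) = None" using tadd_proper False nz by auto
        then show ?thesis using none False by simp
      next
        case 2
        then have "tadd x y = None" "tadd y w = None" using tadd_proper False by auto
        then show ?thesis using none False comm by metis
      next
        case 3
        then have "tadd y w = None" "tadd (tadd x y) w = None" using tadd_proper False nz by auto
        then show ?thesis using none False comm by metis
      qed
    qed
  qed
qed

lemma total: "total_pcm tadd z0 DS"
proof -
  interpret comm_monoid tadd z0 by (rule tadd_monoid)
  show ?thesis by unfold_locales (auto intro: tadd_D zero_elem simp: zero_elem)
qed

interpretation T: total_pcm tadd z0 DS by (rule total)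

lemma le_iff: "a \<in> elems S \<Longrightarrow> b \<in> elems S \<Longrightarrow> T.le (Some a) (Some b) \<longleftrightarrow> ple S a b"
proof
  assume ab: "a \<in> elems S" "b \<in> elems S"
  show "ple S a b" if "T.le (Some a) (Some b)"
    using T.leE[OF that] ab tadd_Some unfolding ple_def by (metis imageE)
  show "T.le (Some a) (Some b)" if "ple S a b"
    using that ab tadd_Some T.leI unfolding ple_def by (metis image_eqI)
qed

lemma orth_iff': "a \<in> elems S \<Longrightarrow> b \<in> elems S \<Longrightarrow> T.orth (Some a) (Some b) \<longleftrightarrow> orthogonal S a b"
proof -
  assume ab: "a \<in> elems S" "b \<in> elems S"
  have "T.orth (Some a) (Some b) \<longleftrightarrow> (\<forall>t\<in>DS. T.le t (Some a) \<and> T.le t (Some b) \<longrightarrow> t = z0)"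
    unfolding T.orth_def using T.le_D1 by blast
  also have "\<dots> \<longleftrightarrow> orthogonal S a b" unfolding orthogonal_def using ab le_iff by auto
  finally show ?thesis .
qed

lemma fin_iff: "a \<in> elems S \<Longrightarrow> T.fin (Some a) \<longleftrightarrow> directly_finite S a"
proof -
  assume a: "a \<in> elems S"
  have "T.fin (Some a) \<longleftrightarrow> (\<forall>x\<in>DS. tadd x (Some a) = Some a \<longrightarrow> x = z0)"
    unfolding T.fin_def using a tadd_D by (metis image_eqI)
  also have "\<dots> \<longleftrightarrow> directly_finite S a" unfolding directly_finite_def using a tadd_Some by auto
  finally show ?thesis .
qed

lemma pinf_iff: "a \<in> elems S \<Longrightarrow> T.pinf (Some a) \<longleftrightarrow> purely_infinite S a"
  unfolding T.pinf_def purely_infinite_def using tadd_Some by auto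

lemma mf_iff: "a \<in> elems S \<Longrightarrow> T.mf (Some a) \<longleftrightarrow> multiple_free S a"
proof -
  assume a: "a \<in> elems S"
  have "T.mf (Some a) \<longleftrightarrow> (\<forall>x\<in>DS. T.le (tadd x x) (Some a) \<longrightarrow> x = z0)"
    unfolding T.mf_def using a tadd_D T.le_D1 by (metis image_eqI)
  also have "\<dots> \<longleftrightarrow> (\<forall>x\<in>elems S. T.le (pplus S x x) (Some a) \<longrightarrow> x = pzero S)" using tadd_Some by auto
  also have "\<dots> \<longleftrightarrow> multiple_free S a"
  proof -
    have "T.le (pplus S x x) (Some a) \<longleftrightarrow> (\<exists>y. pplus S x x = Some y \<and> ple S y a)" if x: "x \<in> elems S" for x
    proof (cases "pplus S x x")
      case None
      then show ?thesis using T.le_D1 by fastforce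
    next
      case (Some y)
      then show ?thesis using le_iff[OF plus_elem[OF x x Some] a] by simp
    qed
    then show ?thesis unfolding multiple_free_def by auto
  qed
  finally show ?thesis .
qed

lemma llrem_iff': "a \<in> elems S \<Longrightarrow> b \<in> elems S \<Longrightarrow> T.llrem (Some a) (Some b) \<longleftrightarrow> ll_rem S a b"
proof -
  assume ab: "a \<in> elems S" "b \<in> elems S"
  have "x \<in> DS" if "T.le (Some b) (tadd (Some a) x)" for x using T.add_D2[OF T.le_D2[OF that]] .
  then have "T.llrem (Some a) (Some b) \<longleftrightarrow> ple S a b \<and> (\<forall>x\<in>DS. T.le (Some b) (tadd (Some a) x) \<longrightarrow> T.le (Some b) x)"
    unfolding T.llrem_def le_iff[OF ab] by blast
  also have "\<dots> \<longleftrightarrow> ple S a b \<and> (\<forall>x\<in>elems S. T.le (Some b) (pplus S a x) \<longrightarrow> ple S b x)"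
    using tadd_Some ab le_iff by auto
  also have "\<dots> \<longleftrightarrow> ll_rem S a b"
  proof -
    have "T.le (Some b) (pplus S a x) \<longleftrightarrow> (\<exists>y. pplus S a x = Some y \<and> ple S b y)" if x: "x \<in> elems S" for x
    proof (cases "pplus S a x")
      case None
      then show ?thesis using T.le_D2 by fastforce
    next
      case (Some y)
      then show ?thesis using le_iff[OF ab(2) plus_elem[OF ab(1) x Some]] by simp
    qed
    then show ?thesis unfolding ll_rem_def by auto
  qed
  finally show ?thesis .
qed

lemma Proj_ext: "p \<in> Proj S \<Longrightarrow> p \<in> extensional (elems S)"
  and Proj_elem: "p \<in> Proj S \<Longrightarrow> x \<in> elems S \<Longrightarrow> p x \<in> elems S"
  and Proj_zero: "p \<in> Proj S \<Longrightarrow> p (pzero S) = pzero S"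
  and Proj_add: "p \<in> Proj S \<Longrightarrow> a \<in> elems S \<Longrightarrow> b \<in> elems S \<Longrightarrow> pplus S a b = Some c \<Longrightarrow> pplus S (p a) (p b) = Some (p c)"
  and Proj_split: "p \<in> Proj S \<Longrightarrow> x \<in> elems S \<Longrightarrow> \<exists>y\<in>perp S (p ` elems S). pplus S (p x) y = Some x"
  unfolding Proj_def by (auto simp: PiE_def)

text \<open>\<open>act_ex\<close> holds because \<open>Proj S\<close> contains every extensional map
  with the defining properties; a given f is read back on the carrier and made extensional.\<close>

lemma proj: "proj_monoid tadd z0 DS (Proj S) map_option"
proof unfold_locales
  fix a b c d assume e: "tadd a b = tadd c d" and D: "tadd c d \<in> DS"
  then have "a \<in> DS" "b \<in> DS" "c \<in> DS" "d \<in> DS" using tadd_D T.add_D2 by metis+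
  then obtain a' b' c' d' where *: "a = Some a'" "b = Some b'" "c = Some c'" "d = Some d'"
    "a' \<in> elems S" "b' \<in> elems S" "c' \<in> elems S" "d' \<in> elems S" by blast
  obtain s where s: "pplus S a' b' = Some s" "pplus S c' d' = Some s"
    using e D tadd_Some[OF *(5,6)] tadd_Some[OF *(7,8)] *(1-4) by auto
  have "\<exists>c00\<in>elems S. \<exists>c01\<in>elems S. \<exists>c10\<in>elems S. \<exists>c11\<in>elems S.
           pplus S c00 c01 = Some a' \<and> pplus S c10 c11 = Some b' \<and>
           pplus S c00 c10 = Some c' \<and> pplus S c01 c11 = Some d'"
    by (rule M1_refinement[unfolded refinement_def, rule_format, of a' b' c' d' s]) (simp_all add: * s)
  then obtain c00 c01 c10 c11 where "c00 \<in> elems S" "c01 \<in> elems S" "c10 \<in> elems S" "c11 \<in> elems S"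
    "pplus S c00 c01 = Some a'" "pplus S c10 c11 = Some b'" "pplus S c00 c10 = Some c'" "pplus S c01 c11 = Some d'"
    by blast
  then have "a = tadd (Some c00) (Some c01) \<and> b = tadd (Some c10) (Some c11) \<and> c = tadd (Some c00) (Some c10) \<and> d = tadd (Some c01) (Some c11)"
    using * tadd_Some by simp
  then show "\<exists>w x y z. a = tadd w x \<and> b = tadd y z \<and> c = tadd w y \<and> d = tadd x z" by blast
next
  fix x y assume l: "T.le x y" "T.le y x"
  then obtain a b where "x = Some a" "y = Some b" "a \<in> elems S" "b \<in> elems S" using T.le_D1 by blast
  then show "x = y" using l le_iff M1_antisym by auto
next
  fix p x assume "p \<in> Proj S" "x \<in> DS" then show "map_option p x \<in> DS" using Proj_elem by auto
next
  fix p assume "p \<in> Proj S" then show "map_option p z0 = z0" using Proj_zero by simp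
next
  fix p x y assume p: "p \<in> Proj S" and d: "tadd x y \<in> DS"
  then have "x \<in> DS" "y \<in> DS" using tadd_D T.add_D2 by metis+
  then obtain a b where "x = Some a" "y = Some b" "a \<in> elems S" "b \<in> elems S" by blast
  then show "map_option p (tadd x y) = tadd (map_option p x) (map_option p y)"
    using d tadd_Some Proj_add[OF p] Proj_elem[OF p] by auto
next
  fix p x assume p: "p \<in> Proj S" and x: "x \<in> DS"
  then obtain a where a: "x = Some a" "a \<in> elems S" by blast
  obtain y where y: "y \<in> perp S (p ` elems S)" "pplus S (p a) y = Some a" using Proj_split p a by blast
  have yS: "y \<in> elems S" "\<And>z. z \<in> elems S \<Longrightarrow> orthogonal S y (p z)" using y unfolding perp_def by auto
  then have "tadd (map_option p x) (Some y) = x \<and> (\<forall>z\<in>DS. T.orth (Some y) (map_option p z))"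
    using a y tadd_Some Proj_elem[OF p] orth_iff' by auto
  then show "\<exists>y. tadd (map_option p x) y = x \<and> (\<forall>z\<in>DS. T.orth y (map_option p z))" by blast
next
  fix f assume fD: "\<And>x. x \<in> DS \<Longrightarrow> f x \<in> DS" and f0: "f z0 = z0"
    and fa: "\<And>x y. tadd x y \<in> DS \<Longrightarrow> f (tadd x y) = tadd (f x) (f y)"
    and fs: "\<And>x. x \<in> DS \<Longrightarrow> \<exists>y. tadd (f x) y = x \<and> (\<forall>z\<in>DS. T.orth y (f z))"
  define p where "p = (\<lambda>a\<in>elems S. the (f (Some a)))"
  have p: "f (Some a) = Some (p a) \<and> p a \<in> elems S" if "a \<in> elems S" for a
    using fD[of "Some a"] that unfolding p_def by auto
  have "p \<in> Proj S" unfolding Proj_def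
  proof (intro CollectI conjI ballI allI impI)
    show "p \<in> elems S \<rightarrow>\<^sub>E elems S" using p unfolding p_def by auto
    show "p (pzero S) = pzero S" using p[OF zero_elem] f0 by simp
    fix a b c assume h: "a \<in> elems S" "b \<in> elems S" "pplus S a b = Some c"
    then have c: "c \<in> elems S" using plus_elem[OF h] by blast
    then have "f (Some c) = tadd (f (Some a)) (f (Some b))" using fa[of "Some a" "Some b"] h tadd_Some by simp
    then show "pplus S (p a) (p b) = Some (p c)" using p h c tadd_Some by simp
  next
    fix x assume x: "x \<in> elems S"
    then obtain y where y: "tadd (f (Some x)) y = Some x" "\<forall>z\<in>DS. T.orth y (f z)" using fs by blast
    then have "y \<in> DS" using T.add_D2[of "f (Some x)" y] x by simp
    then obtain b where b: "y = Some b" "b \<in> elems S" by blast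
    then have "b \<in> perp S (p ` elems S)" unfolding perp_def using y(2) p orth_iff' by auto
    moreover have "pplus S (p x) b = Some x" using y b p x tadd_Some by simp
    ultimately show "\<exists>y\<in>perp S (p ` elems S). pplus S (p x) y = Some x" by blast
  qed
  moreover have "\<forall>x\<in>DS. map_option p x = f x" using p by auto
  ultimately show "\<exists>p\<in>Proj S. \<forall>x\<in>DS. map_option p x = f x" by blast
qed

interpretation T: proj_monoid tadd z0 DS "Proj S" map_option by (rule proj)

lemma Proj_fix: "p \<in> Proj S \<Longrightarrow> a \<in> elems S \<Longrightarrow> a \<in> p ` elems S \<longleftrightarrow> p a = a"
proof
  assume p: "p \<in> Proj S"
  assume "a \<in> p ` elems S"
  then obtain b where "b \<in> elems S" "a = p b" by blast
  then show "p a = a" using T.act_idem[OF p, of "Some b"] by simp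
qed (metis imageI)

lemma Proj_eqI:
  assumes "p \<in> Proj S" "q \<in> Proj S" "\<And>a. a \<in> elems S \<Longrightarrow> p a = q a" shows "p = q"
  using extensionalityI[OF Proj_ext[OF assms(1)] Proj_ext[OF assms(2)]] assms(3) by blast

lemma proj_le_iff: "p \<in> Proj S \<Longrightarrow> q \<in> Proj S \<Longrightarrow> proj_le S p q \<longleftrightarrow> T.pleq p q"
proof -
  assume pq: "p \<in> Proj S" "q \<in> Proj S"
  have "proj_le S p q \<longleftrightarrow> (\<forall>a\<in>elems S. p a \<in> q ` elems S)" unfolding proj_le_def by blast
  also have "\<dots> \<longleftrightarrow> (\<forall>a\<in>elems S. q (p a) = p a)" using Proj_fix Proj_elem pq by blast
  finally show ?thesis unfolding T.pleq_def using pq by auto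
qed

lemma range_unique:
  assumes "p \<in> Proj S" "q \<in> Proj S" "p ` elems S = q ` elems S" shows "p = q"
proof (rule Proj_eqI[OF assms(1,2)])
  fix a assume a: "a \<in> elems S"
  have "T.pleq p q" "T.pleq q p" using proj_le_iff[OF assms(1,2)] proj_le_iff[OF assms(2,1)] assms(3) unfolding proj_le_def by auto
  then have "map_option p (Some a) = map_option q (Some a)" using T.pleq_le T.antisym a by blast
  then show "p a = q a" by simp
qed

lemma proj_onto_eq: "p \<in> Proj S \<Longrightarrow> p ` elems S = X \<Longrightarrow> proj_onto S X = p"
  unfolding proj_onto_def by (rule the_equality) (use range_unique in blast)+

lemma range_eqI:
  assumes "p \<in> Proj S" "X \<subseteq> elems S" "\<And>a. a \<in> elems S \<Longrightarrow> p a = a \<longleftrightarrow> a \<in> X"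
  shows "p ` elems S = X"
  using assms Proj_fix Proj_elem by blast

lemma perp_sub: "perp S X \<subseteq> elems S" unfolding perp_def by blast

text \<open>Identifies the complement, chosen by its action, with the projection onto the orthogonal
  of the range; (M3) speaks about the latter.\<close>

lemma cpl_range:
  assumes p: "p \<in> Proj S" shows "T.cpl p \<in> Proj S" "T.cpl p ` elems S = perp S (p ` elems S)"
proof -
  show c: "T.cpl p \<in> Proj S" using p by simp
  obtain q where q: "T.compl_pair p q" "\<forall>x\<in>DS. map_option q x = x \<longleftrightarrow> (\<forall>z\<in>DS. T.orth x (map_option p z))"
    using T.compl_ex_orth p by blast
  have "T.cpl p = q"
  proof (rule Proj_eqI[OF c])
    show "q \<in> Proj S" using q T.compl_pair_def by blast
    fix a assume "a \<in> elems S"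
    then show "T.cpl p a = q a" using T.compl_pair_act[OF q(1), of "Some a"] by simp
  qed
  moreover have "q a = a \<longleftrightarrow> a \<in> perp S (p ` elems S)" if a: "a \<in> elems S" for a
  proof -
    have "q a = a \<longleftrightarrow> (\<forall>z\<in>DS. T.orth (Some a) (map_option p z))" using q(2) a by auto
    also have "\<dots> \<longleftrightarrow> a \<in> perp S (p ` elems S)" unfolding perp_def using a orth_iff' Proj_elem[OF p] by auto
    finally show ?thesis .
  qed
  ultimately show "T.cpl p ` elems S = perp S (p ` elems S)" using range_eqI c perp_sub by metis
qed

lemma proj_perp_eq: "p \<in> Proj S \<Longrightarrow> proj_perp S p = T.cpl p"
  unfolding proj_perp_def using proj_onto_eq cpl_range by blast

lemma scale: "dim_scale tadd z0 DS (Proj S) map_option"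
proof unfold_locales
  fix X assume X: "X \<subseteq> DS" "X \<noteq> {}"
  define Y where "Y = {a \<in> elems S. Some a \<in> X}"
  have XY: "X = Some ` Y" using X unfolding Y_def by auto
  have "Y \<subseteq> elems S" "Y \<noteq> {}" using X XY unfolding Y_def by auto
  then obtain m where m: "m \<in> elems S" "\<forall>x\<in>Y. ple S m x" "\<forall>y\<in>elems S. (\<forall>x\<in>Y. ple S y x) \<longrightarrow> ple S y m" using M2 by meson
  have YE: "Y \<subseteq> elems S" unfolding Y_def by blast
  have "(\<forall>x\<in>X. T.le (Some m) x) \<and> (\<forall>y\<in>DS. (\<forall>x\<in>X. T.le y x) \<longrightarrow> T.le y (Some m))"
    unfolding XY using m le_iff YE by (auto simp: subset_iff)
  then show "\<exists>m\<in>DS. (\<forall>x\<in>X. T.le m x) \<and> (\<forall>y\<in>DS. (\<forall>x\<in>X. T.le y x) \<longrightarrow> T.le y m)" using m(1) by blast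
next
  fix x y assume "x \<in> DS" "y \<in> DS"
  then obtain a b where ab: "x = Some a" "y = Some b" "a \<in> elems S" "b \<in> elems S" by blast
  then obtain p where p: "p \<in> Proj S" "ple S (p a) (p b)" "ple S (proj_perp S p b) (proj_perp S p a)" using M3 by blast
  have "T.le (map_option p x) (map_option p y)" "T.le (map_option (T.cpl p) y) (map_option (T.cpl p) x)"
    using p ab le_iff proj_perp_eq[OF p(1)] Proj_elem p(1) cpl_range(1)[OF p(1)] by auto
  then show "\<exists>p\<in>Proj S. T.le (map_option p x) (map_option p y) \<and> T.le (map_option (T.cpl p) y) (map_option (T.cpl p) x)" using p(1) by blast
next
  fix x y assume "x \<in> DS" "y \<in> DS"
  then obtain a b where ab: "x = Some a" "y = Some b" "a \<in> elems S" "b \<in> elems S" by blast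
  then obtain p where p: "p \<in> Proj S" "ple S (p a) (p b)" "\<And>q. q \<in> Proj S \<Longrightarrow> ple S (q a) (q b) \<Longrightarrow> proj_le S q p" using M4 by metis
  have "T.le (map_option p x) (map_option p y)" using p ab le_iff Proj_elem by simp
  moreover have "T.pleq q p" if "q \<in> Proj S" "T.le (map_option q x) (map_option q y)" for q
    using p(3)[OF that(1)] that p(1) ab le_iff Proj_elem proj_le_iff by simp
  ultimately show "\<exists>p\<in>Proj S. T.le (map_option p x) (map_option p y) \<and> (\<forall>q\<in>Proj S. T.le (map_option q x) (map_option q y) \<longrightarrow> T.pleq q p)" using p(1) by blast
next
  fix x assume "x \<in> DS"
  then obtain c where c: "x = Some c" "c \<in> elems S" by blast
  then obtain a b where ab: "a \<in> elems S" "b \<in> elems S" "directly_finite S a" "purely_infinite S b" "pplus S a b = Some c" using M5 by blast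
  then have "T.fin (Some a)" "T.pinf (Some b)" "x = tadd (Some a) (Some b)"
    using fin_iff[OF ab(1)] pinf_iff[OF ab(2)] tadd_Some[OF ab(1,2)] c by auto
  then show "\<exists>a b. T.fin a \<and> T.pinf b \<and> x = tadd a b" by blast
next
  fix x y assume h: "T.pinf x" "T.pinf y" "T.llrem x y"
  then obtain a b where ab: "x = Some a" "y = Some b" "a \<in> elems S" "b \<in> elems S" using T.pinf_D by blast
  have perp_iff: "perp S {c} = perp S {b} \<longleftrightarrow> (\<forall>t\<in>DS. T.orth t (Some c) \<longleftrightarrow> T.orth t (Some b))" if c: "c \<in> elems S" for c
    unfolding perp_def using c ab orth_iff' by auto
  let ?X = "{x \<in> elems S. purely_infinite S x \<and> ll_rem S a x \<and> perp S {x} = perp S {b}}"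
  have "\<exists>m\<in>?X. \<forall>x\<in>?X. ple S m x"
    using M6[rule_format, of a b] h ab pinf_iff llrem_iff' by (simp add: Let_def)
  then obtain m where m: "m \<in> ?X" "\<forall>x\<in>?X. ple S m x" by blast
  have X: "c \<in> ?X \<longleftrightarrow> T.pinf (Some c) \<and> T.llrem x (Some c) \<and> (\<forall>t\<in>DS. T.orth t (Some c) \<longleftrightarrow> T.orth t y)"
    if c: "c \<in> elems S" for c
    using ab c pinf_iff[OF c] llrem_iff'[OF ab(3) c] perp_iff[OF c] by simp
  have mE: "m \<in> elems S" using m by blast
  show "\<exists>m. (T.pinf m \<and> T.llrem x m \<and> (\<forall>t\<in>DS. T.orth t m \<longleftrightarrow> T.orth t y)) \<and>
        (\<forall>w. T.pinf w \<and> T.llrem x w \<and> (\<forall>t\<in>DS. T.orth t w \<longleftrightarrow> T.orth t y) \<longrightarrow> T.le m w)"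
  proof (intro exI conjI allI impI)
    show "T.pinf (Some m)" "T.llrem x (Some m)" "\<forall>t\<in>DS. T.orth t (Some m) \<longleftrightarrow> T.orth t y" using X[OF mE] m(1) by blast+
    fix w assume w: "T.pinf w \<and> T.llrem x w \<and> (\<forall>t\<in>DS. T.orth t w \<longleftrightarrow> T.orth t y)"
    then obtain c where c: "w = Some c" "c \<in> elems S" using T.pinf_D by blast
    then have "c \<in> ?X" using w X[OF c(2)] by blast
    then show "T.le (Some m) w" using m(2) c le_iff mE by blast
  qed
qed

end

context proj_monoid
begin

lemma pleq_mt: "pleq a b \<Longrightarrow> pleq a c \<Longrightarrow> pleq a (mt b c)"
  unfolding pleq_def using mt_act act_D by simp

text \<open>The part of r off p lies under both p and its complement, so it vanishes.\<close>

lemma mt_cpl_zero: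
  assumes "p \<in> Pr" "r \<in> Pr" "pleq (mt r (cpl p)) p" shows "pleq r p"
  unfolding pleq_def
proof (intro conjI ballI)
  fix x assume x: "x \<in> D"
  have c: "cpl p \<in> Pr" using assms by simp
  have rx: "r \<cdot> x \<in> D" using act_D assms x by blast
  have "mt r (cpl p) \<cdot> x = cpl p \<cdot> r \<cdot> x" using mt_act[OF assms(2) c x] act_comm[OF assms(2) c x] by simp
  moreover have "p \<cdot> mt r (cpl p) \<cdot> x = mt r (cpl p) \<cdot> x" using pleq_act[OF assms(3) x] .
  ultimately have "cpl p \<cdot> r \<cdot> x = \<zero>" using cpl_zero1[OF assms(1) rx] by simp
  then show "p \<cdot> r \<cdot> x = r \<cdot> x" using cpl_add[OF assms(1) rx] by simp
qed (use assms in auto)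

end

section \<open>Ultrafilters of projections\<close>

context continuous_dimension_scale
begin

interpretation T: dim_scale tadd z0 DS "Proj S" map_option by (rule scale)

lemma filter_sub: "proj_filter S F \<Longrightarrow> p \<in> F \<Longrightarrow> p \<in> Proj S"
  unfolding proj_filter_def by blast

lemma filter_up: "proj_filter S F \<Longrightarrow> p \<in> F \<Longrightarrow> T.pleq p q \<Longrightarrow> q \<in> F"
proof -
  assume h: "proj_filter S F" "p \<in> F" "T.pleq p q"
  then have "q \<in> Proj S" "proj_le S p q" using proj_le_iff filter_sub T.pleq_def by blast+
  then show ?thesis using h unfolding proj_filter_def by blast
qed

lemma filter_mt: "proj_filter S F \<Longrightarrow> p \<in> F \<Longrightarrow> q \<in> F \<Longrightarrow> T.mt p q \<in> F"
proof -
  assume h: "proj_filter S F" "p \<in> F" "q \<in> F"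
  then obtain r where r: "r \<in> F" "proj_le S r p" "proj_le S r q" unfolding proj_filter_def by blast
  then have "T.pleq r p" "T.pleq r q" using proj_le_iff filter_sub[OF h(1)] h by auto
  then show ?thesis using filter_up[OF h(1) r(1) T.pleq_mt] by blast
qed

lemma filterI:
  assumes "F \<subseteq> Proj S" "F \<noteq> {}" "\<And>p q. p \<in> F \<Longrightarrow> T.pleq p q \<Longrightarrow> q \<in> F" "\<And>p q. p \<in> F \<Longrightarrow> q \<in> F \<Longrightarrow> T.mt p q \<in> F"
  shows "proj_filter S F"
  unfolding proj_filter_def
proof (intro conjI ballI impI)
  fix p q assume "p \<in> F" "q \<in> Proj S" "proj_le S p q"
  then show "q \<in> F" using assms(1) assms(3)[of p q] proj_le_iff[of p q] by blast
next
  fix p q assume h: "p \<in> F" "q \<in> F"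
  then have pq: "p \<in> Proj S" "q \<in> Proj S" using assms(1) by auto
  have "proj_le S (T.mt p q) p" "proj_le S (T.mt p q) q"
    using proj_le_iff[OF T.mt_Pr[OF pq]] T.mt_le1[OF pq] T.mt_le2[OF pq] pq by auto
  then show "\<exists>r\<in>F. proj_le S r p \<and> proj_le S r q" using assms(4) h by blast
qed (use assms(1,2) in auto)

lemma filter_nonzero:
  assumes "proj_filter S F" "F \<noteq> Proj S" "p \<in> F" shows "\<exists>x\<in>DS. map_option p x \<noteq> z0"
proof (rule ccontr)
  assume no: "\<not> ?thesis"
  have p: "p \<in> Proj S" using assms filter_sub by blast
  have "T.pleq p q" if q: "q \<in> Proj S" for q
    unfolding T.pleq_def
  proof (intro conjI ballI)
    fix x assume "x \<in> DS"
    then have "map_option p x = z0" using no by blast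
    then show "map_option q (map_option p x) = map_option p x" using T.act_zero[OF q] by (simp only:)
  qed (use p q in auto)
  then have "Proj S \<subseteq> F" using filter_up assms by blast
  then show False using assms filter_sub by blast
qed

lemma filter_cpl: 
  assumes F: "proj_filter S F" "F \<noteq> Proj S" "p \<in> F" shows "T.cpl p \<notin> F"
proof
  assume "T.cpl p \<in> F"
  then have "T.mt p (T.cpl p) \<in> F" using filter_mt F by blast
  then obtain x where x: "x \<in> DS" "map_option (T.mt p (T.cpl p)) x \<noteq> z0" using filter_nonzero F by blast
  have p: "p \<in> Proj S" using F filter_sub by blast
  then show False using x T.mt_act[OF p T.cpl_Pr[OF p] x(1)] T.cpl_zero1[OF p x(1)] by simp
qed

lemma Omega_filter: "F \<in> Omega S \<Longrightarrow> proj_filter S F \<and> F \<noteq> Proj S"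
  unfolding Omega_def proj_ultrafilter_def by blast

lemma Omega_maximal: "F \<in> Omega S \<Longrightarrow> proj_filter S G \<Longrightarrow> G \<noteq> Proj S \<Longrightarrow> F \<subseteq> G \<Longrightarrow> G = F"
  unfolding Omega_def proj_ultrafilter_def by blast

text \<open>The filter generated by F and the complement of p omits p, by
  \<open>mt_cpl_zero\<close>. It is therefore proper and equal to F by maximality.\<close>

lemma Omega_prime:
  assumes F: "F \<in> Omega S" and p: "p \<in> Proj S" "p \<notin> F" shows "T.cpl p \<in> F"
proof -
  have fF: "proj_filter S F" using Omega_filter F by blast
  let ?c = "T.cpl p"
  have c: "?c \<in> Proj S" using p by simp
  define G where "G = {q \<in> Proj S. \<exists>r\<in>F. T.pleq (T.mt r ?c) q}"
  have FG: "F \<subseteq> G" unfolding G_def using filter_sub[OF fF] T.mt_le1 c by blast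
  obtain r0 where r0: "r0 \<in> F" using fF unfolding proj_filter_def by blast
  have cG: "?c \<in> G" unfolding G_def using c r0 T.mt_le2 filter_sub[OF fF] by blast
  have fG: "proj_filter S G"
  proof (rule filterI)
    show "G \<subseteq> Proj S" "G \<noteq> {}" using cG unfolding G_def by auto
    show "q' \<in> G" if "q \<in> G" "T.pleq q q'" for q q'
      using that T.pleq_trans unfolding G_def T.pleq_def[of q q'] by (smt (verit) T.pleq_def mem_Collect_eq)
    fix q1 q2 assume "q1 \<in> G" "q2 \<in> G"
    then obtain r1 r2 where r: "r1 \<in> F" "T.pleq (T.mt r1 ?c) q1" "r2 \<in> F" "T.pleq (T.mt r2 ?c) q2" "q1 \<in> Proj S" "q2 \<in> Proj S"
      unfolding G_def by blast
    have P: "r1 \<in> Proj S" "r2 \<in> Proj S" using r filter_sub[OF fF] by auto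
    let ?r = "T.mt r1 r2"
    have rP: "?r \<in> Proj S" using P by simp
    have "T.pleq (T.mt ?r ?c) (T.mt r1 ?c)" "T.pleq (T.mt ?r ?c) (T.mt r2 ?c)"
      using T.pleq_mt T.pleq_trans[OF T.mt_le1[OF rP c]] T.mt_le1[OF P] T.mt_le2[OF P] T.mt_le2[OF rP c] by blast+
    then have "T.pleq (T.mt ?r ?c) (T.mt q1 q2)" using T.pleq_mt T.pleq_trans r by blast
    then show "T.mt q1 q2 \<in> G" unfolding G_def using filter_mt[OF fF r(1,3)] r T.mt_Pr by blast
  qed
  have "p \<notin> G"
  proof
    assume "p \<in> G"
    then obtain r where r: "r \<in> F" "T.pleq (T.mt r ?c) p" unfolding G_def by blast
    then have "T.pleq r p" using T.mt_cpl_zero p filter_sub[OF fF] by blast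
    then show False using filter_up[OF fF r(1)] p by blast
  qed
  then have "G = F" using Omega_maximal[OF F fG _ FG] p by blast
  then show ?thesis using cG by simp
qed

text \<open>Zorn's lemma is applied to the filters that contain p but not its complement. A maximal
  one is an ultrafilter, since every proper filter containing p omits the complement.\<close>

lemma Omega_ex:
  assumes p: "p \<in> Proj S" and x: "x \<in> DS" "map_option p x \<noteq> z0"
  shows "\<exists>F\<in>Omega S. p \<in> F"
proof -
  let ?c = "T.cpl p"
  let ?A = "{G. proj_filter S G \<and> p \<in> G \<and> ?c \<notin> G}"
  let ?P = "{q. T.pleq p q}"
  have "proj_filter S ?P"
  proof (rule filterI)
    show "?P \<subseteq> Proj S" "?P \<noteq> {}" using T.pleq_def T.pleq_refl[OF p] by auto
  qed (auto intro: T.pleq_trans T.pleq_mt)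
  moreover have "\<not> T.pleq p ?c"
  proof
    assume "T.pleq p ?c"
    then show False using T.pleq_act[of p ?c x] T.cpl_zero2[OF p x(1)] x by simp
  qed
  ultimately have ne: "?A \<noteq> {}" using T.pleq_refl[OF p] by blast
  have "\<exists>M\<in>?A. \<forall>X\<in>?A. M \<subseteq> X \<longrightarrow> X = M"
  proof (rule subset_Zorn_nonempty[OF ne])
    fix C assume C: "C \<noteq> {}" "subset.chain ?A C"
    then have CA: "C \<subseteq> ?A" and lin: "\<And>X Y. X \<in> C \<Longrightarrow> Y \<in> C \<Longrightarrow> X \<subseteq> Y \<or> Y \<subseteq> X"
      unfolding subset.chain_def by auto
    have "proj_filter S (\<Union>C)"
    proof (rule filterI)
      show "\<Union>C \<subseteq> Proj S" using CA filter_sub by blast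
      show "\<Union>C \<noteq> {}" using C CA by blast
      show "q \<in> \<Union>C" if "r \<in> \<Union>C" "T.pleq r q" for r q using that CA filter_up by blast
      show "T.mt r q \<in> \<Union>C" if h: "r \<in> \<Union>C" "q \<in> \<Union>C" for r q
      proof -
        obtain X Y where "X \<in> C" "Y \<in> C" "r \<in> X" "q \<in> Y" using h by blast
        then obtain Z where "Z \<in> C" "r \<in> Z" "q \<in> Z" using lin by blast
        then show ?thesis using filter_mt CA by blast
      qed
    qed
    then show "\<Union>C \<in> ?A" using C CA by blast
  qed
  then obtain M where M: "M \<in> ?A" "\<And>X. X \<in> ?A \<Longrightarrow> M \<subseteq> X \<Longrightarrow> X = M" by blast
  have "M \<in> Omega S" unfolding Omega_def proj_ultrafilter_def
  proof (intro CollectI conjI allI impI)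
    show "proj_filter S M" using M by blast
    show "M \<noteq> Proj S" using M T.cpl_Pr[OF p] by blast
    fix G assume G: "proj_filter S G \<and> G \<noteq> Proj S \<and> M \<subseteq> G"
    then have "p \<in> G" using M by blast
    then show "G = M" using M(2)[of G] G filter_cpl by blast
  qed
  then show ?thesis using M by blast
qed

lemma space:
  assumes E: "finitary_unit S E"
  shows "dim_space tadd z0 DS (Proj S) map_option (Some ` E) (Omega S)"
proof unfold_locales
  have ES: "E \<subseteq> elems S" "\<And>e. e \<in> E \<Longrightarrow> directly_finite S e" using E unfolding finitary_unit_def S_fin_def by auto
  show "T.fin e" if "e \<in> Some ` E" for e using that ES fin_iff by auto
  show "T.orth e e'" if h: "e \<in> Some ` E" "e' \<in> Some ` E" "e \<noteq> e'" for e e'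
  proof -
    obtain a b where "e = Some a" "e' = Some b" "a \<in> E" "b \<in> E" using h by blast
    then show ?thesis using h(3) E ES(1) orth_iff'[of a b] unfolding finitary_unit_def by auto
  qed
  show "\<exists>e\<in>Some ` E. \<not> T.orth x e" if x: "T.fin x" "x \<noteq> z0" for x
  proof -
    obtain a where a: "x = Some a" "a \<in> elems S" using T.fin_D[OF x(1)] by blast
    then have "a \<in> S_fin S - {pzero S}" using x fin_iff unfolding S_fin_def by auto
    then obtain e where e: "e \<in> E" "\<not> orthogonal S a e" using E unfolding finitary_unit_def by blast
    then have "\<not> T.orth x (Some e)" using orth_iff'[of a e] a ES by auto
    then show ?thesis using e by blast
  qed
  show "T.mf e \<or> (\<forall>x. T.mf x \<and> T.le x e \<longrightarrow> x = z0)" if h: "e \<in> Some ` E" for e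
  proof -
    obtain a where a: "e = Some a" "a \<in> E" "a \<in> elems S" using h ES by blast
    show ?thesis
    proof (cases "multiple_free S a")
      case True then show ?thesis using a mf_iff by simp
    next
      case False
      then have n: "\<And>x. x \<in> elems S \<Longrightarrow> multiple_free S x \<Longrightarrow> x \<noteq> pzero S \<Longrightarrow> \<not> ple S x a"
        using a E unfolding finitary_unit_def S_mf_def by blast
      have "x = z0" if x: "T.mf x" "T.le x e" for x
      proof -
        obtain b where b: "x = Some b" "b \<in> elems S" using T.mf_D[OF x(1)] by blast
        then show ?thesis using n[OF b(2)] x mf_iff[OF b(2)] le_iff[OF b(2) a(3)] a(1) by auto
      qed
      then show ?thesis by blast
    qed
  qed
next
  fix F p assume "F \<in> Omega S" "p \<in> F" then show "p \<in> Proj S" using Omega_filter filter_sub by blast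
next
  fix F p q assume "F \<in> Omega S" "p \<in> F" "q \<in> F" then show "T.mt p q \<in> F" using Omega_filter filter_mt by blast
next
  fix F p q assume "F \<in> Omega S" "p \<in> F" "T.pleq p q" then show "q \<in> F" using Omega_filter filter_up by blast
next
  fix F p assume "F \<in> Omega S" "p \<in> Proj S" "p \<notin> F" then show "T.cpl p \<in> F" using Omega_prime by blast
next
  fix F p assume "F \<in> Omega S" "p \<in> F" then show "\<exists>x\<in>DS. map_option p x \<noteq> z0" using Omega_filter filter_nonzero by blast
next
  fix p x assume "p \<in> Proj S" "x \<in> DS" "map_option p x \<noteq> z0" then show "\<exists>F\<in>Omega S. p \<in> F" using Omega_ex by blast
qed

lemma jm_range: "T.jm \<in> Proj S" "T.jm ` elems S = perp S (S_mf S)"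
proof -
  show j: "T.jm \<in> Proj S" by (rule T.jm)
  show "T.jm ` elems S = perp S (S_mf S)"
  proof (rule range_eqI[OF j perp_sub])
    fix a assume a: "a \<in> elems S"
    have "T.jm a = a \<longleftrightarrow> (\<forall>t. T.mf t \<longrightarrow> T.orth (Some a) t)" using T.jm(2)[of "Some a"] a by simp
    also have "\<dots> \<longleftrightarrow> (\<forall>b\<in>elems S. T.mf (Some b) \<longrightarrow> T.orth (Some a) (Some b))" using T.mf_D by blast
    also have "\<dots> \<longleftrightarrow> a \<in> perp S (S_mf S)" unfolding perp_def S_mf_def using a mf_iff orth_iff' by auto
    finally show "T.jm a = a \<longleftrightarrow> a \<in> perp S (S_mf S)" .
  qed
qed

lemma jf_range: "T.jf \<in> Proj S" "T.jf ` elems S = perp S (S_fin S)"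
proof -
  show j: "T.jf \<in> Proj S" by (rule T.jf)
  show "T.jf ` elems S = perp S (S_fin S)"
  proof (rule range_eqI[OF j perp_sub])
    fix a assume a: "a \<in> elems S"
    have "T.jf a = a \<longleftrightarrow> (\<forall>t. T.fin t \<longrightarrow> T.orth (Some a) t)" using T.jf(2)[of "Some a"] a by simp
    also have "\<dots> \<longleftrightarrow> (\<forall>b\<in>elems S. T.fin (Some b) \<longrightarrow> T.orth (Some a) (Some b))" using T.fin_D by blast
    also have "\<dots> \<longleftrightarrow> a \<in> perp S (S_fin S)" unfolding perp_def S_fin_def using a fin_iff orth_iff' by auto
    finally show "T.jf a = a \<longleftrightarrow> a \<in> perp S (S_fin S)" .
  qed
qed

lemma mt_range:
  assumes "p \<in> Proj S" "q \<in> Proj S" shows "T.mt p q ` elems S = p ` elems S \<inter> q ` elems S"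
proof (rule range_eqI)
  show "T.mt p q \<in> Proj S" using assms by simp
  show "p ` elems S \<inter> q ` elems S \<subseteq> elems S" using Proj_elem assms by blast
  fix a assume a: "a \<in> elems S"
  have e: "T.mt p q a = p (q a)" using T.mt_act[OF assms, of "Some a"] a by simp
  have e2: "p (q a) = q (p a)" using T.act_comm[OF assms, of "Some a"] a by simp
  show "T.mt p q a = a \<longleftrightarrow> a \<in> p ` elems S \<inter> q ` elems S"
    using e e2 Proj_fix[OF assms(1) a] Proj_fix[OF assms(2) a] Proj_elem assms a by (metis IntE IntI imageI)
qed

text \<open>The range of \<open>T.jm\<close> is the orthogonal of \<open>S_mf S\<close>, so the
  range of its complement is the double orthogonal.\<close>

lemma Omega_I_eq: "Omega_I S = {F \<in> Omega S. T.cpl T.jm \<in> F}"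
  unfolding Omega_I_def Omega_at_def S_I_def using proj_onto_eq[OF cpl_range[OF jm_range(1)]] jm_range(2) by simp

lemma Omega_II_eq: "Omega_II S = {F \<in> Omega S. T.mt T.jm (T.cpl T.jf) \<in> F}"
proof -
  have c: "T.cpl T.jf \<in> Proj S" using jf_range(1) by simp
  have "T.mt T.jm (T.cpl T.jf) ` elems S = S_II S"
    unfolding S_II_def mt_range[OF jm_range(1) c] cpl_range(2)[OF jf_range(1)] jm_range(2) jf_range(2) ..
  then show ?thesis unfolding Omega_II_def Omega_at_def using proj_onto_eq T.mt_Pr[OF jm_range(1) c] by simp
qed

lemma Omega_III_eq: "Omega_III S = {F \<in> Omega S. T.jf \<in> F}"
  unfolding Omega_III_def Omega_at_def S_III_def using proj_onto_eq[OF jf_range] by simp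

end

section \<open>The topology of the ultrafilter space and continuity\<close>

context continuous_dimension_scale
begin

interpretation T: dim_scale tadd z0 DS "Proj S" map_option by (rule scale)

lemma topspace_Omega: "topspace (Omega_topology S) = Omega S"
proof -
  have "\<exists>p\<in>Proj S. F \<in> Omega_at S p" if F: "F \<in> Omega S" for F
  proof -
    have "proj_filter S F" using Omega_filter F by blast
    then obtain p where "p \<in> F" unfolding proj_filter_def by blast
    then show ?thesis using F filter_sub[OF \<open>proj_filter S F\<close>] unfolding Omega_at_def by blast
  qed
  then have "\<Union> (Omega_at S ` Proj S) = Omega S" unfolding Omega_at_def by blast
  then show ?thesis unfolding Omega_topology_def by simp
qed

text \<open>The generating sets are closed under finite intersections, through \<open>T.mt\<close>,
  and so form a base.\<close>

lemma openin_Omega: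
  "openin (Omega_topology S) W \<longleftrightarrow> W \<subseteq> Omega S \<and> (\<forall>F\<in>W. \<exists>p\<in>F. \<forall>G\<in>Omega S. p \<in> G \<longrightarrow> G \<in> W)"
    (is "_ \<longleftrightarrow> ?R W")
proof
  assume o: "openin (Omega_topology S) W"
  then have "generate_topology_on (Omega_at S ` Proj S) W"
    unfolding Omega_topology_def openin_topology_generated_by_iff .
  then have "\<forall>F\<in>W. F \<in> Omega S \<longrightarrow> (\<exists>p\<in>F. \<forall>G\<in>Omega S. p \<in> G \<longrightarrow> G \<in> W)"
  proof (induction rule: generate_topology_on.induct)
    case (Int A B)
    show ?case
    proof (intro ballI impI)
      fix F assume F: "F \<in> A \<inter> B" "F \<in> Omega S"
      obtain p q where pq: "p \<in> F" "\<forall>G\<in>Omega S. p \<in> G \<longrightarrow> G \<in> A" "q \<in> F" "\<forall>G\<in>Omega S. q \<in> G \<longrightarrow> G \<in> B"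
        using Int F by blast
      have fF: "proj_filter S F" using Omega_filter F by blast
      have P: "p \<in> Proj S" "q \<in> Proj S" using pq filter_sub[OF fF] by auto
      have "T.mt p q \<in> F" using filter_mt[OF fF pq(1,3)] .
      moreover have "p \<in> G" "q \<in> G" if "G \<in> Omega S" "T.mt p q \<in> G" for G
        using filter_up[of G, OF _ that(2)] T.mt_le1[OF P] T.mt_le2[OF P] Omega_filter[OF that(1)] by blast+
      ultimately show "\<exists>p\<in>F. \<forall>G\<in>Omega S. p \<in> G \<longrightarrow> G \<in> A \<inter> B" using pq by blast
    qed
  next
    case (UN K) then show ?case by (meson Union_iff)
  next
    case (Basis s) then show ?case unfolding Omega_at_def by auto
  qed simp
  moreover have "W \<subseteq> Omega S" using openin_subset[OF o] topspace_Omega by simp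
  ultimately show "?R W" by blast
next
  assume R: "?R W"
  let ?K = "{Omega_at S p | p. p \<in> Proj S \<and> Omega_at S p \<subseteq> W}"
  have "F \<in> \<Union>?K" if F: "F \<in> W" for F
  proof -
    obtain p where p: "p \<in> F" "\<forall>G\<in>Omega S. p \<in> G \<longrightarrow> G \<in> W" using R F by blast
    then have "Omega_at S p \<subseteq> W" unfolding Omega_at_def by blast
    moreover have "p \<in> Proj S" using p(1) R F Omega_filter filter_sub by blast
    ultimately show ?thesis using p(1) R F unfolding Omega_at_def by blast
  qed
  then have "W = \<Union>?K" by blast
  moreover have "openin (Omega_topology S) (\<Union>?K)"
    unfolding Omega_topology_def by (rule openin_Union) (auto intro: topology_generated_by_Basis)
  ultimately show "openin (Omega_topology S) W" by simp
qed

text \<open>Two gaps are bridged. U is open, being given by membership of j, so neighbourhoods can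
  be shrunk into it. Thresholds outside \<open>K \<gamma>\<close> are harmless: one below a value of
  f is in \<open>K \<gamma>\<close>, and one beyond the bound is above f on all of U.\<close>

lemma continuous_into_iff:
  fixes K :: "'o::linorder \<Rightarrow> 'o scale_val set" and R :: "real set"
  assumes U: "U = {F \<in> Omega S. j \<in> F}"
    and K: "\<And>\<gamma>. K \<gamma> = Fin ` R \<union> Aleph ` {..\<gamma>}"
  shows "continuous_into (Omega_topology S) U K f \<longleftrightarrow>
    (\<forall>F\<in>U. f F \<in> Fin ` R \<union> range Aleph) \<and>
    (\<forall>F\<in>U. \<forall>k\<in>Fin ` R \<union> range Aleph.
       (k < f F \<longrightarrow> (\<exists>p\<in>F. \<forall>G\<in>Omega S. p \<in> G \<longrightarrow> k < f G)) \<and>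
       (f F < k \<longrightarrow> (\<exists>p\<in>F. \<forall>G\<in>Omega S. p \<in> G \<longrightarrow> f G < k))) \<and>
    (\<exists>\<beta>. \<forall>F\<in>U. f F \<le> Aleph \<beta>)"
proof -
  have oU: "openin (Omega_topology S) U" unfolding openin_Omega U by blast
  have tU: "topspace (subtopology (Omega_topology S) U) = U" using U topspace_Omega by auto
  have Kmem: "k \<in> K \<gamma> \<longleftrightarrow> k \<in> Fin ` R \<union> range Aleph \<and> k \<le> Aleph \<gamma>" for k \<gamma>
    unfolding K by (cases k) auto
  have openU: "openin (subtopology (Omega_topology S) U) {x \<in> U. P (f x)} \<longleftrightarrow>
      (\<forall>F\<in>U. P (f F) \<longrightarrow> (\<exists>p\<in>F. \<forall>G\<in>Omega S. p \<in> G \<longrightarrow> G \<in> U \<and> P (f G)))" for P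
    unfolding openin_open_subtopology[OF oU] openin_Omega using U by auto
  have inU: "(\<exists>p\<in>F. \<forall>G\<in>Omega S. p \<in> G \<longrightarrow> G \<in> U \<and> Q G) \<longleftrightarrow> (\<exists>p\<in>F. \<forall>G\<in>Omega S. p \<in> G \<longrightarrow> Q G)" if F: "F \<in> U" for F Q
  proof
    assume "\<exists>p\<in>F. \<forall>G\<in>Omega S. p \<in> G \<longrightarrow> Q G"
    then obtain p where p: "p \<in> F" "\<forall>G\<in>Omega S. p \<in> G \<longrightarrow> Q G" by blast
    have jF: "j \<in> F" "F \<in> Omega S" using F U by auto
    have fF: "proj_filter S F" using Omega_filter jF by blast
    have P: "p \<in> Proj S" "j \<in> Proj S" using p jF filter_sub[OF fF] by auto
    have "p \<in> G" "j \<in> G" if "G \<in> Omega S" "T.mt p j \<in> G" for G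
      using filter_up[of G, OF _ that(2)] T.mt_le1[OF P] T.mt_le2[OF P] Omega_filter[OF that(1)] by blast+
    then show "\<exists>p\<in>F. \<forall>G\<in>Omega S. p \<in> G \<longrightarrow> G \<in> U \<and> Q G" using filter_mt[OF fF p(1) jF(1)] p(2) U by blast
  qed blast
  show ?thesis
  proof
    assume "continuous_into (Omega_topology S) U K f"
    then obtain \<gamma> where c: "continuous_map (subtopology (Omega_topology S) U) (interval_topology (K \<gamma>)) f"
      unfolding continuous_into_def by blast
    note c' = c[unfolded interval_topology_def continuous_on_generated_topo_iff tU]
    have fK: "f F \<in> K \<gamma>" if "F \<in> U" for F using c' that by blast
    have lt: "\<exists>p\<in>F. \<forall>G\<in>Omega S. p \<in> G \<longrightarrow> k < f G" if F: "F \<in> U" and k: "k \<in> K \<gamma>" "k < f F" for F k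
    proof -
      have "openin (subtopology (Omega_topology S) U) (f -` (K \<gamma> - {x \<in> K \<gamma>. x \<le> k}) \<inter> U)" using c' k by blast
      moreover have "f -` (K \<gamma> - {x \<in> K \<gamma>. x \<le> k}) \<inter> U = {x \<in> U. k < f x}" using fK by auto
      ultimately have "openin (subtopology (Omega_topology S) U) {x \<in> U. k < f x}" by simp
      from openU[THEN iffD1, OF this, rule_format, OF F k(2)] show ?thesis by blast
    qed
    have gt: "\<exists>p\<in>F. \<forall>G\<in>Omega S. p \<in> G \<longrightarrow> f G < k" if F: "F \<in> U" and k: "k \<in> K \<gamma>" "f F < k" for F k
    proof -
      have "openin (subtopology (Omega_topology S) U) (f -` (K \<gamma> - {x \<in> K \<gamma>. k \<le> x}) \<inter> U)" using c' k by blast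
      moreover have "f -` (K \<gamma> - {x \<in> K \<gamma>. k \<le> x}) \<inter> U = {x \<in> U. f x < k}" using fK by auto
      ultimately have "openin (subtopology (Omega_topology S) U) {x \<in> U. f x < k}" by simp
      from openU[THEN iffD1, OF this, rule_format, OF F k(2)] show ?thesis by blast
    qed
    show "(\<forall>F\<in>U. f F \<in> Fin ` R \<union> range Aleph) \<and>
    (\<forall>F\<in>U. \<forall>k\<in>Fin ` R \<union> range Aleph.
       (k < f F \<longrightarrow> (\<exists>p\<in>F. \<forall>G\<in>Omega S. p \<in> G \<longrightarrow> k < f G)) \<and>
       (f F < k \<longrightarrow> (\<exists>p\<in>F. \<forall>G\<in>Omega S. p \<in> G \<longrightarrow> f G < k))) \<and>
    (\<exists>\<beta>. \<forall>F\<in>U. f F \<le> Aleph \<beta>)"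
    proof (intro conjI ballI impI exI)
      fix F assume F: "F \<in> U"
      show "f F \<in> Fin ` R \<union> range Aleph" "f F \<le> Aleph \<gamma>" using fK[OF F] Kmem by auto
      fix k :: "'o scale_val" assume k: "k \<in> Fin ` R \<union> range Aleph"
      show "\<exists>p\<in>F. \<forall>G\<in>Omega S. p \<in> G \<longrightarrow> k < f G" if l: "k < f F"
      proof (rule lt[OF F _ l])
        show "k \<in> K \<gamma>" using k l fK[OF F] Kmem by (meson less_imp_le order_trans)
      qed
      show "\<exists>p\<in>F. \<forall>G\<in>Omega S. p \<in> G \<longrightarrow> f G < k" if l: "f F < k"
      proof (cases "k \<le> Aleph \<gamma>")
        case True then show ?thesis using gt[OF F _ l] k Kmem by blast
      next
        case False
        then have "f G < k" if "G \<in> U" for G using fK[OF that] Kmem by (meson le_less_trans not_le)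
        then show ?thesis using F U by blast
      qed
    qed
  next
    assume a: "(\<forall>F\<in>U. f F \<in> Fin ` R \<union> range Aleph) \<and>
    (\<forall>F\<in>U. \<forall>k\<in>Fin ` R \<union> range Aleph.
       (k < f F \<longrightarrow> (\<exists>p\<in>F. \<forall>G\<in>Omega S. p \<in> G \<longrightarrow> k < f G)) \<and>
       (f F < k \<longrightarrow> (\<exists>p\<in>F. \<forall>G\<in>Omega S. p \<in> G \<longrightarrow> f G < k))) \<and>
    (\<exists>\<beta>. \<forall>F\<in>U. f F \<le> Aleph \<beta>)"
    then obtain \<gamma> where \<gamma>: "\<forall>F\<in>U. f F \<le> Aleph \<gamma>" by blast
    have fK: "f F \<in> K \<gamma>" if "F \<in> U" for F
      using bspec[OF conjunct1[OF a] that] bspec[OF \<gamma> that] Kmem by simp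
    have cond: "\<forall>F\<in>U. \<forall>k\<in>Fin ` R \<union> range Aleph.
       (k < f F \<longrightarrow> (\<exists>p\<in>F. \<forall>G\<in>Omega S. p \<in> G \<longrightarrow> k < f G)) \<and>
       (f F < k \<longrightarrow> (\<exists>p\<in>F. \<forall>G\<in>Omega S. p \<in> G \<longrightarrow> f G < k))" using a by (elim conjE)
    have kR: "k \<in> Fin ` R \<union> range Aleph" if "k \<in> K \<gamma>" for k using that Kmem by blast
    have l: "openin (subtopology (Omega_topology S) U) {x \<in> U. k < f x}" if k: "k \<in> K \<gamma>" for k
    proof (rule iffD2[OF openU], intro ballI impI)
      fix F assume F: "F \<in> U" and lt: "k < f F"
      have "\<exists>p\<in>F. \<forall>G\<in>Omega S. p \<in> G \<longrightarrow> k < f G"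
        using bspec[OF bspec[OF cond F] kR[OF k]] lt by (elim conjE) (rule mp)
      then show "\<exists>p\<in>F. \<forall>G\<in>Omega S. p \<in> G \<longrightarrow> G \<in> U \<and> k < f G" by (rule iffD2[OF inU[OF F]])
    qed
    have g: "openin (subtopology (Omega_topology S) U) {x \<in> U. f x < k}" if k: "k \<in> K \<gamma>" for k
    proof (rule iffD2[OF openU], intro ballI impI)
      fix F assume F: "F \<in> U" and lt: "f F < k"
      have "\<exists>p\<in>F. \<forall>G\<in>Omega S. p \<in> G \<longrightarrow> f G < k"
        using bspec[OF bspec[OF cond F] kR[OF k]] lt by (elim conjE) (rule mp)
      then show "\<exists>p\<in>F. \<forall>G\<in>Omega S. p \<in> G \<longrightarrow> G \<in> U \<and> f G < k" by (rule iffD2[OF inU[OF F]])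
    qed
    have "continuous_map (subtopology (Omega_topology S) U) (interval_topology (K \<gamma>)) f"
      unfolding interval_topology_def continuous_on_generated_topo_iff tU
    proof (intro conjI allI impI)
      show "f ` U \<subseteq> \<Union> ({K \<gamma>} \<union> {K \<gamma> - {x \<in> K \<gamma>. x \<le> a} |a. a \<in> K \<gamma>} \<union> {K \<gamma> - {x \<in> K \<gamma>. a \<le> x} |a. a \<in> K \<gamma>})"
        using fK by auto
      fix W assume "W \<in> {K \<gamma>} \<union> {K \<gamma> - {x \<in> K \<gamma>. x \<le> a} |a. a \<in> K \<gamma>} \<union> {K \<gamma> - {x \<in> K \<gamma>. a \<le> x} |a. a \<in> K \<gamma>}"
      then consider "W = K \<gamma>" | k where "k \<in> K \<gamma>" "W = K \<gamma> - {x \<in> K \<gamma>. x \<le> k}" | k where "k \<in> K \<gamma>" "W = K \<gamma> - {x \<in> K \<gamma>. k \<le> x}" by blast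
      then show "openin (subtopology (Omega_topology S) U) (f -` W \<inter> U)"
      proof cases
        case 1
        then have "f -` W \<inter> U = U" using fK by auto
        then show ?thesis using openin_topspace[of "subtopology (Omega_topology S) U"] tU by simp
      next
        case (2 k)
        then have "f -` W \<inter> U = {x \<in> U. k < f x}" using fK by auto
        then show ?thesis using l 2 by simp
      next
        case (3 k)
        then have "f -` W \<inter> U = {x \<in> U. f x < k}" using fK by auto
        then show ?thesis using g 3 by simp
      qed
    qed
    then show "continuous_into (Omega_topology S) U K f" unfolding continuous_into_def by blast
  qed
qed

text \<open>Otherwise every index has a nonzero unit; by \<open>T.au_strict\<close> different
  indices have different ones, and the index type would inject into the carrier.\<close>

lemma bound_ex:
  assumes large: "elems S \<prec> (UNIV :: 'o::wellorder set)"
  shows "\<exists>\<gamma>::'o. \<forall>u. T.au \<gamma> u \<longrightarrow> u = z0"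
proof (rule ccontr)
  assume "\<not> ?thesis"
  then have "\<exists>u. \<forall>\<xi>::'o. T.au \<xi> (u \<xi>) \<and> u \<xi> \<noteq> z0" by metis
  then obtain u where u: "\<And>\<xi>::'o. T.au \<xi> (u \<xi>)" "\<And>\<xi>. u \<xi> \<noteq> z0" by blast
  have "inj u"
  proof (rule injI)
    fix \<xi> \<eta> assume e: "u \<xi> = u \<eta>"
    have le: "T.le (u \<xi>) (u \<eta>)" "T.le (u \<eta>) (u \<xi>)" using e T.au_D[OF u(1)] by simp_all
    show "\<xi> = \<eta>" using T.au_strict[OF u(1) u(1) le(1) u(2)] T.au_strict[OF u(1) u(1) le(2) u(2)] by simp
  qed
  have "u \<xi> \<in> DS" for \<xi> using T.au_D[OF u(1)] .
  then have uS: "u \<xi> = Some (the (u \<xi>)) \<and> the (u \<xi>) \<in> elems S" for \<xi> by (metis imageE option.sel)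
  have "inj (\<lambda>\<xi>. the (u \<xi>))"
  proof (rule injI)
    fix \<xi> \<eta> assume "the (u \<xi>) = the (u \<eta>)"
    then have "u \<xi> = u \<eta>" using uS by metis
    then show "\<xi> = \<eta>" using injD[OF \<open>inj u\<close>] by simp
  qed
  moreover have "range (\<lambda>\<xi>. the (u \<xi>)) \<subseteq> elems S"
  proof
    fix a assume "a \<in> range (\<lambda>\<xi>. the (u \<xi>))"
    then obtain \<xi> where "a = the (u \<xi>)" by blast
    then show "a \<in> elems S" using uS by blast
  qed
  ultimately have "(UNIV :: 'o set) \<lesssim> elems S" unfolding lepoll_def by blast
  then show False using large lepoll_antisym unfolding lesspoll_def by blast
qed

end

context dim_bounded
begin

lemma CF_cong: "(\<And>\<aa>. \<aa> \<in> \<Omega> \<Longrightarrow> f \<aa> = g \<aa>) \<Longrightarrow> CF f \<longleftrightarrow> CF g"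
  unfolding CF_def cont_def by simp

end

section \<open>Transfer to the concrete scale and its function space\<close>

context continuous_dimension_scale
begin

interpretation T: dim_scale tadd z0 DS "Proj S" map_option by (rule scale)

context
  fixes E :: "'a set" and \<gamma> :: "'o::wellorder"
  assumes fin_unit: "finitary_unit S E"
    and bd: "\<And>u. T.au \<gamma> u \<Longrightarrow> u = z0"
begin

lemma bounded: "dim_bounded tadd z0 DS (Proj S) map_option (Some ` E) (Omega S) \<gamma>"
  by (rule dim_bounded.intro[OF space[OF fin_unit]]) (unfold_locales, rule bd)

interpretation T: dim_bounded tadd z0 DS "Proj S" map_option "Some ` E" "Omega S" \<gamma>
  by (rule bounded)

lemma Omega_types:
  "F \<in> Omega_I S \<longleftrightarrow> F \<in> Omega S \<and> T.jm \<notin> F"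
  "F \<in> Omega_II S \<longleftrightarrow> F \<in> Omega S \<and> T.jm \<in> F \<and> T.jf \<notin> F"
  "F \<in> Omega_III S \<longleftrightarrow> F \<in> Omega S \<and> T.jf \<in> F"
  unfolding Omega_I_eq Omega_II_eq Omega_III_eq
  using T.Om_cpl[OF _ jm_range(1)] T.Om_cpl[OF _ jf_range(1)] T.Om_mt_iff[OF _ jm_range(1) T.cpl_Pr[OF jf_range(1)]]
  by auto

lemma Kat_types:
  "F \<in> Omega_I S \<Longrightarrow> T.Kat F = Fin ` \<nat> \<union> (range Aleph :: 'o scale_val set)"
  "F \<in> Omega_II S \<Longrightarrow> T.Kat F = Fin ` {0..} \<union> (range Aleph :: 'o scale_val set)"
  "F \<in> Omega_III S \<Longrightarrow> T.Kat F = Fin ` {0} \<union> (range Aleph :: 'o scale_val set)"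
  unfolding Omega_types T.Kat_def T.Kfin_def using T.jf_jm_in by auto

text \<open>The three types cover \<open>Omega S\<close>, and on each of them \<open>T.Kat\<close>
  is the corresponding set of values; separate bounds are merged by \<open>max\<close>.\<close>

lemma C_scale_elems:
  fixes f :: "('a \<Rightarrow> 'a) set \<Rightarrow> 'o scale_val"
  shows "f \<in> elems (C_scale S) \<longleftrightarrow> f \<in> extensional (Omega S) \<and> T.CF f"
proof -
  have K: "Zval \<beta> = Fin ` \<nat> \<union> Aleph ` {..\<beta>}" "Rval \<beta> = Fin ` {0..} \<union> Aleph ` {..\<beta>}" "Tval \<beta> = Fin ` {0} \<union> Aleph ` {..\<beta>}" for \<beta> :: 'o
    unfolding Zval_def Rval_def Tval_def by auto
  define Q where "Q U \<longleftrightarrow> (\<forall>F\<in>U. f F \<in> T.Kat F) \<and>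
    (\<forall>F\<in>U. \<forall>k\<in>T.Kat F.
       (k < f F \<longrightarrow> (\<exists>p\<in>F. \<forall>G\<in>Omega S. p \<in> G \<longrightarrow> k < f G)) \<and>
       (f F < k \<longrightarrow> (\<exists>p\<in>F. \<forall>G\<in>Omega S. p \<in> G \<longrightarrow> f G < k))) \<and>
    (\<exists>\<beta>. \<forall>F\<in>U. f F \<le> Aleph \<beta>)" for U
  have I: "continuous_into (Omega_topology S) (Omega_I S) Zval f \<longleftrightarrow> Q (Omega_I S)"
    unfolding continuous_into_iff[OF Omega_I_eq, of Zval, OF K(1)] Q_def using Kat_types(1) by simp
  have II: "continuous_into (Omega_topology S) (Omega_II S) Rval f \<longleftrightarrow> Q (Omega_II S)"
    unfolding continuous_into_iff[OF Omega_II_eq, of Rval, OF K(2)] Q_def using Kat_types(2) by simp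
  have III: "continuous_into (Omega_topology S) (Omega_III S) Tval f \<longleftrightarrow> Q (Omega_III S)"
    unfolding continuous_into_iff[OF Omega_III_eq, of Tval, OF K(3)] Q_def using Kat_types(3) by simp
  have un: "Omega S = Omega_I S \<union> Omega_II S \<union> Omega_III S" using Omega_types T.jf_jm_in by blast
  have QU: "Q (A \<union> B) \<longleftrightarrow> Q A \<and> Q B" for A B
  proof
    assume "Q A \<and> Q B"
    moreover from this obtain \<beta> \<beta>' where "\<forall>F\<in>A. f F \<le> Aleph \<beta>" "\<forall>F\<in>B. f F \<le> Aleph \<beta>'" unfolding Q_def by blast
    then have "\<forall>F\<in>A \<union> B. f F \<le> Aleph (max \<beta> \<beta>')"
      by (meson UnE less_eq_scale_val.simps(4) max.cobounded1 max.cobounded2 order_trans)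
    ultimately show "Q (A \<union> B)" unfolding Q_def by blast
  next
    assume "Q (A \<union> B)"
    then show "Q A \<and> Q B" unfolding Q_def by blast
  qed
  have "Q (Omega S) \<longleftrightarrow> T.CF f" unfolding Q_def T.CF_def T.cont_def by blast
  moreover have "Q (Omega S) \<longleftrightarrow> Q (Omega_I S) \<and> Q (Omega_II S) \<and> Q (Omega_III S)" unfolding un QU by blast
  ultimately show ?thesis unfolding C_scale_def C_pcm_def by (simp add: topspace_Omega I II III)
qed

lemma C_scale_ops:
  fixes f g :: "('a \<Rightarrow> 'a) set \<Rightarrow> 'o scale_val"
  shows C_scale_zero: "pzero (C_scale S) = (\<lambda>F\<in>Omega S. 0 :: 'o scale_val)"
    and C_scale_plus: "pplus (C_scale S) f g = Some (\<lambda>F\<in>Omega S. f F + g F)"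
  unfolding C_scale_def C_pcm_def by (simp_all add: topspace_Omega)

text \<open>Abstract functions matter only on \<open>Omega S\<close>, so they are restricted before
  entering the function space. An element of E fixed by \<open>T.jm\<close> lies in
  \<open>S_II S\<close>, because as a finite element it is also fixed by the complement of
  \<open>T.jf\<close>.\<close>

lemma embedding_dim_emb:
  fixes \<epsilon> :: "'a \<Rightarrow> ('a \<Rightarrow> 'a) set \<Rightarrow> 'o scale_val"
  assumes e: "scale_embedding S E \<epsilon>"
  shows "dim_emb tadd z0 DS (Proj S) map_option (Some ` E) (Omega S) \<gamma> (\<lambda>x. \<epsilon> (the x))"
proof -
  note l = e[unfolded scale_embedding_def lower_embedding_def]
  have C: "\<epsilon> a \<in> elems (C_scale S)" if "a \<in> elems S" for a using l that by blast
  have CF: "T.CF (\<epsilon> a)" and ext: "\<epsilon> a \<in> extensional (Omega S)" if "a \<in> elems S" for a using C[OF that] C_scale_elems by auto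
  have res: "restrict h (Omega S) \<in> elems (C_scale S)" if "T.CF h" for h
    unfolding C_scale_elems using that T.CF_cong[of "restrict h (Omega S)" h] by simp
  show ?thesis
  proof (rule dim_emb.intro[OF bounded], unfold_locales)
    show "T.CF (\<epsilon> (the x))" if "x \<in> DS" for x using that CF by auto
    show "\<epsilon> (the (tadd x y)) F = \<epsilon> (the x) F + \<epsilon> (the y) F" if h: "tadd x y \<in> DS" "F \<in> Omega S" for x y F
    proof -
      have "x \<in> DS" "y \<in> DS" using h T.add_D T.add_D2 by blast+
      then obtain a b where ab: "x = Some a" "y = Some b" "a \<in> elems S" "b \<in> elems S" by blast
      obtain c where c: "tadd x y = Some c" "c \<in> elems S" using h by blast
      then have "pplus S a b = Some c" using ab tadd_Some by simp
      then have "pplus (C_scale S) (\<epsilon> a) (\<epsilon> b) = Some (\<epsilon> c)" using l ab by blast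
      then have "\<epsilon> c = (\<lambda>F\<in>Omega S. \<epsilon> a F + \<epsilon> b F)" using C_scale_plus by simp
      then show ?thesis using ab c h by simp
    qed
    show "T.le x y" if h: "x \<in> DS" "y \<in> DS" "T.CF g" "\<And>F. F \<in> Omega S \<Longrightarrow> \<epsilon> (the x) F + g F = \<epsilon> (the y) F" for x y g
    proof -
      obtain a b where ab: "x = Some a" "y = Some b" "a \<in> elems S" "b \<in> elems S" using h by blast
      have "(\<lambda>F\<in>Omega S. \<epsilon> a F + restrict g (Omega S) F) = \<epsilon> b"
        by (rule extensionalityI[OF _ ext[OF ab(4)]]) (use h(4) ab in auto)
      then have "pplus (C_scale S) (\<epsilon> a) (restrict g (Omega S)) = Some (\<epsilon> b)" using C_scale_plus by simp
      then have "ple (C_scale S) (\<epsilon> a) (\<epsilon> b)" unfolding ple_def using res[OF h(3)] by blast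
      then show ?thesis using l ab le_iff by blast
    qed
    show "\<exists>y\<in>DS. \<forall>F\<in>Omega S. \<epsilon> (the y) F = h F" if h: "x \<in> DS" "T.CF h" "T.CF h'" "\<And>F. F \<in> Omega S \<Longrightarrow> h F + h' F = \<epsilon> (the x) F" for x h h'
    proof -
      obtain a where a: "x = Some a" "a \<in> elems S" using h by blast
      have "(\<lambda>F\<in>Omega S. restrict h (Omega S) F + restrict h' (Omega S) F) = \<epsilon> a"
        by (rule extensionalityI[OF _ ext[OF a(2)]]) (use h(4) a in auto)
      then have "pplus (C_scale S) (restrict h (Omega S)) (restrict h' (Omega S)) = Some (\<epsilon> a)" using C_scale_plus by simp
      then have "ple (C_scale S) (restrict h (Omega S)) (\<epsilon> a)" unfolding ple_def using res[OF h(3)] by blast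
      then have "restrict h (Omega S) \<in> \<epsilon> ` elems S" using l a res[OF h(2)] by blast
      then obtain b where b: "b \<in> elems S" "\<epsilon> b = restrict h (Omega S)" by (metis imageE)
      then show ?thesis by (intro bexI[of _ "Some b"]) auto
    qed
    show "\<epsilon> (the (map_option p x)) F = (if p \<in> F then \<epsilon> (the x) F else 0)" if h: "p \<in> Proj S" "x \<in> DS" "F \<in> Omega S" for p x F
    proof -
      obtain a where a: "x = Some a" "a \<in> elems S" using h by blast
      have "\<epsilon> (p a) = fun_restrict (Omega S) (Omega_at S p) (\<epsilon> a)" using l a h by blast
      then show ?thesis using a h by (simp add: fun_restrict_def Omega_at_def)
    qed
    show "\<epsilon> (the e) F \<in> {0, 1}" if h: "e \<in> Some ` E" "map_option T.jm e = e" "F \<in> Omega S" for e F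
    proof -
      obtain a where a: "e = Some a" "a \<in> E" using h by blast
      have aE: "a \<in> elems S" using a T.E_D by auto
      have ja: "T.jm a = a" using h(2) a by simp
      have c: "T.cpl T.jf \<in> Proj S" using jf_range(1) by simp
      have "map_option T.jf e = z0" using T.jf_fin T.E_fin h(1) by blast
      then have "map_option (T.cpl T.jf) e = e" using T.cpl_add[OF jf_range(1), of e] a aE tadd_zero by simp
      then have "T.cpl T.jf a = a" using a by simp
      then have "a \<in> S_II S" unfolding S_II_def
        using Proj_fix[OF jm_range(1) aE] Proj_fix[OF c aE] ja jm_range(2) cpl_range(2)[OF jf_range(1)] jf_range(2) by auto
      then show ?thesis using l a h by auto
    qed
  qed
qed

lemma eps_embedding: "scale_embedding S E (\<lambda>a\<in>elems S. restrict (T.eps (Some a)) (Omega S))"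
proof -
  interpret M: dim_emb tadd z0 DS "Proj S" map_option "Some ` E" "Omega S" \<gamma> T.eps
    by (rule T.eps_emb)
  let ?e = "\<lambda>a\<in>elems S. restrict (T.eps (Some a)) (Omega S)"
  have C: "?e a \<in> elems (C_scale S)" if "a \<in> elems S" for a
    unfolding C_scale_elems using that T.eps_CF[of "Some a"] T.CF_cong[of "restrict (T.eps (Some a)) (Omega S)" "T.eps (Some a)"] by simp
  \<comment> \<open>Functions in the space are nonnegative, so the algebraic order implies the
    pointwise one.\<close>
  have dom: "h F \<le> T.eps (Some a) F" if hh: "a \<in> elems S" "ple (C_scale S) h (?e a)" "F \<in> Omega S" for a h F
  proof -
    obtain g where g: "g \<in> elems (C_scale S)" "pplus (C_scale S) h g = Some (?e a)" using hh(2) unfolding ple_def by blast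
    then have "(\<lambda>F\<in>Omega S. h F + g F) = restrict (T.eps (Some a)) (Omega S)" using C_scale_plus hh(1) by simp
    from fun_cong[OF this, of F] have "h F + g F = T.eps (Some a) F" using hh(3) by simp
    moreover have "0 \<le> g F" using g(1) T.CF_nonneg hh(3) C_scale_elems by blast
    ultimately show ?thesis using scale_le_add[of "g F" "h F"] by simp
  qed
  have eq0: "restrict (T.eps (Some (pzero S))) (Omega S) = (\<lambda>F\<in>Omega S. 0)"
    by (rule restrict_ext) (use M.phi_zero in blast)
  show ?thesis
    unfolding scale_embedding_def lower_embedding_def
  proof (intro conjI ballI allI impI)
    show "?e \<in> elems S \<rightarrow> elems (C_scale S)" by (rule Pi_I) (rule C)
    show "?e (pzero S) = pzero (C_scale S)" using eq0 zero_elem C_scale_zero by simp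
    show "pplus (C_scale S) (?e a) (?e b) = Some (?e c)" if h: "a \<in> elems S" "b \<in> elems S" "pplus S a b = Some c" for a b c
    proof -
      have c: "c \<in> elems S" using plus_elem[OF h] .
      have t: "tadd (Some a) (Some b) = Some c" using tadd_Some h by simp
      have "T.eps (Some c) F = T.eps (Some a) F + T.eps (Some b) F" if "F \<in> Omega S" for F
        using T.eps_add[OF that, of "Some a" "Some b"] t c by simp
      then show ?thesis using C_scale_plus h c by (auto intro!: restrict_ext)
    qed
    show "inj_on ?e (elems S)"
    proof (rule inj_onI)
      fix a b assume h: "a \<in> elems S" "b \<in> elems S" "?e a = ?e b"
      have "T.eps (Some a) F = T.eps (Some b) F" if "F \<in> Omega S" for F
        using fun_cong[OF h(3), of F] h(1,2) that by simp
      then show "a = b" using M.phi_inj[of "Some a" "Some b"] h by simp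
    qed
    show "ple S a b" if h: "a \<in> elems S" "b \<in> elems S" "ple (C_scale S) (?e a) (?e b)" for a b
    proof -
      have "T.eps (Some a) F \<le> T.eps (Some b) F" if "F \<in> Omega S" for F using dom[OF h(2,3) that] h that by simp
      then show ?thesis using T.eps_reflect[of "Some a" "Some b"] h le_iff by simp
    qed
    show "h \<in> ?e ` elems S" if h: "a \<in> elems S" "h \<in> elems (C_scale S)" "ple (C_scale S) h (?e a)" for a h
    proof -
      have "T.CF h" using h(2) C_scale_elems by blast
      then obtain z where z: "z \<in> DS" "\<forall>F\<in>Omega S. T.eps z F = h F" using T.eps_lower[of "Some a" h] dom[OF h(1,3)] h(1) by blast
      then obtain b where b: "z = Some b" "b \<in> elems S" by blast
      have "h = ?e b"
        by (rule extensionalityI[of _ "Omega S"]) (use h(2) C_scale_elems z b in auto)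
      then show ?thesis using b by blast
    qed
    show "?e (p a) = fun_restrict (Omega S) (Omega_at S p) (?e a)" if h: "a \<in> elems S" "p \<in> Proj S" for a p
      unfolding fun_restrict_def using T.eps_act[of _ "Some a" p] h Proj_elem[OF h(2,1)]
      by (auto intro!: restrict_ext simp: Omega_at_def)
    show "?e e F \<in> {0, 1}" if h: "e \<in> E \<inter> S_II S" "F \<in> Omega S" for e F
      using T.eps_E[of "Some e" F] h T.E_D[of "Some e"] by auto
  qed auto
qed

text \<open>By \<open>dim_emb.phi_eq_eps\<close> every candidate is \<open>T.eps\<close>, whose
  values on E are 0 and 1 in both finite types by \<open>T.eps_E\<close>.\<close>

lemma unique_embedding:
  "(\<exists>!\<epsilon> :: 'a \<Rightarrow> ('a \<Rightarrow> 'a) set \<Rightarrow> 'o scale_val. scale_embedding S E \<epsilon>) \<and>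
    (\<forall>\<epsilon> :: 'a \<Rightarrow> ('a \<Rightarrow> 'a) set \<Rightarrow> 'o scale_val. scale_embedding S E \<epsilon> \<longrightarrow>
       (\<forall>e\<in>E. \<forall>\<aa>\<in>Omega S. \<epsilon> e \<aa> \<in> {0, 1}))"
proof -
  let ?e = "\<lambda>a\<in>elems S. restrict (T.eps (Some a)) (Omega S)"
  have uniq: "\<epsilon> = ?e" if e: "scale_embedding S E \<epsilon>" for \<epsilon> :: "'a \<Rightarrow> ('a \<Rightarrow> 'a) set \<Rightarrow> 'o scale_val"
  proof -
    note l = e[unfolded scale_embedding_def lower_embedding_def]
    show ?thesis
    proof (rule extensionalityI[of _ "elems S"])
      show "\<epsilon> \<in> extensional (elems S)" using l by blast
      fix a assume a: "a \<in> elems S"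
      have "\<epsilon> a \<in> elems (C_scale S)" using l a by blast
      then have ext: "\<epsilon> a \<in> extensional (Omega S)" using C_scale_elems by blast
      have "\<epsilon> a = restrict (T.eps (Some a)) (Omega S)"
      proof (rule extensionalityI[OF ext restrict_extensional])
        fix F assume "F \<in> Omega S"
        then show "\<epsilon> a F = restrict (T.eps (Some a)) (Omega S) F"
          using dim_emb.phi_eq_eps[OF embedding_dim_emb[OF e], of "Some a" F] a by simp
      qed
      then show "\<epsilon> a = ?e a" using a by simp
    qed simp
  qed
  have "?e e \<aa> \<in> {0, 1}" if "e \<in> E" "\<aa> \<in> Omega S" for e \<aa>
    using T.eps_E[of "Some e" \<aa>] T.E_D[of "Some e"] that by auto
  then have "\<forall>e\<in>E. \<forall>\<aa>\<in>Omega S. \<epsilon> e \<aa> \<in> {0, 1}" if "scale_embedding S E \<epsilon>" for \<epsilon> :: "'a \<Rightarrow> ('a \<Rightarrow> 'a) set \<Rightarrow> 'o scale_val"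
    unfolding uniq[OF that] by blast
  moreover have "\<exists>!\<epsilon> :: 'a \<Rightarrow> ('a \<Rightarrow> 'a) set \<Rightarrow> 'o scale_val. scale_embedding S E \<epsilon>"
  proof (rule ex1I)
    show "scale_embedding S E ?e" by (rule eps_embedding)
  qed (rule uniq)
  ultimately show ?thesis by blast
qed

end

end

theorem mainTheorem5:
  fixes S :: "'a pcm" and E :: "'a set"
  assumes "continuous_dimension_scale S"
    and "finitary_unit S E"
    and large: "elems S \<prec> (UNIV :: 'o::wellorder set)"
  shows "(\<exists>!\<epsilon> :: 'a \<Rightarrow> ('a \<Rightarrow> 'a) set \<Rightarrow> 'o scale_val. scale_embedding S E \<epsilon>) \<and>
    (\<forall>\<epsilon> :: 'a \<Rightarrow> ('a \<Rightarrow> 'a) set \<Rightarrow> 'o scale_val. scale_embedding S E \<epsilon> \<longrightarrow>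
       (\<forall>e\<in>E. \<forall>\<aa>\<in>Omega S. \<epsilon> e \<aa> \<in> {0, 1}))"
proof -
  interpret continuous_dimension_scale S by fact
  from bound_ex[OF large] unique_embedding[OF assms(2)] show ?thesis by blast
qed

end
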